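(* Let $N\ge 2$ identical nonlinear circuits, each consisting of the parallel connection of a passive LTI impedance $z_{\mathrm{osc}}(s)$ and a voltage-dependent current source $i_{\mathrm g}=-g(v)$ with $\sigma:=\sup_{v\in\mathbb R}\left|\frac{\mathrm d}{\mathrm dv}g(v)\right|<\infty$, be coupled through a passive, connected LTI electrical network that has no shunt elements and is homogeneous, with Kron-reduced admittance matrix $Y(s)=y_{\mathrm{series}}(s)\,\Gamma$, where $\Gamma=NI-\mathbf 1\mathbf 1^{\mathrm T}$. If $$\left\Vert \mathcal F\big(z_{\mathrm{osc}}(\mathrm j\omega),\,y_{\mathrm{series}}(\mathrm j\omega)N\big)\right\Vert_\infty\,\sigma<1,$$ then the terminal voltages synchronize globally asymptotically, i.e. (for all initial conditions) $$\lim_{t\to\infty}\big(v_j(t)-v_k(t)\big)=0\qquad\forall\, j,k\in\{1,\dots,N\}.$$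
   Context: Coupled system. Circuit $j$ has terminal voltage $v_j$, injects current $i_j$ into the network, and has source current $i_{\mathrm gj}=-g(v_j)$; $g:\mathbb R\to\mathbb R$ may be piecewise linear (then the supremum defining $\sigma$ is over its slopes). In the Laplace domain the linear part obeys $v_j=z_{\mathrm{osc}}\,(i_{\mathrm gj}-i_j)$, where $z_{\mathrm{osc}}(s)$ is the impedance of an interconnection of passive LTI circuit elements, and the network imposes $i=Yv$ with $i=[i_1,\dots,i_N]^{\mathrm T}$, $v=[v_1,\dots,v_N]^{\mathrm T}$. Initial conditions refer to the states of the energy-storage elements. Network. The network has node set $\mathcal A$, boundary nodes $\{1,\dots,N\}\subseteq\mathcal A$ (where the circuits are connected) and interior nodes $\mathcal I=\mathcal A\setminus\{1,\dots,N\}$ (zero current injection). With branch admittances $y_{mn}=y_{nm}$ and no shunt admittances to ground, the admittance matrix $Y_{\mathcal A}$ has entries $[Y_{\mathcal A}]_{mm}=\sum_k y_{mk}$, $[Y_{\mathcal A}]_{mn}=-y_{mn}$ for branches $(m,n)$, and $0$ otherwise. Partitioning $Y_{\mathcal A}$ into boundary ($\mathcal N$) and interior ($\mathcal I$) blocks, the Kron-reduced admittance matrix is $Y=Y_{\mathcal{NN}}-Y_{\mathcal{NI}}Y_{\mathcal{II}}^{-1}Y_{\mathcal{NI}}^{\mathrm T}$ ($Y_{\mathcal{II}}$ is assumed nonsingular). The network is homogeneous if the effective impedances $z_{nm}=(e_n-e_m)^{\mathrm T}Y_{\mathcal A}^\dagger(e_n-e_m)$ are the same for all distinct boundary nodes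 $n,m$ ($\dagger$: Moore-Penrose pseudoinverse; $e_n$: canonical basis vectors); in that case $Y$ has the form $y_{\mathrm{series}}\Gamma$. Linear fractional transformation: $\mathcal F(A,B):=(I+AB)^{-1}A$; for scalars $\mathcal F(a,b)=a/(1+ab)$. For a scalar transfer function $h$ all of whose poles have strictly negative real part, $\Vert h\Vert_\infty:=\sup_{\omega\in\mathbb R}|h(\mathrm j\omega)|$ (the condition on the norm includes that it is defined in this sense). *)

theory Defs
  imports
    "HOL-Analysis.Analysis"
    "HOL-Computational_Algebra.Computational_Algebra"
    "HOL-Computational_Algebra.Field_as_Ring"
    "Jordan_Normal_Form.Gauss_Jordan_Elimination"
    "Jordan_Normal_Form.Schur_Decomposition"
begin

type_synonym transfer_fun = "real poly fract"

text \<open>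
  Poles and values refer to the representation in lowest terms, so that cancelling factors of a
  composite expression such as \<open>z / (1 + z * y)\<close> do not count.
\<close>

definition tf_eval :: "transfer_fun \<Rightarrow> complex \<Rightarrow> complex" where
  "tf_eval h s = poly (map_poly complex_of_real (fst (quot_of_fract h))) s
               / poly (map_poly complex_of_real (snd (quot_of_fract h))) s"

definition tf_poles :: "transfer_fun \<Rightarrow> complex set" where
  "tf_poles h = {s. poly (map_poly complex_of_real (snd (quot_of_fract h))) s = 0}"

definition hinf_norm :: "transfer_fun \<Rightarrow> real" where
  "hinf_norm h = (SUP \<omega>::real. cmod (tf_eval h (\<i> * complex_of_real \<omega>)))"

definition hinf_norm_defined :: "transfer_fun \<Rightarrow> bool" where
  "hinf_norm_defined h \<longleftrightarrow>
     (\<forall>s\<in>tf_poles h. Re s < 0) \<and>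
     bdd_above (range (\<lambda>\<omega>::real. cmod (tf_eval h (\<i> * complex_of_real \<omega>))))"

definition lft :: "'a::field \<Rightarrow> 'a \<Rightarrow> 'a" where
  "lft a b = a / (1 + a * b)"

text \<open>
  The lumped elements are the five classical ones. A pair \<open>(a, b)\<close> is a port between the nodes
  \<open>a\<close> and \<open>b\<close>; the port voltage is the potential of \<open>a\<close> minus that of \<open>b\<close>, the port current is
  counted from \<open>a\<close> through the element to \<open>b\<close>. A circuit is a one-port whose positive and negative
  terminals are the nodes \<open>0\<close> and \<open>1\<close>; the empty list is an open circuit.
\<close>

datatype element =
    Resistor real "nat \<times> nat"
  | Inductor real "nat \<times> nat"
  | Capacitor real "nat \<times> nat"
  | Transformer real "nat \<times> nat" "nat \<times> nat"
  | Gyrator real "nat \<times> nat" "nat \<times> nat"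

type_synonym circuit = "element list"

fun ports :: "element \<Rightarrow> (nat \<times> nat) list" where
  "ports (Resistor r e) = [e]"
| "ports (Inductor l e) = [e]"
| "ports (Capacitor c e) = [e]"
| "ports (Transformer n e f) = [e, f]"
| "ports (Gyrator r e f) = [e, f]"

fun passive_element :: "element \<Rightarrow> bool" where
  "passive_element (Resistor r e) \<longleftrightarrow> r > 0"
| "passive_element (Inductor l e) \<longleftrightarrow> l > 0"
| "passive_element (Capacitor c e) \<longleftrightarrow> c > 0"
| "passive_element (Transformer n e f) \<longleftrightarrow> n \<noteq> 0"
| "passive_element (Gyrator r e f) \<longleftrightarrow> r \<noteq> 0"

definition passive_circuit :: "circuit \<Rightarrow> bool" where
  "passive_circuit c \<longleftrightarrow> (\<forall>e\<in>set c. passive_element e)"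

text \<open>
  Kirchhoff's current law at every node, when the current \<open>i\<close> enters the circuit at terminal \<open>0\<close>
  and leaves it at terminal \<open>1\<close>; \<open>J k p\<close> is the current of port \<open>p\<close> of the \<open>k\<close>-th element.
\<close>

definition kcl :: "circuit \<Rightarrow> (nat \<Rightarrow> nat \<Rightarrow> 'a::comm_ring_1) \<Rightarrow> 'a \<Rightarrow> bool" where
  "kcl c J i \<longleftrightarrow>
     (\<forall>x. (\<Sum>k<length c. \<Sum>p<length (ports (c ! k)).
             (of_bool (fst (ports (c ! k) ! p) = x) - of_bool (snd (ports (c ! k) ! p) = x)) * J k p)
          = (of_bool (x = 0) - of_bool (x = 1)) * i)"

definition port_voltage ::
    "circuit \<Rightarrow> (nat \<Rightarrow> 'a::comm_ring_1) \<Rightarrow> nat \<Rightarrow> nat \<Rightarrow> 'a" where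
  "port_voltage c \<phi> k p = \<phi> (fst (ports (c ! k) ! p)) - \<phi> (snd (ports (c ! k) ! p))"

text \<open>The laws at complex frequency \<open>s\<close>, with zero initial states.\<close>

fun laplace_law ::
    "complex \<Rightarrow> element \<Rightarrow> (nat \<Rightarrow> complex) \<Rightarrow> (nat \<Rightarrow> complex) \<Rightarrow> bool" where
  "laplace_law s (Resistor r e) V J \<longleftrightarrow> V 0 = of_real r * J 0"
| "laplace_law s (Inductor l e) V J \<longleftrightarrow> V 0 = s * of_real l * J 0"
| "laplace_law s (Capacitor c e) V J \<longleftrightarrow> J 0 = s * of_real c * V 0"
| "laplace_law s (Transformer n e f) V J \<longleftrightarrow> V 0 = of_real n * V 1 \<and> J 1 = - of_real n * J 0"
| "laplace_law s (Gyrator r e f) V J \<longleftrightarrow> V 0 = - of_real r * J 1 \<and> V 1 = of_real r * J 0"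

definition laplace_oneport :: "circuit \<Rightarrow> complex \<Rightarrow> complex \<Rightarrow> complex \<Rightarrow> bool" where
  "laplace_oneport c s v i \<longleftrightarrow>
     (\<exists>\<phi> J. \<phi> 0 - \<phi> 1 = v \<and> kcl c J i \<and>
       (\<forall>k<length c. laplace_law s (c ! k) (port_voltage c \<phi> k) (J k)))"

text \<open>
  The open right half-plane contains no pole of the immittance of a passive circuit, and it
  determines a rational function completely.
\<close>

definition has_impedance :: "circuit \<Rightarrow> transfer_fun \<Rightarrow> bool" where
  "has_impedance c z \<longleftrightarrow>
     (\<forall>s. Re s > 0 \<longrightarrow> (\<forall>v i. laplace_oneport c s v i \<longleftrightarrow> v = tf_eval z s * i))"

definition has_admittance :: "circuit \<Rightarrow> transfer_fun \<Rightarrow> bool" where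
  "has_admittance c y \<longleftrightarrow>
     (\<forall>s. Re s > 0 \<longrightarrow> (\<forall>v i. laplace_oneport c s v i \<longleftrightarrow> i = tf_eval y s * v))"

text \<open>
  Time domain, on \<open>t \<ge> 0\<close>. The differential laws \<open>V = l dJ/dt\<close> and \<open>J = c dV/dt\<close> are meant in the
  sense of Caratheodory, i.e. in integrated form, because a piecewise linear source need not
  produce smooth signals. The states of the energy-storage elements (inductor currents and
  capacitor voltages) have unrestricted initial values.
\<close>

fun time_law :: "element \<Rightarrow> (nat \<Rightarrow> real \<Rightarrow> real) \<Rightarrow> (nat \<Rightarrow> real \<Rightarrow> real) \<Rightarrow> bool" where
  "time_law (Resistor r e) V J \<longleftrightarrow> (\<forall>t\<ge>0. V 0 t = r * J 0 t)"
| "time_law (Inductor l e) V J \<longleftrightarrow> (\<forall>t\<ge>0. l * (J 0 t - J 0 0) = integral {0..t} (V 0))"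
| "time_law (Capacitor c e) V J \<longleftrightarrow> (\<forall>t\<ge>0. c * (V 0 t - V 0 0) = integral {0..t} (J 0))"
| "time_law (Transformer n e f) V J \<longleftrightarrow> (\<forall>t\<ge>0. V 0 t = n * V 1 t \<and> J 1 t = - n * J 0 t)"
| "time_law (Gyrator r e f) V J \<longleftrightarrow> (\<forall>t\<ge>0. V 0 t = - r * J 1 t \<and> V 1 t = r * J 0 t)"

definition locally_integrable :: "(real \<Rightarrow> real) \<Rightarrow> bool" where
  "locally_integrable f \<longleftrightarrow> (\<forall>T\<ge>0. f absolutely_integrable_on {0..T})"

definition time_oneport :: "circuit \<Rightarrow> (real \<Rightarrow> real) \<Rightarrow> (real \<Rightarrow> real) \<Rightarrow> bool" where
  "time_oneport c v i \<longleftrightarrow>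
     (\<exists>(\<phi> :: nat \<Rightarrow> real \<Rightarrow> real) (J :: nat \<Rightarrow> nat \<Rightarrow> real \<Rightarrow> real).
       (\<forall>t\<ge>0. \<phi> 0 t - \<phi> 1 t = v t \<and> kcl c (\<lambda>k p. J k p t) (i t)) \<and>
       (\<forall>k<length c.
          (\<forall>p<length (ports (c ! k)).
             locally_integrable (\<lambda>t. port_voltage c (\<lambda>x. \<phi> x t) k p) \<and>
             locally_integrable (J k p)) \<and>
          time_law (c ! k) (\<lambda>p t. port_voltage c (\<lambda>x. \<phi> x t) k p) (J k)))"

text \<open>
  The nodes are \<open>0, \<dots>, M - 1\<close>; the first \<open>N\<close> of them are the boundary nodes. A pair of nodes
  that is not joined by a branch has zero admittance.
\<close>

definition admittance_matrix :: "nat \<Rightarrow> (nat \<Rightarrow> nat \<Rightarrow> transfer_fun) \<Rightarrow> transfer_fun mat" where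
  "admittance_matrix M y =
     Matrix.mat M M (\<lambda>(m, n). if m = n then (\<Sum>k\<in>{..<M} - {m}. y m k) else - y m n)"

definition interior_block :: "nat \<Rightarrow> 'a mat \<Rightarrow> 'a mat" where
  "interior_block N A = (case split_block A N N of (A_NN, A_NI, A_IN, A_II) \<Rightarrow> A_II)"

definition kron_reduction :: "nat \<Rightarrow> 'a::field mat \<Rightarrow> 'a mat" where
  "kron_reduction N A =
     (case split_block A N N of (A_NN, A_NI, A_IN, A_II) \<Rightarrow>
        A_NN - A_NI * the (mat_inverse A_II) * transpose_mat A_NI)"

definition Gamma_mat :: "nat \<Rightarrow> 'a::comm_ring_1 mat" where
  "Gamma_mat N = of_nat N \<cdot>\<^sub>m 1\<^sub>m N - Matrix.mat N N (\<lambda>_. 1)"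

definition connected_network :: "nat \<Rightarrow> (nat \<Rightarrow> nat \<Rightarrow> transfer_fun) \<Rightarrow> bool" where
  "connected_network M y \<longleftrightarrow>
     (\<forall>m<M. \<forall>n<M. (m, n) \<in> {(a, b). a < M \<and> b < M \<and> a \<noteq> b \<and> y a b \<noteq> 0}\<^sup>*)"

definition is_pseudoinverse :: "complex mat \<Rightarrow> complex mat \<Rightarrow> bool" where
  "is_pseudoinverse A X \<longleftrightarrow>
     X \<in> carrier_mat (dim_col A) (dim_row A) \<and>
     A * X * A = A \<and> X * A * X = X \<and>
     mat_adjoint (A * X) = A * X \<and> mat_adjoint (X * A) = X * A"

definition pseudoinverse :: "complex mat \<Rightarrow> complex mat" where
  "pseudoinverse A = (THE X. is_pseudoinverse A X)"

definition effective_impedance :: "complex mat \<Rightarrow> nat \<Rightarrow> nat \<Rightarrow> complex" where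
  "effective_impedance A n m =
     (let e = unit_vec (dim_row A) n - unit_vec (dim_row A) m
      in scalar_prod e (pseudoinverse A *\<^sub>v e))"

definition homogeneous_network :: "nat \<Rightarrow> transfer_fun mat \<Rightarrow> bool" where
  "homogeneous_network N A \<longleftrightarrow>
     (\<forall>s. Re s > 0 \<longrightarrow>
       (\<forall>n<N. \<forall>m<N. \<forall>n'<N. \<forall>m'<N. n \<noteq> m \<longrightarrow> n' \<noteq> m' \<longrightarrow>
          effective_impedance (map_mat (\<lambda>h. tf_eval h s) A) n m =
          effective_impedance (map_mat (\<lambda>h. tf_eval h s) A) n' m'))"

definition piecewise_linear :: "(real \<Rightarrow> real) \<Rightarrow> bool" where
  "piecewise_linear g \<longleftrightarrow>
     continuous_on UNIV g \<and>
     (\<exists>K. (\<forall>a b. finite (K \<inter> {a..b})) \<and>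
          (\<forall>x. x \<notin> K \<longrightarrow> (\<exists>\<alpha> \<beta>. \<forall>\<^sub>F u in nhds x. g u = \<alpha> * u + \<beta>)))"

text \<open>For a piecewise linear function these are its slopes.\<close>

definition slopes :: "(real \<Rightarrow> real) \<Rightarrow> real set" where
  "slopes g = {D. \<exists>x. (g has_real_derivative D) (at x)}"

definition source_gain :: "(real \<Rightarrow> real) \<Rightarrow> real" where
  "source_gain g = (SUP D\<in>slopes g. \<bar>D\<bar>)"

text \<open>
  \<open>\<phi> m\<close> are the node potentials of the network with respect to the common ground of the
  circuits, \<open>b m n\<close> is the current through the branch from \<open>m\<close> to \<open>n\<close> and \<open>i m\<close> the current
  injected at node \<open>m\<close>. Each circuit is the parallel connection of \<open>osc\<close> and the source
  current \<open>- g v\<close>, and feeds the remainder into the network. Branch circuits are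
  used only for \<open>m < n\<close>.
\<close>

definition coupled_trajectory ::
    "nat \<Rightarrow> nat \<Rightarrow> circuit \<Rightarrow> (nat \<Rightarrow> nat \<Rightarrow> circuit) \<Rightarrow> (real \<Rightarrow> real)
      \<Rightarrow> (nat \<Rightarrow> real \<Rightarrow> real) \<Rightarrow> bool" where
  "coupled_trajectory N M osc branch g v \<longleftrightarrow>
     (\<exists>(\<phi> :: nat \<Rightarrow> real \<Rightarrow> real) (b :: nat \<Rightarrow> nat \<Rightarrow> real \<Rightarrow> real) (i :: nat \<Rightarrow> real \<Rightarrow> real).
       (\<forall>j<N. \<forall>t\<ge>0. v j t = \<phi> j t) \<and>
       (\<forall>j<N. time_oneport osc (v j) (\<lambda>t. - g (v j t) - i j t)) \<and>
       (\<forall>n<M. \<forall>m<n. time_oneport (branch m n) (\<lambda>t. \<phi> m t - \<phi> n t) (b m n) \<and>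
                     (\<forall>t\<ge>0. b n m t = - b m n t)) \<and>
       (\<forall>m<M. \<forall>t\<ge>0. i m t = (\<Sum>n\<in>{..<M} - {m}. b m n t)) \<and>
       (\<forall>m. N \<le> m \<and> m < M \<longrightarrow> (\<forall>t\<ge>0. i m t = 0)))"

end

theory Submission
  imports Defs
begin

text \<open>
  No state-space realization of the circuits is constructed. At every instant the equations of the
  whole system form a linear relation \<open>R f e u v\<close> between the states \<open>e\<close>, their rates \<open>f\<close>, the
  mean-free source currents \<open>u\<close> and the mean-free voltages \<open>v\<close>; by Tellegen's theorem it is passive.
  Since \<open>R\<close> may be implicit (algebraic loops, dependent states), a duality argument on the finitely
  many states provides functionals \<open>L 0, \<dots>, L r\<close> of \<open>e\<close> such that \<open>v j = L 0 e + D u j\<close>, each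
  \<open>L (n + 1)\<close> is the derivative of \<open>L n\<close> up to a multiple of \<open>u j\<close>, and a polynomial \<open>\<mu>\<close> annihilates
  the chain. Passivity confines the roots of \<open>\<mu>\<close> to the closed left half-plane. A root on the axis would
  belong to a lossless mode; as the transfer function has no pole there, this mode is invisible at
  the ports and cannot occur in the chain.

  For \<open>\<Sum>j. u j = 0\<close> the homogeneous network acts as the scalar admittance \<open>y_series N\<close>, so the
  transfer function from \<open>u j\<close> to \<open>v j\<close> is \<open>\<F>(z_osc, y_series N)\<close>. Its norm on the imaginary axis
  bounds the \<open>L\<^sup>2\<close> gain: spectral factorization of \<open>\<gamma>\<^sup>2 |\<mu>|\<^sup>2 - |n|\<^sup>2\<close> replaces the Fourier transform.
  The source has incremental gain \<open>\<sigma>\<close>, so the product of the gains is below one, \<open>u\<close> and \<open>v\<close> are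
  square integrable, and stability of \<open>\<mu>\<close> makes \<open>v\<close> tend to zero.
\<close>

text \<open>Impedances are known only in the open right half-plane, and nothing bounds the growth of
  a trajectory beforehand, so trajectories cannot be Laplace transformed. Frequency solutions serve
  instead as test elements of the relation: at large real frequencies their states tend to zero,
  which identifies the direct term \<open>D\<close> and excludes outputs without state; near the
  imaginary axis they show that an axis mode is not driven.

  A trajectory starts from arbitrary states, whereas the norm of the transfer function concerns
  motion from rest. The observed chain is therefore paired with a second chain that is driven from
  rest by the output, reversed in time and cut off at \<open>T\<close>. The pairing is an integral
  of the input against a filtered copy of the output, plus boundary terms in which the initial
  states appear. These terms are of the order of the square root of the output energy and cannot
  compensate a gain below one. The integral is split by completing the square with a free weight
  \<open>\<theta>\<close>; because the input energies are bounded only after summation over the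
  ports, all ports share one weight.\<close>

subsection \<open>Finite-dimensional functionals\<close>

text \<open>Induction on \<open>I\<close>. If an element killed by all functionals of
  \<open>I\<close> is not killed by \<open>x c\<close>, subtracting a multiple of \<open>x c\<close>
  from \<open>\<phi>\<close> reduces to \<open>I\<close>; otherwise \<open>x c\<close> vanishes on
  the common kernel anyway and gets coefficient zero. Linearity is expressed by \<open>comb\<close>,
  so that \<open>S\<close> may consist of tuples of functions.\<close>

lemma functional_dependence:
  fixes x :: "'c \<Rightarrow> 'w \<Rightarrow> real" and \<phi> :: "'w \<Rightarrow> real" and comb :: "real \<Rightarrow> 'w \<Rightarrow> real \<Rightarrow> 'w \<Rightarrow> 'w"
  assumes "finite I"
    and closed: "\<And>a b w w'. w \<in> S \<Longrightarrow> w' \<in> S \<Longrightarrow> comb a w b w' \<in> S"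
    and "\<And>c a b w w'. c \<in> I \<Longrightarrow> w \<in> S \<Longrightarrow> w' \<in> S \<Longrightarrow> x c (comb a w b w') = a * x c w + b * x c w'"
    and "\<And>a b w w'. w \<in> S \<Longrightarrow> w' \<in> S \<Longrightarrow> \<phi> (comb a w b w') = a * \<phi> w + b * \<phi> w'"
    and "\<And>w. w \<in> S \<Longrightarrow> (\<And>c. c \<in> I \<Longrightarrow> x c w = 0) \<Longrightarrow> \<phi> w = 0"
  shows "\<exists>a. \<forall>w\<in>S. \<phi> w = (\<Sum>c\<in>I. a c * x c w)"
  using assms(1,3-)
proof (induction I arbitrary: \<phi> rule: finite_induct)
  case empty
  then show ?case by auto
next
  case (insert c I)
  have linx: "\<And>d a b w w'. d \<in> insert c I \<Longrightarrow> w \<in> S \<Longrightarrow> w' \<in> S \<Longrightarrow> x d (comb a w b w') = a * x d w + b * x d w'"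
    and lin\<phi>: "\<And>a b w w'. w \<in> S \<Longrightarrow> w' \<in> S \<Longrightarrow> \<phi> (comb a w b w') = a * \<phi> w + b * \<phi> w'"
    and ker: "\<And>w. w \<in> S \<Longrightarrow> (\<And>d. d \<in> insert c I \<Longrightarrow> x d w = 0) \<Longrightarrow> \<phi> w = 0"
    by (fact insert.prems)+
  show ?case
  proof (cases "\<exists>w0\<in>S. (\<forall>d\<in>I. x d w0 = 0) \<and> x c w0 \<noteq> 0")
    case True
    then obtain w0 where w0: "w0 \<in> S" "\<forall>d\<in>I. x d w0 = 0" "x c w0 \<noteq> 0" by blast
    define q where "q = \<phi> w0 / x c w0"
    define \<psi> where "\<psi> w = \<phi> w - q * x c w" for w
    have "\<exists>a. \<forall>w\<in>S. \<psi> w = (\<Sum>d\<in>I. a d * x d w)"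
    proof (rule insert.IH)
      show "x d (comb a w b w') = a * x d w + b * x d w'" if "d \<in> I" "w \<in> S" "w' \<in> S" for d a b w w'
        using that linx by blast
      show "\<psi> (comb a w b w') = a * \<psi> w + b * \<psi> w'" if "w \<in> S" "w' \<in> S" for a b w w'
        unfolding \<psi>_def linx[OF insertI1 that] lin\<phi>[OF that] by (simp add: algebra_simps)
      show "\<psi> w = 0" if w: "w \<in> S" and z: "\<And>d. d \<in> I \<Longrightarrow> x d w = 0" for w
      proof -
        \<comment> \<open>Shifting \<open>w\<close> along \<open>w0\<close> kills \<open>x c\<close>
          and leaves the functionals of \<open>I\<close> at zero, so that \<open>ker\<close>
          applies.\<close>
        let ?w = "comb 1 w (- x c w / x c w0) w0"
        have "\<phi> ?w = 0"
        proof (rule ker)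
          show "?w \<in> S" using closed w w0(1) by blast
          show "x d ?w = 0" if "d \<in> insert c I" for d
            unfolding linx[OF that w w0(1)] using that z w0 by auto
        qed
        moreover have "\<phi> ?w = \<phi> w - x c w / x c w0 * \<phi> w0" using w w0 lin\<phi> by simp
        ultimately show ?thesis by (simp add: \<psi>_def q_def)
      qed
    qed
    then obtain a where a: "\<forall>w\<in>S. \<psi> w = (\<Sum>d\<in>I. a d * x d w)" by blast
    have "\<forall>w\<in>S. \<phi> w = (\<Sum>d\<in>insert c I. (a(c := q)) d * x d w)"
    proof
      fix w assume "w \<in> S"
      then have "\<psi> w = (\<Sum>d\<in>I. a d * x d w)" using a by blast
      then have "\<phi> w = q * x c w + (\<Sum>d\<in>I. a d * x d w)" unfolding \<psi>_def by linarith
      also have "(\<Sum>d\<in>I. a d * x d w) = (\<Sum>d\<in>I. (a(c := q)) d * x d w)"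
        by (rule sum.cong[OF refl]) (use insert.hyps(2) in force)
      finally show "\<phi> w = (\<Sum>d\<in>insert c I. (a(c := q)) d * x d w)" using insert.hyps by simp
    qed
    then show ?thesis by blast
  next
    case False
    have "\<exists>a. \<forall>w\<in>S. \<phi> w = (\<Sum>d\<in>I. a d * x d w)"
    proof (rule insert.IH)
      show "x d (comb a w b w') = a * x d w + b * x d w'" if "d \<in> I" "w \<in> S" "w' \<in> S" for d a b w w'
        using that linx by blast
      show "\<phi> w = 0" if "w \<in> S" "\<And>d. d \<in> I \<Longrightarrow> x d w = 0" for w
        using ker[OF that(1)] that(2) False that(1) by blast
    qed (rule lin\<phi>)
    then obtain a where a: "\<forall>w\<in>S. \<phi> w = (\<Sum>d\<in>I. a d * x d w)" by blast
    have "(\<Sum>d\<in>insert c I. (a(c := 0)) d * x d w) = (\<Sum>d\<in>I. a d * x d w)" for w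
    proof -
      have "(\<Sum>d\<in>I. (a(c := 0)) d * x d w) = (\<Sum>d\<in>I. a d * x d w)"
        by (rule sum.cong[OF refl]) (use insert.hyps(2) in force)
      then show ?thesis using insert.hyps by simp
    qed
    then show ?thesis using a by (intro exI[of _ "a(c := 0)"]) simp
  qed
qed

text \<open>Gaussian elimination, one coordinate at a time: the vectors with \<open>x i = 0\<close>
  are spanned by induction, and one vector with nonzero coordinate \<open>i\<close> supplies the
  rest. \<open>I\<close> collects the coordinates of \<open>K\<close> that may still be
  nonzero.\<close>

lemma finite_spanning:
  fixes S :: "('k \<Rightarrow> real) set"
  assumes "finite I" "I \<subseteq> K"
    and "\<And>a b x y. x \<in> S \<Longrightarrow> y \<in> S \<Longrightarrow> (\<lambda>k. a * x k + b * y k) \<in> S"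
    and "\<And>x k. x \<in> S \<Longrightarrow> k \<in> K - I \<Longrightarrow> x k = 0"
  shows "\<exists>B. finite B \<and> B \<subseteq> S \<and> (\<forall>x\<in>S. \<exists>c. \<forall>k\<in>K. x k = (\<Sum>b\<in>B. c b * b k))"
  using assms
proof (induction I arbitrary: S rule: finite_induct)
  case empty
  then show ?case by (intro exI[of _ "{}"]) auto
next
  case (insert i I)
  have closed: "\<And>a b x y. x \<in> S \<Longrightarrow> y \<in> S \<Longrightarrow> (\<lambda>k. a * x k + b * y k) \<in> S" using insert.prems by blast
  define S' where "S' = {x\<in>S. x i = 0}"
  have "\<exists>B. finite B \<and> B \<subseteq> S' \<and> (\<forall>x\<in>S'. \<exists>c. \<forall>k\<in>K. x k = (\<Sum>b\<in>B. c b * b k))"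
  proof (rule insert.IH)
    show "I \<subseteq> K" using insert.prems by blast
    show "(\<lambda>k. a * x k + b * y k) \<in> S'" if "x \<in> S'" "y \<in> S'" for a b x y
      using that closed by (simp add: S'_def)
    show "x k = 0" if "x \<in> S'" "k \<in> K - I" for x k
      using that insert.prems(3)[of x k] by (cases "k = i") (auto simp: S'_def)
  qed
  then obtain B where B: "finite B" "B \<subseteq> S'" "\<forall>x\<in>S'. \<exists>c. \<forall>k\<in>K. x k = (\<Sum>b\<in>B. c b * b k)" by blast
  show ?case
  proof (cases "S' = S")
    case True
    then show ?thesis using B by blast
  next
    case False
    then obtain z where z: "z \<in> S" "z i \<noteq> 0" unfolding S'_def by blast
    have zB: "z \<notin> B" using z B(2) by (auto simp: S'_def)
    have "\<exists>c. \<forall>k\<in>K. x k = (\<Sum>b\<in>insert z B. c b * b k)" if "x \<in> S" for x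
    proof -
      let ?y = "\<lambda>k. 1 * x k + (- x i / z i) * z k"
      have "?y \<in> S'" using closed[OF that z(1), of 1 "- x i / z i"] z by (simp add: S'_def)
      from bspec[OF B(3) this] obtain c where c: "\<forall>k\<in>K. ?y k = (\<Sum>b\<in>B. c b * b k)" by blast
      have "\<forall>k\<in>K. x k = (\<Sum>b\<in>insert z B. (c(z := x i / z i)) b * b k)"
      proof
        fix k assume "k \<in> K"
        have "(\<Sum>b\<in>B. (c(z := x i / z i)) b * b k) = (\<Sum>b\<in>B. c b * b k)"
          by (rule sum.cong) (use zB in auto)
        then have "(\<Sum>b\<in>insert z B. (c(z := x i / z i)) b * b k) = x i / z i * z k + ?y k"
          using c \<open>k \<in> K\<close> zB B(1) by simp
        then show "x k = (\<Sum>b\<in>insert z B. (c(z := x i / z i)) b * b k)" by simp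
      qed
      then show ?thesis by blast
    qed
    then show ?thesis using B z(1) by (intro exI[of _ "insert z B"]) (auto simp: S'_def)
  qed
qed

text \<open>The Riesz representative is needed inside \<open>S\<close>, because it will be used as a
  state again. A vector of \<open>S\<close> orthogonal to a spanning set has zero norm and hence
  \<open>a x = 0\<close>, so \<open>functional_dependence\<close> expresses \<open>a\<close> through
  the inner products with that set.\<close>

lemma weighted_riesz:
  fixes S :: "('k \<Rightarrow> real) set" and a :: "('k \<Rightarrow> real) \<Rightarrow> real"
  assumes "finite K" and m: "\<And>k. k \<in> K \<Longrightarrow> m k > (0::real)"
    and closed: "\<And>a b x y. x \<in> S \<Longrightarrow> y \<in> S \<Longrightarrow> (\<lambda>k. a * x k + b * y k) \<in> S"
    and zero: "(\<lambda>_. 0) \<in> S"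
    and lin: "\<And>c d x y. x \<in> S \<Longrightarrow> y \<in> S \<Longrightarrow> a (\<lambda>k. c * x k + d * y k) = c * a x + d * a y"
    and supp: "\<And>x. x \<in> S \<Longrightarrow> (\<And>k. k \<in> K \<Longrightarrow> x k = 0) \<Longrightarrow> a x = 0"
  shows "\<exists>l\<in>S. \<forall>x\<in>S. a x = (\<Sum>k\<in>K. m k * (l k * x k))"
proof -
  obtain B where B: "finite B" "B \<subseteq> S" "\<forall>x\<in>S. \<exists>c. \<forall>k\<in>K. x k = (\<Sum>b\<in>B. c b * b k)"
    using finite_spanning[OF \<open>finite K\<close> subset_refl closed] by blast
  define ip where "ip x y = (\<Sum>k\<in>K. m k * (x k * y k))" for x y
  have ip_comb: "ip b (\<lambda>k. c * x k + d * y k) = c * ip b x + d * ip b y" for b c d x y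
    unfolding ip_def sum_distrib_left sum.distrib[symmetric] by (rule sum.cong) (simp_all add: algebra_simps)
  have "\<exists>\<alpha>. \<forall>x\<in>S. a x = (\<Sum>b\<in>B. \<alpha> b * ip b x)"
  proof (rule functional_dependence[where comb = "\<lambda>c x d y. (\<lambda>k. c * x k + d * y k)"])
    fix x assume x: "x \<in> S" and z: "\<And>b. b \<in> B \<Longrightarrow> ip b x = 0"
    obtain c where c: "\<forall>k\<in>K. x k = (\<Sum>b\<in>B. c b * b k)" using B(3) x by blast
    have "ip x x = (\<Sum>k\<in>K. \<Sum>b\<in>B. c b * (m k * (b k * x k)))"
      unfolding ip_def
    proof (rule sum.cong[OF refl])
      fix k assume "k \<in> K"
      then have "m k * (x k * x k) = m k * x k * (\<Sum>b\<in>B. c b * b k)" using c by simp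
      then show "m k * (x k * x k) = (\<Sum>b\<in>B. c b * (m k * (b k * x k)))"
        by (simp add: sum_distrib_left mult_ac)
    qed
    also have "\<dots> = (\<Sum>b\<in>B. c b * ip b x)" unfolding ip_def sum_distrib_left by (rule sum.swap)
    also have "\<dots> = 0" using z by simp
    finally have "(\<Sum>k\<in>K. m k * (x k * x k)) = 0" by (simp add: ip_def)
    then have "\<forall>k\<in>K. m k * (x k * x k) = 0"
      using sum_nonneg_eq_0_iff[OF \<open>finite K\<close>, of "\<lambda>k. m k * (x k * x k)"] m by (simp add: less_imp_le)
    then have "x k = 0" if "k \<in> K" for k using m[OF that] that by auto
    then show "a x = 0" using supp[OF x] by blast
  qed (use B(1) closed lin ip_comb in blast)+
  then obtain \<alpha> where \<alpha>: "\<forall>x\<in>S. a x = (\<Sum>b\<in>B. \<alpha> b * ip b x)" by blast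
  define l where "l k = (\<Sum>b\<in>B. \<alpha> b * b k)" for k
  have "(\<lambda>k. \<Sum>b\<in>B'. \<alpha> b * b k) \<in> S" if "B' \<subseteq> B" for B'
  proof -
    have "finite B'" using that B(1) finite_subset by blast
    then show ?thesis using that
    proof (induction B')
      case empty then show ?case using zero by simp
    next
      case (insert b B')
      then have "(\<lambda>k. \<alpha> b * b k + 1 * (\<Sum>b\<in>B'. \<alpha> b * b k)) \<in> S" using B(2) by (intro closed) auto
      then show ?case using insert.hyps by simp
    qed
  qed
  then have "l \<in> S" unfolding l_def[abs_def] by blast
  moreover have "a x = (\<Sum>k\<in>K. m k * (l k * x k))" if "x \<in> S" for x
  proof -
    have "a x = (\<Sum>b\<in>B. \<Sum>k\<in>K. \<alpha> b * (m k * (b k * x k)))" using \<alpha> that by (simp add: ip_def sum_distrib_left)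
    also have "\<dots> = (\<Sum>k\<in>K. m k * (l k * x k))"
      unfolding l_def by (subst sum.swap) (simp add: sum_distrib_left sum_distrib_right mult_ac)
    finally show ?thesis .
  qed
  ultimately show ?thesis by blast
qed

text \<open>A monic annihilating relation without matrices. By induction there is such a relation on
  \<open>K\<close> for the sequence and one for its tail beyond \<open>r1\<close>; both fail at most
  at the new coordinate \<open>x\<close>, where a multiple of the first cancels the defect of the
  second.\<close>

lemma linear_recurrence_finite_dim:
  fixes l :: "nat \<Rightarrow> 'k \<Rightarrow> real"
  assumes "finite K"
  shows "\<exists>r c. \<forall>k\<in>K. l r k = (\<Sum>i<r. c i * l i k)"
  using assms
proof (induction K arbitrary: l rule: finite_induct)
  case empty
  then show ?case by simp
next
  case (insert x K)
  obtain r1 c1 where 1: "\<forall>k\<in>K. l r1 k = (\<Sum>i<r1. c1 i * l i k)" using insert.IH[of l] by blast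
  obtain r2 c2 where 2: "\<forall>k\<in>K. l (Suc r1 + r2) k = (\<Sum>i<r2. c2 i * l (Suc r1 + i) k)"
    using insert.IH[of "\<lambda>i. l (Suc r1 + i)"] by blast
  define d1 where "d1 k = l r1 k - (\<Sum>i<r1. c1 i * l i k)" for k
  define d2 where "d2 k = l (Suc r1 + r2) k - (\<Sum>i<r2. c2 i * l (Suc r1 + i) k)" for k
  show ?case
  proof (cases "d1 x = 0")
    case True
    then show ?thesis using 1 by (intro exI[of _ r1] exI[of _ c1]) (auto simp: d1_def)
  next
    case False
    define q where "q = d2 x / d1 x"
    \<comment> \<open>The tail starts at \<open>Suc r1\<close>, so index \<open>r1\<close> is free
      for the leading term of the first relation, multiplied by \<open>q\<close>.\<close>
    define c where "c i = (if i < r1 then - q * c1 i else if i = r1 then q else c2 (i - Suc r1))" for i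
    have "(\<Sum>i<Suc r1 + r2. c i * l i k) = q * d1 k + (\<Sum>i<r2. c2 i * l (Suc r1 + i) k)" for k
    proof -
      have "(\<Sum>i<Suc r1 + r2. c i * l i k) = (\<Sum>i<Suc r1. c i * l i k) + (\<Sum>i<r2. c (Suc r1 + i) * l (Suc r1 + i) k)"
        by (induction r2) auto
      also have "(\<Sum>i<Suc r1. c i * l i k) = q * d1 k"
        by (simp add: c_def d1_def sum_distrib_left algebra_simps sum_negf)
      finally show ?thesis by (simp add: c_def)
    qed
    then have "l (Suc r1 + r2) k - (\<Sum>i<Suc r1 + r2. c i * l i k) = d2 k - q * d1 k" for k
      by (simp add: d2_def)
    moreover have "\<forall>k\<in>insert x K. d2 k - q * d1 k = 0"
      using 1 2 False by (auto simp: d1_def d2_def q_def)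
    ultimately have "\<forall>k\<in>insert x K. l (Suc r1 + r2) k = (\<Sum>i<Suc r1 + r2. c i * l i k)"
      by (metis eq_iff_diff_eq_0)
    then show ?thesis by blast
  qed
qed

subsection \<open>Passive linear relations\<close>

lemma real_affine_nonneg:
  fixes a b :: real
  assumes "\<And>t. a + t * b \<ge> 0"
  shows "b = 0"
proof (rule ccontr)
  assume "b \<noteq> 0"
  then show False using assms[of "- (a + 1) / b"] by simp
qed

lemma real_quadratic_nonneg:
  fixes b c :: real
  assumes "\<And>t. t * b + t\<^sup>2 * c \<ge> 0"
  shows "b = 0"
proof (rule ccontr)
  assume b: "b \<noteq> 0"
  \<comment> \<open>Opposite in sign to \<open>b\<close> and small enough that the linear term
    dominates the quadratic one.\<close>
  define t where "t = - b / (\<bar>c\<bar> + 1)"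
  have bt: "b = - t * (\<bar>c\<bar> + 1)" by (simp add: t_def)
  have "t * b + t\<^sup>2 * c = t\<^sup>2 * (c - (\<bar>c\<bar> + 1))"
    by (subst bt) (simp add: power2_eq_square algebra_simps)
  moreover have "t \<noteq> 0" using b by (auto simp: t_def)
  ultimately have "t * b + t\<^sup>2 * c < 0" by (simp add: mult_pos_neg)
  then show False using assms[of t] by simp
qed

text \<open>
  \<open>R f e u v\<close> relates the states \<open>e\<close> and their rates \<open>f\<close> to the port variables \<open>u\<close>, \<open>v\<close>; the
  weights \<open>m\<close> are the inductances and capacitances, so that \<open>passivity\<close> is the power balance.
\<close>

locale passive_relation =
  fixes K :: "'k set" and J :: "'j set" and m :: "'k \<Rightarrow> real"
    and R :: "('k \<Rightarrow> real) \<Rightarrow> ('k \<Rightarrow> real) \<Rightarrow> ('j \<Rightarrow> real) \<Rightarrow> ('j \<Rightarrow> real) \<Rightarrow> bool"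
    and H :: "complex \<Rightarrow> complex" and D :: real and P :: "complex set"
  assumes finK: "finite K" and finJ: "finite J"
    and m_pos: "\<And>k. k \<in> K \<Longrightarrow> m k > 0"
    and closed: "\<And>a b f e u v f' e' u' v'. R f e u v \<Longrightarrow> R f' e' u' v' \<Longrightarrow>
       R (\<lambda>k. a * f k + b * f' k) (\<lambda>k. a * e k + b * e' k)
         (\<lambda>j. a * u j + b * u' j) (\<lambda>j. a * v j + b * v' j)"
    and cong_u: "\<And>f e u v u'. R f e u v \<Longrightarrow> (\<And>j. j \<in> J \<Longrightarrow> u j = u' j) \<Longrightarrow> R f e u' v"
    and passivity: "\<And>f e u v. R f e u v \<Longrightarrow> (\<Sum>k\<in>K. m k * (f k * e k)) \<le> (\<Sum>j\<in>J. u j * v j)"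
    and sum_u: "\<And>f e u v. R f e u v \<Longrightarrow> (\<Sum>j\<in>J. u j) = 0"
    and sum_v: "\<And>f e u v. R f e u v \<Longrightarrow> (\<Sum>j\<in>J. v j) = 0"
    and finP: "finite P"
    and lap: "\<And>s u. Re s > 0 \<Longrightarrow> s \<notin> P \<Longrightarrow> (\<Sum>j\<in>J. u j) = 0 \<Longrightarrow> \<exists>e.
       R (\<lambda>k. Re (s * e k)) (\<lambda>k. Re (e k)) (\<lambda>j. u j) (\<lambda>j. Re (H s) * u j) \<and>
       R (\<lambda>k. Im (s * e k)) (\<lambda>k. Im (e k)) (\<lambda>j. 0) (\<lambda>j. Im (H s) * u j)"
    and H_inf: "((\<lambda>x. H (complex_of_real x)) \<longlongrightarrow> complex_of_real D) at_top"
    and H_axis: "\<And>\<omega>::real. \<exists>l. (H \<longlongrightarrow> l) (at (\<i> * of_real \<omega>) within {s. Re s > 0})"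
begin

text \<open>Bilinear also over the complex numbers: conjugates are written out, so that one
  definition covers real functionals and complex eigenvectors.\<close>

definition ip :: "('k \<Rightarrow> 'a::real_normed_field) \<Rightarrow> ('k \<Rightarrow> 'a) \<Rightarrow> 'a" where
  "ip x y = (\<Sum>k\<in>K. of_real (m k) * (x k * y k))"

lemma ip_add_right: "ip x (\<lambda>k. a * y k + b * z k) = a * ip x y + b * ip x z"
  unfolding ip_def sum_distrib_left sum.distrib[symmetric] by (rule sum.cong) (simp_all add: algebra_simps)

lemma ip_scale_right: "ip x (\<lambda>k. a * y k) = a * ip x y"
  by (simp add: ip_def sum_distrib_left algebra_simps)

lemma ip_commute: "ip x y = ip y x"
  by (simp add: ip_def mult.commute)

lemma ip_sum_left: "ip (\<lambda>k. \<Sum>i\<in>I. a i * l i k) y = (\<Sum>i\<in>I. a i * ip (l i) y)"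
proof -
  have "ip (\<lambda>k. \<Sum>i\<in>I. a i * l i k) y = (\<Sum>k\<in>K. \<Sum>i\<in>I. a i * (of_real (m k) * (l i k * y k)))"
    by (simp add: ip_def sum_distrib_left sum_distrib_right mult_ac)
  also have "\<dots> = (\<Sum>i\<in>I. a i * ip (l i) y)" unfolding ip_def sum_distrib_left by (rule sum.swap)
  finally show ?thesis .
qed

lemma ip_cong: "(\<And>k. k \<in> K \<Longrightarrow> x k = x' k) \<Longrightarrow> (\<And>k. k \<in> K \<Longrightarrow> y k = y' k) \<Longrightarrow> ip x y = ip x' y'"
  unfolding ip_def by (rule sum.cong[OF refl]) simp

lemma Re_ip: "Re (ip (\<lambda>k. complex_of_real (l k)) y) = ip l (\<lambda>k. Re (y k))"
  and Im_ip: "Im (ip (\<lambda>k. complex_of_real (l k)) y) = ip l (\<lambda>k. Im (y k))"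
  by (auto simp: ip_def)

section \<open>Complexification and solutions at large real frequencies\<close>

definition RC :: "('k \<Rightarrow> complex) \<Rightarrow> ('k \<Rightarrow> complex) \<Rightarrow> ('j \<Rightarrow> complex) \<Rightarrow> ('j \<Rightarrow> complex) \<Rightarrow> bool" where
  "RC f e u v \<longleftrightarrow> R (\<lambda>k. Re (f k)) (\<lambda>k. Re (e k)) (\<lambda>j. Re (u j)) (\<lambda>j. Re (v j)) \<and>
     R (\<lambda>k. Im (f k)) (\<lambda>k. Im (e k)) (\<lambda>j. Im (u j)) (\<lambda>j. Im (v j))"

lemma RC_comb:
  assumes "RC f e u v" "RC f' e' u' v'"
  shows "RC (\<lambda>k. a * f k + b * f' k) (\<lambda>k. a * e k + b * e' k)
            (\<lambda>j. a * u j + b * u' j) (\<lambda>j. a * v j + b * v' j)"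
proof -
  have r: "R (\<lambda>k. Re (f k)) (\<lambda>k. Re (e k)) (\<lambda>j. Re (u j)) (\<lambda>j. Re (v j))"
    and i: "R (\<lambda>k. Im (f k)) (\<lambda>k. Im (e k)) (\<lambda>j. Im (u j)) (\<lambda>j. Im (v j))"
    and r': "R (\<lambda>k. Re (f' k)) (\<lambda>k. Re (e' k)) (\<lambda>j. Re (u' j)) (\<lambda>j. Re (v' j))"
    and i': "R (\<lambda>k. Im (f' k)) (\<lambda>k. Im (e' k)) (\<lambda>j. Im (u' j)) (\<lambda>j. Im (v' j))"
    using assms by (auto simp: RC_def)
  show ?thesis unfolding RC_def
    using closed[OF closed[OF r i, of "Re a" "- Im a"] closed[OF r' i', of "Re b" "- Im b"], of 1 1]
      closed[OF closed[OF r i, of "Im a" "Re a"] closed[OF r' i', of "Im b" "Re b"], of 1 1]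
    by (simp add: algebra_simps)
qed

lemma RC_of_real:
  assumes "R f e u v"
  shows "RC (\<lambda>k. of_real (f k)) (\<lambda>k. of_real (e k)) (\<lambda>j. of_real (u j)) (\<lambda>j. of_real (v j))"
  using assms closed[OF assms assms, of 0 0] by (simp add: RC_def)

lemma RC_passive:
  assumes "RC f e u v"
  shows "Re (ip f (\<lambda>k. cnj (e k))) \<le> Re (\<Sum>j\<in>J. u j * cnj (v j))"
proof -
  have "Re (ip f (\<lambda>k. cnj (e k))) = (\<Sum>k\<in>K. m k * (Re (f k) * Re (e k))) + (\<Sum>k\<in>K. m k * (Im (f k) * Im (e k)))"
    unfolding ip_def Re_sum sum.distrib[symmetric] by (rule sum.cong[OF refl]) (simp add: algebra_simps)
  also have "\<dots> \<le> (\<Sum>j\<in>J. Re (u j) * Re (v j)) + (\<Sum>j\<in>J. Im (u j) * Im (v j))"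
    using assms passivity unfolding RC_def by (blast intro: add_mono)
  also have "\<dots> = Re (\<Sum>j\<in>J. u j * cnj (v j))"
    unfolding Re_sum sum.distrib[symmetric] by (rule sum.cong[OF refl]) simp
  finally show ?thesis .
qed

lemma lapC:
  assumes "Re s > 0" "s \<notin> P" "(\<Sum>j\<in>J. u j) = 0"
  shows "\<exists>e. RC (\<lambda>k. s * e k) e (\<lambda>j. of_real (u j)) (\<lambda>j. H s * of_real (u j))"
  using lap[OF assms] by (simp add: RC_def)

lemma eventually_regular: "\<forall>\<^sub>F x in at_top. (x::real) > 0 \<and> complex_of_real x \<notin> P"
proof -
  have "finite (complex_of_real -` P)" using finP by (intro finite_vimageI) (auto simp: inj_def)
  then obtain B where "\<And>x. x \<in> complex_of_real -` P \<Longrightarrow> x \<le> B"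
    using bdd_above_finite[of "complex_of_real -` P"] by (auto simp: bdd_above_def)
  then have "\<forall>\<^sub>F x in at_top. complex_of_real x \<notin> P"
    by (intro eventually_mono[OF eventually_gt_at_top[of B]]) force
  then show ?thesis using eventually_gt_at_top[of "0::real"] by eventually_elim auto
qed

text \<open>By passivity, \<open>x\<close> times the weighted square norm of \<open>E x\<close> is
  at most \<open>Re (H x)\<close> times the square sum of the input. Since \<open>H\<close>
  converges along the real axis, the states decay at least like the inverse square root of
  \<open>x\<close>.\<close>

lemma laplace_family:
  assumes u: "(\<Sum>j\<in>J. u j) = 0"
  obtains E :: "real \<Rightarrow> 'k \<Rightarrow> complex"
    where "\<forall>\<^sub>F x in at_top. RC (\<lambda>k. of_real x * E x k) (E x) (\<lambda>j. of_real (u j)) (\<lambda>j. H (of_real x) * of_real (u j))"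
      and "\<And>k. k \<in> K \<Longrightarrow> ((\<lambda>x. E x k) \<longlongrightarrow> 0) at_top"
proof -
  define E where "E x = (SOME e. RC (\<lambda>k. of_real x * e k) e (\<lambda>j. of_real (u j)) (\<lambda>j. H (of_real x) * of_real (u j)))" for x :: real
  have ev: "\<forall>\<^sub>F x in at_top. x > 0 \<and> RC (\<lambda>k. of_real x * E x k) (E x) (\<lambda>j. of_real (u j)) (\<lambda>j. H (of_real x) * of_real (u j))"
    using eventually_regular
  proof eventually_elim
    case (elim x)
    then have "\<exists>e. RC (\<lambda>k. of_real x * e k) e (\<lambda>j. of_real (u j)) (\<lambda>j. H (of_real x) * of_real (u j))"
      by (intro lapC) (use u in auto)
    then have "RC (\<lambda>k. of_real x * E x k) (E x) (\<lambda>j. of_real (u j)) (\<lambda>j. H (of_real x) * of_real (u j))"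
      unfolding E_def by (rule someI_ex)
    then show ?case using elim by simp
  qed
  define G where "G x = norm (H (of_real x)) * (\<Sum>j\<in>J. (u j)\<^sup>2)" for x :: real
  have bound: "\<forall>\<^sub>F x in at_top. (norm (E x k))\<^sup>2 \<le> G x / m k * inverse x" if k: "k \<in> K" for k
    using ev
  proof eventually_elim
    case (elim x)
    have "Re (ip (\<lambda>k. of_real x * E x k) (\<lambda>k. cnj (E x k))) = x * (\<Sum>k\<in>K. m k * (norm (E x k))\<^sup>2)"
      by (simp add: ip_def sum_distrib_left algebra_simps cmod_power2) (simp add: power2_eq_square)
    moreover have "Re (\<Sum>j\<in>J. of_real (u j) * cnj (H (of_real x) * of_real (u j))) = Re (H (of_real x)) * (\<Sum>j\<in>J. (u j)\<^sup>2)"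
      by (simp add: sum_distrib_left power2_eq_square algebra_simps)
    ultimately have "x * (\<Sum>k\<in>K. m k * (norm (E x k))\<^sup>2) \<le> Re (H (of_real x)) * (\<Sum>j\<in>J. (u j)\<^sup>2)"
      using RC_passive[of "\<lambda>k. of_real x * E x k" "E x" "\<lambda>j. of_real (u j)" "\<lambda>j. H (of_real x) * of_real (u j)"] elim
      by linarith
    also have "\<dots> \<le> G x" unfolding G_def by (intro mult_right_mono complex_Re_le_cmod sum_nonneg) auto
    finally have 1: "x * (\<Sum>k\<in>K. m k * (norm (E x k))\<^sup>2) \<le> G x" .
    have "m k * (norm (E x k))\<^sup>2 \<le> (\<Sum>k\<in>K. m k * (norm (E x k))\<^sup>2)"
      by (rule member_le_sum) (use k finK m_pos in \<open>auto simp: less_imp_le\<close>)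
    then have "x * (m k * (norm (E x k))\<^sup>2) \<le> G x" using 1 elim by (meson mult_left_mono less_imp_le order_trans)
    then show ?case using elim m_pos[OF k] by (simp add: field_simps)
  qed
  have "((\<lambda>x. E x k) \<longlongrightarrow> 0) at_top" if k: "k \<in> K" for k
  proof -
    have "((\<lambda>x. G x / m k * inverse x) \<longlongrightarrow> norm (complex_of_real D) * (\<Sum>j\<in>J. (u j)\<^sup>2) / m k * 0) at_top"
      unfolding G_def by (intro tendsto_intros H_inf tendsto_inverse_0_at_top filterlim_ident) (use m_pos[OF k] in auto)
    then have "((\<lambda>x. (norm (E x k))\<^sup>2) \<longlongrightarrow> 0) at_top"
      by (intro tendsto_sandwich[OF _ bound[OF k] tendsto_const]) auto
    then have "((\<lambda>x. sqrt ((norm (E x k))\<^sup>2)) \<longlongrightarrow> sqrt 0) at_top" by (rule tendsto_real_sqrt)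
    then show ?thesis by (simp add: tendsto_norm_zero_iff)
  qed
  moreover have "\<forall>\<^sub>F x in at_top. RC (\<lambda>k. of_real x * E x k) (E x) (\<lambda>j. of_real (u j)) (\<lambda>j. H (of_real x) * of_real (u j))"
    using ev by eventually_elim auto
  ultimately show ?thesis using that by blast
qed

lemma ip_tendsto_zero:
  fixes E :: "real \<Rightarrow> 'k \<Rightarrow> complex"
  assumes "\<And>k. k \<in> K \<Longrightarrow> ((\<lambda>x. E x k) \<longlongrightarrow> 0) at_top"
  shows "((\<lambda>x. ip a (E x)) \<longlongrightarrow> 0) at_top"
proof -
  have "((\<lambda>x. ip a (E x)) \<longlongrightarrow> (\<Sum>k\<in>K. of_real (m k) * (a k * 0))) at_top"
    unfolding ip_def by (intro tendsto_intros assms) auto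
  then show ?thesis by simp
qed

section \<open>Functionals of states and inputs\<close>

definition S0 :: "('k \<Rightarrow> real) set" where
  "S0 = {e. \<exists>f v. R f e (\<lambda>_. 0) v}"

text \<open>Closure under combinations yields zero only from an existing element; a Laplace solution
  with zero input supplies one.\<close>

lemma R_zero: "R (\<lambda>_. 0) (\<lambda>_. 0) (\<lambda>_. 0) (\<lambda>_. 0)"
proof -
  obtain x :: real where x: "x > 0 \<and> complex_of_real x \<notin> P"
    using eventually_happens[OF eventually_regular] by auto
  from lapC[of "of_real x" "\<lambda>_. 0"] x obtain e where
    "RC (\<lambda>k. of_real x * e k) e (\<lambda>_. 0) (\<lambda>_. 0)" by auto
  then show ?thesis using closed[of _ _ _ _ _ _ _ _ 0 0] unfolding RC_def by fastforce
qed

lemma S0_closed: "x \<in> S0 \<Longrightarrow> y \<in> S0 \<Longrightarrow> (\<lambda>k. a * x k + b * y k) \<in> S0"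
  unfolding S0_def using closed[of _ _ "\<lambda>_. 0" _ _ _ "\<lambda>_. 0"] by fastforce

text \<open>A quantity that vanishes with state and input is a linear function of both. Its state
  part can be represented by an element of \<open>S0\<close>, because elements with zero input have
  their state in \<open>S0\<close>; the error made on other states vanishes with the input and is
  absorbed by \<open>\<beta>\<close>. Having \<open>l\<close> in \<open>S0\<close> lets it be
  inserted into the relation as a state.\<close>

lemma transport:
  assumes lin: "\<And>a b f e u v f' e' u' v'. R f e u v \<Longrightarrow> R f' e' u' v' \<Longrightarrow>
       \<phi> (\<lambda>k. a * f k + b * f' k) (\<lambda>k. a * e k + b * e' k)
         (\<lambda>j. a * u j + b * u' j) (\<lambda>j. a * v j + b * v' j) = a * \<phi> f e u v + b * \<phi> f' e' u' v'"
    and cong: "\<And>f e u v u'. (\<And>j. j \<in> J \<Longrightarrow> u j = u' j) \<Longrightarrow> \<phi> f e u v = \<phi> f e u' v"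
    and ker: "\<And>f e v. R f e (\<lambda>_. 0) v \<Longrightarrow> (\<And>k. k \<in> K \<Longrightarrow> e k = 0) \<Longrightarrow> \<phi> f e (\<lambda>_. 0) v = (0::real)"
  shows "\<exists>l\<in>S0. \<exists>\<beta>. \<forall>f e u v. R f e u v \<longrightarrow> \<phi> f e u v = ip l e + (\<Sum>j\<in>J. \<beta> j * u j)"
proof -
  define W where "W = {(f, e, u, v). R f e u v}"
  define comb where "comb a w b w' = (case w of (f, e, u, v) \<Rightarrow> case w' of (f', e', u', v') \<Rightarrow>
     ((\<lambda>k. a * f k + b * f' k), (\<lambda>k. a * e k + b * e' k), (\<lambda>j. a * u j + b * u' j), (\<lambda>j. a * v j + b * v' j)))"
    for a b :: real and w w' :: "('k \<Rightarrow> real) \<times> ('k \<Rightarrow> real) \<times> ('j \<Rightarrow> real) \<times> ('j \<Rightarrow> real)"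
  define x where "x c w = (case w of (f, e, u, v) \<Rightarrow> case c of Inl k \<Rightarrow> e k | Inr j \<Rightarrow> u j)"
    for c :: "'k + 'j" and w :: "('k \<Rightarrow> real) \<times> ('k \<Rightarrow> real) \<times> ('j \<Rightarrow> real) \<times> ('j \<Rightarrow> real)"
  have "\<exists>a. \<forall>w\<in>W. (\<lambda>(f, e, u, v). \<phi> f e u v) w = (\<Sum>c\<in>Inl ` K \<union> Inr ` J. a c * x c w)"
  proof (rule functional_dependence[where comb = comb])
    fix w assume w: "w \<in> W" and z: "\<And>c. c \<in> Inl ` K \<union> Inr ` J \<Longrightarrow> x c w = 0"
    obtain f e u v where [simp]: "w = (f, e, u, v)" by (cases w) auto
    have e0: "e k = 0" if "k \<in> K" for k using z[of "Inl k"] that by (simp add: x_def)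
    have u0: "u j = 0" if "j \<in> J" for j using z[of "Inr j"] that by (simp add: x_def)
    have "R f e (\<lambda>_. 0) v" using w u0 cong_u by (force simp: W_def)
    then have "\<phi> f e (\<lambda>_. 0) v = 0" using ker e0 by blast
    then show "(\<lambda>(f, e, u, v). \<phi> f e u v) w = 0" using cong[of u "\<lambda>_. 0"] u0 by simp
  next
    fix a b w w' assume "w \<in> W" "w' \<in> W"
    moreover obtain f e u v f' e' u' v' where [simp]: "w = (f, e, u, v)" "w' = (f', e', u', v')"
      by (cases w, cases w') auto
    ultimately have *: "R f e u v" "R f' e' u' v'" by (auto simp: W_def)
    show "comb a w b w' \<in> W" using closed[OF *] by (simp add: W_def comb_def)
    show "(\<lambda>(f, e, u, v). \<phi> f e u v) (comb a w b w') =
        a * (\<lambda>(f, e, u, v). \<phi> f e u v) w + b * (\<lambda>(f, e, u, v). \<phi> f e u v) w'"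
      using lin[OF *] by (simp add: comb_def)
    show "x c (comb a w b w') = a * x c w + b * x c w'" for c
      by (simp add: comb_def x_def split: sum.split)
  qed (simp add: finK finJ)
  then obtain a where a: "\<forall>w\<in>W. (\<lambda>(f, e, u, v). \<phi> f e u v) w = (\<Sum>c\<in>Inl ` K \<union> Inr ` J. a c * x c w)" by blast
  have a': "\<phi> f e u v = (\<Sum>k\<in>K. a (Inl k) * e k) + (\<Sum>j\<in>J. a (Inr j) * u j)" if "R f e u v" for f e u v
  proof -
    have "\<phi> f e u v = (\<Sum>c\<in>Inl ` K \<union> Inr ` J. a c * x c (f, e, u, v))"
      using bspec[OF a, of "(f, e, u, v)"] that by (simp add: W_def)
    also have "\<dots> = (\<Sum>c\<in>Inl ` K. a c * x c (f, e, u, v)) + (\<Sum>c\<in>Inr ` J. a c * x c (f, e, u, v))"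
      by (rule sum.union_disjoint) (use finK finJ in auto)
    also have "\<dots> = (\<Sum>k\<in>K. a (Inl k) * e k) + (\<Sum>j\<in>J. a (Inr j) * u j)"
      by (simp add: sum.reindex x_def)
    finally show ?thesis .
  qed
  have "\<exists>l\<in>S0. \<forall>e\<in>S0. (\<Sum>k\<in>K. a (Inl k) * e k) = (\<Sum>k\<in>K. m k * (l k * e k))"
  proof (rule weighted_riesz[OF finK m_pos])
    show "(\<lambda>_. 0) \<in> S0" using R_zero by (auto simp: S0_def)
    show "(\<Sum>k\<in>K. a (Inl k) * (c * x k + d * y k)) = c * (\<Sum>k\<in>K. a (Inl k) * x k) + d * (\<Sum>k\<in>K. a (Inl k) * y k)" for c d x y
      unfolding sum_distrib_left sum.distrib[symmetric] by (rule sum.cong) (simp_all add: algebra_simps)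
  qed (simp_all add: S0_closed)
  then obtain l where l: "l \<in> S0" "\<forall>e\<in>S0. (\<Sum>k\<in>K. a (Inl k) * e k) = ip l e" by (auto simp: ip_def)
  \<comment> \<open>Zero on \<open>S0\<close> by the choice of \<open>l\<close>, hence a function of
    the input alone on the relation.\<close>
  define \<psi> where "\<psi> e = (\<Sum>k\<in>K. a (Inl k) * e k) - ip l e" for e
  have "\<exists>b. \<forall>w\<in>W. (\<lambda>(f, e, u, v). \<psi> e) w = (\<Sum>j\<in>J. b j * (\<lambda>(f, e, u, v). u j) w)"
  proof (rule functional_dependence[where comb = comb])
    fix w assume w: "w \<in> W" and z: "\<And>j. j \<in> J \<Longrightarrow> (\<lambda>(f, e, u, v). u j) w = 0"
    obtain f e u v where [simp]: "w = (f, e, u, v)" by (cases w) auto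
    have "R f e (\<lambda>_. 0) v" using w z cong_u by (force simp: W_def)
    then have "e \<in> S0" by (auto simp: S0_def)
    then show "(\<lambda>(f, e, u, v). \<psi> e) w = 0" using l by (simp add: \<psi>_def)
  next
    have "\<psi> (\<lambda>k. a * e k + b * e' k) = a * \<psi> e + b * \<psi> e'" for a b e e'
    proof -
      have "(\<Sum>k\<in>K. a' (Inl k) * (a * e k + b * e' k)) = a * (\<Sum>k\<in>K. a' (Inl k) * e k) + b * (\<Sum>k\<in>K. a' (Inl k) * e' k)" for a'
        unfolding sum_distrib_left sum.distrib[symmetric] by (rule sum.cong) (simp_all add: algebra_simps)
      then show ?thesis unfolding \<psi>_def ip_add_right by (simp add: right_diff_distrib)
    qed
    then show "(\<lambda>(f, e, u, v). \<psi> e) (comb a w b w') = a * (\<lambda>(f, e, u, v). \<psi> e) w + b * (\<lambda>(f, e, u, v). \<psi> e) w'"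
      if "w \<in> W" "w' \<in> W" for a b w w' by (simp add: comb_def split: prod.split)
  next
    fix a b w w' assume "w \<in> W" "w' \<in> W"
    moreover obtain f e u v f' e' u' v' where [simp]: "w = (f, e, u, v)" "w' = (f', e', u', v')"
      by (cases w, cases w') auto
    ultimately have *: "R f e u v" "R f' e' u' v'" by (auto simp: W_def)
    show "comb a w b w' \<in> W" using closed[OF *] by (simp add: W_def comb_def)
    show "(\<lambda>(f, e, u, v). u j) (comb a w b w') = a * (\<lambda>(f, e, u, v). u j) w + b * (\<lambda>(f, e, u, v). u j) w'" for j
      by (simp add: comb_def)
  qed (simp add: finJ)
  then obtain b where b: "\<forall>w\<in>W. (\<lambda>(f, e, u, v). \<psi> e) w = (\<Sum>j\<in>J. b j * (\<lambda>(f, e, u, v). u j) w)" by blast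
  have "\<phi> f e u v = ip l e + (\<Sum>j\<in>J. (a (Inr j) + b j) * u j)" if "R f e u v" for f e u v
    using a'[OF that] bspec[OF b, of "(f, e, u, v)"] that
    by (simp add: W_def \<psi>_def algebra_simps sum.distrib)
  then show ?thesis by (intro bexI[OF _ l(1)] exI[of _ "\<lambda>j. a (Inr j) + b j"]) simp
qed

text \<open>An element with zero state and zero input may be added with any factor to one whose
  state is \<open>l\<close>. Passivity keeps an affine function of the factor nonnegative, so its
  slope \<open>- ip l f'\<close> is zero: the rate seen by \<open>l\<close> is determined by state
  and input.\<close>

lemma next_functional:
  assumes "l \<in> S0"
  shows "\<exists>l'\<in>S0. \<exists>\<beta>. \<forall>f e u v. R f e u v \<longrightarrow> ip l f = ip l' e + (\<Sum>j\<in>J. \<beta> j * u j)"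
proof (rule transport[where \<phi> = "\<lambda>f e u v. ip l f"])
  fix f' e' v' assume R': "R f' e' (\<lambda>_. 0) v'" and e': "\<And>k. k \<in> K \<Longrightarrow> e' k = 0"
  obtain f0 v0 where R0: "R f0 l (\<lambda>_. 0) v0" using assms by (auto simp: S0_def)
  have "- ip l f0 + t * (- ip l f') \<ge> 0" for t
  proof -
    have "(\<Sum>k\<in>K. m k * ((1 * f0 k + t * f' k) * (1 * l k + t * e' k))) \<le> 0"
      using passivity[OF closed[OF R0 R', of 1 t]] by simp
    also have "(\<Sum>k\<in>K. m k * ((1 * f0 k + t * f' k) * (1 * l k + t * e' k))) = ip l (\<lambda>k. 1 * f0 k + t * f' k)"
      unfolding ip_def by (rule sum.cong[OF refl]) (simp add: e')
    finally show ?thesis unfolding ip_add_right by simp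
  qed
  then have "- ip l f' = 0" by (rule real_affine_nonneg)
  then show "ip l f' = 0" by simp
qed (simp_all only: ip_add_right)

text \<open>The same affine argument, applied to an arbitrary element, gives
  \<open>ip f' e = (\<Sum>j\<in>J. u j * v' j)\<close>. Along the Laplace solutions with input
  \<open>v'\<close> the left side tends to zero with the states, while the right side is the
  constant square sum of \<open>v'\<close>.\<close>

lemma output_functional:
  assumes j: "j \<in> J"
  shows "\<exists>l\<in>S0. \<exists>\<beta>. \<forall>f e u v. R f e u v \<longrightarrow> v j = ip l e + (\<Sum>j\<in>J. \<beta> j * u j)"
proof (rule transport[where \<phi> = "\<lambda>f e u v. v j"])
  fix f' e' v' assume R': "R f' e' (\<lambda>_. 0) v'" and e': "\<And>k. k \<in> K \<Longrightarrow> e' k = 0"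
  have *: "ip f' e = (\<Sum>j\<in>J. u j * v' j)" if "R f e u v" for f e u v
  proof -
    have "((\<Sum>j\<in>J. u j * v j) - ip f e) + t * ((\<Sum>j\<in>J. u j * v' j) - ip f' e) \<ge> 0" for t
    proof -
      have "(\<Sum>k\<in>K. m k * ((1 * f k + t * f' k) * (1 * e k + t * e' k))) \<le> (\<Sum>j\<in>J. u j * (v j + t * v' j))"
        using passivity[OF closed[OF that R', of 1 t]] by simp
      also have "(\<Sum>k\<in>K. m k * ((1 * f k + t * f' k) * (1 * e k + t * e' k))) = ip e (\<lambda>k. 1 * f k + t * f' k)"
        unfolding ip_def by (rule sum.cong[OF refl]) (simp add: e')
      finally show ?thesis unfolding ip_add_right
        by (simp add: ip_commute[of e] algebra_simps sum.distrib sum_distrib_left)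
    qed
    then show ?thesis using real_affine_nonneg by fastforce
  qed
  \<comment> \<open>Outputs of the relation have zero sum, so \<open>v'\<close> is admissible as an
    input.\<close>
  obtain E :: "real \<Rightarrow> 'k \<Rightarrow> complex" where
    E: "\<forall>\<^sub>F x in at_top. RC (\<lambda>k. of_real x * E x k) (E x) (\<lambda>j. of_real (v' j)) (\<lambda>j. H (of_real x) * of_real (v' j))"
      "\<And>k. k \<in> K \<Longrightarrow> ((\<lambda>x. E x k) \<longlongrightarrow> 0) at_top"
    using laplace_family[OF sum_v[OF R']] by blast
  have "\<forall>\<^sub>F x in at_top. Re (ip (\<lambda>k. complex_of_real (f' k)) (E x)) = (\<Sum>j\<in>J. v' j * v' j)"
    using E(1) by eventually_elim (auto simp: RC_def Re_ip dest: *)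
  moreover have "((\<lambda>x. Re (ip (\<lambda>k. complex_of_real (f' k)) (E x))) \<longlongrightarrow> Re 0) at_top"
    by (intro tendsto_Re ip_tendsto_zero E(2))
  ultimately have "((\<lambda>x::real. \<Sum>j\<in>J. v' j * v' j) \<longlongrightarrow> Re 0) at_top"
    by (rule Lim_transform_eventually[rotated])
  then have "(\<Sum>j\<in>J. v' j * v' j) = 0" by (simp add: tendsto_const_iff)
  then show "v' j = 0" using sum_nonneg_eq_0_iff[OF finJ, of "\<lambda>j. v' j * v' j"] j by simp
qed simp_all

end

section \<open>Lossless elements and the output chain\<close>

context passive_relation
begin

lemma RC_zero: "RC (\<lambda>_. 0) (\<lambda>_. 0) (\<lambda>_. 0) (\<lambda>_. 0)"
  using R_zero by (simp add: RC_def)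

lemma RC_sum:
  fixes n :: nat
  assumes "\<And>i. i < n \<Longrightarrow> RC (f i) (e i) (u i) (v i)"
  shows "RC (\<lambda>k. \<Sum>i<n. c i * f i k) (\<lambda>k. \<Sum>i<n. c i * e i k)
            (\<lambda>j. \<Sum>i<n. c i * u i j) (\<lambda>j. \<Sum>i<n. c i * v i j)"
  using assms
proof (induction n)
  case 0
  then show ?case using RC_zero by simp
next
  case (Suc n)
  have "RC (\<lambda>k. \<Sum>i<n. c i * f i k) (\<lambda>k. \<Sum>i<n. c i * e i k)
           (\<lambda>j. \<Sum>i<n. c i * u i j) (\<lambda>j. \<Sum>i<n. c i * v i j)"
    by (rule Suc.IH) (simp add: Suc.prems)
  from RC_comb[OF this Suc.prems[of n], of 1 "c n"] show ?case by simp
qed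

text \<open>
  At a lossless element of the relation with zero input the quadratic form of the dissipated
  power is minimal, hence its polar form vanishes there.
\<close>

lemma lossless_polar:
  assumes w0: "RC f0 e0 (\<lambda>_. 0) v0" and lossless: "Re (ip f0 (\<lambda>k. cnj (e0 k))) = 0"
    and w: "RC f e u v"
  shows "(\<Sum>j\<in>J. u j * cnj (v0 j)) = ip (\<lambda>k. cnj (f0 k)) e + ip (\<lambda>k. cnj (e0 k)) f"
proof -
  define b where "b f e u = (\<Sum>j\<in>J. u j * cnj (v0 j)) - ip (\<lambda>k. cnj (f0 k)) e - ip (\<lambda>k. cnj (e0 k)) f"
    for f e :: "'k \<Rightarrow> complex" and u :: "'j \<Rightarrow> complex"
  have Re_b: "Re (b f e u) = 0" if w: "RC f e u v" for f e u v
  proof (rule real_quadratic_nonneg)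
    fix t :: real
    define c where "c = Re (\<Sum>j\<in>J. u j * cnj (v j)) - Re (ip f (\<lambda>k. cnj (e k)))"
    have "Re (ip (\<lambda>k. 1 * f0 k + of_real t * f k) (\<lambda>k. cnj (1 * e0 k + of_real t * e k))) \<le>
        Re (\<Sum>j\<in>J. (1 * 0 + of_real t * u j) * cnj (1 * v0 j + of_real t * v j))"
      using RC_passive[OF RC_comb[OF w0 w, of 1 "of_real t"]] .
    moreover have "Re (\<Sum>j\<in>J. (1 * 0 + of_real t * u j) * cnj (1 * v0 j + of_real t * v j)) =
        t * Re (\<Sum>j\<in>J. u j * cnj (v0 j)) + t\<^sup>2 * Re (\<Sum>j\<in>J. u j * cnj (v j))"
      unfolding Re_sum sum_distrib_left sum.distrib[symmetric]
      by (rule sum.cong[OF refl]) (simp add: power2_eq_square algebra_simps)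
    moreover have "Re (ip (\<lambda>k. 1 * f0 k + of_real t * f k) (\<lambda>k. cnj (1 * e0 k + of_real t * e k))) =
        Re (ip f0 (\<lambda>k. cnj (e0 k))) + t * Re (ip (\<lambda>k. cnj (f0 k)) e) + t * Re (ip (\<lambda>k. cnj (e0 k)) f)
         + t\<^sup>2 * Re (ip f (\<lambda>k. cnj (e k)))"
      unfolding ip_def Re_sum sum_distrib_left sum.distrib[symmetric]
      by (rule sum.cong[OF refl]) (simp add: power2_eq_square algebra_simps)
    ultimately show "t * Re (b f e u) + t\<^sup>2 * c \<ge> 0"
      unfolding b_def c_def lossless by (simp add: algebra_simps)
  qed
  \<comment> \<open>Multiplication by \<open>- \<i>\<close> turns the imaginary part of
    \<open>b\<close> into a real part, to which \<open>Re_b\<close> applies.\<close>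
  have b_scale: "b (\<lambda>k. - \<i> * f k) (\<lambda>k. - \<i> * e k) (\<lambda>j. - \<i> * u j) = - \<i> * b f e u"
    unfolding b_def ip_scale_right by (simp add: sum_distrib_left algebra_simps sum_negf)
  have "RC (\<lambda>k. - \<i> * f k) (\<lambda>k. - \<i> * e k) (\<lambda>j. - \<i> * u j) (\<lambda>j. - \<i> * v j)"
    using RC_comb[OF w w, of "- \<i>" 0] by simp
  from Re_b[OF this] have "Im (b f e u) = 0" unfolding b_scale by simp
  with Re_b[OF w] have "b f e u = 0" by (simp add: complex_eq_iff)
  then show ?thesis by (simp add: b_def algebra_simps)
qed

text \<open>Along Laplace solutions the polar identity has a constant left side. The rates on the
  right need not tend to zero, but by \<open>f\<close> they enter only as \<open>c\<close> times a
  state term, and all state terms tend to zero. So \<open>v0\<close> is orthogonal to every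
  mean-free input, among them its own real and imaginary parts.\<close>

lemma lossless_output_zero:
  assumes w0: "RC f0 e0 (\<lambda>_. 0) v0" and lossless: "Re (ip f0 (\<lambda>k. cnj (e0 k))) = 0"
    and f: "\<And>f e u v. RC f e u v \<Longrightarrow> ip (\<lambda>k. cnj (e0 k)) f = c * ip (\<lambda>k. cnj (e0 k)) e"
    and j: "j \<in> J"
  shows "v0 j = 0"
proof -
  have *: "(\<Sum>j\<in>J. of_real (u j) * cnj (v0 j)) = 0" if u: "(\<Sum>j\<in>J. u j) = 0" for u
  proof -
    obtain E :: "real \<Rightarrow> 'k \<Rightarrow> complex" where
      E: "\<forall>\<^sub>F x in at_top. RC (\<lambda>k. of_real x * E x k) (E x) (\<lambda>j. of_real (u j)) (\<lambda>j. H (of_real x) * of_real (u j))"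
        "\<And>k. k \<in> K \<Longrightarrow> ((\<lambda>x. E x k) \<longlongrightarrow> 0) at_top"
      using laplace_family[OF u] by blast
    have "\<forall>\<^sub>F x in at_top. ip (\<lambda>k. cnj (f0 k)) (E x) + c * ip (\<lambda>k. cnj (e0 k)) (E x)
        = (\<Sum>j\<in>J. of_real (u j) * cnj (v0 j))"
      using E(1)
    proof eventually_elim
      case (elim x)
      then show ?case using lossless_polar[OF w0 lossless elim] f[OF elim] by simp
    qed
    moreover have "((\<lambda>x. ip (\<lambda>k. cnj (f0 k)) (E x) + c * ip (\<lambda>k. cnj (e0 k)) (E x)) \<longlongrightarrow> 0 + c * 0) at_top"
      by (intro tendsto_intros ip_tendsto_zero E(2))
    ultimately have "((\<lambda>x::real. (\<Sum>j\<in>J. of_real (u j) * cnj (v0 j))) \<longlongrightarrow> 0 + c * 0) at_top"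
      by (rule Lim_transform_eventually[rotated])
    then show ?thesis by (simp add: tendsto_const_iff)
  qed
  have s: "(\<Sum>j\<in>J. Re (v0 j)) = 0" "(\<Sum>j\<in>J. Im (v0 j)) = 0"
    using w0 sum_v unfolding RC_def by blast+
  have "(\<Sum>j\<in>J. Re (v0 j) * Re (v0 j)) = 0"
    using arg_cong[OF *[OF s(1)], of Re] by simp
  moreover have "(\<Sum>j\<in>J. Im (v0 j) * Im (v0 j)) = 0"
    using arg_cong[OF *[OF s(2)], of Im] by (simp add: sum_negf)
  ultimately have "Re (v0 j) = 0" "Im (v0 j) = 0"
    using sum_nonneg_eq_0_iff[OF finJ, of "\<lambda>j. Re (v0 j) * Re (v0 j)"]
      sum_nonneg_eq_0_iff[OF finJ, of "\<lambda>j. Im (v0 j) * Im (v0 j)"] j by auto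
  then show ?thesis by (simp add: complex_eq_iff)
qed

lemma functional_chain:
  assumes "l0 \<in> S0"
  obtains L \<beta> where "L 0 = l0" "\<And>n::nat. L n \<in> S0"
    "\<And>n f e u v. R f e u v \<Longrightarrow> ip (L n) f = ip (L (Suc n)) e + (\<Sum>j\<in>J. \<beta> n j * u j)"
proof -
  define Q where "Q l l' \<longleftrightarrow> l' \<in> S0 \<and> (\<exists>\<beta>. \<forall>f e u v. R f e u v \<longrightarrow> ip l f = ip l' e + (\<Sum>j\<in>J. \<beta> j * u j))" for l l'
  define L where "L n = ((\<lambda>l. SOME l'. Q l l') ^^ n) l0" for n
  have Q: "Q l (SOME l'. Q l l')" if "l \<in> S0" for l
  proof -
    have "\<exists>l'. Q l l'" using next_functional[OF that] unfolding Q_def by blast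
    then show ?thesis by (rule someI_ex)
  qed
  have S: "L n \<in> S0" for n
    by (induction n) (use assms Q in \<open>auto simp: L_def Q_def\<close>)
  have "Q (L n) (L (Suc n))" for n using Q[OF S] by (simp add: L_def)
  then have "\<forall>n. \<exists>\<beta>. \<forall>f e u v. R f e u v \<longrightarrow> ip (L n) f = ip (L (Suc n)) e + (\<Sum>j\<in>J. \<beta> j * u j)"
    by (auto simp: Q_def)
  from choice[OF this] obtain \<beta> where "\<forall>n. \<forall>f e u v. R f e u v \<longrightarrow> ip (L n) f = ip (L (Suc n)) e + (\<Sum>j\<in>J. \<beta> n j * u j)"
    by blast
  moreover have "L 0 = l0" by (simp add: L_def)
  ultimately show ?thesis
  proof (intro that[of L \<beta>])
    show "L n \<in> S0" for n by (rule S)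
  qed blast+
qed

text \<open>
  The states enter the output at port \<open>j\<close> through \<open>L 0\<close>, and \<open>L (n + 1)\<close> is the derivative of
  \<open>L n\<close> along the relation up to the direct influence \<open>h n\<close> of the input.
\<close>

definition output_chain :: "'j \<Rightarrow> (nat \<Rightarrow> 'k \<Rightarrow> real) \<Rightarrow> (nat \<Rightarrow> real) \<Rightarrow> bool" where
  "output_chain j L h \<longleftrightarrow> (\<forall>n. L n \<in> S0) \<and>
     (\<forall>f e u v. R f e u v \<longrightarrow> v j = ip (L 0) e + D * u j \<and>
        (\<forall>n. ip (L n) f = ip (L (Suc n)) e + h n * u j))"

text \<open>Evaluation of the chain on Laplace solutions at large real frequencies \<open>x\<close>,
  where every value \<open>q n x\<close> tends to zero. The output equation then gives the direct
  term in the limit. If the output is exactly \<open>D * u j\<close>, then \<open>q 0\<close>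
  vanishes eventually; in each further step \<open>q (Suc n)\<close> is eventually constant, so the
  constant is its limit zero.\<close>

lemma markov_parameters_vanish:
  assumes L0: "\<And>f e u v. R f e u v \<Longrightarrow> v j = ip (L 0) e + (\<Sum>j\<in>J. d j * u j)"
    and Ln: "\<And>n f e u v. R f e u v \<Longrightarrow> ip (L n) f = ip (L (Suc n)) e + (\<Sum>j\<in>J. \<beta> n j * u j)"
    and u: "(\<Sum>j\<in>J. u j) = 0"
  shows "(\<Sum>j\<in>J. d j * u j) = D * u j"
    and "\<forall>\<^sub>F x in at_top. H (of_real x) * of_real (u j) = of_real (D * u j) \<Longrightarrow> (\<Sum>j\<in>J. \<beta> n j * u j) = 0"
proof -
  obtain E :: "real \<Rightarrow> 'k \<Rightarrow> complex" where
    E: "\<forall>\<^sub>F x in at_top. RC (\<lambda>k. of_real x * E x k) (E x) (\<lambda>j. of_real (u j)) (\<lambda>j. H (of_real x) * of_real (u j))"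
      "\<And>k. k \<in> K \<Longrightarrow> ((\<lambda>x. E x k) \<longlongrightarrow> 0) at_top"
    using laplace_family[OF u] by blast
  define q where "q n x = ip (\<lambda>k. complex_of_real (L n k)) (E x)" for n x
  have q0: "(q n \<longlongrightarrow> 0) at_top" for n
    unfolding q_def by (intro ip_tendsto_zero E(2))
  have out: "\<forall>\<^sub>F x in at_top. H (of_real x) * of_real (u j) = q 0 x + of_real (\<Sum>j\<in>J. d j * u j)"
    using E(1)
  proof eventually_elim
    case (elim x)
    then show ?case unfolding q_def
      by (intro complex_eqI) (auto simp: Re_ip Im_ip RC_def dest!: L0)
  qed
  have step: "\<forall>\<^sub>F x in at_top. of_real x * q n x = q (Suc n) x + of_real (\<Sum>j\<in>J. \<beta> n j * u j)" for n
    using E(1)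
  proof eventually_elim
    case (elim x)
    have "of_real x * q n x = ip (\<lambda>k. complex_of_real (L n k)) (\<lambda>k. of_real x * E x k)"
      unfolding q_def ip_scale_right ..
    also have "\<dots> = q (Suc n) x + of_real (\<Sum>j\<in>J. \<beta> n j * u j)"
      unfolding q_def
      using elim by (intro complex_eqI) (auto simp only: Re_ip Im_ip RC_def Re_complex_of_real Im_complex_of_real plus_complex.sel Ln mult_zero_right sum.neutral_const)
    finally show ?case .
  qed
  have "((\<lambda>x. H (of_real x) * of_real (u j)) \<longlongrightarrow> 0 + of_real (\<Sum>j\<in>J. d j * u j)) at_top"
    by (rule Lim_transform_eventually[OF tendsto_add[OF q0[of 0] tendsto_const]])
      (use out in eventually_elim, simp)
  moreover have "((\<lambda>x. H (of_real x) * of_real (u j)) \<longlongrightarrow> of_real D * of_real (u j)) at_top"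
    by (intro tendsto_intros H_inf)
  ultimately have "complex_of_real (\<Sum>j\<in>J. d j * u j) = of_real (D * u j)"
    using tendsto_unique[OF trivial_limit_at_top_linorder] by fastforce
  then show d: "(\<Sum>j\<in>J. d j * u j) = D * u j" by (metis of_real_eq_iff)
  assume const: "\<forall>\<^sub>F x in at_top. H (of_real x) * of_real (u j) = of_real (D * u j)"
  have zero: "\<forall>\<^sub>F x in at_top. q n x = 0" for n
  proof (induction n)
    case 0
    show ?case using out const by eventually_elim (simp add: d)
  next
    case (Suc n)
    have ev: "\<forall>\<^sub>F x in at_top. q (Suc n) x = - of_real (\<Sum>j\<in>J. \<beta> n j * u j)"
      using Suc step[of n] by eventually_elim (simp add: add_eq_0_iff)
    have "((\<lambda>x::real. - complex_of_real (\<Sum>j\<in>J. \<beta> n j * u j)) \<longlongrightarrow> 0) at_top"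
      by (rule Lim_transform_eventually[OF q0 ev])
    then have "- complex_of_real (\<Sum>j\<in>J. \<beta> n j * u j) = 0" by (simp add: tendsto_const_iff)
    with ev show ?case by simp
  qed
  have "\<forall>\<^sub>F x in at_top. q n x = 0 \<and> q (Suc n) x = 0 \<and>
      of_real x * q n x = q (Suc n) x + of_real (\<Sum>j\<in>J. \<beta> n j * u j)"
    by (intro eventually_conj zero step)
  then obtain x where "q n x = 0" "q (Suc n) x = 0"
      "of_real x * q n x = q (Suc n) x + of_real (\<Sum>j\<in>J. \<beta> n j * u j)"
    by (auto dest!: eventually_happens simp del: of_real_sum)
  then have "complex_of_real (\<Sum>j\<in>J. \<beta> n j * u j) = 0" by (simp del: of_real_sum)
  then show "(\<Sum>j\<in>J. \<beta> n j * u j) = 0" by (metis of_real_eq_0_iff)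
qed

text \<open>Why only the port's own input enters: subtracting \<open>u j\<close> times a fixed
  mean-free input leaves an input that vanishes at \<open>j\<close>; the Laplace output at
  \<open>j\<close> is then zero, and by \<open>markov_parameters_vanish\<close> this input does not
  influence the chain.\<close>

lemma observability_chain:
  assumes j: "j \<in> J" and j': "j' \<in> J" "j' \<noteq> j"
  shows "\<exists>L h. output_chain j L h \<and>
    ((\<forall>s. Re s > 0 \<longrightarrow> s \<notin> P \<longrightarrow> H s = of_real D) \<longrightarrow> (\<forall>n. h n = 0))"
proof -
  obtain l0 d where l0: "l0 \<in> S0" "\<And>f e u v. R f e u v \<Longrightarrow> v j = ip l0 e + (\<Sum>j\<in>J. d j * u j)"
    using output_functional[OF j] by blast
  obtain L \<beta> where L: "L 0 = l0" "\<And>n::nat. L n \<in> S0"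
    "\<And>n f e u v. R f e u v \<Longrightarrow> ip (L n) f = ip (L (Suc n)) e + (\<Sum>j\<in>J. \<beta> n j * u j)"
    using functional_chain[OF l0(1)] by blast
  note out = l0(2)[folded L(1)]
  \<comment> \<open>The second port only balances the sum; the coefficient \<open>h n\<close> is the
    response to this input.\<close>
  define us where "us i = (if i = j then 1 else if i = j' then -1 else 0 :: real)" for i
  have "(\<Sum>i\<in>J. us i) = (\<Sum>i\<in>{j, j'}. us i)"
    by (rule sum.mono_neutral_right) (use finJ j j' in \<open>auto simp: us_def\<close>)
  then have us: "(\<Sum>i\<in>J. us i) = 0" using j' by (simp add: us_def)
  define h where "h n = (\<Sum>j\<in>J. \<beta> n j * us j)" for n
  have "(\<Sum>i\<in>J. \<beta> n i * u i) = h n * u j" if "R f e u v" for n f e u v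
  proof -
    define w where "w i = u i - u j * us i" for i
    have "(\<Sum>i\<in>J. w i) = 0"
      using sum_u[OF that] us by (simp add: w_def sum_subtractf sum_distrib_left[symmetric])
    from markov_parameters_vanish(2)[OF out L(3) this, where n = n]
    have "(\<Sum>i\<in>J. \<beta> n i * w i) = 0" by (simp add: w_def us_def)
    moreover have "(\<Sum>i\<in>J. \<beta> n i * w i) = (\<Sum>i\<in>J. \<beta> n i * u i) - u j * h n"
      unfolding w_def h_def right_diff_distrib sum_subtractf sum_distrib_left by (simp add: mult_ac)
    ultimately show ?thesis by (simp add: mult.commute)
  qed
  then have 1: "ip (L n) f = ip (L (Suc n)) e + h n * u j" if "R f e u v" for n f e u v
    using L(3)[OF that] that by metis
  have 2: "v j = ip (L 0) e + D * u j" if "R f e u v" for f e u v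
    using out[OF that] markov_parameters_vanish(1)[OF out L(3) sum_u[OF that]] by simp
  have 3: "h n = 0" if "\<And>s. Re s > 0 \<Longrightarrow> s \<notin> P \<Longrightarrow> H s = of_real D" for n
    unfolding h_def
  proof (rule markov_parameters_vanish(2)[OF out L(3) us])
    show "\<forall>\<^sub>F x in at_top. H (of_real x) * of_real (us j) = of_real (D * us j)"
      using eventually_regular by eventually_elim (simp add: that)
  qed
  have "output_chain j L h" unfolding output_chain_def using L(2) 1 2 by blast
  then show ?thesis using 3 by blast
qed

end

text \<open>
  If \<open>x k' = x (k + 1) + h k * u\<close> and \<open>\<Sum>k. \<mu> k * x k = 0\<close>, then \<open>x 0 + D * u\<close> has the transfer
  function \<open>transfer_numerator D h \<mu> / \<mu>\<close>.
\<close>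

definition transfer_numerator :: "real \<Rightarrow> (nat \<Rightarrow> real) \<Rightarrow> real poly \<Rightarrow> real poly" where
  "transfer_numerator D h \<mu> =
     Polynomial.smult D \<mu> + (\<Sum>k\<le>degree \<mu>. Polynomial.smult (coeff \<mu> k) (\<Sum>i<k. Polynomial.monom (h i) (k - 1 - i)))"

lemma of_real_poly_add: "map_poly complex_of_real (p + q) = map_poly of_real p + map_poly of_real q"
  by (intro poly_eqI) (simp add: coeff_map_poly)

lemma of_real_poly_smult: "map_poly complex_of_real (Polynomial.smult a p) = Polynomial.smult (of_real a) (map_poly of_real p)"
  by (intro poly_eqI) (simp add: coeff_map_poly)

lemma of_real_poly_sum: "map_poly complex_of_real (\<Sum>i\<in>I. p i) = (\<Sum>i\<in>I. map_poly of_real (p i))"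
  by (intro poly_eqI) (simp add: coeff_map_poly coeff_sum)

lemma of_real_poly_monom: "map_poly complex_of_real (Polynomial.monom a n) = Polynomial.monom (of_real a) n"
  by (intro poly_eqI) (simp add: coeff_map_poly)

lemma poly_transfer_numerator:
  "poly (map_poly complex_of_real (transfer_numerator D h \<mu>)) s = of_real D * poly (map_poly of_real \<mu>) s +
     (\<Sum>k\<le>degree \<mu>. of_real (coeff \<mu> k) * (\<Sum>i<k. of_real (h i) * s ^ (k - 1 - i)))"
  unfolding transfer_numerator_def
  by (simp add: of_real_poly_add of_real_poly_smult of_real_poly_sum of_real_poly_monom poly_sum poly_monom)

section \<open>Stability of the annihilating polynomial\<close>

context passive_relation
begin

lemma cnj_ip: "cnj (ip x y) = ip (\<lambda>k. cnj (x k)) (\<lambda>k. cnj (y k))"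
  by (simp add: ip_def)

lemma ip_cnj_pos:
  assumes "k0 \<in> K" "l k0 \<noteq> 0"
  shows "\<exists>n>0. ip l (\<lambda>k. cnj (l k)) = complex_of_real n"
proof (intro exI conjI)
  show "(\<Sum>k\<in>K. m k * (cmod (l k))\<^sup>2) > 0"
    by (rule sum_pos2[OF finK assms(1)]) (use assms m_pos in \<open>auto simp: less_imp_le\<close>)
  show "ip l (\<lambda>k. cnj (l k)) = complex_of_real (\<Sum>k\<in>K. m k * (cmod (l k))\<^sup>2)"
    unfolding ip_def by (simp add: complex_norm_square[symmetric])
qed

lemma eventually_regular_axis: "\<forall>\<^sub>F s in at a within {s. Re s > 0}. Re s > 0 \<and> s \<notin> P"
proof -
  \<comment> \<open>The point \<open>a\<close> may lie in \<open>P\<close>, but the punctured filter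
    at \<open>a\<close> never attains it.\<close>
  have "open (- (P - {a}))" using finP by (intro open_Compl finite_imp_closed) auto
  then show ?thesis unfolding eventually_at_topological by (intro exI[of _ "- (P - {a})"]) auto
qed

lemma axis_not_bot:
  assumes "Re a = 0"
  shows "at a within {s. Re s > 0} \<noteq> bot"
proof -
  have "a islimpt {s. Re s > 0}" unfolding islimpt_approachable
  proof (intro allI impI)
    fix e :: real assume "e > 0"
    then show "\<exists>x'\<in>{s. Re s > 0}. x' \<noteq> a \<and> dist x' a < e"
      using assms by (intro bexI[of _ "a + of_real (e / 2)"]) (auto simp: dist_norm)
  qed
  then show ?thesis by (simp add: trivial_limit_within)
qed

text \<open>The values of the functionals along the Laplace solution with input \<open>u j = 1\<close>.\<close>

fun markov_seq :: "(nat \<Rightarrow> real) \<Rightarrow> nat \<Rightarrow> complex \<Rightarrow> complex" where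
  "markov_seq h 0 s = H s - of_real D"
| "markov_seq h (Suc n) s = s * markov_seq h n s - of_real (h n)"

lemma markov_seq_closed_form:
  "markov_seq h n s = s ^ n * (H s - of_real D) - (\<Sum>i<n. of_real (h i) * s ^ (n - 1 - i))"
proof (induction n)
  case (Suc n)
  have "s * (\<Sum>i<n. of_real (h i) * s ^ (n - 1 - i)) = (\<Sum>i<n. of_real (h i) * s ^ (Suc n - 1 - i))"
    unfolding sum_distrib_left
  proof (rule sum.cong[OF refl])
    fix i assume "i \<in> {..<n}"
    then have "Suc (n - 1 - i) = Suc n - 1 - i" by auto
    then have "s * s ^ (n - 1 - i) = s ^ (Suc n - 1 - i)" by (metis power_Suc)
    then show "s * (of_real (h i) * s ^ (n - 1 - i)) = of_real (h i) * s ^ (Suc n - 1 - i)"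
      by (metis mult.left_commute)
  qed
  then show ?case unfolding markov_seq.simps Suc.IH right_diff_distrib by simp
qed simp

lemma markov_seq_tendsto:
  assumes "Re a = 0"
  shows "\<exists>l. (markov_seq h n \<longlongrightarrow> l) (at a within {s. Re s > 0})"
proof (induction n)
  case 0
  have "a = \<i> * of_real (Im a)" using assms by (simp add: complex_eq_iff)
  then obtain l where "(H \<longlongrightarrow> l) (at a within {s. Re s > 0})" using H_axis by metis
  then have "((\<lambda>s. H s - of_real D) \<longlongrightarrow> l - of_real D) (at a within {s. Re s > 0})"
    by (intro tendsto_intros)
  then show ?case by auto
next
  case (Suc n)
  then obtain l where "(markov_seq h n \<longlongrightarrow> l) (at a within {s. Re s > 0})" by blast
  then have "((\<lambda>s. s * markov_seq h n s - of_real (h n)) \<longlongrightarrow> a * l - of_real (h n)) (at a within {s. Re s > 0})"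
    by (intro tendsto_intros)
  then show ?case by auto
qed

context
  fixes j j' :: 'j and L :: "nat \<Rightarrow> 'k \<Rightarrow> real" and h :: "nat \<Rightarrow> real"
  assumes j: "j \<in> J" and j': "j' \<in> J" "j' \<noteq> j"
    and chain: "output_chain j L h"
begin

lemma LS: "L n \<in> S0"
  and L0: "R f e u v \<Longrightarrow> v j = ip (L 0) e + D * u j"
  and Ln: "R f e u v \<Longrightarrow> ip (L n) f = ip (L (Suc n)) e + h n * u j"
  using chain unfolding output_chain_def by blast+

lemma RC_L0: "RC f e u v \<Longrightarrow> v j = ip (\<lambda>k. of_real (L 0 k)) e + of_real D * u j"
  by (intro complex_eqI) (auto simp: Re_ip Im_ip RC_def dest: L0)

lemma RC_Ln:
  "RC f e u v \<Longrightarrow> ip (\<lambda>k. of_real (L n k)) f = ip (\<lambda>k. of_real (L (Suc n) k)) e + of_real (h n) * u j"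
  by (intro complex_eqI) (auto simp: Re_ip Im_ip RC_def dest: Ln)

lemma laplace_markov:
  assumes "Re s > 0" "s \<notin> P"
  obtains e where "\<And>n. ip (\<lambda>k. complex_of_real (L n k)) e = markov_seq h n s"
    "\<exists>f u v. RC f e u v \<and> f = (\<lambda>k. s * e k) \<and> u j = 1"
proof -
  define us where "us i = (if i = j then 1 else if i = j' then -1 else 0 :: real)" for i
  have "(\<Sum>i\<in>J. us i) = (\<Sum>i\<in>{j, j'}. us i)"
    by (rule sum.mono_neutral_right) (use finJ j j' in \<open>auto simp: us_def\<close>)
  then have us: "(\<Sum>i\<in>J. us i) = 0" using j' by (simp add: us_def)
  obtain e where e: "RC (\<lambda>k. s * e k) e (\<lambda>j. of_real (us j)) (\<lambda>j. H s * of_real (us j))"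
    using lapC[OF assms us] by blast
  have uj: "us j = 1" by (simp add: us_def)
  have "ip (\<lambda>k. complex_of_real (L n k)) e = markov_seq h n s" for n
  proof (induction n)
    case 0
    then show ?case using RC_L0[OF e] uj by simp
  next
    case (Suc n)
    then show ?case using RC_Ln[OF e, of n] uj unfolding ip_scale_right by simp
  qed
  then show ?thesis using e uj by (intro that[of e]) (auto intro!: exI)
qed

text \<open>By \<open>eig\<close> the combination \<open>l\<close> of the functionals has rate
  \<open>z * ip l e + b * u j\<close>. Its conjugate is a state with zero input, and passivity there
  excludes \<open>Re z > 0\<close>. On the axis this state is lossless; once \<open>b = 0\<close> is
  known, its output vanishes and it is orthogonal to every \<open>L n\<close>, hence to the
  combination \<open>l\<close>, although that pairing is its positive square norm.\<close>

lemma eigenfunctional_stable: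
  fixes p :: "nat \<Rightarrow> complex" and z :: complex and r :: nat
  assumes eig: "\<And>k. k \<in> K \<Longrightarrow> (\<Sum>i<r. p i * of_real (L (Suc i) k)) = z * (\<Sum>i<r. p i * of_real (L i k))"
    and nz: "k0 \<in> K" "(\<Sum>i<r. p i * of_real (L i k0)) \<noteq> 0"
  shows "Re z < 0"
proof (rule ccontr)
  assume "\<not> Re z < 0"
  then have z0: "Re z \<ge> 0" by simp
  define l where "l k = (\<Sum>i<r. p i * of_real (L i k))" for k
  define b where "b = (\<Sum>i<r. p i * of_real (h i))"
  have RCf: "ip l f = z * ip l e + b * u j" if "RC f e u v" for f e u v
  proof -
    have "ip l f = (\<Sum>i<r. p i * ip (\<lambda>k. of_real (L i k)) f)"
      unfolding l_def[abs_def] by (rule ip_sum_left)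
    also have "\<dots> = (\<Sum>i<r. p i * ip (\<lambda>k. of_real (L (Suc i) k)) e) + b * u j"
      unfolding b_def sum_distrib_right sum.distrib[symmetric]
    proof (rule sum.cong[OF refl])
      fix i
      show "p i * ip (\<lambda>k. of_real (L i k)) f = p i * ip (\<lambda>k. of_real (L (Suc i) k)) e + p i * of_real (h i) * u j"
        using RC_Ln[OF that, of i]
        by (simp add: distrib_left)
    qed
    also have "(\<Sum>i<r. p i * ip (\<lambda>k. of_real (L (Suc i) k)) e) = ip (\<lambda>k. \<Sum>i<r. p i * of_real (L (Suc i) k)) e"
      by (rule ip_sum_left[symmetric])
    also have "\<dots> = ip (\<lambda>k. z * l k) e" by (rule ip_cong) (simp_all add: eig l_def)
    also have "\<dots> = z * ip l e" by (simp add: ip_commute[of _ e] ip_scale_right)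
    finally show ?thesis .
  qed
  \<comment> \<open>Membership in \<open>S0\<close> supplies rates and outputs for each
    \<open>L i\<close>. Conjugate coefficients are taken so that pairing \<open>l\<close> with the
    resulting state gives a positive number.\<close>
  have "\<exists>f v. R f (L i) (\<lambda>_. 0) v" for i using LS[of i] by (simp add: S0_def)
  then obtain F V where FV: "R (F i) (L i) (\<lambda>_. 0) (V i)" for i by metis
  define f0 where "f0 k = (\<Sum>i<r. cnj (p i) * of_real (F i k))" for k
  define v0 where "v0 j = (\<Sum>i<r. cnj (p i) * of_real (V i j))" for j
  have "RC f0 (\<lambda>k. \<Sum>i<r. cnj (p i) * of_real (L i k)) (\<lambda>j. \<Sum>i<r. cnj (p i) * of_real 0) v0"
    unfolding f0_def[abs_def] v0_def[abs_def] by (rule RC_sum) (rule RC_of_real[OF FV])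
  moreover have "(\<lambda>k. \<Sum>i<r. cnj (p i) * of_real (L i k)) = (\<lambda>k. cnj (l k))"
    by (simp add: l_def)
  ultimately have w0: "RC f0 (\<lambda>k. cnj (l k)) (\<lambda>_. 0) v0" by simp
  obtain n where n: "n > 0" "ip l (\<lambda>k. cnj (l k)) = complex_of_real n"
    using ip_cnj_pos[OF nz(1), of l] nz(2) by (auto simp: l_def)
  have lf0: "ip l f0 = z * of_real n" using RCf[OF w0] n by simp
  have "Re (ip f0 l) \<le> 0" using RC_passive[OF w0] by simp
  then have "Re z * n \<le> 0" using lf0 by (simp add: ip_commute)
  then have Rez: "Re z = 0" using z0 n(1) by (simp add: mult_le_0_iff)
  have lossless: "Re (ip f0 (\<lambda>k. cnj (cnj (l k)))) = 0"
    using lf0 Rez by (simp add: ip_commute[of f0])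
  let ?F = "at z within {s. Re s > 0}"
  \<comment> \<open>Along Laplace solutions \<open>(s - z) * ip l e = b\<close>. The values of
    \<open>ip l e\<close> converge as \<open>s\<close> tends to \<open>z\<close>, since
    \<open>H\<close> has a limit at every axis point, so the left side tends to zero.\<close>
  have "b = 0"
  proof -
    have "\<forall>i. \<exists>q. (markov_seq h i \<longlongrightarrow> q) ?F" using markov_seq_tendsto[OF Rez] by blast
    then obtain q where q: "\<And>i. (markov_seq h i \<longlongrightarrow> q i) ?F" by metis
    have "((\<lambda>s. (s - z) * (\<Sum>i<r. p i * markov_seq h i s)) \<longlongrightarrow> (z - z) * (\<Sum>i<r. p i * q i)) ?F"
      by (intro tendsto_intros q)
    moreover have "\<forall>\<^sub>F s in ?F. (s - z) * (\<Sum>i<r. p i * markov_seq h i s) = b"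
      using eventually_regular_axis[of z]
    proof eventually_elim
      case (elim s)
      then obtain e where e: "\<And>n. ip (\<lambda>k. complex_of_real (L n k)) e = markov_seq h n s"
        "\<exists>f u v. RC f e u v \<and> f = (\<lambda>k. s * e k) \<and> u j = 1" using laplace_markov by blast
      then obtain u v where "RC (\<lambda>k. s * e k) e u v" "u j = 1" by blast
      from RCf[OF this(1)] this(2) have "(s - z) * ip l e = b"
        unfolding ip_scale_right by (simp add: algebra_simps)
      moreover have "ip l e = (\<Sum>i<r. p i * markov_seq h i s)"
        unfolding l_def[abs_def] ip_sum_left e(1) ..
      ultimately show ?case by simp
    qed
    ultimately have "((\<lambda>s. b) \<longlongrightarrow> (z - z) * (\<Sum>i<r. p i * q i)) ?F"
      by (rule Lim_transform_eventually)
    then show ?thesis using axis_not_bot[OF Rez] by (simp add: tendsto_const_iff)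
  qed
  then have RCf': "ip (\<lambda>k. cnj (cnj (l k))) f = z * ip (\<lambda>k. cnj (cnj (l k))) e" if "RC f e u v" for f e u v
    using RCf[OF that] by simp
  have v0: "v0 i = 0" if "i \<in> J" for i
    by (rule lossless_output_zero[OF w0 lossless _ that]) (rule RCf')
  define a where "a n = ip (\<lambda>k. of_real (L n k)) (\<lambda>k. cnj (l k))" for n
  \<comment> \<open>The polar identity at the element with state \<open>L n\<close> and the chain
    equation at the lossless element compute the same number; \<open>cnj z = - z\<close> is where
    the axis enters.\<close>
  have step: "a (Suc n) = z * a n" for n
  proof -
    note rc = RC_of_real[OF FV[of n]]
    have "0 = ip (\<lambda>k. cnj (f0 k)) (\<lambda>k. of_real (L n k)) + ip l (\<lambda>k. of_real (F n k))"
      using lossless_polar[OF w0 lossless rc] v0 by simp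
    also have "ip l (\<lambda>k. of_real (F n k)) = z * ip l (\<lambda>k. of_real (L n k))"
      using RCf'[OF rc] by simp
    finally have "cnj (ip (\<lambda>k. cnj (f0 k)) (\<lambda>k. of_real (L n k)) + z * ip l (\<lambda>k. of_real (L n k))) = 0"
      by simp
    then have "ip f0 (\<lambda>k. of_real (L n k)) + cnj z * a n = 0"
      by (simp add: cnj_ip a_def ip_commute)
    moreover have "cnj z = - z" using Rez by (simp add: complex_eq_iff)
    ultimately have "ip (\<lambda>k. of_real (L n k)) f0 = z * a n" by (simp add: ip_commute)
    moreover have "ip (\<lambda>k. of_real (L n k)) f0 = a (Suc n)"
      using RC_Ln[OF w0, of n] by (simp add: a_def)
    ultimately show ?thesis by simp
  qed
  have "a 0 = 0" using RC_L0[OF w0] v0[OF j] by (simp add: a_def)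
  then have a: "a n = 0" for n by (induction n) (simp_all add: step)
  have "ip l (\<lambda>k. cnj (l k)) = (\<Sum>i<r. p i * a i)"
    unfolding a_def l_def[abs_def] by (rule ip_sum_left)
  then show False using a n by simp
qed

text \<open>The shortest recurrence is taken. Dividing \<open>\<mu>\<close> by a root factor leaves
  weights \<open>p\<close> that make an eigenfunctional with eigenvalue \<open>z\<close>, and
  minimality keeps this functional nonzero, so that \<open>eigenfunctional_stable\<close>
  applies.\<close>

lemma annihilating_poly:
  obtains \<mu> :: "real poly" where "lead_coeff \<mu> = 1"
    "\<And>k. k \<in> K \<Longrightarrow> (\<Sum>i\<le>degree \<mu>. coeff \<mu> i * L i k) = 0"
    "\<And>z. poly (map_poly complex_of_real \<mu>) z = 0 \<Longrightarrow> Re z < 0"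
proof -
  define Q where "Q r \<longleftrightarrow> (\<exists>c. \<forall>k\<in>K. L r k = (\<Sum>i<r. c i * L i k))" for r
  define r where "r = (LEAST r. Q r)"
  have "\<exists>r. Q r" unfolding Q_def by (rule linear_recurrence_finite_dim[OF finK])
  then have "Q r" unfolding r_def by (metis LeastI)
  then obtain c where c: "\<forall>k\<in>K. L r k = (\<Sum>i<r. c i * L i k)" unfolding Q_def by blast
  define \<mu> where "\<mu> = Polynomial.monom 1 r - (\<Sum>i<r. Polynomial.monom (c i) i)"
  have coeff: "coeff \<mu> n = (if n = r then 1 else if n < r then - c n else 0)" for n
    unfolding \<mu>_def by (auto simp: coeff_sum)
  have deg: "degree \<mu> = r"
    by (rule antisym[OF degree_le le_degree]) (simp_all add: coeff)
  have rel: "(\<Sum>i\<le>r. coeff \<mu> i * L i k) = 0" if "k \<in> K" for k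
  proof -
    have "(\<Sum>i\<le>r. coeff \<mu> i * L i k) = (\<Sum>i<r. coeff \<mu> i * L i k) + L r k"
      by (simp add: lessThan_Suc_atMost[symmetric] coeff)
    also have "(\<Sum>i<r. coeff \<mu> i * L i k) = - (\<Sum>i<r. c i * L i k)"
      unfolding sum_negf[symmetric] by (rule sum.cong[OF refl]) (simp add: coeff)
    finally show ?thesis using c that by simp
  qed
  have "Re z < 0" if z: "poly (map_poly complex_of_real \<mu>) z = 0" for z
  proof -
    obtain p where p: "map_poly complex_of_real \<mu> = [:- z, 1:] * p"
      using z by (auto simp: poly_eq_0_iff_dvd)
    have \<mu>0: "map_poly complex_of_real \<mu> \<noteq> 0" using coeff[of r]
      by (metis coeff_0 coeff_map_poly of_real_0 of_real_1 zero_neq_one)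
    then have p0: "p \<noteq> 0" using p by auto
    have "degree (map_poly complex_of_real \<mu>) = r" by (simp add: degree_map_poly deg)
    moreover have "degree ([:- z, 1:] * p) = degree [:- z, 1:] + degree p"
      by (rule degree_mult_eq) (use p0 in simp_all)
    ultimately have degp: "r = Suc (degree p)" unfolding p by simp
    have cp0: "of_real (coeff \<mu> 0) = - z * coeff p 0"
      using arg_cong[OF p, of "\<lambda>q. coeff q 0"] by (simp add: coeff_map_poly)
    have cp: "of_real (coeff \<mu> (Suc i)) = coeff p i - z * coeff p (Suc i)" for i
      using arg_cong[OF p, of "\<lambda>q. coeff q (Suc i)"] by (simp add: coeff_map_poly)
    have pr: "coeff p r = 0" using degp by (simp add: coeff_eq_0)
    have lead: "coeff p (r - 1) = 1"
      using cp[of "r - 1"] degp pr by (simp add: coeff)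
    \<comment> \<open>Comparison of coefficients in \<open>\<mu> = [:- z, 1:] * p\<close>, inserted
      into the recurrence.\<close>
    have eig: "(\<Sum>i<r. coeff p i * of_real (L (Suc i) k)) = z * (\<Sum>i<r. coeff p i * of_real (L i k))"
      if k: "k \<in> K" for k
    proof -
      have "0 = (\<Sum>i<Suc r. complex_of_real (coeff \<mu> i) * of_real (L i k))"
        using arg_cong[OF rel[OF k], of complex_of_real] by (simp add: lessThan_Suc_atMost)
      also have "\<dots> = - z * coeff p 0 * of_real (L 0 k) +
          (\<Sum>i<r. (coeff p i - z * coeff p (Suc i)) * of_real (L (Suc i) k))"
        by (subst sum.lessThan_Suc_shift) (simp add: cp0 cp)
      also have "\<dots> = (\<Sum>i<r. coeff p i * of_real (L (Suc i) k)) -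
          z * (coeff p 0 * of_real (L 0 k) + (\<Sum>i<r. coeff p (Suc i) * of_real (L (Suc i) k)))"
        by (simp add: left_diff_distrib sum_subtractf sum_distrib_left distrib_left mult.assoc)
      also have "coeff p 0 * of_real (L 0 k) + (\<Sum>i<r. coeff p (Suc i) * of_real (L (Suc i) k)) =
          (\<Sum>i<Suc r. coeff p i * of_real (L i k))"
        by (subst sum.lessThan_Suc_shift) simp
      also have "\<dots> = (\<Sum>i<r. coeff p i * of_real (L i k))" by (simp add: pr)
      finally show ?thesis by simp
    qed
    have "\<exists>k\<in>K. (\<Sum>i<r. coeff p i * of_real (L i k)) \<noteq> 0"
    proof (rule ccontr)
      assume "\<not> ?thesis"
      then have zero: "(\<Sum>i<r. coeff p i * complex_of_real (L i k)) = 0" if "k \<in> K" for k using that by blast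
      \<comment> \<open>Were the functional zero, the real part of the relation, whose leading
        coefficient is 1, would be a shorter recurrence.\<close>
      have "L (r - 1) k = (\<Sum>i<r - 1. - Re (coeff p i) * L i k)" if "k \<in> K" for k
      proof -
        have "0 = Re (\<Sum>i<r. coeff p i * complex_of_real (L i k))" using zero[OF that] by simp
        also have "\<dots> = (\<Sum>i<Suc (r - 1). Re (coeff p i) * L i k)" using degp by simp
        also have "\<dots> = (\<Sum>i<r - 1. Re (coeff p i) * L i k) + L (r - 1) k"
          unfolding sum.lessThan_Suc lead by simp
        finally show ?thesis by (simp add: sum_negf)
      qed
      then have "Q (r - 1)" unfolding Q_def by (intro exI[of _ "\<lambda>i. - Re (coeff p i)"]) blast
      then have "r \<le> r - 1" unfolding r_def by (rule Least_le)
      then show False using degp by simp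
    qed
    then show ?thesis using eigenfunctional_stable[OF eig] by blast
  qed
  then show ?thesis using that[of \<mu>] rel deg coeff by simp
qed

end

text \<open>The equation for \<open>H\<close> is the annihilating relation evaluated on a Laplace
  solution; the closed form of \<open>markov_seq\<close> separates the multiple of
  \<open>H s\<close> from the numerator. The last conjunct serves the case of a constant transfer
  function, where the input cannot be recovered from the rates.\<close>

theorem output_system:
  assumes "j \<in> J" "j' \<in> J" "j' \<noteq> j"
  shows "\<exists>L h (\<mu> :: real poly). output_chain j L h \<and> lead_coeff \<mu> = 1 \<and>
    (\<forall>z. poly (map_poly complex_of_real \<mu>) z = 0 \<longrightarrow> Re z < 0) \<and>
    (\<forall>e. (\<Sum>i\<le>degree \<mu>. coeff \<mu> i * ip (L i) e) = (0 :: real)) \<and>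
    (\<forall>s. Re s > 0 \<longrightarrow> s \<notin> P \<longrightarrow> H s * poly (map_poly complex_of_real \<mu>) s =
       poly (map_poly complex_of_real (transfer_numerator D h \<mu>)) s) \<and>
    ((\<forall>s. Re s > 0 \<longrightarrow> s \<notin> P \<longrightarrow> H s = of_real D) \<longrightarrow> (\<forall>n. h n = 0))"
proof -
  obtain L h where L: "output_chain j L h"
    and const: "(\<forall>s. Re s > 0 \<longrightarrow> s \<notin> P \<longrightarrow> H s = of_real D) \<longrightarrow> (\<forall>n. h n = 0)"
    using observability_chain[OF assms] by blast
  obtain \<mu> :: "real poly" where \<mu>: "lead_coeff \<mu> = 1"
    "\<And>k. k \<in> K \<Longrightarrow> (\<Sum>i\<le>degree \<mu>. coeff \<mu> i * L i k) = 0"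
    "\<And>z. poly (map_poly complex_of_real \<mu>) z = 0 \<Longrightarrow> Re z < 0"
    using annihilating_poly[OF assms L] by blast
  have rel: "(\<Sum>i\<le>degree \<mu>. coeff \<mu> i * ip (L i) e) = 0" for e :: "'k \<Rightarrow> real"
    using ip_cong[of "\<lambda>k. \<Sum>i\<le>degree \<mu>. coeff \<mu> i * L i k" "\<lambda>_. 0" e e] \<mu>(2)
    unfolding ip_sum_left by (simp add: ip_def)
  have num: "H s * poly (map_poly complex_of_real \<mu>) s =
       poly (map_poly complex_of_real (transfer_numerator D h \<mu>)) s" if s: "Re s > 0" "s \<notin> P" for s
  proof -
    obtain e where e: "\<And>n. ip (\<lambda>k. complex_of_real (L n k)) e = markov_seq h n s"
      using laplace_markov[OF assms L s] by blast
    have "0 = (\<Sum>i\<le>degree \<mu>. of_real (coeff \<mu> i) * ip (\<lambda>k. complex_of_real (L i k)) e)"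
      by (intro complex_eqI) (simp_all add: Re_ip Im_ip rel)
    also have "\<dots> = (\<Sum>i\<le>degree \<mu>. of_real (coeff \<mu> i) * s ^ i) * (H s - of_real D) -
        (\<Sum>k\<le>degree \<mu>. of_real (coeff \<mu> k) * (\<Sum>i<k. of_real (h i) * s ^ (k - 1 - i)))"
      unfolding e markov_seq_closed_form right_diff_distrib sum_subtractf sum_distrib_right
      by (simp add: mult.assoc left_diff_distrib right_diff_distrib)
    also have "(\<Sum>i\<le>degree \<mu>. of_real (coeff \<mu> i) * s ^ i) = poly (map_poly complex_of_real \<mu>) s"
      by (simp add: poly_altdef degree_map_poly coeff_map_poly)
    finally show ?thesis unfolding poly_transfer_numerator by (simp add: algebra_simps)
  qed
  show ?thesis using L \<mu>(1,3) rel num const by (intro exI[of _ L] exI[of _ h] exI[of _ \<mu>]) blast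
qed

end

subsection \<open>Signals with locally integrable derivatives\<close>

text \<open>Boundedness is added to integrability so that products stay in the class and primitives
  are Lipschitz. The sort covers real and complex signals alike.\<close>

definition bounded_integrable :: "real \<Rightarrow> (real \<Rightarrow> 'a::{real_normed_field,euclidean_space}) \<Rightarrow> bool" where
  "bounded_integrable T f \<longleftrightarrow> f absolutely_integrable_on {0..T} \<and> bounded (f ` {0..T})"

lemma bounded_integrable_cong:
  assumes "\<And>t. t \<in> {0..T} \<Longrightarrow> f t = g t" "bounded_integrable T f"
  shows "bounded_integrable T g"
proof -
  have "f absolutely_integrable_on {0..T} \<longleftrightarrow> g absolutely_integrable_on {0..T}"
    by (rule set_integrable_cong[OF refl]) (use assms in auto)
  moreover have "f ` {0..T} = g ` {0..T}" by (rule image_cong[OF refl]) (use assms in auto)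
  ultimately show ?thesis using assms(2) by (simp add: bounded_integrable_def)
qed

lemma bounded_integrable_continuous:
  "continuous_on {0..T} f \<Longrightarrow> bounded_integrable T f"
  by (simp add: bounded_integrable_def absolutely_integrable_continuous_real compact_imp_bounded compact_continuous_image)

lemma bounded_integrable_add:
  assumes "bounded_integrable T f" "bounded_integrable T g"
  shows "bounded_integrable T (\<lambda>t. f t + g t)"
  using assms unfolding bounded_integrable_def
  by (auto intro: bounded_plus_comp set_integral_add)

lemma bounded_integrable_mult:
  assumes "bounded_integrable T f" "bounded_integrable T g"
  shows "bounded_integrable T (\<lambda>t. f t * g t)"
proof -
  have "bilinear ((*) :: 'a \<Rightarrow> 'a \<Rightarrow> 'a)"
    using bounded_bilinear_mult by (simp add: bilinear_conv_bounded_bilinear)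
  moreover have "f \<in> borel_measurable (lebesgue_on {0..T})"
    using assms(1) unfolding bounded_integrable_def by (blast intro: absolutely_integrable_imp_borel_measurable lmeasurable_interval fmeasurableD)
  ultimately have "(\<lambda>t. f t * g t) absolutely_integrable_on {0..T}"
    using assms absolutely_integrable_bounded_measurable_product[of "(*)" f "{0..T}" g]
    unfolding bounded_integrable_def by simp
  moreover obtain A B where AB: "\<forall>t\<in>{0..T}. norm (f t) \<le> A" "\<forall>t\<in>{0..T}. norm (g t) \<le> B"
    using assms unfolding bounded_integrable_def bounded_iff by auto
  have "\<forall>t\<in>{0..T}. norm (f t * g t) \<le> A * B"
  proof
    fix t assume t: "t \<in> {0..T}"
    then have "norm (f t) \<le> A" "norm (g t) \<le> B" using AB by blast+
    moreover from this(1) have "0 \<le> A" using norm_ge_zero order_trans by blast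
    ultimately show "norm (f t * g t) \<le> A * B" unfolding norm_mult by (intro mult_mono) auto
  qed
  then have "bounded ((\<lambda>t. f t * g t) ` {0..T})" by (auto simp: bounded_iff)
  ultimately show ?thesis by (simp add: bounded_integrable_def)
qed

lemma bounded_integrable_const: "bounded_integrable T (\<lambda>t. c)"
  by (rule bounded_integrable_continuous) simp

lemma bounded_integrable_cmult: "bounded_integrable T f \<Longrightarrow> bounded_integrable T (\<lambda>t. c * f t)"
  by (rule bounded_integrable_mult[OF bounded_integrable_const])

lemma bounded_integrable_diff:
  assumes "bounded_integrable T f" "bounded_integrable T g"
  shows "bounded_integrable T (\<lambda>t. f t - g t)"
  using bounded_integrable_add[OF assms(1) bounded_integrable_cmult[OF assms(2), of "-1"]] by simp

lemma bounded_integrable_sum: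
  "(\<And>i. i \<in> I \<Longrightarrow> bounded_integrable T (f i)) \<Longrightarrow> bounded_integrable T (\<lambda>t. \<Sum>i\<in>I. f i t)"
  by (induction I rule: infinite_finite_induct)
    (auto intro: bounded_integrable_add bounded_integrable_const)

lemma bounded_integrable_linear:
  fixes f :: "real \<Rightarrow> 'a::{real_normed_field,euclidean_space}" and L :: "'a \<Rightarrow> 'b::{real_normed_field,euclidean_space}"
  assumes "bounded_linear L" "bounded_integrable T f"
  shows "bounded_integrable T (\<lambda>t. L (f t))"
proof -
  have "(L \<circ> f) absolutely_integrable_on {0..T}"
    using assms(2) unfolding bounded_integrable_def by (intro absolutely_integrable_linear[OF _ assms(1)]) simp
  moreover have "bounded (L ` (f ` {0..T}))"
    using assms(2) unfolding bounded_integrable_def by (intro bounded_linear_image[OF _ assms(1)]) simp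
  ultimately show ?thesis by (simp add: bounded_integrable_def o_def image_image)
qed

lemma bounded_integrable_integrable:
  "bounded_integrable T f \<Longrightarrow> 0 \<le> a \<Longrightarrow> b \<le> T \<Longrightarrow> f integrable_on {a..b}"
  unfolding bounded_integrable_def
  by (meson absolutely_integrable_on_def atLeastatMost_subset_iff integrable_on_subinterval)

lemma bounded_integrable_norm_square:
  fixes f :: "real \<Rightarrow> complex"
  assumes "bounded_integrable T f"
  shows "bounded_integrable T (\<lambda>t. (cmod (f t))\<^sup>2)"
proof -
  have "bounded_integrable T (\<lambda>t. Re (f t * cnj (f t)))"
    by (intro bounded_integrable_linear[OF bounded_linear_Re] bounded_integrable_mult assms
        bounded_integrable_linear[OF bounded_linear_cnj])
  then show ?thesis by (simp only: complex_mult_cnj complex.sel(1) cmod_power2 Re_complex_of_real)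
qed

text \<open>The integrated form of \<open>F' = f\<close>, matching the Caratheodory sense of the
  circuit laws; no pointwise derivative is claimed.\<close>

definition primitive_on :: "real \<Rightarrow> (real \<Rightarrow> 'a::{real_normed_field,euclidean_space}) \<Rightarrow> (real \<Rightarrow> 'a) \<Rightarrow> bool" where
  "primitive_on T F f \<longleftrightarrow> bounded_integrable T f \<and> (\<forall>t\<in>{0..T}. F t = F 0 + integral {0..t} f)"

lemma primitive_onD:
  "primitive_on T F f \<Longrightarrow> t \<in> {0..T} \<Longrightarrow> F t = F 0 + integral {0..t} f"
  "primitive_on T F f \<Longrightarrow> bounded_integrable T f"
  unfolding primitive_on_def by blast+

lemma primitive_on_cong:
  assumes "\<And>t. t \<in> {0..T} \<Longrightarrow> F t = G t" "\<And>t. t \<in> {0..T} \<Longrightarrow> f t = g t" "primitive_on T F f"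
  shows "primitive_on T G g"
  unfolding primitive_on_def
proof (intro conjI ballI)
  show "bounded_integrable T g" using assms bounded_integrable_cong unfolding primitive_on_def by blast
  fix t assume t: "t \<in> {0..T}"
  have "integral {0..t} f = integral {0..t} g" by (rule integral_cong) (use t assms(2) in auto)
  moreover have "F t = F 0 + integral {0..t} f" using assms(3) t unfolding primitive_on_def by blast
  ultimately show "G t = G 0 + integral {0..t} g" using assms(1)[OF t] assms(1)[of 0] t by auto
qed

lemma primitive_on_diff:
  assumes "primitive_on T F f" "0 \<le> s" "s \<le> t" "t \<le> T"
  shows "F t - F s = integral {s..t} f"
proof -
  have "f integrable_on {0..t}" using assms primitive_onD(2)[OF assms(1)] by (auto intro: bounded_integrable_integrable)
  then have "integral {0..s} f + integral {s..t} f = integral {0..t} f"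
    using assms by (intro Henstock_Kurzweil_Integration.integral_combine) auto
  moreover have "F s = F 0 + integral {0..s} f" "F t = F 0 + integral {0..t} f"
    using assms by (auto intro!: primitive_onD(1)[OF assms(1)])
  ultimately show ?thesis by (simp add: algebra_simps)
qed

lemma primitive_on_lipschitz:
  assumes "primitive_on T F f"
  obtains B where "B \<ge> 0" "\<And>t. t \<in> {0..T} \<Longrightarrow> norm (f t) \<le> B"
    "\<And>s t. 0 \<le> s \<Longrightarrow> s \<le> t \<Longrightarrow> t \<le> T \<Longrightarrow> norm (F t - F s) \<le> B * (t - s)"
proof -
  obtain B where B: "B > 0" "\<And>t. t \<in> {0..T} \<Longrightarrow> norm (f t) \<le> B"
    using assms unfolding primitive_on_def bounded_integrable_def bounded_pos by auto
  have "norm (F t - F s) \<le> B * (t - s)" if "0 \<le> s" "s \<le> t" "t \<le> T" for s t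
  proof -
    have "f integrable_on {s..t}" using assms that by (auto simp: primitive_on_def intro: bounded_integrable_integrable)
    then have "norm (integral {s..t} f) \<le> integral {s..t} (\<lambda>_. B)"
      by (rule integral_norm_bound_integral) (use B(2) that in auto)
    then show ?thesis using that by (simp add: primitive_on_diff[OF assms that] mult.commute)
  qed
  then show ?thesis using B by (intro that[of B]) auto
qed

lemma primitive_on_continuous:
  assumes "primitive_on T F f"
  shows "continuous_on {0..T} F"
proof -
  have "f integrable_on {0..T}" using assms unfolding primitive_on_def by (blast intro: bounded_integrable_integrable order_refl)
  then have "continuous_on {0..T} (\<lambda>t. F 0 + integral {0..t} f)"
    by (intro continuous_intros indefinite_integral_continuous_1)
  then show ?thesis
    by (rule continuous_on_eq) (rule primitive_onD(1)[OF assms, symmetric])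
qed

lemma primitive_on_bounded_integrable:
  "primitive_on T F f \<Longrightarrow> bounded_integrable T F"
  by (intro bounded_integrable_continuous primitive_on_continuous)

lemma primitive_on_linear:
  fixes f :: "real \<Rightarrow> 'a::{real_normed_field,euclidean_space}" and L :: "'a \<Rightarrow> 'b::{real_normed_field,euclidean_space}"
  assumes "bounded_linear L" "primitive_on T F f"
  shows "primitive_on T (\<lambda>t. L (F t)) (\<lambda>t. L (f t))"
  unfolding primitive_on_def
proof (intro conjI ballI)
  show "bounded_integrable T (\<lambda>t. L (f t))"
    by (rule bounded_integrable_linear[OF assms(1) primitive_onD(2)[OF assms(2)]])
  fix t assume t: "t \<in> {0..T}"
  then have "f integrable_on {0..t}"
    using primitive_onD(2)[OF assms(2)] by (auto intro: bounded_integrable_integrable)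
  then have I: "integral {0..t} (\<lambda>t. L (f t)) = L (integral {0..t} f)"
    using integral_linear[OF _ assms(1)] by (simp add: o_def)
  have "L (F t) = L (F 0 + integral {0..t} f)" by (rule arg_cong[OF primitive_onD(1)[OF assms(2) t]])
  also have "\<dots> = L (F 0) + L (integral {0..t} f)"
    by (rule linear_add[OF bounded_linear.linear[OF assms(1)]])
  finally show "L (F t) = L (F 0) + integral {0..t} (\<lambda>t. L (f t))" unfolding I .
qed

lemma primitive_on_add:
  assumes "primitive_on T F f" "primitive_on T G g"
  shows "primitive_on T (\<lambda>t. F t + G t) (\<lambda>t. f t + g t)"
  unfolding primitive_on_def
proof (intro conjI ballI)
  show "bounded_integrable T (\<lambda>t. f t + g t)"
    by (rule bounded_integrable_add[OF primitive_onD(2)[OF assms(1)] primitive_onD(2)[OF assms(2)]])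
  fix t assume t: "t \<in> {0..T}"
  then have "f integrable_on {0..t}" "g integrable_on {0..t}"
    using primitive_onD(2)[OF assms(1)] primitive_onD(2)[OF assms(2)] by (auto intro: bounded_integrable_integrable)
  then have "integral {0..t} (\<lambda>t. f t + g t) = integral {0..t} f + integral {0..t} g"
    by (rule Henstock_Kurzweil_Integration.integral_add)
  moreover have "F t = F 0 + integral {0..t} f" "G t = G 0 + integral {0..t} g"
    by (rule primitive_onD(1)[OF assms(1) t], rule primitive_onD(1)[OF assms(2) t])
  ultimately show "F t + G t = F 0 + G 0 + integral {0..t} (\<lambda>t. f t + g t)"
    by (metis (no_types, lifting) add.assoc add.commute)
qed

lemma primitive_on_cmult:
  "primitive_on T F f \<Longrightarrow> primitive_on T (\<lambda>t. c * F t) (\<lambda>t. c * f t)"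
  by (rule primitive_on_linear[OF bounded_linear_mult_right])

lemma primitive_on_const: "primitive_on T (\<lambda>t. c) (\<lambda>t. 0)"
  by (simp add: primitive_on_def bounded_integrable_const)

lemma primitive_on_sum:
  "(\<And>i. i \<in> I \<Longrightarrow> primitive_on T (F i) (f i)) \<Longrightarrow> primitive_on T (\<lambda>t. \<Sum>i\<in>I. F i t) (\<lambda>t. \<Sum>i\<in>I. f i t)"
  by (induction I rule: infinite_finite_induct) (simp_all add: primitive_on_add primitive_on_const)

text \<open>Difference quotients are bounded by \<open>C\<close> times the distance, so the
  derivative is zero everywhere.\<close>

lemma constant_of_quadratic_increments:
  fixes p :: "real \<Rightarrow> 'a::real_normed_vector"
  assumes "\<And>s t. 0 \<le> s \<Longrightarrow> s \<le> t \<Longrightarrow> t \<le> T \<Longrightarrow> norm (p t - p s) \<le> C * (t - s)\<^sup>2"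
    and "0 \<le> t" "t \<le> T"
  shows "p t = p 0"
proof -
  have sym: "norm (p y - p x) \<le> C * \<bar>y - x\<bar>\<^sup>2" if "x \<in> {0..T}" "y \<in> {0..T}" for x y
    using assms(1)[of x y] assms(1)[of y x] that by (cases "x \<le> y") (auto simp: norm_minus_commute power2_commute)
  have "(p has_derivative (\<lambda>h. 0)) (at x within {0..T})" if x: "x \<in> {0..T}" for x
  proof (rule has_derivativeI_sandwich[of 1 _ _ _ _ "\<lambda>y. C * \<bar>y - x\<bar>"])
    fix y assume y: "y \<in> {0..T}" "y \<noteq> x"
    then have "norm (p y - p x) / \<bar>y - x\<bar> \<le> C * \<bar>y - x\<bar>"
      using sym[OF x y(1)] by (simp add: divide_simps power2_eq_square)
    then show "norm (p y - p x - 0) / norm (y - x) \<le> C * \<bar>y - x\<bar>" by simp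
  next
    have "((\<lambda>y. C * \<bar>y - x\<bar>) \<longlongrightarrow> C * \<bar>x - x\<bar>) (at x within {0..T})"
      by (intro tendsto_intros)
    then show "((\<lambda>y. C * \<bar>y - x\<bar>) \<longlongrightarrow> 0) (at x within {0..T})" by simp
  qed simp_all
  then obtain c where "\<forall>x\<in>{0..T}. p x = c"
    using has_derivative_zero_constant[of "{0..T}" p] by auto
  then show ?thesis using assms by auto
qed

text \<open>
  The derivatives need not exist anywhere; the increments of the difference of the two sides are
  nevertheless quadratically small.
\<close>

lemma primitive_on_mult:
  assumes F: "primitive_on T F f" and G: "primitive_on T G g"
  shows "primitive_on T (\<lambda>t. F t * G t) (\<lambda>t. f t * G t + F t * g t)"
proof -
  let ?h = "\<lambda>t. f t * G t + F t * g t"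
  obtain A where A: "A \<ge> 0" "\<And>t. t \<in> {0..T} \<Longrightarrow> norm (f t) \<le> A"
    "\<And>s t. 0 \<le> s \<Longrightarrow> s \<le> t \<Longrightarrow> t \<le> T \<Longrightarrow> norm (F t - F s) \<le> A * (t - s)"
    using primitive_on_lipschitz[OF F] by blast
  obtain B where B: "B \<ge> 0" "\<And>t. t \<in> {0..T} \<Longrightarrow> norm (g t) \<le> B"
    "\<And>s t. 0 \<le> s \<Longrightarrow> s \<le> t \<Longrightarrow> t \<le> T \<Longrightarrow> norm (G t - G s) \<le> B * (t - s)"
    using primitive_on_lipschitz[OF G] by blast
  note bf = F[unfolded primitive_on_def, THEN conjunct1] and bg = G[unfolded primitive_on_def, THEN conjunct1]
  note bF = primitive_on_bounded_integrable[OF F] and bG = primitive_on_bounded_integrable[OF G]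
  have bh: "bounded_integrable T ?h"
    by (rule bounded_integrable_add[OF bounded_integrable_mult[OF bf bG] bounded_integrable_mult[OF bF bg]])
  define p where "p t = F t * G t - integral {0..t} ?h" for t
  have "norm (p t - p s) \<le> 2 * A * B * (t - s)\<^sup>2" if st: "0 \<le> s" "s \<le> t" "t \<le> T" for s t
  proof -
    \<comment> \<open>The remainder after splitting the increment of the product at
      \<open>G t\<close> and \<open>F s\<close>. Each of its terms is a bounded function times a
      Lipschitz increment, hence of order \<open>t - s\<close> on an interval of that
      length.\<close>
    let ?k = "\<lambda>\<tau>. f \<tau> * (G t - G \<tau>) + (F s - F \<tau>) * g \<tau>"
    have i: "(\<lambda>\<tau>. f \<tau> * G t) integrable_on {s..t}" "(\<lambda>\<tau>. F s * g \<tau>) integrable_on {s..t}"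
        "?h integrable_on {s..t}"
      by (rule bounded_integrable_integrable[OF _ st(1,3)],
          rule bounded_integrable_mult bh, rule bf bounded_integrable_const, rule bg bounded_integrable_const)+
        (rule bounded_integrable_integrable[OF bh st(1,3)])
    have "integral {0..s} ?h + integral {s..t} ?h = integral {0..t} ?h"
      using st bounded_integrable_integrable[OF bh order_refl st(3)]
      by (intro Henstock_Kurzweil_Integration.integral_combine) auto
    then have "p t - p s = F t * G t - F s * G s - integral {s..t} ?h"
      by (simp add: p_def algebra_simps)
    also have "F t * G t - F s * G s = (F t - F s) * G t + F s * (G t - G s)" by (simp add: algebra_simps)
    also have "\<dots> = integral {s..t} (\<lambda>\<tau>. f \<tau> * G t) + integral {s..t} (\<lambda>\<tau>. F s * g \<tau>)"
      unfolding primitive_on_diff[OF F st] primitive_on_diff[OF G st] by simp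
    also have "\<dots> = integral {s..t} (\<lambda>\<tau>. f \<tau> * G t + F s * g \<tau>)"
      by (rule Henstock_Kurzweil_Integration.integral_add[symmetric]) (fact i)+
    also have "\<dots> - integral {s..t} ?h = integral {s..t} (\<lambda>\<tau>. (f \<tau> * G t + F s * g \<tau>) - ?h \<tau>)"
      by (intro Henstock_Kurzweil_Integration.integral_diff[symmetric] integrable_add i)
    also have "\<dots> = integral {s..t} ?k" by (rule integral_cong) (simp add: algebra_simps)
    finally have eq: "p t - p s = integral {s..t} ?k" .
    have "norm (integral {s..t} ?k) \<le> integral {s..t} (\<lambda>_. 2 * A * B * (t - s))"
    proof (rule integral_norm_bound_integral)
      show "?k integrable_on {s..t}"
        by (rule bounded_integrable_integrable[OF bounded_integrable_add[OF
              bounded_integrable_mult[OF bf bounded_integrable_diff[OF bounded_integrable_const bG]]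
              bounded_integrable_mult[OF bounded_integrable_diff[OF bounded_integrable_const bF] bg]] st(1,3)])
      fix \<tau> assume \<tau>: "\<tau> \<in> {s..t}"
      have "norm (f \<tau> * (G t - G \<tau>)) \<le> A * (B * (t - s))"
        unfolding norm_mult
      proof (rule mult_mono)
        show "norm (G t - G \<tau>) \<le> B * (t - s)"
          using B(3)[of \<tau> t] \<tau> st mult_left_mono[of "t - \<tau>" "t - s" B] B(1) by auto
      qed (use A \<tau> st in auto)
      moreover have "norm ((F s - F \<tau>) * g \<tau>) \<le> (A * (t - s)) * B"
        unfolding norm_mult
      proof (rule mult_mono)
        show "norm (F s - F \<tau>) \<le> A * (t - s)"
          using A(3)[of s \<tau>] \<tau> st mult_left_mono[of "\<tau> - s" "t - s" A] A(1) by (auto simp: norm_minus_commute)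
      qed (use A B \<tau> st in auto)
      ultimately show "norm (?k \<tau>) \<le> 2 * A * B * (t - s)"
        using norm_triangle_ineq[of "f \<tau> * (G t - G \<tau>)" "(F s - F \<tau>) * g \<tau>"] by (simp add: algebra_simps)
    qed (rule integrable_const_ivl)
    then show ?thesis using st by (simp add: eq power2_eq_square algebra_simps)
  qed
  then have p: "p t = p 0" if "0 \<le> t" "t \<le> T" for t
    using constant_of_quadratic_increments[of T p "2 * A * B"] that by blast
  have "F t * G t = F 0 * G 0 + integral {0..t} ?h" if "t \<in> {0..T}" for t
  proof -
    have "F t * G t = p t + integral {0..t} ?h" by (simp add: p_def)
    also have "p t = F 0 * G 0" using p[of t] that by (simp add: p_def)
    finally show ?thesis .
  qed
  then show ?thesis unfolding primitive_on_def using bh by blast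
qed

lemma primitive_on_integral:
  assumes "bounded_integrable T f"
  shows "primitive_on T (\<lambda>t. integral {0..t} f) f"
  using assms by (simp add: primitive_on_def)

lemma primitive_on_exp: "primitive_on T (\<lambda>t. exp (of_real t * z)) (\<lambda>t. z * exp (of_real t * z :: complex))"
  unfolding primitive_on_def
proof (intro conjI ballI)
  show "bounded_integrable T (\<lambda>t. z * exp (of_real t * z))"
    by (rule bounded_integrable_continuous) (intro continuous_intros)
  fix t assume t: "t \<in> {0..T}"
  have d: "((\<lambda>x. exp (x * z)) has_field_derivative z * exp (of_real \<tau> * z)) (at (of_real \<tau>))" for \<tau> :: real
  proof -
    have "((\<lambda>x. exp (x * z)) has_field_derivative exp (of_real \<tau> * z) * (1 * z)) (at (of_real \<tau>))"
      by (intro DERIV_chain2[OF DERIV_exp] DERIV_cmult_right DERIV_ident)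
    then show ?thesis by (simp only: mult_1 mult.commute)
  qed
  have "((\<lambda>t. z * exp (of_real t * z)) has_integral (exp (of_real t * z) - exp (of_real 0 * z))) {0..t}"
  proof (rule fundamental_theorem_of_calculus)
    show "0 \<le> t" using t by simp
    show "((\<lambda>t. exp (of_real t * z)) has_vector_derivative z * exp (of_real \<tau> * z)) (at \<tau> within {0..t})" for \<tau>
      by (rule has_vector_derivative_real_field[OF d])
  qed
  then show "exp (of_real t * z) = exp (of_real 0 * z) + integral {0..t} (\<lambda>t. z * exp (of_real t * z))"
    by (metis integral_unique add.commute diff_add_cancel)
qed

text \<open>Differentiating \<open>|x|\<^sup>2\<close> and absorbing the cross term \<open>x a\<close> into the decay by AM-GM.\<close>

lemma first_order_energy:
  fixes x a :: "real \<Rightarrow> complex"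
  assumes x: "primitive_on T x (\<lambda>t. z * x t + a t)" and a: "bounded_integrable T a"
    and \<alpha>: "Re z \<le> - \<alpha>" "\<alpha> > 0" and st: "0 \<le> s" "s \<le> t" "t \<le> T"
  shows "(cmod (x t))\<^sup>2 + \<alpha> * integral {s..t} (\<lambda>\<tau>. (cmod (x \<tau>))\<^sup>2)
    \<le> (cmod (x s))\<^sup>2 + (1 / \<alpha>) * integral {s..t} (\<lambda>\<tau>. (cmod (a \<tau>))\<^sup>2)"
proof -
  let ?f = "\<lambda>t. z * x t + a t"
  have "primitive_on T (\<lambda>t. x t * cnj (x t)) (\<lambda>t. ?f t * cnj (x t) + x t * cnj (?f t))"
    by (rule primitive_on_mult[OF x primitive_on_linear[OF bounded_linear_cnj x]])
  from primitive_on_linear[OF bounded_linear_Re this]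
  have p: "primitive_on T (\<lambda>t. (cmod (x t))\<^sup>2) (\<lambda>t. 2 * Re (?f t * cnj (x t)))"
  proof (rule primitive_on_cong[rotated 2])
    show "Re (x t * cnj (x t)) = (cmod (x t))\<^sup>2" for t
      by (simp only: complex_mult_cnj complex.sel(1) cmod_power2 Re_complex_of_real)
    show "Re (?f t * cnj (x t) + x t * cnj (?f t)) = 2 * Re (?f t * cnj (x t))" for t
      by (simp add: algebra_simps)
  qed
  note bx = bounded_integrable_integrable[OF bounded_integrable_norm_square[OF primitive_on_bounded_integrable[OF x]] st(1,3)]
  note ba = bounded_integrable_integrable[OF bounded_integrable_norm_square[OF a] st(1,3)]
  have "(cmod (x t))\<^sup>2 - (cmod (x s))\<^sup>2 = integral {s..t} (\<lambda>t. 2 * Re (?f t * cnj (x t)))"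
    by (rule primitive_on_diff[OF p st])
  also have "\<dots> \<le> integral {s..t} (\<lambda>\<tau>. (- \<alpha>) * (cmod (x \<tau>))\<^sup>2 + (1 / \<alpha>) * (cmod (a \<tau>))\<^sup>2)"
  proof (rule integral_le)
    show "(\<lambda>t. 2 * Re (?f t * cnj (x t))) integrable_on {s..t}"
      using p by (auto simp: primitive_on_def intro: bounded_integrable_integrable[OF _ st(1,3)])
    show "(\<lambda>\<tau>. (- \<alpha>) * (cmod (x \<tau>))\<^sup>2 + (1 / \<alpha>) * (cmod (a \<tau>))\<^sup>2) integrable_on {s..t}"
      by (intro integrable_add integrable_on_mult_right bx ba)
    fix \<tau>
    have "Re (?f \<tau> * cnj (x \<tau>)) = Re z * (cmod (x \<tau>))\<^sup>2 + Re (a \<tau> * cnj (x \<tau>))"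
      unfolding cmod_power2 by (simp add: power2_eq_square algebra_simps)
    moreover have "Re z * (cmod (x \<tau>))\<^sup>2 \<le> - \<alpha> * (cmod (x \<tau>))\<^sup>2"
      by (rule mult_right_mono[OF \<alpha>(1)]) simp
    moreover have "Re (a \<tau> * cnj (x \<tau>)) \<le> cmod (a \<tau>) * cmod (x \<tau>)"
      using complex_Re_le_cmod[of "a \<tau> * cnj (x \<tau>)"] by (simp add: norm_mult)
    moreover have "2 * (cmod (a \<tau>) * cmod (x \<tau>)) \<le> \<alpha> * (cmod (x \<tau>))\<^sup>2 + (1 / \<alpha>) * (cmod (a \<tau>))\<^sup>2"
    proof -
      have "0 \<le> (\<alpha> * cmod (x \<tau>) - cmod (a \<tau>))\<^sup>2 / \<alpha>" using \<alpha>(2) by simp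
      also have "\<dots> = \<alpha> * (cmod (x \<tau>))\<^sup>2 + (1 / \<alpha>) * (cmod (a \<tau>))\<^sup>2 - 2 * (cmod (a \<tau>) * cmod (x \<tau>))"
        using \<alpha>(2) by (simp add: power2_eq_square add_divide_distrib diff_divide_distrib left_diff_distrib right_diff_distrib)
      finally show ?thesis by simp
    qed
    ultimately show "2 * Re (?f \<tau> * cnj (x \<tau>)) \<le> (- \<alpha>) * (cmod (x \<tau>))\<^sup>2 + (1 / \<alpha>) * (cmod (a \<tau>))\<^sup>2"
      by linarith
  qed
  also have "\<dots> = (- \<alpha>) * integral {s..t} (\<lambda>\<tau>. (cmod (x \<tau>))\<^sup>2) + (1 / \<alpha>) * integral {s..t} (\<lambda>\<tau>. (cmod (a \<tau>))\<^sup>2)"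
    unfolding Henstock_Kurzweil_Integration.integral_add[OF integrable_on_mult_right[OF bx] integrable_on_mult_right[OF ba]]
    by simp
  finally show ?thesis by simp
qed

definition square_integrable :: "(real \<Rightarrow> complex) \<Rightarrow> bool" where
  "square_integrable f \<longleftrightarrow> (\<forall>T. bounded_integrable T f) \<and>
     (\<exists>B. \<forall>T\<ge>0. integral {0..T} (\<lambda>t. (cmod (f t))\<^sup>2) \<le> B)"

text \<open>The energy inequality from time 0 bounds the square integral. For the limit, the finite
  square integral forces \<open>x\<close> to be small at some late time; the energy inequality
  started there adds only the tail of the input energy and keeps \<open>x\<close> small from then
  on.\<close>

lemma first_order_square_integrable:
  fixes x a :: "real \<Rightarrow> complex"
  assumes x: "\<And>T. primitive_on T x (\<lambda>t. z * x t + a t)" and a: "square_integrable a"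
    and z: "Re z < 0"
  shows "square_integrable x" "(x \<longlongrightarrow> 0) at_top"
proof -
  define \<alpha> where "\<alpha> = - Re z"
  have \<alpha>: "Re z \<le> - \<alpha>" "\<alpha> > 0" using z by (simp_all add: \<alpha>_def)
  have ba: "bounded_integrable T a" for T using a by (simp add: square_integrable_def)
  have bx: "bounded_integrable T x" for T by (rule primitive_on_bounded_integrable[OF x])
  let ?A = "\<lambda>T. integral {0..T} (\<lambda>t. (cmod (a t))\<^sup>2)"
  let ?X = "\<lambda>T. integral {0..T} (\<lambda>t. (cmod (x t))\<^sup>2)"
  note energy = first_order_energy[OF x ba \<alpha>]
  obtain B where B: "\<And>T. T \<ge> 0 \<Longrightarrow> ?A T \<le> B" using a by (auto simp: square_integrable_def)
  have XB: "?X T \<le> ((cmod (x 0))\<^sup>2 + (1 / \<alpha>) * B) / \<alpha>" if "T \<ge> 0" for T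
  proof -
    have "\<alpha> * ?X T \<le> (cmod (x T))\<^sup>2 + \<alpha> * ?X T" by simp
    also have "\<dots> \<le> (cmod (x 0))\<^sup>2 + (1 / \<alpha>) * ?A T" using energy[of 0 T T] that by simp
    also have "\<dots> \<le> (cmod (x 0))\<^sup>2 + (1 / \<alpha>) * B" using B[OF that] \<alpha> by (simp add: divide_right_mono)
    finally show ?thesis using \<alpha>(2) by (simp add: pos_le_divide_eq mult.commute)
  qed
  then show "square_integrable x" using bx unfolding square_integrable_def by blast
  have split: "integral {0..s} (\<lambda>t. (cmod (f t))\<^sup>2) + integral {s..t} (\<lambda>t. (cmod (f t))\<^sup>2) = integral {0..t} (\<lambda>t. (cmod (f t))\<^sup>2)"
    if "0 \<le> s" "s \<le> t" "\<And>T. bounded_integrable T f" for s t f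
    using that bounded_integrable_integrable[OF bounded_integrable_norm_square[OF that(3)[of t]] order_refl order_refl]
    by (intro Henstock_Kurzweil_Integration.integral_combine) auto
  have nonneg: "integral {s..t} (\<lambda>t. (cmod (f t))\<^sup>2) \<ge> 0" if "0 \<le> s" "\<And>T. bounded_integrable T f" for s t f
    using that bounded_integrable_integrable[OF bounded_integrable_norm_square[OF that(2)[of t]] that(1) order_refl]
    by (intro Henstock_Kurzweil_Integration.integral_nonneg) auto
  have conv: "\<exists>l. (F \<longlongrightarrow> l) at_top"
    if F: "\<And>s t. 0 \<le> s \<Longrightarrow> s \<le> t \<Longrightarrow> F s \<le> F t" "\<And>t. 0 \<le> t \<Longrightarrow> F t \<le> C" for F :: "real \<Rightarrow> real" and C
  proof -
    have bdd: "bdd_above (F ` {0..})" using F(2) by (auto simp: bdd_above_def)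
    show ?thesis
    proof (intro exI increasing_tendsto)
      show "\<forall>\<^sub>F t in at_top. F t \<le> Sup (F ` {0..})"
        using eventually_ge_at_top[of 0] by eventually_elim (auto intro!: cSup_upper bdd)
      fix y assume "y < Sup (F ` {0..})"
      then obtain s where "s \<ge> 0" "y < F s" using less_cSup_iff[OF _ bdd] by auto
      then have "y < F t" if "t \<ge> s" for t using F(1)[of s t] that by simp
      then show "\<forall>\<^sub>F t in at_top. y < F t" unfolding eventually_at_top_linorder by blast
    qed
  qed
  obtain la where la: "(?A \<longlongrightarrow> la) at_top"
    using conv[of ?A B] B split[OF _ _ ba] nonneg[OF _ ba] by (metis add_increasing2 order_refl)
  have Ala: "?A t \<le> la" if "0 \<le> t" for t
  proof (rule tendsto_lowerbound[OF la])
    show "\<forall>\<^sub>F T in at_top. ?A t \<le> ?A T"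
      using eventually_ge_at_top[of t] by eventually_elim (use that split[OF _ _ ba] nonneg[OF _ ba] in \<open>metis add_increasing2 order_refl\<close>)
  qed simp
  have "((\<lambda>t. (cmod (x t))\<^sup>2) \<longlongrightarrow> 0) at_top"
  proof (rule tendstoI)
    fix \<epsilon> :: real assume \<epsilon>: "\<epsilon> > 0"
    \<comment> \<open>The tail of the input energy enters the energy inequality with factor
      \<open>1 / \<alpha>\<close>; this threshold turns it into half of
      \<open>\<epsilon>\<close>.\<close>
    have "\<forall>\<^sub>F t in at_top. dist (?A t) la < \<alpha> * \<epsilon> / 2" by (rule tendstoD[OF la]) (use \<alpha> \<epsilon> in simp)
    then obtain s0 where s0: "\<And>s. s \<ge> s0 \<Longrightarrow> dist (?A s) la < \<alpha> * \<epsilon> / 2" by (auto simp: eventually_at_top_linorder)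
    define s1 where "s1 = max s0 0"
    have "\<exists>s\<ge>s1. (cmod (x s))\<^sup>2 < \<epsilon> / 2"
    proof (rule ccontr)
      assume "\<not> ?thesis"
      then have ge: "(cmod (x s))\<^sup>2 \<ge> \<epsilon> / 2" if "s \<ge> s1" for s using that by force
      define C where "C = ((cmod (x 0))\<^sup>2 + (1 / \<alpha>) * B) / \<alpha>"
      \<comment> \<open>Long enough that the supposed lower bound, half of
        \<open>\<epsilon>\<close>, integrates to \<open>\<bar>C\<bar> + 1\<close> and so exceeds the
        bound \<open>C\<close>.\<close>
      define t where "t = s1 + (\<bar>C\<bar> + 1) * 2 / \<epsilon>"
      have t: "t \<ge> s1" "s1 \<ge> 0" using \<epsilon> by (auto simp: t_def s1_def)
      have "integral {s1..t} (\<lambda>_. \<epsilon> / 2) \<le> integral {s1..t} (\<lambda>t. (cmod (x t))\<^sup>2)"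
        by (rule integral_le) (use ge t bounded_integrable_integrable[OF bounded_integrable_norm_square[OF bx] t(2) order_refl] in auto)
      also have "\<dots> \<le> ?X t" using split[OF t(2,1) bx] nonneg[OF order_refl bx, of s1] by simp
      also have "\<dots> \<le> C" using XB[of t] t unfolding C_def by simp
      finally show False using t \<epsilon> by (simp add: t_def)
    qed
    then obtain s where s: "s \<ge> s1" "(cmod (x s))\<^sup>2 < \<epsilon> / 2" by blast
    have "dist ((cmod (x t))\<^sup>2) 0 < \<epsilon>" if t: "t \<ge> s" for t
    proof -
      have s': "s \<ge> 0" "s \<ge> s0" using s by (auto simp: s1_def)
      have "(cmod (x t))\<^sup>2 \<le> (cmod (x t))\<^sup>2 + \<alpha> * integral {s..t} (\<lambda>\<tau>. (cmod (x \<tau>))\<^sup>2)"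
        using nonneg[OF s'(1) bx] \<alpha> by simp
      also have "\<dots> \<le> (cmod (x s))\<^sup>2 + (1 / \<alpha>) * integral {s..t} (\<lambda>\<tau>. (cmod (a \<tau>))\<^sup>2)"
        by (rule energy[OF s'(1) t order_refl])
      also have "integral {s..t} (\<lambda>\<tau>. (cmod (a \<tau>))\<^sup>2) < \<alpha> * \<epsilon> / 2"
        using split[OF s'(1) t ba] Ala[of t] Ala[of s] s0[OF s'(2)] t s'(1) by (simp add: dist_real_def)
      then have "(1 / \<alpha>) * integral {s..t} (\<lambda>\<tau>. (cmod (a \<tau>))\<^sup>2) < \<epsilon> / 2" using \<alpha>(2) by (simp add: pos_divide_less_eq mult.commute)
      finally show ?thesis using s(2) by simp
    qed
    then show "\<forall>\<^sub>F t in at_top. dist ((cmod (x t))\<^sup>2) 0 < \<epsilon>"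
      unfolding eventually_at_top_linorder by blast
  qed
  then have "((\<lambda>t. sqrt ((cmod (x t))\<^sup>2)) \<longlongrightarrow> sqrt 0) at_top" by (rule tendsto_real_sqrt)
  then show "(x \<longlongrightarrow> 0) at_top" by (simp add: tendsto_norm_zero_iff)
qed

lemma first_order_solution:
  fixes a :: "real \<Rightarrow> complex"
  assumes a: "\<And>T. bounded_integrable T a"
  shows "\<exists>x. x 0 = 0 \<and> (\<forall>T. primitive_on T x (\<lambda>t. z * x t + a t))"
proof -
  define x where "x t = exp (of_real t * z) * integral {0..t} (\<lambda>\<tau>. exp (of_real \<tau> * - z) * a \<tau>)" for t
  have "primitive_on T x (\<lambda>t. z * x t + a t)" for T
  proof -
    have b: "bounded_integrable T (\<lambda>\<tau>. exp (of_real \<tau> * - z) * a \<tau>)"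
      by (intro bounded_integrable_mult[OF _ a] bounded_integrable_continuous continuous_intros)
    have e: "exp (of_real t * z) * (exp (of_real t * - z) * a t) = a t" for t
      by (simp add: mult.assoc[symmetric] exp_add[symmetric])
    show ?thesis
      using primitive_on_mult[OF primitive_on_exp primitive_on_integral[OF b], of z]
      by (rule primitive_on_cong[rotated 2]) (simp_all only: x_def e mult.assoc)
  qed
  then show ?thesis by (intro exI[of _ x]) (simp add: x_def)
qed

subsection \<open>Driven and observed chains\<close>

lemma cmod_add_square_le: "(cmod (a + b))\<^sup>2 \<le> 2 * (cmod a)\<^sup>2 + 2 * (cmod b)\<^sup>2"
proof -
  have "(cmod (a + b))\<^sup>2 \<le> (cmod a + cmod b)\<^sup>2" by (intro power_mono norm_triangle_ineq) simp
  also have "\<dots> \<le> 2 * (cmod a)\<^sup>2 + 2 * (cmod b)\<^sup>2"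
    using sum_squares_bound[of "cmod a" "cmod b"] by (simp add: power2_sum)
  finally show ?thesis .
qed

lemma integral_cmod_add_square_le:
  assumes "bounded_integrable T f" "bounded_integrable T g"
  shows "integral {0..T} (\<lambda>t. (cmod (f t + g t))\<^sup>2)
    \<le> 2 * integral {0..T} (\<lambda>t. (cmod (f t))\<^sup>2) + 2 * integral {0..T} (\<lambda>t. (cmod (g t))\<^sup>2)"
proof -
  note i = bounded_integrable_integrable[OF bounded_integrable_norm_square order_refl order_refl]
  have "integral {0..T} (\<lambda>t. (cmod (f t + g t))\<^sup>2) \<le> integral {0..T} (\<lambda>t. 2 * (cmod (f t))\<^sup>2 + 2 * (cmod (g t))\<^sup>2)"
    by (rule integral_le[OF i[OF bounded_integrable_add[OF assms]]
        integrable_add[OF integrable_on_mult_right[OF i[OF assms(1)]] integrable_on_mult_right[OF i[OF assms(2)]]]])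
      (rule cmod_add_square_le)
  also have "\<dots> = 2 * integral {0..T} (\<lambda>t. (cmod (f t))\<^sup>2) + 2 * integral {0..T} (\<lambda>t. (cmod (g t))\<^sup>2)"
    unfolding Henstock_Kurzweil_Integration.integral_add[OF integrable_on_mult_right[OF i[OF assms(1)]] integrable_on_mult_right[OF i[OF assms(2)]]]
    by simp
  finally show ?thesis .
qed

lemma square_integrable_add:
  assumes "square_integrable f" "square_integrable g"
  shows "square_integrable (\<lambda>t. f t + g t)"
proof -
  have f: "bounded_integrable T f" and g: "bounded_integrable T g" for T
    using assms by (auto simp: square_integrable_def)
  obtain A B where A: "\<And>T. T \<ge> 0 \<Longrightarrow> integral {0..T} (\<lambda>t. (cmod (f t))\<^sup>2) \<le> A"
    and B: "\<And>T. T \<ge> 0 \<Longrightarrow> integral {0..T} (\<lambda>t. (cmod (g t))\<^sup>2) \<le> B"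
    using assms by (auto simp: square_integrable_def)
  have "integral {0..T} (\<lambda>t. (cmod (f t + g t))\<^sup>2) \<le> 2 * A + 2 * B" if "T \<ge> 0" for T
    using integral_cmod_add_square_le[OF f[of T] g[of T]] A[OF that] B[OF that] by linarith
  then show ?thesis unfolding square_integrable_def using bounded_integrable_add[OF f g] by blast
qed

lemma square_integrable_cmult:
  assumes "square_integrable f"
  shows "square_integrable (\<lambda>t. c * f t)"
proof -
  obtain A where A: "\<And>T. T \<ge> 0 \<Longrightarrow> integral {0..T} (\<lambda>t. (cmod (f t))\<^sup>2) \<le> A"
    using assms by (auto simp: square_integrable_def)
  have "integral {0..T} (\<lambda>t. (cmod (c * f t))\<^sup>2) \<le> (cmod c)\<^sup>2 * A" if "T \<ge> 0" for T
    using mult_left_mono[OF A[OF that], of "(cmod c)\<^sup>2"] by (simp add: norm_mult power_mult_distrib)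
  moreover have "bounded_integrable T (\<lambda>t. c * f t)" for T
    using assms by (simp add: square_integrable_def bounded_integrable_cmult)
  ultimately show ?thesis unfolding square_integrable_def by blast
qed

lemma square_integrable_cong:
  assumes "square_integrable f" "\<And>t. t \<ge> 0 \<Longrightarrow> f t = g t"
  shows "square_integrable g"
proof -
  have "bounded_integrable T g" for T
    by (rule bounded_integrable_cong[of T f]) (use assms in \<open>auto simp: square_integrable_def\<close>)
  moreover have "integral {0..T} (\<lambda>t. (cmod (f t))\<^sup>2) = integral {0..T} (\<lambda>t. (cmod (g t))\<^sup>2)" for T
    by (rule integral_cong) (use assms in auto)
  ultimately show ?thesis using assms(1) unfolding square_integrable_def by simp
qed

text \<open>The response from rest of the differential equation with characteristic polynomial
  \<open>p\<close> and right side \<open>W\<close>; \<open>X k\<close> is its k-th derivative. The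
  highest derivative is only bounded and integrable: no initial value or further derivative is asked
  of it.\<close>

definition driven_chain :: "complex poly \<Rightarrow> (real \<Rightarrow> complex) \<Rightarrow> (nat \<Rightarrow> real \<Rightarrow> complex) \<Rightarrow> bool" where
  "driven_chain p W X \<longleftrightarrow>
     (\<forall>k<degree p. X k 0 = 0 \<and> (\<forall>T. primitive_on T (X k) (X (Suc k)))) \<and>
     (\<forall>k\<le>degree p. \<forall>T. bounded_integrable T (X k)) \<and>
     (\<forall>t. (\<Sum>k\<le>degree p. coeff p k * X k t) = W t)"

text \<open>Pointwise bounds and decay are asked below the degree, where \<open>X k\<close> is
  continuous. They control the boundary terms at the end of an interval, with a constant
  \<open>C\<close> that does not depend on its length.\<close>

definition chain_bounds :: "complex poly \<Rightarrow> real \<Rightarrow> (real \<Rightarrow> complex) \<Rightarrow> (nat \<Rightarrow> real \<Rightarrow> complex) \<Rightarrow> bool" where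
  "chain_bounds p C W X \<longleftrightarrow>
     (\<forall>k\<le>degree p. \<forall>T\<ge>0. integral {0..T} (\<lambda>t. (cmod (X k t))\<^sup>2) \<le> C * integral {0..T} (\<lambda>t. (cmod (W t))\<^sup>2)) \<and>
     (\<forall>k<degree p. \<forall>T\<ge>0. (cmod (X k T))\<^sup>2 \<le> C * integral {0..T} (\<lambda>t. (cmod (W t))\<^sup>2)) \<and>
     (square_integrable W \<longrightarrow> (\<forall>k<degree p. (X k \<longlongrightarrow> 0) at_top))"

lemma square_integral_nonneg:
  "bounded_integrable T f \<Longrightarrow> integral {0..T} (\<lambda>t. (cmod (f t))\<^sup>2) \<ge> 0"
  using bounded_integrable_integrable[OF bounded_integrable_norm_square order_refl order_refl]
  by (intro Henstock_Kurzweil_Integration.integral_nonneg) auto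

text \<open>To add the root \<open>q\<close>, the response for \<open>p\<close> is filtered once
  more, \<open>x' = q * x + Z 0\<close> from rest; differentiating gives
  \<open>X (Suc k) = q * X k + Z k\<close>. The two terms of \<open>c 0\<close> bound the energy and
  the pointwise value of \<open>x\<close>; the recursion of \<open>c\<close> estimates a squared sum
  by twice the squares.\<close>

lemma driven_chain_extend:
  assumes Z: "driven_chain p W Z" "chain_bounds p C W Z" and C: "C \<ge> 0"
    and q: "Re q < 0" and W: "\<And>T. bounded_integrable T W"
    and p': "p' = [:- q, 1:] * p" and p0: "p \<noteq> 0"
    and c0: "c 0 = C / (Re q)\<^sup>2 + C / - Re q" and cSuc: "\<And>k. c (Suc k) = 2 * (cmod q)\<^sup>2 * c k + 2 * C"
  shows "\<exists>X. driven_chain p' W X \<and> chain_bounds p' (\<Sum>k\<le>Suc (degree p). c k) W X"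
proof -
  define r where "r = degree p"
  have "degree p' = degree [:- q, 1:] + degree p" unfolding p' by (rule degree_mult_eq) (use p0 in simp_all)
  then have deg: "degree p' = Suc r" by (simp add: r_def)
  have cp0: "coeff p' 0 = - q * coeff p 0" and cp: "coeff p' (Suc k) = coeff p k - q * coeff p (Suc k)" for k
    by (simp_all add: p')
  have Z0: "Z k 0 = 0" and Zp: "primitive_on T (Z k) (Z (Suc k))" if "k < r" for k T
    using Z(1) that by (auto simp: driven_chain_def r_def)
  have Zb: "bounded_integrable T (Z k)" if "k \<le> r" for k T
    using Z(1) that by (auto simp: driven_chain_def r_def)
  have Zs: "(\<Sum>k\<le>r. coeff p k * Z k t) = W t" for t
    using Z(1) by (auto simp: driven_chain_def r_def)
  have ZI: "integral {0..T} (\<lambda>t. (cmod (Z k t))\<^sup>2) \<le> C * integral {0..T} (\<lambda>t. (cmod (W t))\<^sup>2)" if "k \<le> r" "T \<ge> 0" for k T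
    using Z(2) that by (auto simp: chain_bounds_def r_def)
  have ZT: "(cmod (Z k T))\<^sup>2 \<le> C * integral {0..T} (\<lambda>t. (cmod (W t))\<^sup>2)" if "k < r" "T \<ge> 0" for k T
    using Z(2) that by (auto simp: chain_bounds_def r_def)
  have Zl: "(Z k \<longlongrightarrow> 0) at_top" if "square_integrable W" "k < r" for k
    using Z(2) that by (auto simp: chain_bounds_def r_def)
  obtain x where x: "x 0 = 0" "\<And>T. primitive_on T x (\<lambda>t. q * x t + Z 0 t)"
    using first_order_solution[OF Zb[of 0], of q] by auto
  define X where "X = rec_nat x (\<lambda>k f t. q * f t + Z k t)"
  have X0: "X 0 = x" and XS: "X (Suc k) = (\<lambda>t. q * X k t + Z k t)" for k by (simp_all add: X_def)
  have Xp: "X k 0 = 0 \<and> (\<forall>T. primitive_on T (X k) (X (Suc k)))" if "k \<le> r" for k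
    using that
  proof (induction k)
    case 0
    then show ?case using x by (simp add: X0 XS)
  next
    case (Suc k)
    then have IH: "X k 0 = 0" "\<And>T. primitive_on T (X k) (X (Suc k))" by auto
    have "primitive_on T (\<lambda>t. q * X k t + Z k t) (\<lambda>t. q * X (Suc k) t + Z (Suc k) t)" for T
      using Suc.prems by (intro primitive_on_add primitive_on_cmult IH Zp) auto
    then show ?case unfolding XS[of "Suc k"] XS[of k] using IH(1) Z0[of k] Suc.prems by (simp add: XS)
  qed
  have Xb: "bounded_integrable T (X k)" if "k \<le> Suc r" for k T
    using that
  proof (cases k)
    case 0
    then show ?thesis using primitive_on_bounded_integrable[OF x(2)] by (simp add: X0)
  next
    case (Suc k')
    then have "bounded_integrable T (X k')" using Xp[of k'] that by (blast intro: primitive_on_bounded_integrable Suc_le_mono[THEN iffD1])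
    then show ?thesis unfolding Suc XS using Suc that by (intro bounded_integrable_add bounded_integrable_cmult Zb) auto
  qed
  \<comment> \<open>The coefficients of \<open>[:- q, 1:] * p\<close> acting on \<open>X\<close>
    amount to those of \<open>p\<close> acting on \<open>X (Suc k) - q * X k\<close>, which is
    \<open>Z k\<close>.\<close>
  have sum: "(\<Sum>k\<le>degree p'. coeff p' k * X k t) = W t" for t
  proof -
    have "(\<Sum>k\<le>Suc r. coeff p' k * X k t) = coeff p' 0 * X 0 t + (\<Sum>k\<le>r. coeff p' (Suc k) * X (Suc k) t)"
      by (rule sum.atMost_Suc_shift)
    also have "\<dots> = (\<Sum>k\<le>r. coeff p k * X (Suc k) t) - q * (coeff p 0 * X 0 t + (\<Sum>k\<le>r. coeff p (Suc k) * X (Suc k) t))"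
      by (simp add: cp0 cp left_diff_distrib sum_subtractf sum_distrib_left distrib_left mult.assoc)
    also have "coeff p 0 * X 0 t + (\<Sum>k\<le>r. coeff p (Suc k) * X (Suc k) t) = (\<Sum>k\<le>Suc r. coeff p k * X k t)"
      by (rule sum.atMost_Suc_shift[symmetric])
    also have "\<dots> = (\<Sum>k\<le>r. coeff p k * X k t)" by (simp add: r_def coeff_eq_0)
    also have "(\<Sum>k\<le>r. coeff p k * X (Suc k) t) - q * (\<Sum>k\<le>r. coeff p k * X k t) = (\<Sum>k\<le>r. coeff p k * Z k t)"
      unfolding sum_distrib_left sum_subtractf[symmetric] by (rule sum.cong[OF refl]) (simp add: XS algebra_simps)
    finally show ?thesis by (simp add: deg Zs)
  qed
  define \<alpha> where "\<alpha> = - Re q"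
  have \<alpha>: "Re q \<le> - \<alpha>" "\<alpha> > 0" using q by (simp_all add: \<alpha>_def)
  let ?W = "\<lambda>T. integral {0..T} (\<lambda>t. (cmod (W t))\<^sup>2)"
  have W0: "?W T \<ge> 0" for T by (rule square_integral_nonneg[OF W])
  have c_nonneg: "c k \<ge> 0" for k
  proof (induction k)
    case 0
    show ?case unfolding c0 by (intro add_nonneg_nonneg divide_nonneg_nonneg) (use C q in auto)
  qed (use C in \<open>simp add: cSuc\<close>)
  have first: "\<alpha> * integral {0..T} (\<lambda>t. (cmod (x t))\<^sup>2) \<le> C / \<alpha> * ?W T" "(cmod (x T))\<^sup>2 \<le> C / \<alpha> * ?W T" if "T \<ge> 0" for T
  proof -
    have "(cmod (x T))\<^sup>2 + \<alpha> * integral {0..T} (\<lambda>t. (cmod (x t))\<^sup>2)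
        \<le> (1 / \<alpha>) * integral {0..T} (\<lambda>t. (cmod (Z 0 t))\<^sup>2)"
      using first_order_energy[OF x(2) Zb[of 0 T] \<alpha>, of 0 T] that x(1) by simp
    also have "\<dots> \<le> (1 / \<alpha>) * (C * ?W T)" by (rule mult_left_mono[OF ZI[OF _ that]]) (use \<alpha> in auto)
    finally have le: "(cmod (x T))\<^sup>2 + \<alpha> * integral {0..T} (\<lambda>t. (cmod (x t))\<^sup>2) \<le> C / \<alpha> * ?W T" by simp
    have "\<alpha> * integral {0..T} (\<lambda>t. (cmod (x t))\<^sup>2) \<ge> 0"
      using \<alpha> square_integral_nonneg[OF primitive_on_bounded_integrable[OF x(2)[of T]]] by simp
    with le show "\<alpha> * integral {0..T} (\<lambda>t. (cmod (x t))\<^sup>2) \<le> C / \<alpha> * ?W T" "(cmod (x T))\<^sup>2 \<le> C / \<alpha> * ?W T"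
      using zero_le_power2[of "cmod (x T)"] by linarith+
  qed
  have c0': "c 0 = C / \<alpha>\<^sup>2 + C / \<alpha>" by (simp add: c0 \<alpha>_def)
  have int: "integral {0..T} (\<lambda>t. (cmod (X k t))\<^sup>2) \<le> c k * ?W T" if "k \<le> Suc r" "T \<ge> 0" for k T
    using that
  proof (induction k)
    case 0
    have "integral {0..T} (\<lambda>t. (cmod (x t))\<^sup>2) \<le> C / \<alpha> * ?W T / \<alpha>"
      using first(1)[OF 0(2)] \<alpha>(2) by (simp add: pos_le_divide_eq mult.commute)
    also have "\<dots> = C / \<alpha>\<^sup>2 * ?W T" by (simp add: power2_eq_square)
    also have "\<dots> \<le> c 0 * ?W T" unfolding c0' using C \<alpha> by (intro mult_right_mono W0) simp
    finally show ?case by (simp add: X0)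
  next
    case (Suc k)
    then have k: "k \<le> r" by simp
    have "integral {0..T} (\<lambda>t. (cmod (X (Suc k) t))\<^sup>2) \<le> 2 * integral {0..T} (\<lambda>t. (cmod (q * X k t))\<^sup>2) + 2 * integral {0..T} (\<lambda>t. (cmod (Z k t))\<^sup>2)"
      unfolding XS using k by (intro integral_cmod_add_square_le bounded_integrable_cmult Xb Zb) auto
    also have "\<dots> = 2 * (cmod q)\<^sup>2 * integral {0..T} (\<lambda>t. (cmod (X k t))\<^sup>2) + 2 * integral {0..T} (\<lambda>t. (cmod (Z k t))\<^sup>2)"
      by (simp add: norm_mult power_mult_distrib)
    also have "\<dots> \<le> 2 * (cmod q)\<^sup>2 * (c k * ?W T) + 2 * (C * ?W T)"
      using Suc k by (intro add_mono mult_left_mono ZI) auto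
    finally show ?case by (simp add: cSuc algebra_simps)
  qed
  have pnt: "(cmod (X k T))\<^sup>2 \<le> c k * ?W T" if "k \<le> r" "T \<ge> 0" for k T
    using that
  proof (induction k)
    case 0
    have "C / \<alpha> * ?W T \<le> c 0 * ?W T" unfolding c0' using C \<alpha> by (intro mult_right_mono W0) simp
    then show ?case using first(2)[OF 0(2)] by (simp add: X0)
  next
    case (Suc k)
    have "(cmod (X (Suc k) T))\<^sup>2 \<le> 2 * (cmod (q * X k T))\<^sup>2 + 2 * (cmod (Z k T))\<^sup>2"
      unfolding XS by (rule cmod_add_square_le)
    also have "\<dots> = 2 * (cmod q)\<^sup>2 * (cmod (X k T))\<^sup>2 + 2 * (cmod (Z k T))\<^sup>2"
      by (simp add: norm_mult power_mult_distrib)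
    also have "\<dots> \<le> 2 * (cmod q)\<^sup>2 * (c k * ?W T) + 2 * (C * ?W T)"
      using Suc by (intro add_mono mult_left_mono ZT) auto
    finally show ?case by (simp add: cSuc algebra_simps)
  qed
  have lim: "(X k \<longlongrightarrow> 0) at_top" if sq: "square_integrable W" and "k \<le> r" for k
    using that(2)
  proof (induction k)
    case 0
    obtain B where B: "\<And>T. T \<ge> 0 \<Longrightarrow> ?W T \<le> B" using sq by (auto simp: square_integrable_def)
    have "square_integrable (Z 0)" unfolding square_integrable_def
    proof (intro conjI allI exI impI)
      fix T :: real assume "0 \<le> T"
      then show "integral {0..T} (\<lambda>t. (cmod (Z 0 t))\<^sup>2) \<le> C * B"
        using ZI[of 0 T] mult_left_mono[OF B[of T] C] by simp
    qed (simp add: Zb)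
    then show ?case unfolding X0 by (rule first_order_square_integrable(2)[OF x(2) _ q])
  next
    case (Suc k)
    have "((\<lambda>t. q * X k t + Z k t) \<longlongrightarrow> q * 0 + 0) at_top"
      using Suc by (intro tendsto_intros Zl[OF sq]) auto
    then show ?case by (simp add: XS)
  qed
  have cle: "c k \<le> (\<Sum>k\<le>Suc r. c k)" if "k \<le> Suc r" for k
    by (rule member_le_sum) (use that c_nonneg in auto)
  have "driven_chain p' W X" unfolding driven_chain_def using Xp Xb sum by (simp add: deg less_Suc_eq_le)
  moreover have "chain_bounds p' (\<Sum>k\<le>Suc r. c k) W X" unfolding chain_bounds_def deg
  proof (intro conjI allI impI)
    show "integral {0..T} (\<lambda>t. (cmod (X k t))\<^sup>2) \<le> (\<Sum>k\<le>Suc r. c k) * ?W T" if "k \<le> Suc r" "0 \<le> T" for k T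
      by (rule order_trans[OF int[OF that] mult_right_mono[OF cle[OF that(1)] W0]])
    show "(cmod (X k T))\<^sup>2 \<le> (\<Sum>k\<le>Suc r. c k) * ?W T" if "k < Suc r" "0 \<le> T" for k T
      by (rule order_trans[OF pnt mult_right_mono[OF cle W0]]) (use that in auto)
    show "(X k \<longlongrightarrow> 0) at_top" if "square_integrable W" "k < Suc r" for k
      by (rule lim) (use that in auto)
  qed
  ultimately show ?thesis unfolding r_def by blast
qed

text \<open>The constant is chosen before the input: later the input depends on the end time
  \<open>T\<close>, while the bounds must not.\<close>

lemma driven_chain_exists:
  assumes "\<And>q. q \<in> set qs \<Longrightarrow> Re q < 0"
  shows "\<exists>C\<ge>0. \<forall>W. (\<forall>T. bounded_integrable T W) \<longrightarrow>
    (\<exists>X. driven_chain (\<Prod>q\<leftarrow>qs. [:- q, 1:]) W X \<and> chain_bounds (\<Prod>q\<leftarrow>qs. [:- q, 1:]) C W X)"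
  using assms
proof (induction qs)
  case Nil
  show ?case
  proof (intro exI[of _ "1::real"] conjI allI impI)
    fix W :: "real \<Rightarrow> complex" assume "\<forall>T. bounded_integrable T W"
    then show "\<exists>X. driven_chain (\<Prod>q\<leftarrow>[]. [:- q, 1:]) W X \<and> chain_bounds (\<Prod>q\<leftarrow>[]. [:- q, 1:]) 1 W X"
      by (intro exI[of _ "\<lambda>k. W"]) (simp add: driven_chain_def chain_bounds_def)
  qed simp
next
  case (Cons q qs)
  let ?p = "\<Prod>q\<leftarrow>qs. [:- q, 1:]"
  obtain C where C: "C \<ge> 0" "\<And>W. (\<forall>T. bounded_integrable T W) \<Longrightarrow> \<exists>Z. driven_chain ?p W Z \<and> chain_bounds ?p C W Z"
    using Cons by fastforce
  have q: "Re q < 0" using Cons.prems by simp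
  have p0: "?p \<noteq> 0" by (auto simp: prod_list_zero_iff)
  define c where "c = rec_nat (C / (Re q)\<^sup>2 + C / - Re q) (\<lambda>k a. 2 * (cmod q)\<^sup>2 * a + 2 * C)"
  have c0: "c 0 = C / (Re q)\<^sup>2 + C / - Re q" and cSuc: "c (Suc k) = 2 * (cmod q)\<^sup>2 * c k + 2 * C" for k
    by (simp_all add: c_def)
  have c_nonneg: "c k \<ge> 0" for k
  proof (induction k)
    case 0
    show ?case unfolding c0 by (intro add_nonneg_nonneg divide_nonneg_nonneg) (use C(1) q in auto)
  qed (use C(1) in \<open>simp add: cSuc\<close>)
  show ?case
  proof (intro exI[of _ "\<Sum>k\<le>Suc (degree ?p). c k"] conjI allI impI)
    show "0 \<le> (\<Sum>k\<le>Suc (degree ?p). c k)" by (rule sum_nonneg) (rule c_nonneg)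
    fix W :: "real \<Rightarrow> complex" assume W: "\<forall>T. bounded_integrable T W"
    obtain Z where Z: "driven_chain ?p W Z" "chain_bounds ?p C W Z" using C(2)[OF W] by blast
    have "\<And>T. bounded_integrable T W" using W by blast
    from driven_chain_extend[OF Z C(1) q this refl p0 c0 cSuc]
    show "\<exists>X. driven_chain (\<Prod>q\<leftarrow>q # qs. [:- q, 1:]) W X \<and>
        chain_bounds (\<Prod>q\<leftarrow>q # qs. [:- q, 1:]) (\<Sum>k\<le>Suc (degree ?p). c k) W X"
      by simp
  qed
qed

text \<open>For a divisor \<open>p\<close> of \<open>\<mu>\<close>, \<open>Y p\<close> is the
  differential operator \<open>p\<close> applied to \<open>y 0\<close>, up to input terms.
  \<open>Y \<mu>\<close> vanishes for \<open>t \<ge> 0\<close>, and \<open>Y p\<close> solves a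
  stable first-order equation driven by \<open>Y (p * [:- q, 1:])\<close> and \<open>u\<close>;
  removing the roots one by one leads from \<open>\<mu>\<close> to 1, that is to
  \<open>y 0\<close>.\<close>

lemma observer_chain_tendsto_zero:
  fixes y :: "nat \<Rightarrow> real \<Rightarrow> complex" and \<mu> :: "complex poly"
  assumes \<mu>: "\<mu> = (\<Prod>q\<leftarrow>qs. [:- q, 1:])" and qs: "\<And>q. q \<in> set qs \<Longrightarrow> Re q < 0"
    and y: "\<And>k T. k < degree \<mu> \<Longrightarrow> primitive_on T (y k) (\<lambda>t. y (Suc k) t + h k * u t)"
    and rel: "\<And>t. t \<ge> 0 \<Longrightarrow> (\<Sum>k\<le>degree \<mu>. coeff \<mu> k * y k t) = 0"
    and u: "square_integrable u"
  shows "(y 0 \<longlongrightarrow> 0) at_top"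
proof -
  define r where "r = degree \<mu>"
  define Y where "Y p t = (\<Sum>k\<le>r. coeff p k * y k t)" for p t
  have \<mu>0: "\<mu> \<noteq> 0" unfolding \<mu> by (auto simp: prod_list_zero_iff)
  \<comment> \<open>\<open>rs\<close> lists the roots already removed from \<open>p\<close>; the
    empty list is the case \<open>p = \<mu>\<close>.\<close>
  have "square_integrable (Y p) \<and> (Y p \<longlongrightarrow> 0) at_top"
    if "p * (\<Prod>q\<leftarrow>rs. [:- q, 1:]) = \<mu>" "set rs \<subseteq> set qs" for p rs
    using that
  proof (induction rs arbitrary: p)
    case Nil
    then have z: "0 = Y p t" if "t \<ge> 0" for t using rel[OF that] by (simp add: Y_def r_def)
    moreover have "square_integrable (\<lambda>t. 0)"
      by (auto simp: square_integrable_def bounded_integrable_const)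
    ultimately have "square_integrable (Y p)" by (rule square_integrable_cong[rotated])
    moreover have "(Y p \<longlongrightarrow> 0) at_top"
    proof (rule Lim_transform_eventually[OF tendsto_const])
      show "\<forall>\<^sub>F t in at_top. 0 = Y p t"
        by (rule eventually_mono[OF eventually_ge_at_top[of 0] z])
    qed
    ultimately show ?case by blast
  next
    case (Cons q rs)
    have "p * [:- q, 1:] * (\<Prod>q\<leftarrow>rs. [:- q, 1:]) = \<mu>"
      using Cons.prems(1) by (simp only: list.map prod_list.Cons mult.assoc)
    then have IH: "square_integrable (Y (p * [:- q, 1:]))"
      using Cons.IH Cons.prems(2) by auto
    have q: "Re q < 0" using Cons.prems(2) qs by auto
    have nz: "p \<noteq> 0" "(\<Prod>q\<leftarrow>rs. [:- q, 1:]) \<noteq> 0" using Cons.prems(1) \<mu>0 by auto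
    have "\<mu> = p * [:- q, 1:] * (\<Prod>q\<leftarrow>rs. [:- q, 1:])"
      using Cons.prems(1) by (simp only: list.map prod_list.Cons mult.assoc)
    moreover have "degree (p * [:- q, 1:] * (\<Prod>q\<leftarrow>rs. [:- q, 1:])) =
        degree p + degree [:- q, 1:] + degree (\<Prod>q\<leftarrow>rs. [:- q, 1:])"
      using nz by (subst degree_mult_eq; simp add: degree_mult_eq del: mult_pCons_right)+
    ultimately have degp: "degree p < r" by (simp add: r_def)
    define b where "b = (\<Sum>k<r. coeff p k * h k)"
    have Yp: "Y p t = (\<Sum>k<r. coeff p k * y k t)" for t
      unfolding Y_def lessThan_Suc_atMost[symmetric] using degp by (simp add: coeff_eq_0)
    have Yp1: "(\<Sum>k<r. coeff p k * (y (Suc k) t + h k * u t)) = q * Y p t + (Y (p * [:- q, 1:]) t + b * u t)" for t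
    proof -
      have "Y (p * [:- q, 1:]) t = (\<Sum>k\<le>r. (coeff (pCons 0 p) k - q * coeff p k) * y k t)"
        by (simp add: Y_def)
      also have "\<dots> = (\<Sum>k\<le>r. coeff (pCons 0 p) k * y k t) - q * Y p t"
        by (simp add: Y_def left_diff_distrib sum_subtractf sum_distrib_left mult.assoc)
      also have "(\<Sum>k\<le>r. coeff (pCons 0 p) k * y k t) = (\<Sum>k<r. coeff p k * y (Suc k) t)"
        unfolding lessThan_Suc_atMost[symmetric] sum.lessThan_Suc_shift by simp
      finally show ?thesis unfolding b_def
        by (simp add: distrib_left sum.distrib sum_distrib_right mult.assoc)
    qed
    have prim: "primitive_on T (Y p) (\<lambda>t. q * Y p t + (Y (p * [:- q, 1:]) t + b * u t))" for T
    proof -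
      have "primitive_on T (\<lambda>t. \<Sum>k<r. coeff p k * y k t) (\<lambda>t. \<Sum>k<r. coeff p k * (y (Suc k) t + h k * u t))"
        by (intro primitive_on_sum primitive_on_cmult y) (simp add: r_def)
      then show ?thesis by (simp only: Yp1 Yp[symmetric] eta_contract_eq)
    qed
    have sq: "square_integrable (\<lambda>t. Y (p * [:- q, 1:]) t + b * u t)"
      by (intro square_integrable_add IH square_integrable_cmult u)
    show ?case
      by (rule conjI[OF first_order_square_integrable(1)[OF prim sq q] first_order_square_integrable(2)[OF prim sq q]])
  qed
  from this[of 1 qs] have "(Y 1 \<longlongrightarrow> 0) at_top" by (simp add: \<mu>)
  moreover have "Y 1 = y 0"
  proof
    fix t
    have "Y 1 t = (\<Sum>k\<in>{0}. coeff 1 k * y k t)"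
      unfolding Y_def by (rule sum.mono_neutral_right) (auto simp: coeff_eq_0)
    then show "Y 1 t = y 0 t" by simp
  qed
  ultimately show ?thesis by simp
qed

section \<open>Polynomials on the imaginary axis and spectral factorization\<close>

lemma poly_eq_on_line:
  fixes p q :: "complex poly" and c :: complex
  assumes "c \<noteq> 0" "\<And>x::real. poly p (c * of_real x) = poly q (c * of_real x)"
  shows "p = q"
proof (rule ccontr)
  assume "p \<noteq> q"
  then have "finite {z. poly (p - q) z = 0}" by (intro poly_roots_finite) simp
  moreover have "range (\<lambda>x::real. c * of_real x) \<subseteq> {z. poly (p - q) z = 0}" using assms(2) by auto
  ultimately have "finite (range (\<lambda>x::real. c * complex_of_real x))" by (rule finite_subset[rotated])
  moreover have "inj (\<lambda>x::real. c * complex_of_real x)" using assms(1) by (auto simp: inj_def)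
  ultimately show False using finite_imageD infinite_UNIV_char_0 by blast
qed

lemma poly_cnj_real: "poly (map_poly cnj p) (of_real x) = cnj (poly p (of_real x))"
  by (simp add: poly_altdef degree_map_poly coeff_map_poly)

lemma poly_cnj_linear_mult: "map_poly cnj ([:a, b:] * q) = [:cnj a, cnj b:] * map_poly cnj q"
proof (rule poly_eq_on_line[of 1])
  fix x :: real
  have "poly (map_poly cnj ([:a, b:] * q)) (of_real x) = cnj (poly [:a, b:] (of_real x) * poly q (of_real x))"
    unfolding poly_cnj_real poly_mult by (rule refl)
  then show "poly (map_poly cnj ([:a, b:] * q)) (1 * of_real x) = poly ([:cnj a, cnj b:] * map_poly cnj q) (1 * of_real x)"
    by (simp add: poly_cnj_real)
qed simp

lemma nonneg_limit:
  fixes f :: "complex \<Rightarrow> complex"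
  assumes "isCont f (of_real a)" "\<And>x::real. x > a \<Longrightarrow> \<exists>c\<ge>0. f (of_real x) = of_real c"
  shows "\<exists>c\<ge>0. f (of_real a) = of_real c"
proof -
  have "isCont (\<lambda>x. f (complex_of_real x)) a"
    by (rule isCont_o2[where f = complex_of_real and g = f, OF _ assms(1)]) simp
  then have lim: "((\<lambda>x. f (complex_of_real x)) \<longlongrightarrow> f (of_real a)) (at_right a)"
    by (auto simp: isCont_def intro: tendsto_within_subset)
  have ev: "\<forall>\<^sub>F x in at_right a. \<exists>c\<ge>0. f (of_real x) = of_real c"
    using eventually_at_right_less[of a] by eventually_elim (use assms(2) in auto)
  have "((\<lambda>x. Im (f (complex_of_real x))) \<longlongrightarrow> Im (f (of_real a))) (at_right a)"
    by (intro tendsto_intros lim)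
  moreover have "\<forall>\<^sub>F x in at_right a. Im (f (complex_of_real x)) = 0" using ev by eventually_elim auto
  ultimately have "((\<lambda>x. 0) \<longlongrightarrow> Im (f (of_real a))) (at_right a)"
    by (rule Lim_transform_eventually)
  then have "Im (f (of_real a)) = 0" by (simp add: tendsto_const_iff)
  moreover have "0 \<le> Re (f (of_real a))"
  proof (rule tendsto_lowerbound)
    show "((\<lambda>x. Re (f (complex_of_real x))) \<longlongrightarrow> Re (f (of_real a))) (at_right a)"
      by (intro tendsto_intros lim)
    show "\<forall>\<^sub>F x in at_right a. 0 \<le> Re (f (complex_of_real x))" using ev by eventually_elim auto
  qed simp
  ultimately show ?thesis by (intro exI[of _ "Re (f (of_real a))"]) (simp add: complex_eq_iff)
qed

text \<open>
  Fejer-Riesz: non-real roots come in conjugate pairs, and real roots have even multiplicity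
  because of the sign.
\<close>

lemma nonneg_poly_factor:
  fixes p :: "complex poly"
  assumes "\<And>x::real. \<exists>c\<ge>0. poly p (of_real x) = of_real c"
  shows "\<exists>q. p = q * map_poly cnj q"
  using assms
proof (induction "degree p" arbitrary: p rule: less_induct)
  case less
  show ?case
  proof (cases "degree p = 0")
    case True
    then obtain a where a: "p = [:a:]" by (metis degree_eq_zeroE)
    obtain c where "c \<ge> 0" "a = of_real c" using less.prems[of 0] a by auto
    have "map_poly cnj [:complex_of_real (sqrt c):] = [:of_real (sqrt c):]"
      by (intro poly_eqI) (simp add: coeff_map_poly coeff_pCons split: nat.split)
    then have "p = [:of_real (sqrt c):] * map_poly cnj [:of_real (sqrt c):]"
      using \<open>c \<ge> 0\<close> \<open>a = of_real c\<close> by (simp add: a of_real_mult[symmetric] del: of_real_mult)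
    then show ?thesis by blast
  next
    case False
    then have "\<not> constant (poly p)" by (simp add: constant_degree)
    then obtain w where w: "poly p w = 0" using fundamental_theorem_of_algebra by blast
    then obtain p1 where p1: "p = [:- w, 1:] * p1" by (auto simp: poly_eq_0_iff_dvd)
    have "p \<noteq> 0" using False by auto
    have root2: "poly p1 (cnj w) = 0"
    proof (cases "Im w = 0")
      case False
      have "map_poly cnj p = p"
      proof (rule poly_eq_on_line[of 1])
        fix x :: real
        show "poly (map_poly cnj p) (1 * of_real x) = poly p (1 * of_real x)"
          using less.prems[of x] by (auto simp: poly_cnj_real)
      qed simp
      moreover have "map_poly cnj p = [:- cnj w, 1:] * map_poly cnj p1"
        unfolding p1 poly_cnj_linear_mult by simp
      ultimately have "p = [:- cnj w, 1:] * map_poly cnj p1" by metis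
      then have "poly p (cnj w) = 0" by simp
      then have "(cnj w - w) * poly p1 (cnj w) = 0" unfolding p1 by (simp add: algebra_simps)
      moreover have "cnj w \<noteq> w" using False by (simp add: complex_eq_iff)
      ultimately show ?thesis by simp
    next
      case True
      define a where "a = Re w"
      have wa: "w = of_real a" using True by (simp add: a_def complex_eq_iff)
      \<comment> \<open>By sign, \<open>p1\<close> is nonnegative to the right of \<open>a\<close>
        and nonpositive to the left, so it vanishes at \<open>a\<close>. The left side is reduced to
        a limit from the right by \<open>z\<close> to \<open>- z\<close>.\<close>
      have sgn: "\<exists>c\<ge>0. of_real (x - a) * poly p1 (of_real x) = of_real c" for x :: real
        using less.prems[of x] unfolding p1 wa by (simp add: algebra_simps)
      have "\<exists>c\<ge>0. poly p1 (of_real a) = of_real c"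
      proof (rule nonneg_limit)
        fix x :: real assume x: "x > a"
        obtain c where "c \<ge> 0" "of_real (x - a) * poly p1 (of_real x) = complex_of_real c" using sgn by blast
        then have "poly p1 (of_real x) = of_real (c / (x - a))" using x by (simp add: field_simps)
        then show "\<exists>c\<ge>0. poly p1 (of_real x) = of_real c" using x \<open>c \<ge> 0\<close> by (intro exI[of _ "c / (x - a)"]) simp
      qed simp
      moreover have "\<exists>c\<ge>0. - poly p1 (- of_real (- a)) = complex_of_real c"
      proof (rule nonneg_limit[where f = "\<lambda>z. - poly p1 (- z)"])
        fix x :: real assume x: "x > - a"
        obtain c where c: "c \<ge> 0" "of_real (- x - a) * poly p1 (of_real (- x)) = complex_of_real c" using sgn by blast
        have "of_real (x + a) \<noteq> (0 :: complex)" using x by (metis add_less_same_cancel2 less_minus_iff of_real_eq_0_iff less_irrefl add.inverse_unique add.commute)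
        moreover have "- poly p1 (- of_real x) * of_real (x + a) = of_real c"
          using c(2) by (simp add: algebra_simps)
        ultimately have "- poly p1 (- of_real x) = of_real (c / (x + a))"
          unfolding of_real_divide by (metis nonzero_eq_divide_eq)
        then show "\<exists>c\<ge>0. - poly p1 (- of_real x) = of_real c" using x c(1) by (intro exI[of _ "c / (x + a)"]) simp
      qed (intro continuous_intros)
      ultimately obtain c d where "c \<ge> 0" "d \<ge> 0" "poly p1 (of_real a) = of_real c" "- poly p1 (of_real a) = complex_of_real d"
        by auto
      then have "of_real (c + d) = (0 :: complex)" by (simp add: add_eq_0_iff)
      then have "c + d = 0" by (metis of_real_eq_0_iff)
      then show ?thesis using \<open>c \<ge> 0\<close> \<open>d \<ge> 0\<close> \<open>poly p1 (of_real a) = of_real c\<close> wa by simp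
    qed
    then obtain p2 where p2: "p1 = [:- cnj w, 1:] * p2" by (auto simp: poly_eq_0_iff_dvd)
    \<comment> \<open>The two factors removed form a square modulus on the real line, so
      \<open>p2\<close> inherits the sign away from \<open>w\<close>, and at a real \<open>w\<close>
      by continuity.\<close>
    have val: "poly p (of_real x) = of_real ((cmod (of_real x - w))\<^sup>2) * poly p2 (of_real x)" for x :: real
    proof -
      have "poly p (of_real x) = ((of_real x - w) * cnj (of_real x - w)) * poly p2 (of_real x)"
        unfolding p1 p2 by (simp add: algebra_simps)
      then show ?thesis unfolding complex_norm_square by simp
    qed
    have away: "\<exists>c\<ge>0. poly p2 (of_real x) = of_real c" if "of_real x \<noteq> w" for x :: real
    proof -
      obtain c where c: "c \<ge> 0" "poly p (of_real x) = of_real c" using less.prems by blast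
      have "(cmod (of_real x - w))\<^sup>2 \<noteq> 0" using that by simp
      then have "poly p2 (of_real x) = of_real (c / (cmod (of_real x - w))\<^sup>2)"
        using c(2) unfolding val of_real_divide by (metis nonzero_mult_div_cancel_left of_real_eq_0_iff)
      then show ?thesis using c(1) by (intro exI[of _ "c / (cmod (of_real x - w))\<^sup>2"]) simp
    qed
    have all: "\<exists>c\<ge>0. poly p2 (of_real x) = of_real c" for x :: real
    proof (cases "of_real x = w")
      case True
      show ?thesis by (rule nonneg_limit) (use away True in auto)
    qed (rule away)
    have "p2 \<noteq> 0" using \<open>p \<noteq> 0\<close> p1 p2 by auto
    then have "degree p2 < degree p" unfolding p1 p2 by (simp add: degree_mult_eq del: mult_pCons_left)
    then obtain q where q: "p2 = q * map_poly cnj q" using less.hyps all by blast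
    have "p = ([:- w, 1:] * q) * map_poly cnj ([:- w, 1:] * q)"
      unfolding poly_cnj_linear_mult p1 p2 q by (simp only: complex_cnj_minus complex_cnj_one mult_ac)
    then show ?thesis by blast
  qed
qed

text \<open>The paraconjugate: the conjugate of the value of \<open>p\<close> at the reflected point
  \<open>- cnj s\<close>. It is a polynomial in \<open>s\<close> whose values on the imaginary axis
  are the conjugates of those of \<open>p\<close>.\<close>

definition para_conj :: "complex poly \<Rightarrow> complex poly" where
  "para_conj p = pcompose (map_poly cnj p) [:0, -1:]"

lemma coeff_para_conj: "coeff (para_conj p) k = cnj (coeff p k) * (- 1) ^ k"
  unfolding para_conj_def by (simp add: coeff_pcompose_linear coeff_map_poly)

lemma poly_map_cnj: "poly (map_poly cnj p) z = cnj (poly p (cnj z))"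
  by (simp add: poly_altdef degree_map_poly coeff_map_poly)

lemma poly_para_conj_axis: "poly (para_conj p) (\<i> * of_real \<omega>) = cnj (poly p (\<i> * of_real \<omega>))"
  by (simp add: para_conj_def poly_pcompose poly_map_cnj)

lemma degree_para_conj: "degree (para_conj p) = degree p"
  by (simp add: para_conj_def degree_map_poly)

text \<open>The substitution \<open>s = \<i> * \<omega>\<close> turns the bound on the axis into
  nonnegativity on the real line; the factor found there is rotated back. Its degree is half of that
  of the left side.\<close>

lemma spectral_factor:
  fixes \<mu> n :: "complex poly"
  assumes deg: "degree n \<le> degree \<mu>"
    and bound: "\<And>\<omega>::real. cmod (poly n (\<i> * of_real \<omega>)) \<le> \<gamma> * cmod (poly \<mu> (\<i> * of_real \<omega>))"
  shows "\<exists>q. degree q \<le> degree \<mu> \<and>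
    Polynomial.smult (of_real (\<gamma>\<^sup>2)) (\<mu> * para_conj \<mu>) - n * para_conj n = q * para_conj q"
proof -
  define F where "F = Polynomial.smult (of_real (\<gamma>\<^sup>2)) (\<mu> * para_conj \<mu>) - n * para_conj n"
  define p where "p = pcompose F [:0, \<i>:]"
  have F: "poly F (\<i> * of_real \<omega>) =
      of_real (\<gamma>\<^sup>2 * (cmod (poly \<mu> (\<i> * of_real \<omega>)))\<^sup>2 - (cmod (poly n (\<i> * of_real \<omega>)))\<^sup>2)" for \<omega>
    by (simp add: F_def poly_para_conj_axis complex_norm_square del: of_real_power)
  have pF: "poly p (of_real \<omega>) = poly F (\<i> * of_real \<omega>)" for \<omega>
    by (simp add: p_def poly_pcompose mult.commute)
  obtain m where m: "p = m * map_poly cnj m"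
  proof -
    have "\<exists>c\<ge>0. poly p (of_real \<omega>) = of_real c" for \<omega>
    proof -
      have "(cmod (poly n (\<i> * of_real \<omega>)))\<^sup>2 \<le> (\<gamma> * cmod (poly \<mu> (\<i> * of_real \<omega>)))\<^sup>2"
        by (rule power_mono[OF bound]) simp
      then show ?thesis unfolding pF F
        by (intro exI[of _ "\<gamma>\<^sup>2 * (cmod (poly \<mu> (\<i> * of_real \<omega>)))\<^sup>2 - (cmod (poly n (\<i> * of_real \<omega>)))\<^sup>2"])
          (simp add: power_mult_distrib)
    qed
    then show ?thesis using nonneg_poly_factor that by blast
  qed
  define q where "q = pcompose m [:0, - \<i>:]"
  have eq: "F = q * para_conj q"
  proof (rule poly_eq_on_line[of \<i>])
    fix \<omega> :: real
    have "poly [:0, - \<i>:] (\<i> * of_real \<omega>) = of_real \<omega>" by (simp add: complex_eq_iff)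
    then have "poly q (\<i> * of_real \<omega>) = poly m (of_real \<omega>)" by (simp only: q_def poly_pcompose)
    then show "poly F (\<i> * of_real \<omega>) = poly (q * para_conj q) (\<i> * of_real \<omega>)"
      unfolding pF[symmetric] by (simp add: m poly_para_conj_axis poly_cnj_real)
  qed simp
  have "degree F \<le> 2 * degree \<mu>"
    unfolding F_def
  proof (rule degree_diff_le)
    show "degree (Polynomial.smult (of_real (\<gamma>\<^sup>2)) (\<mu> * para_conj \<mu>)) \<le> 2 * degree \<mu>"
      by (rule order_trans[OF degree_smult_le]) (use degree_mult_le[of \<mu> "para_conj \<mu>"] in \<open>simp add: degree_para_conj\<close>)
    show "degree (n * para_conj n) \<le> 2 * degree \<mu>"
      using degree_mult_le[of n "para_conj n"] deg by (simp add: degree_para_conj)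
  qed
  moreover have "degree F = 2 * degree q"
  proof (cases "q = 0")
    case False
    then have "para_conj q \<noteq> 0" by (metis coeff_0 coeff_para_conj complex_cnj_zero_iff leading_coeff_0_iff mult_eq_0_iff power_eq_0_iff zero_neq_neg_one)
    then show ?thesis unfolding eq using False by (simp add: degree_mult_eq degree_para_conj)
  qed (simp add: eq)
  ultimately show ?thesis using eq unfolding F_def by (intro exI[of _ q]) auto
qed

text \<open>
  Integration by parts: since the boundary terms vanish asymptotically, \<open>E i j\<close> depends only on
  \<open>i + j\<close>, up to sign.
\<close>

lemma chain_products_asymptotic:
  fixes X :: "nat \<Rightarrow> real \<Rightarrow> real"
  assumes X0: "\<And>k. k < r \<Longrightarrow> X k 0 = 0"
    and Xp: "\<And>k T. k < r \<Longrightarrow> primitive_on T (X k) (X (Suc k))"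
    and Xb: "\<And>k T. k \<le> r \<Longrightarrow> bounded_integrable T (X k)"
    and Xl: "\<And>k. k < r \<Longrightarrow> (X k \<longlongrightarrow> 0) at_top"
  defines "E \<equiv> \<lambda>i j S. integral {0..S} (\<lambda>t. X i t * X j t)"
  defines "c \<equiv> \<lambda>k S. if k \<le> r then E k 0 S else (- 1) ^ (k - r) * E r (k - r) S"
  assumes "i \<le> r" "j \<le> r"
  shows "((\<lambda>S. E i j S - (- 1) ^ j * c (i + j) S) \<longlongrightarrow> 0) at_top"
  using \<open>i \<le> r\<close> \<open>j \<le> r\<close>
proof (induction j arbitrary: i)
  case 0
  then show ?case by (simp add: c_def)
next
  case (Suc j)
  show ?case
  proof (cases "i = r")
    case True
    have "(- 1) ^ Suc j * ((- 1) ^ Suc j * x) = (x :: real)" for x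
      by (simp only: mult.assoc[symmetric] power_add[symmetric] power_mult_distrib[symmetric]) simp
    then have "E i (Suc j) S - (- 1) ^ Suc j * c (i + Suc j) S = 0" for S
      unfolding c_def True by simp
    then show ?thesis by simp
  next
    case False
    then have ir: "i < r" and jr: "j < r" using Suc.prems by auto
    \<comment> \<open>The boundary term at 0 vanishes and the one at \<open>S\<close> tends to zero,
      so one derivative changes sides at the price of a sign.\<close>
    have "\<forall>\<^sub>F S in at_top. E (Suc i) j S + E i (Suc j) S = X i S * X j S"
      using eventually_ge_at_top[of 0]
    proof eventually_elim
      case (elim S)
      have "primitive_on S (\<lambda>t. X i t * X j t) (\<lambda>t. X (Suc i) t * X j t + X i t * X (Suc j) t)"
        by (rule primitive_on_mult[OF Xp[OF ir] Xp[OF jr]])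
      from primitive_onD(1)[OF this, of S] have "X i S * X j S =
          integral {0..S} (\<lambda>t. X (Suc i) t * X j t + X i t * X (Suc j) t)"
        using elim X0[OF ir] by simp
      also have "\<dots> = E (Suc i) j S + E i (Suc j) S"
        unfolding E_def using ir jr
        by (intro Henstock_Kurzweil_Integration.integral_add
            bounded_integrable_integrable[OF _ order_refl order_refl] bounded_integrable_mult Xb) auto
      finally show ?case by simp
    qed
    moreover have "((\<lambda>S. X i S * X j S) \<longlongrightarrow> 0 * 0) at_top"
      by (intro tendsto_intros Xl ir jr)
    ultimately have "((\<lambda>S. E (Suc i) j S + E i (Suc j) S) \<longlongrightarrow> 0) at_top"
      using Lim_transform_eventually eventually_mono by (smt (verit) mult_zero_left)
    moreover have "((\<lambda>S. E (Suc i) j S - (- 1) ^ j * c (Suc i + j) S) \<longlongrightarrow> 0) at_top"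
      by (rule Suc.IH) (use ir jr in auto)
    ultimately have "((\<lambda>S. (E (Suc i) j S + E i (Suc j) S) - (E (Suc i) j S - (- 1) ^ j * c (Suc i + j) S)) \<longlongrightarrow> 0 - 0) at_top"
      by (rule tendsto_diff)
    then show ?thesis by simp
  qed
qed

text \<open>The linear functional that sends the k-th power to \<open>c k\<close>. With the
  asymptotic moments of a chain it makes the energy of a combination of the \<open>X k\<close>
  depend, in the limit, only on the polynomial \<open>p * para_conj p\<close>.\<close>

definition poly_functional :: "nat \<Rightarrow> (nat \<Rightarrow> real) \<Rightarrow> complex poly \<Rightarrow> complex" where
  "poly_functional m c p = (\<Sum>k\<le>m. coeff p k * of_real (c k))"

lemma poly_functional_add: "poly_functional m c (p + q) = poly_functional m c p + poly_functional m c q"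
  by (simp add: poly_functional_def distrib_right sum.distrib)

lemma poly_functional_diff: "poly_functional m c (p - q) = poly_functional m c p - poly_functional m c q"
  by (simp add: poly_functional_def left_diff_distrib sum_subtractf)

lemma poly_functional_smult: "poly_functional m c (Polynomial.smult a p) = a * poly_functional m c p"
  by (simp add: poly_functional_def sum_distrib_left mult.assoc)

lemma poly_functional_sum: "poly_functional m c (\<Sum>i\<in>I. p i) = (\<Sum>i\<in>I. poly_functional m c (p i))"
proof -
  have "poly_functional m c 0 = 0" by (simp add: poly_functional_def)
  then show ?thesis by (induction I rule: infinite_finite_induct) (auto simp: poly_functional_add)
qed

lemma poly_functional_monom: "k \<le> m \<Longrightarrow> poly_functional m c (Polynomial.monom a k) = a * of_real (c k)"
proof -
  assume "k \<le> m"
  have "poly_functional m c (Polynomial.monom a k) = (\<Sum>i\<in>{k}. coeff (Polynomial.monom a k) i * of_real (c i))"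
    unfolding poly_functional_def by (rule sum.mono_neutral_right) (use \<open>k \<le> m\<close> in auto)
  then show ?thesis by simp
qed

text \<open>The sign in \<open>para_conj\<close> is the one produced by integrating by parts
  \<open>j\<close> times.\<close>

lemma poly_functional_para_conj:
  assumes "degree p \<le> r"
  shows "poly_functional (2 * r) c (p * para_conj p) =
    (\<Sum>i\<le>r. \<Sum>j\<le>r. coeff p i * cnj (coeff p j) * of_real ((- 1) ^ j * c (i + j)))"
proof -
  have p: "p = (\<Sum>i\<le>r. Polynomial.monom (coeff p i) i)"
    using poly_as_sum_of_monoms'[OF assms] by simp
  have p': "para_conj p = (\<Sum>j\<le>r. Polynomial.monom (cnj (coeff p j) * (- 1) ^ j) j)"
    using poly_as_sum_of_monoms'[of "para_conj p" r] assms by (simp add: degree_para_conj coeff_para_conj)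
  have "p * para_conj p = (\<Sum>i\<le>r. \<Sum>j\<le>r. Polynomial.monom (coeff p i * (cnj (coeff p j) * (- 1) ^ j)) (i + j))"
    by (subst p, subst p') (simp add: sum_product mult_monom)
  then have "poly_functional (2 * r) c (p * para_conj p) =
      (\<Sum>i\<le>r. \<Sum>j\<le>r. poly_functional (2 * r) c (Polynomial.monom (coeff p i * (cnj (coeff p j) * (- 1) ^ j)) (i + j)))"
    by (simp add: poly_functional_sum)
  also have "\<dots> = (\<Sum>i\<le>r. \<Sum>j\<le>r. coeff p i * cnj (coeff p j) * of_real ((- 1) ^ j * c (i + j)))"
    by (intro sum.cong refl) (simp add: poly_functional_monom mult.assoc)
  finally show ?thesis .
qed

text \<open>
  With \<open>\<gamma>\<^sup>2 |\<mu>|\<^sup>2 - |n|\<^sup>2 = |p|\<^sup>2\<close> on the axis, the difference of the two integrals is the integral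
  of \<open>|\<Sum>k. coeff p k * X k|\<^sup>2\<close>, because both depend only on the values of the quadratic forms there.
\<close>

lemma chain_gain:
  fixes X :: "nat \<Rightarrow> real \<Rightarrow> real" and \<mu> n :: "real poly"
  assumes X0: "\<And>k. k < degree \<mu> \<Longrightarrow> X k 0 = 0"
    and Xp: "\<And>k T. k < degree \<mu> \<Longrightarrow> primitive_on T (X k) (X (Suc k))"
    and Xb: "\<And>k T. k \<le> degree \<mu> \<Longrightarrow> bounded_integrable T (X k)"
    and Xl: "\<And>k. k < degree \<mu> \<Longrightarrow> (X k \<longlongrightarrow> 0) at_top"
    and W: "\<And>t. t \<ge> 0 \<Longrightarrow> (\<Sum>k\<le>degree \<mu>. coeff \<mu> k * X k t) = W t"
    and W0: "\<And>t. t > T \<Longrightarrow> W t = 0" and T: "T \<ge> 0"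
    and deg: "degree n \<le> degree \<mu>"
    and bound: "\<And>\<omega>::real. cmod (poly (map_poly of_real n) (\<i> * of_real \<omega>)) \<le> \<gamma> * cmod (poly (map_poly of_real \<mu>) (\<i> * of_real \<omega>))"
  shows "integral {0..T} (\<lambda>t. (\<Sum>k\<le>degree \<mu>. coeff n k * X k t)\<^sup>2) \<le> \<gamma>\<^sup>2 * integral {0..T} (\<lambda>t. (W t)\<^sup>2)"
proof -
  define r where "r = degree \<mu>"
  define E where "E = (\<lambda>i j S. integral {0..S} (\<lambda>t. X i t * X j t))"
  define c where "c = (\<lambda>S k. if k \<le> r then E k 0 S else (- 1) ^ (k - r) * E r (k - r) S)"
  define I where "I p S = integral {0..S} (\<lambda>t. (cmod (\<Sum>k\<le>r. coeff p k * of_real (X k t)))\<^sup>2)" for p :: "complex poly" and S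
  have asym: "((\<lambda>S. E i j S - (- 1) ^ j * c S (i + j)) \<longlongrightarrow> 0) at_top" if "i \<le> r" "j \<le> r" for i j
    using chain_products_asymptotic[of r X i j] X0 Xp Xb Xl that unfolding E_def c_def r_def by blast
  define a where "a p i j = Re (coeff p i * cnj (coeff p j))" for p :: "complex poly" and i j
  have sq: "(cmod (\<Sum>k\<le>r. coeff p k * of_real (X k t)))\<^sup>2 =
      (\<Sum>i\<le>r. \<Sum>j\<le>r. a p i j * (X i t * X j t))" for p t
  proof -
    have "complex_of_real ((cmod (\<Sum>k\<le>r. coeff p k * of_real (X k t)))\<^sup>2) =
        (\<Sum>i\<le>r. \<Sum>j\<le>r. (coeff p i * of_real (X i t)) * (cnj (coeff p j) * of_real (X j t)))"
      unfolding complex_norm_square by (simp add: sum_product)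
    from arg_cong[OF this, of Re] show ?thesis by (simp add: a_def algebra_simps)
  qed
  have bi: "bounded_integrable S (\<lambda>t. a p i j * (X i t * X j t))" if "i \<le> r" "j \<le> r" for S p i j
    using that by (intro bounded_integrable_cmult bounded_integrable_mult Xb) (auto simp: r_def)
  have I: "I p S = (\<Sum>i\<le>r. \<Sum>j\<le>r. a p i j * E i j S)" for p S
  proof -
    have "I p S = (\<Sum>i\<le>r. integral {0..S} (\<lambda>t. \<Sum>j\<le>r. a p i j * (X i t * X j t)))"
      unfolding I_def sq
      by (rule integral_sum) (auto intro!: bounded_integrable_integrable[OF _ order_refl order_refl] bounded_integrable_sum bi)
    also have "\<dots> = (\<Sum>i\<le>r. \<Sum>j\<le>r. integral {0..S} (\<lambda>t. a p i j * (X i t * X j t)))"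
      by (intro sum.cong refl integral_sum) (auto intro!: bounded_integrable_integrable[OF _ order_refl order_refl] bi)
    finally show ?thesis by (simp add: E_def)
  qed
  have lim: "((\<lambda>S. I p S - Re (poly_functional (2 * r) (c S) (p * para_conj p))) \<longlongrightarrow> 0) at_top" if "degree p \<le> r" for p
  proof -
    have "I p S - Re (poly_functional (2 * r) (c S) (p * para_conj p)) =
        (\<Sum>i\<le>r. \<Sum>j\<le>r. a p i j * (E i j S - (- 1) ^ j * c S (i + j)))" for S
    proof -
      have "Re (poly_functional (2 * r) (c S) (p * para_conj p)) =
          (\<Sum>i\<le>r. \<Sum>j\<le>r. a p i j * ((- 1) ^ j * c S (i + j)))"
        unfolding poly_functional_para_conj[OF that] Re_sum by (intro sum.cong refl) (simp only: a_def Re_complex_of_real times_complex.sel Im_complex_of_real mult_zero_right diff_zero)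
      then show ?thesis unfolding I by (simp only: right_diff_distrib sum_subtractf)
    qed
    moreover have "((\<lambda>S. \<Sum>i\<le>r. \<Sum>j\<le>r. a p i j * (E i j S - (- 1) ^ j * c S (i + j))) \<longlongrightarrow>
        (\<Sum>i\<le>r. \<Sum>j\<le>r. a p i j * 0)) at_top"
      by (intro tendsto_sum tendsto_mult tendsto_const asym) auto
    ultimately show ?thesis by simp
  qed
  let ?\<mu> = "map_poly complex_of_real \<mu>" and ?n = "map_poly complex_of_real n"
  have dm: "degree ?\<mu> = r" and dn: "degree ?n \<le> r" using deg by (simp_all add: degree_map_poly r_def)
  obtain q where q: "degree q \<le> r"
    "Polynomial.smult (of_real (\<gamma>\<^sup>2)) (?\<mu> * para_conj ?\<mu>) - ?n * para_conj ?n = q * para_conj q"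
    using spectral_factor[of ?n ?\<mu> \<gamma>] dn dm bound by auto
  have "((\<lambda>S. \<gamma>\<^sup>2 * (I ?\<mu> S - Re (poly_functional (2 * r) (c S) (?\<mu> * para_conj ?\<mu>)))
      - (I ?n S - Re (poly_functional (2 * r) (c S) (?n * para_conj ?n)))
      - (I q S - Re (poly_functional (2 * r) (c S) (q * para_conj q)))) \<longlongrightarrow> \<gamma>\<^sup>2 * 0 - 0 - 0) at_top"
    by (intro tendsto_intros lim) (use dm dn q in auto)
  moreover have "\<gamma>\<^sup>2 * Re (poly_functional (2 * r) (c S) (?\<mu> * para_conj ?\<mu>)) - Re (poly_functional (2 * r) (c S) (?n * para_conj ?n))
      = Re (poly_functional (2 * r) (c S) (q * para_conj q))" for S
    unfolding q(2)[symmetric] poly_functional_diff poly_functional_smult by (simp del: of_real_power)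
  \<comment> \<open>The spectral identity cancels the three functional values exactly, so nothing
    need be known about the convergence of \<open>c S\<close>.\<close>
  ultimately have lim0: "((\<lambda>S. \<gamma>\<^sup>2 * I ?\<mu> S - I ?n S - I q S) \<longlongrightarrow> 0) at_top"
    by (simp add: algebra_simps)
  have real: "(cmod (\<Sum>k\<le>r. coeff (map_poly complex_of_real p) k * of_real (X k t)))\<^sup>2 = (\<Sum>k\<le>r. coeff p k * X k t)\<^sup>2" for p t
  proof -
    have "(\<Sum>k\<le>r. coeff (map_poly complex_of_real p) k * of_real (X k t)) = of_real (\<Sum>k\<le>r. coeff p k * X k t)"
      by (simp add: coeff_map_poly)
    then show ?thesis by (simp only: norm_of_real power2_abs)
  qed
  have bn: "bounded_integrable S (\<lambda>t. (\<Sum>k\<le>r. coeff p k * X k t)\<^sup>2)" for S and p :: "real poly"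
    unfolding power2_eq_square by (intro bounded_integrable_mult bounded_integrable_sum bounded_integrable_cmult Xb) (auto simp: r_def)
  have comb: "integral {0..T} (\<lambda>t. (\<Sum>k\<le>r. coeff p k * X k t)\<^sup>2) + integral {T..S} (\<lambda>t. (\<Sum>k\<le>r. coeff p k * X k t)\<^sup>2)
      = integral {0..S} (\<lambda>t. (\<Sum>k\<le>r. coeff p k * X k t)\<^sup>2)" if "S \<ge> T" for S and p :: "real poly"
    using T that bounded_integrable_integrable[OF bn[of S p] order_refl order_refl] by (intro Henstock_Kurzweil_Integration.integral_combine) auto
  \<comment> \<open>Past \<open>T\<close> the input is zero, so its energy no longer depends on
    \<open>S\<close>; the single instant \<open>T\<close>, where it may be nonzero, is
    negligible.\<close>
  have I\<mu>: "I ?\<mu> S = integral {0..T} (\<lambda>t. (W t)\<^sup>2)" if S: "S \<ge> T" for S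
  proof -
    have "integral {T..S} (\<lambda>t. (\<Sum>k\<le>r. coeff \<mu> k * X k t)\<^sup>2) = integral {T..S} (\<lambda>t. 0)"
      by (rule integral_spike[of "{T}"]) (use W W0 T in \<open>auto simp: r_def\<close>)
    moreover have "integral {0..T} (\<lambda>t. (\<Sum>k\<le>r. coeff \<mu> k * X k t)\<^sup>2) = integral {0..T} (\<lambda>t. (W t)\<^sup>2)"
      by (rule integral_cong) (use W in \<open>auto simp: r_def\<close>)
    ultimately show ?thesis unfolding I_def real using comb[OF S, of \<mu>] by simp
  qed
  \<comment> \<open>The response may continue after \<open>T\<close>; its energy there has the
    favourable sign.\<close>
  have In: "I ?n S \<ge> integral {0..T} (\<lambda>t. (\<Sum>k\<le>r. coeff n k * X k t)\<^sup>2)" if S: "S \<ge> T" for S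
  proof -
    have "integral {T..S} (\<lambda>t. (\<Sum>k\<le>r. coeff n k * X k t)\<^sup>2) \<ge> 0"
      by (rule Henstock_Kurzweil_Integration.integral_nonneg[OF bounded_integrable_integrable[OF bn T order_refl]]) simp
    then show ?thesis unfolding I_def real using comb[OF S, of n] by simp
  qed
  have Iq: "I q S \<ge> 0" for S
  proof -
    have "bounded_integrable S (\<lambda>t. (cmod (\<Sum>k\<le>r. coeff q k * of_real (X k t)))\<^sup>2)"
      unfolding sq by (intro bounded_integrable_sum bi) auto
    then show ?thesis unfolding I_def
      by (intro Henstock_Kurzweil_Integration.integral_nonneg[OF bounded_integrable_integrable[OF _ order_refl order_refl]]) auto
  qed
  have "0 \<le> \<gamma>\<^sup>2 * integral {0..T} (\<lambda>t. (W t)\<^sup>2) - integral {0..T} (\<lambda>t. (\<Sum>k\<le>r. coeff n k * X k t)\<^sup>2)"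
  proof (rule tendsto_upperbound[OF lim0])
    show "\<forall>\<^sub>F S in at_top. \<gamma>\<^sup>2 * I ?\<mu> S - I ?n S - I q S \<le> \<gamma>\<^sup>2 * integral {0..T} (\<lambda>t. (W t)\<^sup>2) - integral {0..T} (\<lambda>t. (\<Sum>k\<le>r. coeff n k * X k t)\<^sup>2)"
      using eventually_ge_at_top[of T]
    proof eventually_elim
      case (elim S)
      show ?case using In[OF elim] Iq[of S] I\<mu>[OF elim] by simp
    qed
  qed simp
  then show ?thesis by (simp add: r_def)
qed

section \<open>Time reversal and the gain of an observed chain\<close>

lemma has_integral_flip:
  fixes f :: "real \<Rightarrow> 'a::euclidean_space"
  assumes "(f has_integral i) {a..b}"
  shows "((\<lambda>t. f (T - t)) has_integral i) {T - b..T - a}"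
proof -
  have "((\<lambda>x. f (- 1 *\<^sub>R x + T)) has_integral (1 / \<bar>- 1\<bar> ^ DIM(real)) *\<^sub>R i)
      ((\<lambda>x. (1 / - 1) *\<^sub>R x + - ((1 / - 1) *\<^sub>R T)) ` cbox a b)"
    by (rule has_integral_affinity) (use assms in auto)
  moreover have "(\<lambda>x. (1 / - 1) *\<^sub>R x + - ((1 / - 1) *\<^sub>R T)) ` cbox a b = {T - b..T - a}"
  proof -
    have "(\<lambda>x. T - x) ` {a..b} = {T - b..T - a}" by simp
    then show ?thesis by (simp add: algebra_simps)
  qed
  ultimately show ?thesis by (simp add: algebra_simps)
qed

lemma integral_flip:
  fixes f :: "real \<Rightarrow> 'a::euclidean_space"
  assumes "f integrable_on {a..b}"
  shows "integral {T - b..T - a} (\<lambda>t. f (T - t)) = integral {a..b} f"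
  by (rule integral_unique[OF has_integral_flip[OF integrable_integral[OF assms]]])

lemma bounded_integrable_flip:
  assumes "bounded_integrable T f"
  shows "bounded_integrable T (\<lambda>t. f (T - t))"
proof -
  have "f integrable_on {0..T}" "(\<lambda>t. norm (f t)) integrable_on {0..T}"
    using assms by (auto simp: bounded_integrable_def absolutely_integrable_on_def)
  then have "(\<lambda>t. f (T - t)) integrable_on {0..T}" "(\<lambda>t. norm (f (T - t))) integrable_on {0..T}"
    using has_integral_flip[of f _ 0 T T] has_integral_flip[of "\<lambda>t. norm (f t)" _ 0 T T]
    by (auto simp: integrable_on_def)
  moreover have "bounded ((\<lambda>t. f (T - t)) ` {0..T})"
    by (rule bounded_subset[of "f ` {0..T}"]) (use assms in \<open>auto simp: bounded_integrable_def\<close>)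
  ultimately show ?thesis by (simp add: bounded_integrable_def absolutely_integrable_on_def)
qed

lemma bounded_integrable_extend_zero:
  assumes "bounded_integrable T f" "T \<ge> 0"
  shows "bounded_integrable S (\<lambda>t. if t \<le> T then f t else 0)"
proof -
  have "(\<lambda>t. if t \<in> {0..T} then f t else 0) absolutely_integrable_on UNIV"
    by (rule iffD2[OF absolutely_integrable_restrict_UNIV]) (use assms in \<open>simp add: bounded_integrable_def\<close>)
  then have "(\<lambda>t. if t \<in> {0..T} then f t else 0) absolutely_integrable_on {0..S}"
    by (rule set_integrable_subset) auto
  moreover have "bounded ((\<lambda>t. if t \<in> {0..T} then f t else 0) ` {0..S})"
    by (rule bounded_subset[of "insert 0 (f ` {0..T})"]) (use assms in \<open>auto simp: bounded_integrable_def\<close>)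
  ultimately have "bounded_integrable S (\<lambda>t. if t \<in> {0..T} then f t else 0)"
    by (simp add: bounded_integrable_def)
  then show ?thesis by (rule bounded_integrable_cong[rotated]) auto
qed

lemma monic_complex_factorization:
  fixes \<mu> :: "real poly"
  assumes "lead_coeff \<mu> = 1"
  obtains qs where "map_poly complex_of_real \<mu> = (\<Prod>q\<leftarrow>qs. [:- q, 1:])"
    "\<And>q. q \<in> set qs \<Longrightarrow> poly (map_poly complex_of_real \<mu>) q = 0"
proof -
  let ?p = "map_poly complex_of_real \<mu>"
  obtain qs where "Polynomial.smult (coeff ?p (degree ?p)) (\<Prod>q\<leftarrow>qs. [:- q, 1:]) = ?p"
    using fundamental_theorem_algebra_factorized[of ?p] by blast
  moreover have "coeff ?p (degree ?p) = 1" using assms by (simp add: degree_map_poly coeff_map_poly)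
  ultimately have p: "?p = (\<Prod>q\<leftarrow>qs. [:- q, 1:])" by simp
  have "poly (\<Prod>q\<leftarrow>qs. [:- q, 1:]) q = 0" if "q \<in> set qs" for q
    using that by (induction qs) auto
  then show ?thesis using that p by simp
qed

lemma degree_transfer_numerator: "degree (transfer_numerator D h \<mu>) \<le> degree \<mu>"
  unfolding transfer_numerator_def
proof (rule degree_add_le)
  show "degree (\<Sum>k\<le>degree \<mu>. Polynomial.smult (coeff \<mu> k) (\<Sum>i<k. Polynomial.monom (h i) (k - 1 - i))) \<le> degree \<mu>"
  proof (rule degree_sum_le)
    fix k assume k: "k \<in> {..degree \<mu>}"
    have "degree (\<Sum>i<k. Polynomial.monom (h i) (k - 1 - i)) \<le> degree \<mu>"
    proof (rule degree_sum_le)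
      fix i assume "i \<in> {..<k}"
      show "degree (Polynomial.monom (h i) (k - 1 - i)) \<le> degree \<mu>"
        by (rule order_trans[OF degree_monom_le]) (use k in auto)
    qed simp
    then show "degree (Polynomial.smult (coeff \<mu> k) (\<Sum>i<k. Polynomial.monom (h i) (k - 1 - i))) \<le> degree \<mu>"
      using degree_smult_le order_trans by blast
  qed simp
qed (rule degree_smult_le)

text \<open>The defining sum with arbitrary numbers \<open>U k\<close> in place of the powers of
  \<open>s\<close>; in the pairing, \<open>U k\<close> is the integral of the input against the
  reversed \<open>X k\<close>.\<close>

lemma transfer_numerator_functional:
  fixes U :: "nat \<Rightarrow> real"
  shows "(\<Sum>k\<le>degree \<mu>. coeff (transfer_numerator D h \<mu>) k * U k) =
    D * (\<Sum>k\<le>degree \<mu>. coeff \<mu> k * U k) + (\<Sum>k\<le>degree \<mu>. coeff \<mu> k * (\<Sum>i<k. h i * U (k - 1 - i)))"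
proof -
  let ?r = "degree \<mu>"
  have "(\<Sum>k\<le>?r. (\<Sum>l\<le>?r. coeff \<mu> l * (\<Sum>i<l. coeff (Polynomial.monom (h i) (l - 1 - i)) k)) * U k) =
      (\<Sum>l\<le>?r. coeff \<mu> l * (\<Sum>i<l. h i * U (l - 1 - i)))"
  proof -
    have "(\<Sum>k\<le>?r. (\<Sum>l\<le>?r. coeff \<mu> l * (\<Sum>i<l. coeff (Polynomial.monom (h i) (l - 1 - i)) k)) * U k) =
        (\<Sum>k\<le>?r. \<Sum>l\<le>?r. coeff \<mu> l * ((\<Sum>i<l. coeff (Polynomial.monom (h i) (l - 1 - i)) k) * U k))"
      by (simp only: sum_distrib_right mult.assoc)
    also have "\<dots> = (\<Sum>l\<le>?r. coeff \<mu> l * (\<Sum>k\<le>?r. \<Sum>i<l. coeff (Polynomial.monom (h i) (l - 1 - i)) k * U k))"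
      by (subst sum.swap) (simp only: sum_distrib_left sum_distrib_right)
    also have "\<dots> = (\<Sum>l\<le>?r. coeff \<mu> l * (\<Sum>i<l. h i * U (l - 1 - i)))"
    proof (rule sum.cong[OF refl])
      fix l assume l: "l \<in> {..?r}"
      have "(\<Sum>k\<le>?r. \<Sum>i<l. coeff (Polynomial.monom (h i) (l - 1 - i)) k * U k) =
          (\<Sum>i<l. \<Sum>k\<le>?r. coeff (Polynomial.monom (h i) (l - 1 - i)) k * U k)" by (rule sum.swap)
      also have "\<dots> = (\<Sum>i<l. h i * U (l - 1 - i))"
      proof (rule sum.cong[OF refl])
        fix i assume "i \<in> {..<l}"
        have "(\<Sum>k\<le>?r. coeff (Polynomial.monom (h i) (l - 1 - i)) k * U k) =
            (\<Sum>k\<in>{l - 1 - i}. coeff (Polynomial.monom (h i) (l - 1 - i)) k * U k)"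
          by (rule sum.mono_neutral_right) (use l in auto)
        then show "(\<Sum>k\<le>?r. coeff (Polynomial.monom (h i) (l - 1 - i)) k * U k) = h i * U (l - 1 - i)" by simp
      qed
      finally show "coeff \<mu> l * (\<Sum>k\<le>?r. \<Sum>i<l. coeff (Polynomial.monom (h i) (l - 1 - i)) k * U k) =
          coeff \<mu> l * (\<Sum>i<l. h i * U (l - 1 - i))" by simp
    qed
    finally show ?thesis .
  qed
  then show ?thesis
    unfolding transfer_numerator_def by (simp add: coeff_sum distrib_right sum.distrib sum_distrib_left mult.assoc)
qed

text \<open>Pairing the observer chain \<open>y\<close> with the time-reversed driven chain \<open>X\<close>.\<close>

lemma chain_pairing:
  fixes y X :: "nat \<Rightarrow> real \<Rightarrow> real" and \<mu> :: "real poly"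
  defines "r \<equiv> degree \<mu>"
  assumes y: "\<And>k. k < r \<Longrightarrow> primitive_on T (y k) (\<lambda>t. y (Suc k) t + h k * u t)"
    and yr: "bounded_integrable T (y r)" and u: "bounded_integrable T u" and T: "T \<ge> 0"
    and rel: "\<And>t. t \<ge> 0 \<Longrightarrow> (\<Sum>k\<le>r. coeff \<mu> k * y k t) = 0"
    and X0: "\<And>k. k < r \<Longrightarrow> X k 0 = 0"
    and Xp: "\<And>k. k < r \<Longrightarrow> primitive_on T (X k) (X (Suc k))"
    and Xb: "\<And>k. k \<le> r \<Longrightarrow> bounded_integrable T (X k)"
    and W: "\<And>t. 0 \<le> t \<Longrightarrow> t \<le> T \<Longrightarrow> (\<Sum>k\<le>r. coeff \<mu> k * X k t) = y 0 (T - t) + D * u (T - t)"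
  shows "integral {0..T} (\<lambda>t. (y 0 t + D * u t)\<^sup>2) =
    integral {0..T} (\<lambda>t. u t * (\<Sum>k\<le>r. coeff (transfer_numerator D h \<mu>) k * X k (T - t))) +
    (\<Sum>k\<le>r. coeff \<mu> k * (\<Sum>i<k. y i 0 * X (k - 1 - i) T))"
proof -
  define Z where "Z k t = X k (T - t)" for k t
  have Zb: "bounded_integrable T (Z k)" if "k \<le> r" for k
    unfolding Z_def[abs_def] by (rule bounded_integrable_flip[OF Xb[OF that]])
  have yb: "bounded_integrable T (y k)" if "k \<le> r" for k
    using that yr primitive_on_bounded_integrable[OF y[of k]] by (cases "k = r") auto
  have Zp: "primitive_on T (Z k) (\<lambda>t. - Z (Suc k) t)" if k: "k < r" for k
    unfolding primitive_on_def
  proof (intro conjI ballI)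
    show "bounded_integrable T (\<lambda>t. - Z (Suc k) t)"
      using bounded_integrable_cmult[OF Zb[of "Suc k"], of "-1"] k by simp
    fix t assume t: "t \<in> {0..T}"
    have "X k T - X k (T - t) = integral {T - t..T} (X (Suc k))"
      by (rule primitive_on_diff[OF Xp[OF k]]) (use t in auto)
    also have "\<dots> = integral {T - T..T - (T - t)} (\<lambda>\<tau>. X (Suc k) (T - \<tau>))"
      by (rule integral_flip[symmetric], rule bounded_integrable_integrable[OF Xb]) (use t k in auto)
    finally show "Z k t = Z k 0 + integral {0..t} (\<lambda>t. - Z (Suc k) t)" by (simp add: Z_def)
  qed
  define A where "A a b = integral {0..T} (\<lambda>t. y a t * Z b t)" for a b
  define U where "U b = integral {0..T} (\<lambda>t. u t * Z b t)" for b
  note ii = bounded_integrable_integrable[OF _ order_refl order_refl]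
  \<comment> \<open>Integration by parts moves one derivative from the reversed chain to
    \<open>y\<close>. The boundary term at \<open>T\<close> vanishes because \<open>X\<close> starts
    at rest; the one at 0 carries the initial value of \<open>y\<close>.\<close>
  have step: "A a (Suc b) = A (Suc a) b + (h a * U b + y a 0 * X b T)" if "a < r" "b < r" for a b
  proof -
    have "primitive_on T (\<lambda>t. y a t * Z b t) (\<lambda>t. (y (Suc a) t + h a * u t) * Z b t + y a t * - Z (Suc b) t)"
      by (rule primitive_on_mult[OF y[OF that(1)] Zp[OF that(2)]])
    from primitive_onD(1)[OF this, of T] T have "y a T * Z b T = y a 0 * Z b 0 +
        integral {0..T} (\<lambda>t. (y (Suc a) t + h a * u t) * Z b t + y a t * - Z (Suc b) t)" by simp
    moreover have "Z b T = 0" "Z b 0 = X b T" using X0[OF that(2)] by (simp_all add: Z_def)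
    moreover have "integral {0..T} (\<lambda>t. (y (Suc a) t + h a * u t) * Z b t + y a t * - Z (Suc b) t) =
        A (Suc a) b + h a * U b - A a (Suc b)"
    proof -
      have i: "(\<lambda>t. y (Suc a) t * Z b t) integrable_on {0..T}" "(\<lambda>t. h a * (u t * Z b t)) integrable_on {0..T}"
          "(\<lambda>t. y a t * Z (Suc b) t) integrable_on {0..T}"
        using that by (auto intro!: ii bounded_integrable_mult bounded_integrable_const yb Zb u)
      have "integral {0..T} (\<lambda>t. (y (Suc a) t + h a * u t) * Z b t + y a t * - Z (Suc b) t) =
          integral {0..T} (\<lambda>t. (y (Suc a) t * Z b t + h a * (u t * Z b t)) - y a t * Z (Suc b) t)"
        by (rule integral_cong) (simp add: algebra_simps)
      also have "\<dots> = integral {0..T} (\<lambda>t. y (Suc a) t * Z b t) + integral {0..T} (\<lambda>t. h a * (u t * Z b t))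
          - integral {0..T} (\<lambda>t. y a t * Z (Suc b) t)"
        by (simp only: Henstock_Kurzweil_Integration.integral_diff[OF integrable_add[OF i(1,2)] i(3)]
            Henstock_Kurzweil_Integration.integral_add[OF i(1,2)])
      finally show ?thesis by (simp add: A_def U_def)
    qed
    ultimately show ?thesis by simp
  qed
  have shift: "A 0 k = A m (k - m) + (\<Sum>i<m. h i * U (k - 1 - i) + y i 0 * X (k - 1 - i) T)" if "m \<le> k" "k \<le> r" for m k
    using that
  proof (induction m)
    case (Suc m)
    then have "k - m = Suc (k - 1 - m)" by auto
    then have "A m (k - m) = A (Suc m) (k - 1 - m) + (h m * U (k - 1 - m) + y m 0 * X (k - 1 - m) T)"
      using step[of m "k - 1 - m"] Suc.prems by auto
    moreover have "k - 1 - m = k - Suc m" by simp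
    ultimately show ?case using Suc by simp
  qed simp
  have v: "y 0 t + D * u t = (\<Sum>k\<le>r. coeff \<mu> k * Z k t)" if "t \<in> {0..T}" for t
    using W[of "T - t"] that by (simp add: Z_def)
  have lin: "integral {0..T} (\<lambda>t. f t * (\<Sum>k\<le>r. c k * Z k t)) = (\<Sum>k\<le>r. c k * integral {0..T} (\<lambda>t. f t * Z k t))"
    if f: "bounded_integrable T f" for f and c :: "nat \<Rightarrow> real"
  proof -
    have "integral {0..T} (\<lambda>t. f t * (\<Sum>k\<le>r. c k * Z k t)) = integral {0..T} (\<lambda>t. \<Sum>k\<le>r. c k * (f t * Z k t))"
      by (simp only: sum_distrib_left mult.left_commute)
    also have "\<dots> = (\<Sum>k\<le>r. integral {0..T} (\<lambda>t. c k * (f t * Z k t)))"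
      by (rule integral_sum) (auto intro!: ii bounded_integrable_cmult bounded_integrable_mult f Zb)
    finally show ?thesis by simp
  qed
  have y0b: "bounded_integrable T (y 0)" by (rule yb) simp
  have "integral {0..T} (\<lambda>t. (y 0 t + D * u t)\<^sup>2) =
      integral {0..T} (\<lambda>t. (y 0 t + D * u t) * (\<Sum>k\<le>r. coeff \<mu> k * Z k t))"
    by (rule integral_cong) (simp only: v[symmetric] power2_eq_square)
  also have "\<dots> = (\<Sum>k\<le>r. coeff \<mu> k * integral {0..T} (\<lambda>t. (y 0 t + D * u t) * Z k t))"
    by (rule lin) (intro bounded_integrable_add bounded_integrable_cmult y0b u)
  also have "\<dots> = (\<Sum>k\<le>r. coeff \<mu> k * (A 0 k + D * U k))"
  proof (rule sum.cong[OF refl])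
    fix k assume "k \<in> {..r}"
    then have i: "(\<lambda>t. y 0 t * Z k t) integrable_on {0..T}" "(\<lambda>t. D * (u t * Z k t)) integrable_on {0..T}"
      by (auto intro!: ii bounded_integrable_mult bounded_integrable_const y0b Zb u)
    show "coeff \<mu> k * integral {0..T} (\<lambda>t. (y 0 t + D * u t) * Z k t) = coeff \<mu> k * (A 0 k + D * U k)"
      using Henstock_Kurzweil_Integration.integral_add[OF i] by (simp add: A_def U_def distrib_right mult.assoc)
  qed
  also have "\<dots> = (\<Sum>k\<le>r. coeff \<mu> k * A k 0) +
      (D * (\<Sum>k\<le>r. coeff \<mu> k * U k) + (\<Sum>k\<le>r. coeff \<mu> k * (\<Sum>i<k. h i * U (k - 1 - i))))
      + (\<Sum>k\<le>r. coeff \<mu> k * (\<Sum>i<k. y i 0 * X (k - 1 - i) T))"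
    using shift[of _ _] by (simp add: shift[OF order_refl] sum.distrib distrib_left sum_distrib_left mult.left_commute cong: sum.cong_simp)
  \<comment> \<open>All derivatives have been moved to \<open>y\<close>, where \<open>rel\<close>
    annihilates the combination.\<close>
  also have "(\<Sum>k\<le>r. coeff \<mu> k * A k 0) = 0"
  proof -
    have "(\<Sum>k\<le>r. coeff \<mu> k * A k 0) = (\<Sum>k\<le>r. integral {0..T} (\<lambda>t. coeff \<mu> k * (y k t * Z 0 t)))"
      by (simp add: A_def)
    also have "\<dots> = integral {0..T} (\<lambda>t. \<Sum>k\<le>r. coeff \<mu> k * (y k t * Z 0 t))"
      by (rule integral_sum[symmetric]) (auto intro!: ii bounded_integrable_cmult bounded_integrable_mult yb Zb)
    also have "\<dots> = integral {0..T} (\<lambda>t. 0)"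
      by (rule integral_cong) (use rel in \<open>auto simp: mult.assoc[symmetric] sum_distrib_right[symmetric]\<close>)
    finally show ?thesis by simp
  qed
  also have "D * (\<Sum>k\<le>r. coeff \<mu> k * U k) + (\<Sum>k\<le>r. coeff \<mu> k * (\<Sum>i<k. h i * U (k - 1 - i))) =
      (\<Sum>k\<le>r. coeff (transfer_numerator D h \<mu>) k * U k)"
    unfolding r_def by (rule transfer_numerator_functional[symmetric])
  also have "\<dots> = integral {0..T} (\<lambda>t. u t * (\<Sum>k\<le>r. coeff (transfer_numerator D h \<mu>) k * Z k t))"
    unfolding U_def by (rule lin[symmetric, OF u])
  finally show ?thesis by (simp add: Z_def)
qed

text \<open>The output itself, reversed and cut off, drives the auxiliary chain, so the pairing
  equals the output energy \<open>V\<close>. It splits into the integral of the input times a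
  filtered output \<open>N\<close>, whose energy is at most \<open>\<gamma>\<^sup>2 * V\<close> by
  \<open>chain_gain\<close>, and boundary terms of size \<open>B * sqrt V\<close>. The weight
  \<open>\<theta>\<close> comes from completing the square and stays free until the ports are
  summed.\<close>

lemma observer_chain_gain:
  fixes y :: "nat \<Rightarrow> real \<Rightarrow> real" and \<mu> :: "real poly"
  assumes \<mu>: "lead_coeff \<mu> = 1" and stable: "\<And>z. poly (map_poly complex_of_real \<mu>) z = 0 \<Longrightarrow> Re z < 0"
    and y: "\<And>k T. k < degree \<mu> \<Longrightarrow> primitive_on T (y k) (\<lambda>t. y (Suc k) t + h k * u t)"
    and yr: "\<And>T. bounded_integrable T (y (degree \<mu>))" and u: "\<And>T. bounded_integrable T u"
    and rel: "\<And>t. t \<ge> 0 \<Longrightarrow> (\<Sum>k\<le>degree \<mu>. coeff \<mu> k * y k t) = 0"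
    and bound: "\<And>\<omega>::real. cmod (poly (map_poly of_real (transfer_numerator D h \<mu>)) (\<i> * of_real \<omega>))
        \<le> \<gamma> * cmod (poly (map_poly of_real \<mu>) (\<i> * of_real \<omega>))"
  shows "\<exists>B\<ge>0. \<forall>T\<ge>0. \<forall>\<theta>>0. integral {0..T} (\<lambda>t. (y 0 t + D * u t)\<^sup>2)
    \<le> \<theta> / 2 * integral {0..T} (\<lambda>t. (u t)\<^sup>2) + \<gamma>\<^sup>2 / (2 * \<theta>) * integral {0..T} (\<lambda>t. (y 0 t + D * u t)\<^sup>2)
      + B * sqrt (integral {0..T} (\<lambda>t. (y 0 t + D * u t)\<^sup>2))"
proof -
  let ?\<mu> = "map_poly complex_of_real \<mu>"
  define r where "r = degree \<mu>"
  obtain qs where qs: "?\<mu> = (\<Prod>q\<leftarrow>qs. [:- q, 1:])" "\<And>q. q \<in> set qs \<Longrightarrow> poly ?\<mu> q = 0"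
    using monic_complex_factorization[OF \<mu>] by blast
  obtain C where C: "C \<ge> 0" "\<And>W. (\<forall>T. bounded_integrable T W) \<Longrightarrow> \<exists>X. driven_chain ?\<mu> W X \<and> chain_bounds ?\<mu> C W X"
    using driven_chain_exists[of qs] stable qs unfolding qs(1) by metis
  have deg: "degree ?\<mu> = r" by (simp add: degree_map_poly r_def)
  \<comment> \<open>Bounds the boundary terms of the pairing: initial values of \<open>y\<close>
    times end values of the driven chain, the latter at most \<open>sqrt C * sqrt V\<close>.\<close>
  define B where "B = (\<Sum>k\<le>r. \<bar>coeff \<mu> k\<bar> * (\<Sum>i<k. \<bar>y i 0\<bar> * sqrt C))"
  let ?n = "transfer_numerator D h \<mu>"
  define v where "v t = y 0 t + D * u t" for t
  have y0b: "bounded_integrable T (y 0)" for T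
    using primitive_on_bounded_integrable[OF y[of 0 T]] yr[of T] by (cases "degree \<mu> = 0") auto
  have vb: "bounded_integrable T v" for T
    unfolding v_def[abs_def] by (intro bounded_integrable_add bounded_integrable_cmult y0b u)
  note ii = bounded_integrable_integrable[OF _ order_refl order_refl]
  have main: "integral {0..T} (\<lambda>t. (v t)\<^sup>2) \<le> \<theta> / 2 * integral {0..T} (\<lambda>t. (u t)\<^sup>2)
      + \<gamma>\<^sup>2 / (2 * \<theta>) * integral {0..T} (\<lambda>t. (v t)\<^sup>2) + B * sqrt (integral {0..T} (\<lambda>t. (v t)\<^sup>2))"
    if T: "T \<ge> 0" and \<theta>: "\<theta> > 0" for T \<theta>
  proof -
    \<comment> \<open>Vanishing after \<open>T\<close> makes \<open>w\<close> a square integrable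
      input on the whole half-line, so that the driven chain decays and \<open>chain_gain\<close>
      applies.\<close>
    define w where "w t = (if t \<le> T then v (T - t) else 0)" for t
    have wb: "bounded_integrable S w" for S
      unfolding w_def[abs_def] by (rule bounded_integrable_extend_zero[OF bounded_integrable_flip[OF vb] T])
    define V where "V = integral {0..T} (\<lambda>t. (v t)\<^sup>2)"
    have vv: "bounded_integrable T (\<lambda>t. (v t)\<^sup>2)"
      unfolding power2_eq_square by (rule bounded_integrable_mult[OF vb vb])
    have V0: "V \<ge> 0" unfolding V_def by (rule Henstock_Kurzweil_Integration.integral_nonneg[OF ii[OF vv]]) simp
    have wV: "integral {0..T} (\<lambda>t. (w t)\<^sup>2) = V"
    proof -
      have "integral {0..T} (\<lambda>t. (w t)\<^sup>2) = integral {0..T} (\<lambda>t. (v (T - t))\<^sup>2)"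
        by (rule integral_cong) (simp add: w_def)
      also have "\<dots> = V" using integral_flip[OF ii[OF vv], of T] by (simp add: V_def)
      finally show ?thesis .
    qed
    have wC: "bounded_integrable S (\<lambda>t. complex_of_real (w t))" for S
      by (rule bounded_integrable_linear[OF bounded_linear_of_real wb])
    obtain X where X: "driven_chain ?\<mu> (\<lambda>t. of_real (w t)) X" "chain_bounds ?\<mu> C (\<lambda>t. of_real (w t)) X"
      using C(2) wC by blast
    \<comment> \<open>The chain is built from complex roots; as \<open>\<mu>\<close> and
      \<open>w\<close> are real, its real part satisfies the same equations.\<close>
    define x where "x k t = Re (X k t)" for k t
    have x0: "x k 0 = 0" if "k < r" for k using X(1) that by (simp add: driven_chain_def r_def degree_map_poly x_def)
    have xp: "primitive_on S (x k) (x (Suc k))" if "k < r" for k S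
      unfolding x_def[abs_def]
      by (rule primitive_on_linear[OF bounded_linear_Re]) (use X(1) that in \<open>simp add: driven_chain_def r_def degree_map_poly\<close>)
    have xb: "bounded_integrable S (x k)" if "k \<le> r" for k S
      unfolding x_def[abs_def]
      by (rule bounded_integrable_linear[OF bounded_linear_Re]) (use X(1) that in \<open>simp add: driven_chain_def r_def degree_map_poly\<close>)
    have xw: "(\<Sum>k\<le>r. coeff \<mu> k * x k t) = w t" for t
    proof -
      have "(\<Sum>k\<le>r. coeff ?\<mu> k * X k t) = of_real (w t)" using X(1) by (simp add: driven_chain_def r_def degree_map_poly)
      from arg_cong[OF this, of Re] show ?thesis by (simp add: coeff_map_poly x_def)
    qed
    have sq: "square_integrable (\<lambda>t. complex_of_real (w t))"
      unfolding square_integrable_def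
    proof (intro conjI allI exI impI)
      fix S :: real assume S: "S \<ge> 0"
      have "integral {0..S} (\<lambda>t. (cmod (complex_of_real (w t)))\<^sup>2) = integral {0..S} (\<lambda>t. (w t)\<^sup>2)" by simp
      also have "\<dots> \<le> integral {0..max S T} (\<lambda>t. (w t)\<^sup>2)"
        using wb by (intro integral_subset_le ii) (auto simp: power2_eq_square intro: bounded_integrable_mult)
      also have "\<dots> = integral {0..T} (\<lambda>t. (w t)\<^sup>2) + integral {T..max S T} (\<lambda>t. (w t)\<^sup>2)"
        using T wb by (intro Henstock_Kurzweil_Integration.integral_combine[symmetric] ii)
          (auto simp: power2_eq_square intro: bounded_integrable_mult)
      also have "integral {T..max S T} (\<lambda>t. (w t)\<^sup>2) = integral {T..max S T} (\<lambda>t. 0)"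
        by (rule integral_spike[of "{T}"]) (auto simp: w_def)
      finally show "integral {0..S} (\<lambda>t. (cmod (complex_of_real (w t)))\<^sup>2) \<le> V" using wV by simp
    qed (rule wC)
    have xl: "(x k \<longlongrightarrow> 0) at_top" if "k < r" for k
    proof -
      have "(X k \<longlongrightarrow> 0) at_top" using X(2) sq that by (simp add: chain_bounds_def r_def degree_map_poly)
      from tendsto_Re[OF this] show ?thesis by (simp add: x_def[abs_def])
    qed
    have xT: "\<bar>x k T\<bar> \<le> sqrt C * sqrt V" if "k < r" for k
    proof -
      have "(cmod (X k T))\<^sup>2 \<le> C * integral {0..T} (\<lambda>t. (cmod (complex_of_real (w t)))\<^sup>2)"
        using X(2) that T by (simp add: chain_bounds_def r_def degree_map_poly)
      then have "(cmod (X k T))\<^sup>2 \<le> C * V" using wV by simp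
      then have "cmod (X k T) \<le> sqrt (C * V)" by (rule real_le_rsqrt)
      then show ?thesis using abs_Re_le_cmod[of "X k T"] by (simp add: x_def real_sqrt_mult)
    qed
    define N where "N t = (\<Sum>k\<le>r. coeff ?n k * x k (T - t))" for t
    have pair: "V = integral {0..T} (\<lambda>t. u t * N t) + (\<Sum>k\<le>r. coeff \<mu> k * (\<Sum>i<k. y i 0 * x (k - 1 - i) T))"
      unfolding V_def v_def N_def r_def
      by (rule chain_pairing) (use y yr u T rel x0 xp xb xw in \<open>auto simp: r_def w_def v_def\<close>)
    have Nsum: "bounded_integrable T (\<lambda>t. \<Sum>k\<le>r. coeff ?n k * x k t)"
      by (intro bounded_integrable_sum bounded_integrable_cmult xb) auto
    have Nb: "bounded_integrable T N" unfolding N_def[abs_def] by (rule bounded_integrable_flip[OF Nsum])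
    have "integral {0..T} (\<lambda>t. (N t)\<^sup>2) = integral {0..T} (\<lambda>t. (\<Sum>k\<le>r. coeff ?n k * x k t)\<^sup>2)"
      using integral_flip[of "\<lambda>t. (\<Sum>k\<le>r. coeff ?n k * x k t)\<^sup>2" 0 T T] ii[OF bounded_integrable_mult[OF Nsum Nsum]]
      by (simp add: N_def power2_eq_square)
    also have "\<dots> \<le> \<gamma>\<^sup>2 * integral {0..T} (\<lambda>t. (w t)\<^sup>2)"
      unfolding r_def
      by (rule chain_gain) (use x0 xp xb xl xw T bound degree_transfer_numerator in \<open>auto simp: r_def w_def\<close>)
    finally have NV: "integral {0..T} (\<lambda>t. (N t)\<^sup>2) \<le> \<gamma>\<^sup>2 * V" unfolding wV .
    have i2: "(\<lambda>t. (u t)\<^sup>2) integrable_on {0..T}" "(\<lambda>t. (N t)\<^sup>2) integrable_on {0..T}"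
      unfolding power2_eq_square by (intro ii bounded_integrable_mult u Nb)+
    have "integral {0..T} (\<lambda>t. u t * N t) \<le> integral {0..T} (\<lambda>t. \<theta> / 2 * (u t)\<^sup>2 + 1 / (2 * \<theta>) * (N t)\<^sup>2)"
    proof (rule integral_le)
      show "(\<lambda>t. u t * N t) integrable_on {0..T}" by (intro ii bounded_integrable_mult u Nb)
      show "(\<lambda>t. \<theta> / 2 * (u t)\<^sup>2 + 1 / (2 * \<theta>) * (N t)\<^sup>2) integrable_on {0..T}"
        by (intro integrable_add integrable_on_mult_right i2)
      fix t
      have "0 \<le> (\<theta> * u t - N t)\<^sup>2 / (2 * \<theta>)" using \<theta> by simp
      also have "\<dots> = \<theta> / 2 * (u t)\<^sup>2 + 1 / (2 * \<theta>) * (N t)\<^sup>2 - u t * N t"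
        using \<theta> by (simp add: power2_eq_square add_divide_distrib diff_divide_distrib left_diff_distrib right_diff_distrib)
      finally show "u t * N t \<le> \<theta> / 2 * (u t)\<^sup>2 + 1 / (2 * \<theta>) * (N t)\<^sup>2" by simp
    qed
    also have "\<dots> = \<theta> / 2 * integral {0..T} (\<lambda>t. (u t)\<^sup>2) + 1 / (2 * \<theta>) * integral {0..T} (\<lambda>t. (N t)\<^sup>2)"
      unfolding Henstock_Kurzweil_Integration.integral_add[OF integrable_on_mult_right[OF i2(1)] integrable_on_mult_right[OF i2(2)]]
      by simp
    also have "1 / (2 * \<theta>) * integral {0..T} (\<lambda>t. (N t)\<^sup>2) \<le> 1 / (2 * \<theta>) * (\<gamma>\<^sup>2 * V)"
      by (rule mult_left_mono[OF NV]) (use \<theta> in simp)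
    finally have uN: "integral {0..T} (\<lambda>t. u t * N t) \<le> \<theta> / 2 * integral {0..T} (\<lambda>t. (u t)\<^sup>2) + \<gamma>\<^sup>2 / (2 * \<theta>) * V"
      by simp
    have "(\<Sum>k\<le>r. coeff \<mu> k * (\<Sum>i<k. y i 0 * x (k - 1 - i) T)) \<le>
        (\<Sum>k\<le>r. \<bar>coeff \<mu> k\<bar> * (\<Sum>i<k. \<bar>y i 0\<bar> * (sqrt C * sqrt V)))"
    proof (rule sum_mono)
      fix k assume k: "k \<in> {..r}"
      have "\<bar>\<Sum>i<k. y i 0 * x (k - 1 - i) T\<bar> \<le> (\<Sum>i<k. \<bar>y i 0\<bar> * (sqrt C * sqrt V))"
        by (rule order_trans[OF sum_abs sum_mono]) (use k in \<open>auto simp: abs_mult intro!: mult_left_mono xT\<close>)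
      then have "\<bar>coeff \<mu> k * (\<Sum>i<k. y i 0 * x (k - 1 - i) T)\<bar> \<le> \<bar>coeff \<mu> k\<bar> * (\<Sum>i<k. \<bar>y i 0\<bar> * (sqrt C * sqrt V))"
        unfolding abs_mult by (rule mult_left_mono) simp
      then show "coeff \<mu> k * (\<Sum>i<k. y i 0 * x (k - 1 - i) T) \<le> \<bar>coeff \<mu> k\<bar> * (\<Sum>i<k. \<bar>y i 0\<bar> * (sqrt C * sqrt V))"
        by linarith
    qed
    also have "\<dots> = B * sqrt V" by (simp add: B_def sum_distrib_right mult.assoc)
    finally have "V \<le> \<theta> / 2 * integral {0..T} (\<lambda>t. (u t)\<^sup>2) + \<gamma>\<^sup>2 / (2 * \<theta>) * V + B * sqrt V"
      using pair uN by linarith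
    then show ?thesis by (simp add: V_def)
  qed
  have "B \<ge> 0" unfolding B_def using C(1) by (intro sum_nonneg mult_nonneg_nonneg) auto
  then show ?thesis using main unfolding v_def by blast
qed

subsection \<open>The small-gain argument\<close>

text \<open>Enlarging both gains makes them positive, so that their quotient can serve as the weight
  \<open>\<theta>\<close>; the strict small-gain condition leaves room for it.\<close>

lemma small_gain_margin:
  fixes \<gamma> \<sigma> :: real
  assumes "\<gamma> \<ge> 0" "\<sigma> \<ge> 0" "\<gamma> * \<sigma> < 1"
  obtains \<delta> where "\<delta> > 0" "(\<gamma> + \<delta>) * (\<sigma> + \<delta>) < 1"
proof -
  define p where "p = \<gamma> + \<sigma> + 1"
  have p: "p > 0" using assms by (simp add: p_def)
  \<comment> \<open>The cap 1 gives \<open>\<delta> * \<delta> \<le> \<delta>\<close>; the other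
    bound keeps the sum of all terms containing \<open>\<delta>\<close> within half of the margin
    \<open>1 - \<gamma> * \<sigma>\<close>.\<close>
  define \<delta> where "\<delta> = min 1 ((1 - \<gamma> * \<sigma>) / (2 * p))"
  have \<delta>: "\<delta> > 0" "\<delta> \<le> 1" using assms p by (auto simp: \<delta>_def)
  have "\<delta> * p \<le> (1 - \<gamma> * \<sigma>) / (2 * p) * p"
    by (rule mult_right_mono) (use p in \<open>auto simp: \<delta>_def\<close>)
  also have "\<dots> = (1 - \<gamma> * \<sigma>) / 2" using p by simp
  finally have "\<delta> * (\<gamma> + \<sigma> + 1) < 1 - \<gamma> * \<sigma>" using assms(3) by (simp add: p_def)
  moreover have "\<delta> * \<delta> \<le> \<delta>" using \<delta> mult_left_mono[of \<delta> 1 \<delta>] by simp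
  ultimately have "(\<gamma> + \<delta>) * (\<sigma> + \<delta>) < 1" by (simp add: algebra_simps)
  then show ?thesis using that \<delta>(1) by blast
qed

text \<open>Resolves the instantaneous loop through \<open>D\<close>. It bounds the outputs by the
  continuous functionals of the state, first to see that the inputs are locally bounded and finally
  to pass the limit on to the outputs.\<close>

lemma L2_set_contraction:
  fixes y u v :: "'j \<Rightarrow> real"
  assumes "\<And>j. j \<in> J \<Longrightarrow> v j = y j + D * u j" and "(\<Sum>j\<in>J. (u j)\<^sup>2) \<le> \<sigma>\<^sup>2 * (\<Sum>j\<in>J. (v j)\<^sup>2)"
    and "\<sigma> \<ge> 0" "\<bar>D\<bar> * \<sigma> < 1"
  shows "L2_set v J \<le> L2_set y J / (1 - \<bar>D\<bar> * \<sigma>)"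
proof -
  have "L2_set v J = L2_set (\<lambda>j. y j + D * u j) J"
    by (rule L2_set_cong) (use assms in auto)
  also have "\<dots> \<le> L2_set y J + L2_set (\<lambda>j. D * u j) J" by (rule L2_set_triangle_ineq)
  also have "L2_set (\<lambda>j. D * u j) J = \<bar>D\<bar> * L2_set u J"
    unfolding L2_set_def by (simp add: power_mult_distrib sum_distrib_left[symmetric] real_sqrt_mult)
  also have "L2_set u J \<le> \<sigma> * L2_set v J"
    unfolding L2_set_def using real_sqrt_le_mono[OF assms(2)] assms(3) by (simp add: real_sqrt_mult)
  finally have "L2_set v J \<le> L2_set y J + \<bar>D\<bar> * (\<sigma> * L2_set v J)" by (simp add: mult_left_mono)
  then show ?thesis using assms(4) by (simp add: pos_le_divide_eq algebra_simps)
qed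

lemma quadratic_sqrt_bound:
  fixes V \<kappa> B :: real
  assumes "V \<ge> 0" "V \<le> \<kappa> * V + B * sqrt V" "\<kappa> < 1" "B \<ge> 0"
  shows "V \<le> (B / (1 - \<kappa>))\<^sup>2"
proof (cases "V = 0")
  case False
  then have s: "sqrt V > 0" using assms by simp
  have "(1 - \<kappa>) * sqrt V * sqrt V = (1 - \<kappa>) * V" using assms(1) by (simp add: mult.assoc)
  also have "\<dots> \<le> B * sqrt V" using assms by (simp add: algebra_simps)
  finally have "(1 - \<kappa>) * sqrt V \<le> B" by (rule mult_right_le_imp_le[OF _ s])
  then have "sqrt V \<le> B / (1 - \<kappa>)" using assms(3) by (simp add: pos_le_divide_eq mult.commute)
  then have "(sqrt V)\<^sup>2 \<le> (B / (1 - \<kappa>))\<^sup>2" by (rule power_mono) (use s in simp)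
  then show ?thesis using assms(1) by simp
qed simp

context passive_relation
begin

text \<open>The inputs are assumed neither measurable nor bounded, and \<open>lip\<close> couples
  the ports only through sums of squares. Each port is therefore analysed through its own chain, and
  the energies are added before the loop is closed.\<close>

theorem small_gain_tendsto_zero:
  fixes f e :: "real \<Rightarrow> 'k \<Rightarrow> real" and u v :: "real \<Rightarrow> 'j \<Rightarrow> real"
  assumes J: "j1 \<in> J" "j2 \<in> J" "j1 \<noteq> j2"
    and traj: "\<And>t. t \<ge> 0 \<Longrightarrow> R (f t) (e t) (u t) (v t)"
    and f: "\<And>k T. k \<in> K \<Longrightarrow> (\<lambda>t. f t k) absolutely_integrable_on {0..T}"
    and e: "\<And>k t. k \<in> K \<Longrightarrow> t \<ge> 0 \<Longrightarrow> e t k = e 0 k + integral {0..t} (\<lambda>\<tau>. f \<tau> k)"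
    and lip: "\<And>t. t \<ge> 0 \<Longrightarrow> (\<Sum>j\<in>J. (u t j)\<^sup>2) \<le> \<sigma>\<^sup>2 * (\<Sum>j\<in>J. (v t j)\<^sup>2)"
    and \<sigma>: "\<sigma> \<ge> 0" and \<gamma>: "\<gamma> \<ge> 0" "\<bar>D\<bar> \<le> \<gamma>" "\<gamma> * \<sigma> < 1"
    and axis: "\<And>(\<omega>::real) l. (H \<longlongrightarrow> l) (at (\<i> * of_real \<omega>) within {s. Re s > 0}) \<Longrightarrow> cmod l \<le> \<gamma>"
    and j: "j \<in> J"
  shows "((\<lambda>t. v t j) \<longlongrightarrow> 0) at_top"
proof -
  define Q where "Q j L h \<mu> \<longleftrightarrow> output_chain j L h \<and> lead_coeff \<mu> = 1 \<and>
    (\<forall>z. poly (map_poly complex_of_real \<mu>) z = 0 \<longrightarrow> Re z < 0) \<and>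
    (\<forall>e. (\<Sum>i\<le>degree \<mu>. coeff \<mu> i * ip (L i) e) = (0 :: real)) \<and>
    (\<forall>s. Re s > 0 \<longrightarrow> s \<notin> P \<longrightarrow> H s * poly (map_poly complex_of_real \<mu>) s =
       poly (map_poly complex_of_real (transfer_numerator D h \<mu>)) s) \<and>
    ((\<forall>s. Re s > 0 \<longrightarrow> s \<notin> P \<longrightarrow> H s = of_real D) \<longrightarrow> (\<forall>n. h n = 0))" for j L h \<mu>
  have Q0: "\<forall>j\<in>J. \<exists>L h \<mu>. Q j L h \<mu>"
  proof
    fix j assume j: "j \<in> J"
    obtain j' where "j' \<in> J" "j' \<noteq> j" using J by (cases "j = j1") auto
    from output_system[OF j this] show "\<exists>L h \<mu>. Q j L h \<mu>" unfolding Q_def .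
  qed
  from bchoice[OF Q0] obtain L where Q1: "\<forall>j\<in>J. \<exists>h \<mu>. Q j (L j) h \<mu>" by blast
  from bchoice[OF Q1] obtain h where Q2: "\<forall>j\<in>J. \<exists>\<mu>. Q j (L j) (h j) \<mu>" by blast
  from bchoice[OF Q2] obtain \<mu> where Q: "\<forall>j\<in>J. Q j (L j) (h j) (\<mu> j)" by blast
  have chain: "output_chain j (L j) (h j)"
    and lead: "lead_coeff (\<mu> j) = 1"
    and stable: "\<And>z. poly (map_poly complex_of_real (\<mu> j)) z = 0 \<Longrightarrow> Re z < 0"
    and rel: "\<And>e. (\<Sum>i\<le>degree (\<mu> j). coeff (\<mu> j) i * ip (L j i) e) = (0 :: real)"
    and num: "\<And>s. Re s > 0 \<Longrightarrow> s \<notin> P \<Longrightarrow> H s * poly (map_poly complex_of_real (\<mu> j)) s =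
       poly (map_poly complex_of_real (transfer_numerator D (h j) (\<mu> j))) s"
    and const: "(\<forall>s. Re s > 0 \<longrightarrow> s \<notin> P \<longrightarrow> H s = of_real D) \<Longrightarrow> (\<forall>n. h j n = 0)"
    if "j \<in> J" for j
    using bspec[OF Q that] unfolding Q_def by blast+
  define y where "y j k t = ip (L j k) (e t)" for j k t
  have out: "v t j = y j 0 t + D * u t j" if "j \<in> J" "t \<ge> 0" for j t
    using chain[OF that(1)] traj[OF that(2)] unfolding output_chain_def y_def by blast
  have step: "ip (L j k) (f t) = y j (Suc k) t + h j k * u t j" if "j \<in> J" "t \<ge> 0" for j k t
    using chain[OF that(1)] traj[OF that(2)] unfolding output_chain_def y_def by blast
  have ipf: "(\<lambda>t. ip (L j k) (f t)) absolutely_integrable_on {0..T}" for j k T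
    unfolding ip_def of_real_eq_id id_def
    by (intro absolutely_integrable_sum finK set_integrable_mult_right f)
  have yint: "y j k t = y j k 0 + integral {0..t} (\<lambda>\<tau>. ip (L j k) (f \<tau>))" if "t \<ge> 0" for j k t
  proof -
    have int: "(\<lambda>\<tau>. f \<tau> i) integrable_on {0..t}" if "i \<in> K" for i
      using f[OF that] by (rule set_lebesgue_integral_eq_integral(1))
    have "integral {0..t} (\<lambda>\<tau>. ip (L j k) (f \<tau>)) = (\<Sum>i\<in>K. integral {0..t} (\<lambda>\<tau>. m i * (L j k i * f \<tau> i)))"
      unfolding ip_def of_real_eq_id id_def by (rule integral_sum[OF finK]) (intro integrable_on_mult_right int)
    also have "\<dots> = (\<Sum>i\<in>K. m i * (L j k i * (e t i - e 0 i)))"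
    proof (rule sum.cong[OF refl])
      fix i assume "i \<in> K"
      from e[OF this that] have "integral {0..t} (\<lambda>\<tau>. f \<tau> i) = e t i - e 0 i" by simp
      then show "integral {0..t} (\<lambda>\<tau>. m i * (L j k i * f \<tau> i)) = m i * (L j k i * (e t i - e 0 i))" by simp
    qed
    also have "\<dots> = y j k t - y j k 0"
      unfolding y_def ip_def of_real_eq_id id_def sum_subtractf[symmetric]
      by (rule sum.cong[OF refl]) (simp add: right_diff_distrib)
    finally show ?thesis by simp
  qed
  have ycont: "continuous_on {0..T} (y j k)" for j k T
  proof -
    have "continuous_on {0..T} (\<lambda>t. y j k 0 + integral {0..t} (\<lambda>\<tau>. ip (L j k) (f \<tau>)))"
      by (intro continuous_intros indefinite_integral_continuous_1 set_lebesgue_integral_eq_integral(1)[OF ipf])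
    then show ?thesis by (rule continuous_on_eq) (simp add: yint[symmetric])
  qed
  have yb: "bounded_integrable T (y j k)" for j k T
    by (rule bounded_integrable_continuous[OF ycont])
  have D\<sigma>: "\<bar>D\<bar> * \<sigma> < 1" using \<gamma> \<sigma> mult_right_mono[OF \<gamma>(2) \<sigma>] by simp
  have contr: "L2_set (v t) J \<le> L2_set (\<lambda>j. y j 0 t) J / (1 - \<bar>D\<bar> * \<sigma>)" if "t \<ge> 0" for t
    by (rule L2_set_contraction[OF _ lip[OF that] \<sigma> D\<sigma>]) (use out that in auto)
  \<comment> \<open>The functionals \<open>y j 0\<close> are continuous, hence bounded on compact
    intervals; \<open>contr\<close> and \<open>lip\<close> carry the bound to the input.\<close>
  have ubound: "bounded ((\<lambda>t. u t j) ` {0..T})" if "j \<in> J" for j T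
  proof -
    have "continuous_on {0..T} (\<lambda>t. L2_set (\<lambda>j. y j 0 t) J / (1 - \<bar>D\<bar> * \<sigma>))"
      unfolding L2_set_def by (intro continuous_intros ycont) (use D\<sigma> in auto)
    then have "bounded ((\<lambda>t. L2_set (\<lambda>j. y j 0 t) J / (1 - \<bar>D\<bar> * \<sigma>)) ` {0..T})"
      by (intro compact_imp_bounded compact_continuous_image) auto
    then obtain B where B': "\<forall>x\<in>(\<lambda>t. L2_set (\<lambda>j. y j 0 t) J / (1 - \<bar>D\<bar> * \<sigma>)) ` {0..T}. norm x \<le> B"
      unfolding bounded_iff by blast
    have B: "L2_set (\<lambda>j. y j 0 t) J / (1 - \<bar>D\<bar> * \<sigma>) \<le> B" if "t \<in> {0..T}" for t
      using bspec[OF B' imageI[OF that]] unfolding real_norm_def by linarith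
    have "\<bar>u t j\<bar> \<le> \<sigma> * B" if t: "t \<in> {0..T}" for t
    proof -
      have "\<bar>u t j\<bar> = sqrt ((u t j)\<^sup>2)" by simp
      also have "\<dots> \<le> sqrt (\<Sum>j\<in>J. (u t j)\<^sup>2)"
        by (rule real_sqrt_le_mono, rule member_le_sum[OF \<open>j \<in> J\<close>]) (use finJ in auto)
      also have "\<dots> \<le> \<sigma> * L2_set (v t) J"
        using real_sqrt_le_mono[OF lip[of t]] t \<sigma> by (simp add: L2_set_def real_sqrt_mult)
      also have "\<dots> \<le> \<sigma> * B" using contr[of t] B[OF t] t \<sigma> by (intro mult_left_mono) auto
      finally show ?thesis .
    qed
    then show ?thesis unfolding bounded_iff by (intro exI[of _ "\<sigma> * B"]) auto
  qed
  have prim: "primitive_on T (y j k) (\<lambda>t. y j (Suc k) t + h j k * u t j)" if "j \<in> J" for j k T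
  proof -
    have eq: "ip (L j k) (f t) = y j (Suc k) t + h j k * u t j" if "t \<in> {0..T}" for t
      by (rule step[OF \<open>j \<in> J\<close>]) (use that in auto)
    have "(\<lambda>t. y j (Suc k) t + h j k * u t j) absolutely_integrable_on {0..T}"
      by (rule iffD1[OF set_integrable_cong[OF refl refl eq] ipf])
    moreover have "bounded ((\<lambda>t. y j (Suc k) t + h j k * u t j) ` {0..T})"
    proof -
      have "bounded (y j (Suc k) ` {0..T})" using yb[of T j "Suc k"] by (simp add: bounded_integrable_def)
      moreover have "bounded ((\<lambda>t. h j k * u t j) ` {0..T})"
        using bounded_scaling[OF ubound[OF \<open>j \<in> J\<close>, of T], of "h j k"] by (simp add: image_image)
      ultimately show ?thesis by (rule bounded_plus_comp)
    qed
    ultimately have "bounded_integrable T (\<lambda>t. y j (Suc k) t + h j k * u t j)"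
      by (simp add: bounded_integrable_def)
    moreover have "y j k t = y j k 0 + integral {0..t} (\<lambda>t. y j (Suc k) t + h j k * u t j)" if "t \<in> {0..T}" for t
    proof -
      have "integral {0..t} (\<lambda>\<tau>. ip (L j k) (f \<tau>)) = integral {0..t} (\<lambda>t. y j (Suc k) t + h j k * u t j)"
        by (rule integral_cong) (use step[OF \<open>j \<in> J\<close>] in auto)
      then show ?thesis using yint[of t j k] that by simp
    qed
    ultimately show ?thesis unfolding primitive_on_def by blast
  qed
  \<comment> \<open>Stated for a signal \<open>w\<close> that may replace \<open>u\<close>: if all
    \<open>h j k\<close> vanish, zero can be used, without any regularity of the input.\<close>
  have y0_lim: "(y j 0 \<longlongrightarrow> 0) at_top"
    if j: "j \<in> J" and w: "square_integrable (\<lambda>t. of_real (w t))"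
      and wy: "\<And>k T. k < degree (\<mu> j) \<Longrightarrow> primitive_on T (y j k) (\<lambda>t. y j (Suc k) t + h j k * w t)" for j w
  proof -
    let ?\<mu> = "map_poly complex_of_real (\<mu> j)"
    obtain qs where qs: "?\<mu> = (\<Prod>q\<leftarrow>qs. [:- q, 1:])" "\<And>q. q \<in> set qs \<Longrightarrow> poly ?\<mu> q = 0"
      using monic_complex_factorization[OF lead[OF j]] by blast
    have "((\<lambda>t. complex_of_real (y j 0 t)) \<longlongrightarrow> 0) at_top"
    proof (rule observer_chain_tendsto_zero[OF qs(1) _ _ _ w, where y = "\<lambda>k t. of_real (y j k t)" and h = "\<lambda>k. of_real (h j k)"])
      show "Re q < 0" if "q \<in> set qs" for q by (rule stable[OF j qs(2)[OF that]])
      show "primitive_on T (\<lambda>t. complex_of_real (y j k t)) (\<lambda>t. of_real (y j (Suc k) t) + of_real (h j k) * of_real (w t))"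
        if "k < degree ?\<mu>" for k T
        using primitive_on_linear[OF bounded_linear_of_real wy[of k T], where 'b = complex] that
        by (simp add: degree_map_poly)
      show "(\<Sum>k\<le>degree ?\<mu>. coeff ?\<mu> k * complex_of_real (y j k t)) = 0" for t
        using arg_cong[OF rel[OF j, of "e t"], of complex_of_real]
        by (simp add: degree_map_poly coeff_map_poly y_def)
    qed
    from tendsto_Re[OF this] show ?thesis by simp
  qed
  have "(y j 0 \<longlongrightarrow> 0) at_top" if j: "j \<in> J" for j
  proof (cases "\<forall>s. Re s > 0 \<longrightarrow> s \<notin> P \<longrightarrow> H s = of_real D")
    case True
    then have h0: "h j n = 0" for n using const[OF j] by blast
    show ?thesis
    proof (rule y0_lim[OF j, of "\<lambda>t. 0"])
      show "primitive_on T (y j k) (\<lambda>t. y j (Suc k) t + h j k * 0)" for k T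
        using prim[OF j, of T k] by (simp add: h0)
    qed (auto simp: square_integrable_def bounded_integrable_const)
  next
    case False
    \<comment> \<open>Measurability of the input is not given, but a chain with some \<open>h j k \<noteq> 0\<close> recovers \<open>u\<close> from the rates.\<close>
    have ub: "bounded_integrable T (\<lambda>t. u t j)" if j: "j \<in> J" for j T
    proof -
      \<comment> \<open>Only the \<open>h j i\<close> below the degree enter
        \<open>transfer_numerator\<close>; if they all vanished, \<open>H\<close> would equal
        \<open>D\<close> in the half-plane off \<open>P\<close>.\<close>
      have "\<exists>k<degree (\<mu> j). h j k \<noteq> 0"
      proof (rule ccontr)
        assume "\<not> ?thesis"
        then have z: "h j i = 0" if "i < degree (\<mu> j)" for i using that by blast
        have "H s = of_real D" if s: "Re s > 0" "s \<notin> P" for s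
        proof -
          have "poly (map_poly complex_of_real (transfer_numerator D (h j) (\<mu> j))) s = of_real D * poly (map_poly of_real (\<mu> j)) s"
            unfolding poly_transfer_numerator by (simp add: z)
          then have "H s * poly (map_poly complex_of_real (\<mu> j)) s = of_real D * poly (map_poly of_real (\<mu> j)) s"
            using num[OF j s] by simp
          moreover have "poly (map_poly complex_of_real (\<mu> j)) s \<noteq> 0" using stable[OF j, of s] s by auto
          ultimately show ?thesis by simp
        qed
        with False show False by blast
      qed
      then obtain k where k: "k < degree (\<mu> j)" "h j k \<noteq> 0" by blast
      have "bounded_integrable T (\<lambda>t. 1 / h j k * ((y j (Suc k) t + h j k * u t j) - y j (Suc k) t))"
        by (intro bounded_integrable_cmult bounded_integrable_diff yb primitive_onD(2)[OF prim[OF j]])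
      then show ?thesis using k(2) by simp
    qed
    obtain \<delta> where \<delta>: "\<delta> > 0" "(\<gamma> + \<delta>) * (\<sigma> + \<delta>) < 1" using small_gain_margin[OF \<gamma>(1) \<sigma> \<gamma>(3)] by blast
    define \<gamma>' \<sigma>' where "\<gamma>' = \<gamma> + \<delta>" and "\<sigma>' = \<sigma> + \<delta>"
    have pos: "\<gamma>' > 0" "\<sigma>' > 0" "\<gamma>' * \<sigma>' < 1" "\<sigma> \<le> \<sigma>'" "\<gamma> \<le> \<gamma>'" using \<delta> \<gamma> \<sigma> by (auto simp: \<gamma>'_def \<sigma>'_def)
    define U where "U j T = integral {0..T} (\<lambda>t. (u t j)\<^sup>2)" for j T
    define V where "V j T = integral {0..T} (\<lambda>t. (y j 0 t + D * u t j)\<^sup>2)" for j T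
    have "\<exists>B\<ge>0. \<forall>T\<ge>0. \<forall>\<theta>>0. V j T \<le> \<theta> / 2 * U j T + \<gamma>'\<^sup>2 / (2 * \<theta>) * V j T + B * sqrt (V j T)"
      if j: "j \<in> J" for j
      unfolding U_def V_def
    proof (rule observer_chain_gain[where y = "y j" and u = "\<lambda>t. u t j" and h = "h j" and \<mu> = "\<mu> j" and D = D and \<gamma> = \<gamma>'])
      show "lead_coeff (\<mu> j) = 1" by (rule lead[OF j])
      show "Re z < 0" if "poly (map_poly complex_of_real (\<mu> j)) z = 0" for z by (rule stable[OF j that])
      show "primitive_on T (y j k) (\<lambda>t. y j (Suc k) t + h j k * u t j)" for k T by (rule prim[OF j])
      show "bounded_integrable T (y j (degree (\<mu> j)))" for T by (rule yb)
      show "bounded_integrable T (\<lambda>t. u t j)" for T by (rule ub[OF j])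
      show "(\<Sum>k\<le>degree (\<mu> j). coeff (\<mu> j) k * y j k t) = 0" for t using rel[OF j] by (simp add: y_def)
      fix \<omega> :: real
      let ?n = "map_poly complex_of_real (transfer_numerator D (h j) (\<mu> j))" and ?m = "map_poly complex_of_real (\<mu> j)"
      let ?F = "at (\<i> * of_real \<omega>) within {s. Re s > 0}"
      obtain l where l: "(H \<longlongrightarrow> l) ?F" using H_axis by blast
      \<comment> \<open>\<open>num\<close> holds off \<open>P\<close> in the open half-plane; the
        limit carries it to the axis, where the gain is given.\<close>
      have "((\<lambda>s. H s * poly ?m s) \<longlongrightarrow> l * poly ?m (\<i> * of_real \<omega>)) ?F"
        by (intro tendsto_intros l)
      moreover have "\<forall>\<^sub>F s in ?F. H s * poly ?m s = poly ?n s"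
        using eventually_regular_axis by eventually_elim (use num[OF j] in auto)
      ultimately have "((\<lambda>s. poly ?n s) \<longlongrightarrow> l * poly ?m (\<i> * of_real \<omega>)) ?F"
        by (rule Lim_transform_eventually)
      moreover have "((\<lambda>s. poly ?n s) \<longlongrightarrow> poly ?n (\<i> * of_real \<omega>)) ?F" by (intro tendsto_intros)
      moreover have "?F \<noteq> bot" by (rule axis_not_bot) simp
      ultimately have "poly ?n (\<i> * of_real \<omega>) = l * poly ?m (\<i> * of_real \<omega>)" using tendsto_unique by blast
      then have "cmod (poly ?n (\<i> * of_real \<omega>)) = cmod l * cmod (poly ?m (\<i> * of_real \<omega>))" by (simp add: norm_mult)
      also have "\<dots> \<le> \<gamma>' * cmod (poly ?m (\<i> * of_real \<omega>))"
        using axis[OF l] pos by (intro mult_right_mono) auto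
      finally show "cmod (poly ?n (\<i> * of_real \<omega>)) \<le> \<gamma>' * cmod (poly ?m (\<i> * of_real \<omega>))" .
    qed
    then have "\<forall>j\<in>J. \<exists>B\<ge>0. \<forall>T\<ge>0. \<forall>\<theta>>0. V j T \<le> \<theta> / 2 * U j T + \<gamma>'\<^sup>2 / (2 * \<theta>) * V j T + B * sqrt (V j T)" by blast
    from bchoice[OF this] obtain B where B: "\<And>j. j \<in> J \<Longrightarrow> B j \<ge> 0"
      "\<And>j T \<theta>. j \<in> J \<Longrightarrow> T \<ge> 0 \<Longrightarrow> \<theta> > 0 \<Longrightarrow> V j T \<le> \<theta> / 2 * U j T + \<gamma>'\<^sup>2 / (2 * \<theta>) * V j T + B j * sqrt (V j T)"
      by blast
    define C where "C = (\<Sum>j\<in>J. B j)"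
    have C0: "C \<ge> 0" unfolding C_def by (rule sum_nonneg[OF B(1)])
    note ii = bounded_integrable_integrable[OF _ order_refl order_refl]
    have ub2: "bounded_integrable T (\<lambda>t. (u t j)\<^sup>2)" and vb2: "bounded_integrable T (\<lambda>t. (y j 0 t + D * u t j)\<^sup>2)"
      if "j \<in> J" for j T
      unfolding power2_eq_square
      by (intro bounded_integrable_mult bounded_integrable_add bounded_integrable_cmult yb ub that)+
    have U0: "U j T \<ge> 0" and V0: "V j T \<ge> 0" if "j \<in> J" for j T
      unfolding U_def V_def
      by (rule Henstock_Kurzweil_Integration.integral_nonneg[OF ii[OF ub2[OF that]]], simp)
        (rule Henstock_Kurzweil_Integration.integral_nonneg[OF ii[OF vb2[OF that]]], simp)
    have UV: "(\<Sum>j\<in>J. U j T) \<le> \<sigma>'\<^sup>2 * (\<Sum>j\<in>J. V j T)" for T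
    proof -
      have "(\<Sum>j\<in>J. U j T) = integral {0..T} (\<lambda>t. \<Sum>j\<in>J. (u t j)\<^sup>2)"
        unfolding U_def by (rule integral_sum[symmetric, OF finJ ii[OF ub2]])
      also have "\<dots> \<le> integral {0..T} (\<lambda>t. \<sigma>'\<^sup>2 * (\<Sum>j\<in>J. (y j 0 t + D * u t j)\<^sup>2))"
      proof (rule integral_le)
        show "(\<lambda>t. \<Sum>j\<in>J. (u t j)\<^sup>2) integrable_on {0..T}" by (intro integrable_sum finJ ii ub2)
        show "(\<lambda>t. \<sigma>'\<^sup>2 * (\<Sum>j\<in>J. (y j 0 t + D * u t j)\<^sup>2)) integrable_on {0..T}"
          by (intro integrable_on_mult_right integrable_sum finJ ii vb2)
        fix t assume "t \<in> {0..T}"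
        then have t: "t \<ge> 0" by simp
        have "(\<Sum>j\<in>J. (u t j)\<^sup>2) \<le> \<sigma>\<^sup>2 * (\<Sum>j\<in>J. (v t j)\<^sup>2)" by (rule lip[OF t])
        also have "\<dots> \<le> \<sigma>'\<^sup>2 * (\<Sum>j\<in>J. (v t j)\<^sup>2)"
          using pos(4) \<sigma> by (intro mult_right_mono power_mono sum_nonneg) auto
        finally show "(\<Sum>j\<in>J. (u t j)\<^sup>2) \<le> \<sigma>'\<^sup>2 * (\<Sum>j\<in>J. (y j 0 t + D * u t j)\<^sup>2)"
          using out t by simp
      qed
      also have "\<dots> = \<sigma>'\<^sup>2 * (\<Sum>j\<in>J. V j T)"
        unfolding V_def by (simp add: integral_sum[OF finJ ii[OF vb2]])
      finally show ?thesis .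
    qed
    \<comment> \<open>The choice of \<open>\<theta>\<close> that makes the two quadratic terms equal.\<close>
    define \<theta> where "\<theta> = \<gamma>' / \<sigma>'"
    have \<theta>: "\<theta> > 0" using pos by (simp add: \<theta>_def)
    have Vbound: "(\<Sum>j\<in>J. V j T) \<le> (C / (1 - \<gamma>' * \<sigma>'))\<^sup>2" if T: "T \<ge> 0" for T
    proof (rule quadratic_sqrt_bound)
      let ?V = "\<Sum>j\<in>J. V j T"
      show "?V \<ge> 0" by (rule sum_nonneg[OF V0])
      have "?V \<le> (\<Sum>j\<in>J. \<theta> / 2 * U j T + \<gamma>'\<^sup>2 / (2 * \<theta>) * V j T + B j * sqrt ?V)"
      proof (rule sum_mono)
        fix j assume j: "j \<in> J"
        have "V j T \<le> ?V" by (rule member_le_sum[OF j]) (use V0 finJ in auto)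
        then have "B j * sqrt (V j T) \<le> B j * sqrt ?V" by (intro mult_left_mono B(1)[OF j]) simp
        then show "V j T \<le> \<theta> / 2 * U j T + \<gamma>'\<^sup>2 / (2 * \<theta>) * V j T + B j * sqrt ?V"
          using B(2)[OF j T \<theta>] by linarith
      qed
      also have "\<dots> = \<theta> / 2 * (\<Sum>j\<in>J. U j T) + \<gamma>'\<^sup>2 / (2 * \<theta>) * ?V + C * sqrt ?V"
        unfolding C_def by (simp only: sum.distrib sum_distrib_left sum_distrib_right)
      also have "\<theta> / 2 * (\<Sum>j\<in>J. U j T) \<le> \<theta> / 2 * (\<sigma>'\<^sup>2 * ?V)"
        by (rule mult_left_mono[OF UV]) (use \<theta> in simp)
      also have "\<theta> / 2 * (\<sigma>'\<^sup>2 * ?V) = \<gamma>' * \<sigma>' / 2 * ?V"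
        using pos by (simp add: \<theta>_def power2_eq_square)
      also have "\<gamma>'\<^sup>2 / (2 * \<theta>) * ?V = \<gamma>' * \<sigma>' / 2 * ?V"
        using pos by (simp add: \<theta>_def power2_eq_square)
      finally show "?V \<le> \<gamma>' * \<sigma>' * ?V + C * sqrt ?V" by simp
    qed (use pos C0 in auto)
    have "square_integrable (\<lambda>t. complex_of_real (u t j))"
      unfolding square_integrable_def
    proof (intro conjI allI exI impI)
      show "bounded_integrable T (\<lambda>t. complex_of_real (u t j))" for T
        by (rule bounded_integrable_linear[OF bounded_linear_of_real ub[OF j]])
      fix T :: real assume T: "0 \<le> T"
      have "U j T \<le> (\<Sum>j\<in>J. U j T)" by (rule member_le_sum[OF j]) (use U0 finJ in auto)
      also have "\<dots> \<le> \<sigma>'\<^sup>2 * (\<Sum>j\<in>J. V j T)" by (rule UV)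
      also have "\<dots> \<le> \<sigma>'\<^sup>2 * (C / (1 - \<gamma>' * \<sigma>'))\<^sup>2" by (rule mult_left_mono[OF Vbound[OF T]]) simp
      finally show "integral {0..T} (\<lambda>t. (cmod (complex_of_real (u t j)))\<^sup>2) \<le> \<sigma>'\<^sup>2 * (C / (1 - \<gamma>' * \<sigma>'))\<^sup>2"
        by (simp add: U_def)
    qed
    then show ?thesis by (rule y0_lim[OF j _ prim[OF j]])
  qed
  then have "((\<lambda>t. L2_set (\<lambda>j. y j 0 t) J / (1 - \<bar>D\<bar> * \<sigma>)) \<longlongrightarrow> sqrt (\<Sum>j\<in>J. 0\<^sup>2) / (1 - \<bar>D\<bar> * \<sigma>)) at_top"
    unfolding L2_set_def by (intro tendsto_intros) (use D\<sigma> in auto)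
  then have lim: "((\<lambda>t. L2_set (\<lambda>j. y j 0 t) J / (1 - \<bar>D\<bar> * \<sigma>)) \<longlongrightarrow> 0) at_top" by simp
  have "\<forall>\<^sub>F t in at_top. norm (v t j) \<le> L2_set (\<lambda>j. y j 0 t) J / (1 - \<bar>D\<bar> * \<sigma>)"
    using eventually_ge_at_top[of 0]
  proof eventually_elim
    case (elim t)
    have "\<bar>v t j\<bar> = sqrt ((v t j)\<^sup>2)" by simp
    also have "\<dots> \<le> L2_set (v t) J"
      unfolding L2_set_def by (rule real_sqrt_le_mono, rule member_le_sum[OF j]) (use finJ in auto)
    finally show ?case using contr[OF elim] by simp
  qed
  then show ?thesis by (rule Lim_null_comparison[OF _ lim])
qed

end

subsection \<open>Transfer functions\<close>

abbreviation cpoly :: "real poly \<Rightarrow> complex poly" where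
  "cpoly \<equiv> map_poly complex_of_real"

lemma cpoly_mult: "cpoly (p * q) = cpoly p * cpoly q"
  by (intro poly_eqI) (simp add: coeff_map_poly coeff_mult)

lemma cpoly_1: "cpoly 1 = 1"
  by (intro poly_eqI) (simp add: coeff_map_poly)

lemma poly_cpoly_real: "poly (cpoly p) (of_real x) = of_real (poly p x)"
  by (simp add: poly_altdef degree_map_poly coeff_map_poly)

lemma MOST_cpoly_nonzero:
  assumes "p \<noteq> 0"
  shows "MOST s. poly (cpoly p) s \<noteq> 0"
proof -
  have "cpoly p \<noteq> 0" using assms by (metis coeff_0 coeff_map_poly of_real_0 of_real_eq_0_iff poly_eqI)
  then show ?thesis unfolding eventually_cofinite by (simp add: poly_roots_finite)
qed

text \<open>Values belong to the reduced fraction. Another representation agrees with it off the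
  zeros of the two denominators, which is why this and the later evaluation rules are stated for all
  but finitely many \<open>s\<close>.\<close>

lemma tf_eval_Fract:
  assumes "b \<noteq> 0"
  shows "MOST s. tf_eval (Fract a b) s = poly (cpoly a) s / poly (cpoly b) s"
proof -
  define n d where "n = fst (quot_of_fract (Fract a b))" and "d = snd (quot_of_fract (Fract a b))"
  have d: "d \<noteq> 0" by (simp add: d_def)
  have "Fract n d = Fract a b" unfolding n_def d_def by (rule Fract_quot_of_fract)
  then have nd: "n * b = a * d" using assms d by (simp add: eq_fract)
  show ?thesis
    using MOST_cpoly_nonzero[OF assms] MOST_cpoly_nonzero[OF d]
  proof eventually_elim
    case (elim s)
    have "poly (cpoly n) s * poly (cpoly b) s = poly (cpoly a) s * poly (cpoly d) s"
      using arg_cong[OF nd, of "\<lambda>p. poly (cpoly p) s"] by (simp add: cpoly_mult)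
    then show ?case using elim unfolding tf_eval_def n_def[symmetric] d_def[symmetric] by (simp add: frac_eq_eq)
  qed
qed

lemma tf_cases:
  obtains a b where "h = Fract a b" "b \<noteq> 0" "MOST s. tf_eval h s = poly (cpoly a) s / poly (cpoly b) s" "MOST s. poly (cpoly b) s \<noteq> 0"
proof (cases h)
  case (Fract a b)
  show ?thesis by (rule that[OF Fract(1,2)]) (use Fract tf_eval_Fract MOST_cpoly_nonzero in auto)
qed

lemma tf_eval_0 [simp]: "tf_eval 0 s = 0"
  by (simp add: tf_eval_def)

lemma tf_eval_1 [simp]: "tf_eval 1 s = 1"
  by (simp add: tf_eval_def cpoly_1)

lemma tf_eval_add: "MOST s. tf_eval (g + h) s = tf_eval g s + tf_eval h s"
proof (cases g rule: tf_cases)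
  case g: (1 a b)
  show ?thesis
  proof (cases h rule: tf_cases)
    case h: (1 c d)
    have "g + h = Fract (a * d + c * b) (b * d)" "b * d \<noteq> 0" using g h by auto
    with tf_eval_Fract[of "b * d" "a * d + c * b"]
    have "MOST s. tf_eval (g + h) s = poly (cpoly (a * d + c * b)) s / poly (cpoly (b * d)) s" by simp
    then show ?thesis using g(3,4) h(3,4)
      by eventually_elim (simp add: cpoly_mult of_real_poly_add add_frac_eq)
  qed
qed

lemma tf_eval_mult: "MOST s. tf_eval (g * h) s = tf_eval g s * tf_eval h s"
proof (cases g rule: tf_cases)
  case g: (1 a b)
  show ?thesis
  proof (cases h rule: tf_cases)
    case h: (1 c d)
    have "g * h = Fract (a * c) (b * d)" "b * d \<noteq> 0" using g h by auto
    with tf_eval_Fract[of "b * d" "a * c"]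
    have "MOST s. tf_eval (g * h) s = poly (cpoly (a * c)) s / poly (cpoly (b * d)) s" by simp
    then show ?thesis using g(3,4) h(3,4)
      by eventually_elim (simp add: cpoly_mult)
  qed
qed

lemma tf_eval_nonzero:
  assumes "h \<noteq> 0"
  shows "MOST s. tf_eval h s \<noteq> 0"
proof (cases h rule: tf_cases)
  case (1 a b)
  then have "a \<noteq> 0" using assms by (auto simp: rat_number_collapse fract_collapse)
  from MOST_cpoly_nonzero[OF this] 1(3,4) show ?thesis by eventually_elim simp
qed

lemma tf_eval_divide:
  assumes "h \<noteq> 0"
  shows "MOST s. tf_eval (g / h) s = tf_eval g s / tf_eval h s"
proof -
  have "g = g / h * h" using assms by simp
  then have "MOST s. tf_eval g s = tf_eval (g / h) s * tf_eval h s" using tf_eval_mult[of "g / h" h] by simp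
  then show ?thesis using tf_eval_nonzero[OF assms] by eventually_elim (simp add: nonzero_eq_divide_eq)
qed

lemma tf_eval_uminus: "MOST s. tf_eval (- h) s = - tf_eval h s"
proof -
  have "MOST s. tf_eval (h + - h) s = tf_eval h s + tf_eval (- h) s" by (rule tf_eval_add)
  then show ?thesis by eventually_elim (simp add: eq_neg_iff_add_eq_0 add.commute)
qed

lemma tf_eval_diff: "MOST s. tf_eval (g - h) s = tf_eval g s - tf_eval h s"
  using tf_eval_add[of g "- h"] tf_eval_uminus[of h] by eventually_elim simp

lemma tf_eval_sum:
  assumes "finite I"
  shows "MOST s. tf_eval (\<Sum>i\<in>I. h i) s = (\<Sum>i\<in>I. tf_eval (h i) s)"
  using assms
proof (induction I)
  case (insert i I)
  show ?case using insert.IH tf_eval_add[of "h i" "\<Sum>i\<in>I. h i"]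
    by eventually_elim (simp add: insert.hyps)
qed simp

lemma tf_eval_of_nat: "MOST s. tf_eval (of_nat n) s = of_nat n"
proof (induction n)
  case (Suc n)
  show ?case using Suc tf_eval_add[of 1 "of_nat n"] by eventually_elim simp
qed simp

lemma tf_eval_real: "\<exists>r. tf_eval h (of_real x) = of_real r"
  unfolding tf_eval_def poly_cpoly_real of_real_divide[symmetric] by blast

lemma MOST_large_real:
  assumes "MOST s. Q s"
  shows "\<forall>\<^sub>F x in at_top. Q (complex_of_real x)"
proof -
  have "finite (complex_of_real -` {s. \<not> Q s})"
    using assms by (intro finite_vimageI) (auto simp: eventually_cofinite inj_def)
  then obtain B where "\<forall>x\<in>complex_of_real -` {s. \<not> Q s}. x \<le> B"
    using bdd_above_finite[of "complex_of_real -` {s. \<not> Q s}"] by (auto simp: bdd_above_def)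
  then show ?thesis
    by (intro eventually_mono[OF eventually_gt_at_top[of B]]) force
qed

lemma poly_quotient_tendsto:
  fixes p q :: "complex poly"
  assumes "degree p \<le> degree q" "q \<noteq> 0"
  shows "((\<lambda>x. poly p x / poly q x) \<longlongrightarrow> coeff p (degree q) / lead_coeff q) at_infinity"
proof (cases "degree p = degree q")
  case False
  then show ?thesis using assms poly_divide_tendsto_0_at_infinity[of p q] by (simp add: coeff_eq_0)
next
  case True
  have "((\<lambda>x. (poly p x / x ^ degree p) / (poly q x / x ^ degree q)) \<longlongrightarrow> lead_coeff p / lead_coeff q) at_infinity"
    by (intro tendsto_divide poly_divide_tendsto_aux) (use assms in auto)
  moreover have "\<forall>\<^sub>F x::complex in at_infinity. (poly p x / x ^ degree p) / (poly q x / x ^ degree q) = poly p x / poly q x"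
    using eventually_not_equal_at_infinity[of 0] by eventually_elim (simp add: True)
  ultimately show ?thesis using True by (simp add: Lim_transform_eventually)
qed

lemma hinf_norm_bound:
  assumes "hinf_norm_defined h"
  shows "cmod (tf_eval h (\<i> * of_real \<omega>)) \<le> hinf_norm h"
  unfolding hinf_norm_def by (rule cSUP_upper) (use assms in \<open>auto simp: hinf_norm_defined_def\<close>)

lemma hinf_norm_nonneg: "hinf_norm_defined h \<Longrightarrow> hinf_norm h \<ge> 0"
  using hinf_norm_bound[of h 0] norm_ge_zero order_trans by blast

lemma tf_eval_tendsto_axis:
  assumes "hinf_norm_defined h"
  shows "(tf_eval h \<longlongrightarrow> tf_eval h (\<i> * of_real \<omega>)) (at (\<i> * of_real \<omega>) within A)"
proof -
  have "poly (cpoly (snd (quot_of_fract h))) (\<i> * of_real \<omega>) \<noteq> 0"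
    using assms unfolding hinf_norm_defined_def tf_poles_def by force
  then show ?thesis unfolding tf_eval_def[abs_def] by (intro tendsto_intros)
qed

lemma imaginary_axis_at_infinity: "filterlim (\<lambda>\<omega>. \<i> * complex_of_real \<omega>) at_infinity at_top"
  by (rule filterlim_norm_at_top_imp_at_infinity)
    (use filterlim_abs_real in \<open>simp add: norm_mult\<close>)

text \<open>Boundedness on the axis makes the fraction proper: otherwise the reciprocal would tend
  to zero along the axis, although its modulus is at least \<open>1 / (hinf_norm h + 1)\<close>
  there, where the 1 guards against a zero norm. A proper fraction has the same limit in all
  directions, so the limit along the reals obeys the bound from the axis.\<close>

lemma tf_eval_tendsto_infinity:
  assumes "hinf_norm_defined h"
  obtains D where "((\<lambda>x. tf_eval h (complex_of_real x)) \<longlongrightarrow> of_real D) at_top" "\<bar>D\<bar> \<le> hinf_norm h"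
proof -
  define n d where "n = fst (quot_of_fract h)" and "d = snd (quot_of_fract h)"
  have d: "d \<noteq> 0" by (simp add: d_def)
  then have cd: "cpoly d \<noteq> 0" by (metis coeff_0 coeff_map_poly of_real_0 of_real_eq_0_iff poly_eqI)
  have h: "tf_eval h s = poly (cpoly n) s / poly (cpoly d) s" for s by (simp add: tf_eval_def n_def d_def)
  have deg: "degree n \<le> degree d"
  proof (rule ccontr)
    assume "\<not> ?thesis"
    then have lt: "degree (cpoly n) > degree (cpoly d)" by (simp add: degree_map_poly)
    then have "cpoly n \<noteq> 0" by auto
    have "((\<lambda>\<omega>. poly (cpoly d) (\<i> * of_real \<omega>) / poly (cpoly n) (\<i> * of_real \<omega>)) \<longlongrightarrow> 0) at_top"
      by (rule filterlim_compose[OF poly_divide_tendsto_0_at_infinity[OF lt] imaginary_axis_at_infinity])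
    then have "((\<lambda>\<omega>. cmod (poly (cpoly d) (\<i> * of_real \<omega>) / poly (cpoly n) (\<i> * of_real \<omega>))) \<longlongrightarrow> 0) at_top"
      by (rule tendsto_norm_zero)
    moreover have "\<forall>\<^sub>F \<omega> in at_top. 1 / (hinf_norm h + 1) \<le> cmod (poly (cpoly d) (\<i> * of_real \<omega>) / poly (cpoly n) (\<i> * of_real \<omega>))"
    proof -
      have "finite {s. poly (cpoly n * cpoly d) s = 0}" using \<open>cpoly n \<noteq> 0\<close> cd by (intro poly_roots_finite) simp
      then have "finite ((\<lambda>\<omega>. \<i> * complex_of_real \<omega>) -` {s. poly (cpoly n * cpoly d) s = 0})"
        by (intro finite_vimageI) (auto simp: inj_def)
      from bdd_above_finite[OF this]
      obtain B where B: "\<And>\<omega>. poly (cpoly n * cpoly d) (\<i> * of_real \<omega>) = 0 \<Longrightarrow> \<omega> \<le> B"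
        by (auto simp: bdd_above_def)
      show ?thesis using eventually_gt_at_top[of B]
      proof eventually_elim
        case (elim \<omega>)
        then have nz: "poly (cpoly n) (\<i> * of_real \<omega>) \<noteq> 0" "poly (cpoly d) (\<i> * of_real \<omega>) \<noteq> 0"
          using B[of \<omega>] by auto
        have le: "cmod (poly (cpoly n) (\<i> * of_real \<omega>)) / cmod (poly (cpoly d) (\<i> * of_real \<omega>)) \<le> hinf_norm h + 1"
          using hinf_norm_bound[OF assms, of \<omega>] unfolding h norm_divide by simp
        have "1 / (hinf_norm h + 1) \<le> 1 / (cmod (poly (cpoly n) (\<i> * of_real \<omega>)) / cmod (poly (cpoly d) (\<i> * of_real \<omega>)))"
          by (rule divide_left_mono[OF le]) (use nz hinf_norm_nonneg[OF assms] in auto)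
        then show ?case by (simp add: norm_divide)
      qed
    qed
    ultimately have "1 / (hinf_norm h + 1) \<le> 0" by (rule tendsto_lowerbound) simp
    then show False using hinf_norm_nonneg[OF assms] by simp
  qed
  have lim: "(tf_eval h \<longlongrightarrow> coeff (cpoly n) (degree (cpoly d)) / lead_coeff (cpoly d)) at_infinity"
    unfolding h[abs_def] by (rule poly_quotient_tendsto) (use deg cd in \<open>simp_all add: degree_map_poly\<close>)
  define D where "D = coeff n (degree d) / lead_coeff d"
  have D: "coeff (cpoly n) (degree (cpoly d)) / lead_coeff (cpoly d) = of_real D"
    by (simp add: D_def degree_map_poly coeff_map_poly)
  have "((\<lambda>x. tf_eval h (complex_of_real x)) \<longlongrightarrow> of_real D) at_top"
    by (rule filterlim_compose[OF lim[unfolded D]])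
      (rule filterlim_compose[OF filterlim_of_real_at_infinity filterlim_mono[OF filterlim_ident order_refl]], simp add: at_top_le_at_infinity)
  moreover have "((\<lambda>\<omega>. tf_eval h (\<i> * complex_of_real \<omega>)) \<longlongrightarrow> of_real D) at_top"
    by (rule filterlim_compose[OF lim[unfolded D] imaginary_axis_at_infinity])
  then have "((\<lambda>\<omega>. cmod (tf_eval h (\<i> * complex_of_real \<omega>))) \<longlongrightarrow> cmod (of_real D)) at_top"
    by (rule tendsto_norm)
  then have "cmod (of_real D) \<le> hinf_norm h"
    by (rule tendsto_upperbound) (auto intro: always_eventually hinf_norm_bound[OF assms])
  ultimately show ?thesis using that by simp
qed

text \<open>Both kinds of source are continuous and, on each compact interval, differentiable off a
  finite set. The fundamental theorem for such functions integrates \<open>g'\<close> without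
  continuity of the derivative, and \<open>g'\<close> is bounded by the supremum of the
  slopes.\<close>

lemma lipschitz_bound_of_slopes:
  assumes g: "(\<forall>x. g differentiable (at x)) \<or> piecewise_linear g" and bdd: "bdd_above (abs ` slopes g)"
  shows "\<bar>g a - g b\<bar> \<le> source_gain g * \<bar>a - b\<bar>" and "source_gain g \<ge> 0"
proof -
  have slope: "\<bar>D\<bar> \<le> source_gain g" if "(g has_real_derivative D) (at x)" for D x
    unfolding source_gain_def by (rule cSUP_upper[OF _ bdd]) (use that in \<open>auto simp: slopes_def\<close>)
  have sub: "\<exists>F. finite F \<and> continuous_on {a..b} g \<and> (\<forall>x\<in>{a<..<b} - F. \<exists>D. (g has_real_derivative D) (at x))" for a b
    using g
  proof
    assume d: "\<forall>x. g differentiable (at x)"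
    then have "continuous_on {a..b} g"
      by (intro continuous_at_imp_continuous_on) (auto intro: differentiable_imp_continuous_within)
    then show ?thesis using d by (intro exI[of _ "{}"]) (auto simp: real_differentiable_def)
  next
    assume pl: "piecewise_linear g"
    then obtain Z where Z: "\<And>a b. finite (Z \<inter> {a..b})"
      "\<And>x. x \<notin> Z \<Longrightarrow> \<exists>\<alpha> \<beta>. \<forall>\<^sub>F u in nhds x. g u = \<alpha> * u + \<beta>"
      unfolding piecewise_linear_def by blast
    have "\<exists>D. (g has_real_derivative D) (at x)" if x: "x \<notin> Z" for x
    proof -
      obtain \<alpha> \<beta> where ev: "\<forall>\<^sub>F u in nhds x. g u = \<alpha> * u + \<beta>" using Z(2)[OF x] by blast
      have "((\<lambda>u. \<alpha> * u + \<beta>) has_real_derivative \<alpha>) (at x)" by (auto intro!: derivative_eq_intros)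
      then have "(g has_real_derivative \<alpha>) (at x)" using DERIV_cong_ev[OF refl ev refl] by blast
      then show ?thesis by blast
    qed
    moreover have "continuous_on {a..b} g"
      using pl unfolding piecewise_linear_def by (blast intro: continuous_on_subset)
    ultimately show ?thesis using Z(1)[of a b] by (intro exI[of _ "Z \<inter> {a..b}"]) auto
  qed
  show nonneg: "source_gain g \<ge> 0"
  proof -
    \<comment> \<open>A point of differentiability shows that the supremum is taken over a nonempty
      set of absolute values.\<close>
    obtain F where F: "finite F" "\<forall>x\<in>{0<..<1::real} - F. \<exists>D. (g has_real_derivative D) (at x)" using sub by blast
    have "infinite ({0<..<1::real} - F)" using F(1) by (simp add: infinite_Ioo)
    then obtain x where "x \<in> {0<..<1::real} - F" by (metis equals0I finite.emptyI)
    then obtain D where "(g has_real_derivative D) (at x)" using F(2) by blast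
    from slope[OF this] show ?thesis by linarith
  qed
  have "\<bar>g b - g a\<bar> \<le> source_gain g * (b - a)" if ab: "a \<le> b" for a b
  proof -
    obtain F where F: "finite F" "continuous_on {a..b} g" "\<forall>x\<in>{a<..<b} - F. \<exists>D. (g has_real_derivative D) (at x)"
      using sub by blast
    from F(3) have "\<exists>g'. \<forall>x\<in>{a<..<b} - F. (g has_real_derivative g' x) (at x)" by (rule bchoice)
    then obtain g' where g': "\<And>x. x \<in> {a<..<b} - F \<Longrightarrow> (g has_real_derivative g' x) (at x)" by blast
    have "(g' has_integral (g b - g a)) {a..b}"
      by (rule fundamental_theorem_of_calculus_interior_strong[OF F(1) ab _ F(2)])
        (use g' in \<open>auto simp: has_real_derivative_iff_has_vector_derivative\<close>)
    then have "norm (g b - g a) \<le> source_gain g * Sigma_Algebra.measure lborel (cbox a b)"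
      using F(1) g' slope nonneg
      by (intro has_integral_bound_spike_finite[of _ "F \<union> {a, b}" g']) (auto simp: less_le)
    then show ?thesis using ab by simp
  qed
  from this[of a b] this[of b a] show "\<bar>g a - g b\<bar> \<le> source_gain g * \<bar>a - b\<bar>"
    by (cases "a \<le> b") (auto simp: abs_minus_commute)
qed

subsection \<open>Circuits as static relations\<close>

text \<open>Common to both domains: with \<open>f = s * e\<close> these are the laws at frequency
  \<open>s\<close>, with \<open>f\<close> the rate of \<open>e\<close> those in time.\<close>

fun static_law :: "element \<Rightarrow> (nat \<Rightarrow> 'a::real_field) \<Rightarrow> (nat \<Rightarrow> 'a) \<Rightarrow> 'a \<Rightarrow> 'a \<Rightarrow> bool" where
  "static_law (Resistor r x) V J f e \<longleftrightarrow> V 0 = of_real r * J 0 \<and> f = 0 \<and> e = 0"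
| "static_law (Inductor l x) V J f e \<longleftrightarrow> V 0 = of_real l * f \<and> e = J 0"
| "static_law (Capacitor c x) V J f e \<longleftrightarrow> J 0 = of_real c * f \<and> e = V 0"
| "static_law (Transformer n x y) V J f e \<longleftrightarrow>
     V 0 = of_real n * V 1 \<and> J 1 = - (of_real n * J 0) \<and> f = 0 \<and> e = 0"
| "static_law (Gyrator r x y) V J f e \<longleftrightarrow>
     V 0 = - (of_real r * J 1) \<and> V 1 = of_real r * J 0 \<and> f = 0 \<and> e = 0"

text \<open>The weights of the stored energy. The default keeps every weight positive, and the
  states it multiplies are zero.\<close>

fun storage :: "element \<Rightarrow> real" where
  "storage (Inductor l x) = l"
| "storage (Capacitor c x) = c"
| "storage _ = 1"

text \<open>
  The equations of a circuit at one instant (or one frequency): \<open>e k\<close> is the state of the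
  \<open>k\<close>-th element (inductor current or capacitor voltage) and \<open>f k\<close> its rate of change; both are
  zero for elements without state.
\<close>

definition static_oneport :: "circuit \<Rightarrow> 'a::real_field \<Rightarrow> 'a \<Rightarrow> (nat \<Rightarrow> 'a) \<Rightarrow> (nat \<Rightarrow> 'a) \<Rightarrow> bool" where
  "static_oneport c v i f e \<longleftrightarrow>
     (\<exists>\<phi> J. \<phi> 0 - \<phi> 1 = v \<and> kcl c J i \<and>
       (\<forall>k<length c. static_law (c ! k) (port_voltage c \<phi> k) (J k) (f k) (e k)))"

lemma storage_pos: "passive_element x \<Longrightarrow> storage x > 0"
  by (cases x) auto

text \<open>Kirchhoff's current law at each node is weighted with the potential and summed. Node
  names are arbitrary natural numbers, so the sum runs over the finite set \<open>X\<close> of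
  terminals and nodes in use.\<close>

lemma tellegen:
  assumes "kcl c J i"
  shows "(\<Sum>k<length c. \<Sum>p<length (ports (c ! k)). port_voltage c \<phi> k p * J k p) = (\<phi> 0 - \<phi> 1) * i"
proof -
  define X where "X = {0, 1} \<union> (\<Union>k<length c. \<Union>p<length (ports (c ! k)). {fst (ports (c ! k) ! p), snd (ports (c ! k) ! p)})"
  have X: "finite X" "0 \<in> X" "1 \<in> X"
    "\<And>k p. k < length c \<Longrightarrow> p < length (ports (c ! k)) \<Longrightarrow> fst (ports (c ! k) ! p) \<in> X \<and> snd (ports (c ! k) ! p) \<in> X"
    by (auto simp: X_def)
  have pick: "(\<Sum>x\<in>X. \<phi> x * of_bool (a = x)) = \<phi> a" if "a \<in> X" for a
  proof -
    have "(\<Sum>x\<in>X. \<phi> x * of_bool (a = x)) = (\<Sum>x\<in>{a}. \<phi> x * of_bool (a = x))"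
      by (rule sum.mono_neutral_right) (use X(1) that in auto)
    then show ?thesis by simp
  qed
  have "(\<Sum>k<length c. \<Sum>p<length (ports (c ! k)). port_voltage c \<phi> k p * J k p) =
      (\<Sum>k<length c. \<Sum>p<length (ports (c ! k)). \<Sum>x\<in>X. \<phi> x *
        ((of_bool (fst (ports (c ! k) ! p) = x) - of_bool (snd (ports (c ! k) ! p) = x)) * J k p))"
  proof (intro sum.cong refl)
    fix k p assume "k \<in> {..<length c}" "p \<in> {..<length (ports (c ! k))}"
    then have m: "fst (ports (c ! k) ! p) \<in> X" "snd (ports (c ! k) ! p) \<in> X" using X(4) by auto
    have "(\<Sum>x\<in>X. \<phi> x * ((of_bool (fst (ports (c ! k) ! p) = x) - of_bool (snd (ports (c ! k) ! p) = x)) * J k p))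
        = ((\<Sum>x\<in>X. \<phi> x * of_bool (fst (ports (c ! k) ! p) = x)) - (\<Sum>x\<in>X. \<phi> x * of_bool (snd (ports (c ! k) ! p) = x))) * J k p"
      by (simp only: sum_subtractf[symmetric] sum_distrib_right right_diff_distrib mult.assoc[symmetric])
    then show "port_voltage c \<phi> k p * J k p = (\<Sum>x\<in>X. \<phi> x *
        ((of_bool (fst (ports (c ! k) ! p) = x) - of_bool (snd (ports (c ! k) ! p) = x)) * J k p))"
      unfolding pick[OF m(1)] pick[OF m(2)] port_voltage_def by simp
  qed
  also have "\<dots> = (\<Sum>x\<in>X. \<phi> x * (\<Sum>k<length c. \<Sum>p<length (ports (c ! k)).
        (of_bool (fst (ports (c ! k) ! p) = x) - of_bool (snd (ports (c ! k) ! p) = x)) * J k p))"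
    unfolding sum_distrib_left by (subst sum.swap, subst (2) sum.swap) (rule refl)
  also have "\<dots> = (\<Sum>x\<in>X. \<phi> x * ((of_bool (x = 0) - of_bool (x = 1)) * i))"
    using assms unfolding kcl_def by simp
  also have "\<dots> = ((\<Sum>x\<in>X. \<phi> x * of_bool (0 = x)) - (\<Sum>x\<in>X. \<phi> x * of_bool (1 = x))) * i"
    by (simp only: sum_subtractf[symmetric] sum_distrib_right right_diff_distrib mult.assoc[symmetric] eq_commute)
  also have "\<dots> = (\<phi> 0 - \<phi> 1) * i" unfolding pick[OF X(2)] pick[OF X(3)] ..
  finally show ?thesis .
qed

lemma static_law_passive:
  fixes V J :: "nat \<Rightarrow> real"
  assumes "passive_element x" "static_law x V J f e"
  shows "storage x * (f * e) \<le> (\<Sum>p<length (ports x). V p * J p)"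
  using assms by (cases x) (auto simp: lessThan_Suc mult.assoc)

lemma static_oneport_passive:
  fixes v i :: real
  assumes "passive_circuit c" "static_oneport c v i f e"
  shows "(\<Sum>k<length c. storage (c ! k) * (f k * e k)) \<le> v * i"
proof -
  obtain \<phi> J where *: "\<phi> 0 - \<phi> 1 = v" "kcl c J i"
    "\<And>k. k < length c \<Longrightarrow> static_law (c ! k) (port_voltage c \<phi> k) (J k) (f k) (e k)"
    using assms(2) unfolding static_oneport_def by blast
  have "(\<Sum>k<length c. storage (c ! k) * (f k * e k)) \<le>
      (\<Sum>k<length c. \<Sum>p<length (ports (c ! k)). port_voltage c \<phi> k p * J k p)"
    by (intro sum_mono static_law_passive *(3)) (use assms(1) in \<open>auto simp: passive_circuit_def\<close>)
  also have "\<dots> = v * i" using tellegen[OF *(2)] *(1) by simp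
  finally show ?thesis .
qed

lemma kcl_comb:
  assumes "kcl c J i" "kcl c J' i'"
  shows "kcl c (\<lambda>k p. a * J k p + b * J' k p) (a * i + b * i')"
  unfolding kcl_def
proof
  fix x
  let ?w = "\<lambda>k p. of_bool (fst (ports (c ! k) ! p) = x) - of_bool (snd (ports (c ! k) ! p) = x)"
  have "(\<Sum>k<length c. \<Sum>p<length (ports (c ! k)). ?w k p * (a * J k p + b * J' k p)) =
      a * (\<Sum>k<length c. \<Sum>p<length (ports (c ! k)). ?w k p * J k p) +
      b * (\<Sum>k<length c. \<Sum>p<length (ports (c ! k)). ?w k p * J' k p)"
    unfolding sum_distrib_left sum.distrib[symmetric] by (intro sum.cong refl) (simp only: distrib_left mult.left_commute)
  then show "(\<Sum>k<length c. \<Sum>p<length (ports (c ! k)). ?w k p * (a * J k p + b * J' k p)) =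
      (of_bool (x = 0) - of_bool (x = 1)) * (a * i + b * i')"
    using assms unfolding kcl_def by (simp only: distrib_left mult.left_commute)
qed

lemma static_law_comb:
  "static_law x V J f e \<Longrightarrow> static_law x V' J' f' e' \<Longrightarrow>
   static_law x (\<lambda>p. a * V p + b * V' p) (\<lambda>p. a * J p + b * J' p) (a * f + b * f') (a * e + b * e')"
  by (cases x) (auto simp: algebra_simps)

lemma static_oneport_comb:
  assumes "static_oneport c v i f e" "static_oneport c v' i' f' e'"
  shows "static_oneport c (a * v + b * v') (a * i + b * i') (\<lambda>k. a * f k + b * f' k) (\<lambda>k. a * e k + b * e' k)"
proof -
  obtain \<phi> J \<phi>' J' where *: "\<phi> 0 - \<phi> 1 = v" "kcl c J i"
    "\<And>k. k < length c \<Longrightarrow> static_law (c ! k) (port_voltage c \<phi> k) (J k) (f k) (e k)"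
    "\<phi>' 0 - \<phi>' 1 = v'" "kcl c J' i'"
    "\<And>k. k < length c \<Longrightarrow> static_law (c ! k) (port_voltage c \<phi>' k) (J' k) (f' k) (e' k)"
    using assms unfolding static_oneport_def by blast
  have pv: "port_voltage c (\<lambda>x. a * \<phi> x + b * \<phi>' x) k = (\<lambda>p. a * port_voltage c \<phi> k p + b * port_voltage c \<phi>' k p)" for k
    by (rule ext) (simp add: port_voltage_def algebra_simps)
  show ?thesis unfolding static_oneport_def
  proof (intro exI conjI allI impI)
    show "(\<lambda>x. a * \<phi> x + b * \<phi>' x) 0 - (\<lambda>x. a * \<phi> x + b * \<phi>' x) 1 = a * v + b * v'"
      by (simp add: *(1)[symmetric] *(4)[symmetric] algebra_simps)
    show "kcl c (\<lambda>k p. a * J k p + b * J' k p) (a * i + b * i')" by (rule kcl_comb[OF *(2,5)])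
  qed (unfold pv, intro static_law_comb *(3,6))
qed

lemma static_oneport_zero: "static_oneport c 0 0 (\<lambda>k. 0) (\<lambda>k. 0)"
  unfolding static_oneport_def
proof (intro exI conjI allI impI)
  show "static_law (c ! k) (port_voltage c (\<lambda>x. 0) k) (\<lambda>p. 0) 0 0" for k
    by (cases "c ! k") (simp_all add: port_voltage_def)
qed (simp_all add: kcl_def)

lemma static_oneport_sum:
  fixes n :: nat
  assumes "\<And>l. l < n \<Longrightarrow> static_oneport c (v l) (i l) (f l) (e l)"
  shows "static_oneport c (\<Sum>l<n. a l * v l) (\<Sum>l<n. a l * i l) (\<lambda>k. \<Sum>l<n. a l * f l k) (\<lambda>k. \<Sum>l<n. a l * e l k)"
  using assms
proof (induction n)
  case 0
  then show ?case by (simp add: static_oneport_zero)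
next
  case (Suc n)
  then have "static_oneport c (\<Sum>l<n. a l * v l) (\<Sum>l<n. a l * i l) (\<lambda>k. \<Sum>l<n. a l * f l k) (\<lambda>k. \<Sum>l<n. a l * e l k)" by simp
  from static_oneport_comb[OF this Suc.prems[of n], of 1 "a n"] show ?case by simp
qed

text \<open>Element values are real, so \<open>Re\<close> and \<open>Im\<close> map complex
  solutions to real ones, where passivity is available.\<close>

lemma static_oneport_linear:
  fixes h :: "complex \<Rightarrow> real"
  assumes h: "linear h" and "static_oneport c v i f e"
  shows "static_oneport c (h v) (h i) (\<lambda>k. h (f k)) (\<lambda>k. h (e k))"
proof -
  have hr: "h (of_real r * x) = r * h x" for r x
    using linear_scale[OF h, of r x] by (simp add: scaleR_conv_of_real)
  have h_simps: "h 0 = 0" "h (x + y) = h x + h y" "h (x - y) = h x - h y" "h (- x) = - h x" for x y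
    using h by (simp_all add: linear_0 linear_add linear_diff linear_neg)
  have hb: "h ((of_bool a - of_bool b) * x) = (of_bool a - of_bool b) * h x" for a b x
    by (cases a; cases b) (simp_all add: h_simps)
  obtain \<phi> J where *: "\<phi> 0 - \<phi> 1 = v" "kcl c J i"
    "\<And>k. k < length c \<Longrightarrow> static_law (c ! k) (port_voltage c \<phi> k) (J k) (f k) (e k)"
    using assms(2) unfolding static_oneport_def by blast
  have pv: "port_voltage c (\<lambda>x. h (\<phi> x)) k = (\<lambda>p. h (port_voltage c \<phi> k p))" for k
    by (rule ext) (simp add: port_voltage_def h_simps)
  have law: "static_law x (\<lambda>p. h (V p)) (\<lambda>p. h (I p)) (h g) (h d)" if "static_law x V I g d" for x V I g d
    using that by (cases x) (auto simp: hr h_simps)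
  show ?thesis unfolding static_oneport_def
  proof (intro exI conjI allI impI)
    show "(\<lambda>x. h (\<phi> x)) 0 - (\<lambda>x. h (\<phi> x)) 1 = h v" by (simp add: *(1)[symmetric] h_simps)
    show "kcl c (\<lambda>k p. h (J k p)) (h i)" unfolding kcl_def
    proof
      fix x
      have "h (\<Sum>k<length c. \<Sum>p<length (ports (c ! k)).
          (of_bool (fst (ports (c ! k) ! p) = x) - of_bool (snd (ports (c ! k) ! p) = x)) * J k p) =
          h ((of_bool (x = 0) - of_bool (x = 1)) * i)" using *(2) unfolding kcl_def by simp
      then show "(\<Sum>k<length c. \<Sum>p<length (ports (c ! k)).
          (of_bool (fst (ports (c ! k) ! p) = x) - of_bool (snd (ports (c ! k) ! p) = x)) * h (J k p)) =
          (of_bool (x = 0) - of_bool (x = 1)) * h i"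
        by (simp only: linear_sum[OF h] hb)
    qed
    show "static_law (c ! k) (port_voltage c (\<lambda>x. h (\<phi> x)) k) (\<lambda>p. h (J k p)) (h (f k)) (h (e k))" if "k < length c" for k
      unfolding pv by (rule law[OF *(3)[OF that]])
  qed
qed

lemma laplace_oneport_static:
  assumes "laplace_oneport c s v i"
  shows "\<exists>e. static_oneport c v i (\<lambda>k. s * e k) e"
proof -
  obtain \<phi> J where *: "\<phi> 0 - \<phi> 1 = v" "kcl c J i"
    "\<And>k. k < length c \<Longrightarrow> laplace_law s (c ! k) (port_voltage c \<phi> k) (J k)"
    using assms unfolding laplace_oneport_def by blast
  have "\<exists>e. static_law x V I (s * e) e" if "laplace_law s x V I" for x V I
    using that by (cases x) (auto simp: mult_ac intro: exI[of _ 0])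
  then have "\<forall>k\<in>{..<length c}. \<exists>e. static_law (c ! k) (port_voltage c \<phi> k) (J k) (s * e) e" using *(3) by blast
  from bchoice[OF this] obtain e where
    "\<forall>k\<in>{..<length c}. static_law (c ! k) (port_voltage c \<phi> k) (J k) (s * e k) (e k)" by blast
  then show ?thesis unfolding static_oneport_def using *(1,2) by blast
qed

text \<open>Positive realness: after splitting into real and imaginary parts, the powers delivered
  to the storage elements combine to \<open>Re s\<close> times a weighted sum of squares.\<close>

lemma laplace_oneport_passive:
  assumes c: "passive_circuit c" and l: "laplace_oneport c s v i" and s: "Re s \<ge> 0"
  shows "Re (v * cnj i) \<ge> 0"
proof -
  obtain e where e: "static_oneport c v i (\<lambda>k. s * e k) e" using laplace_oneport_static[OF l] by blast
  have lin: "linear Re" "linear Im" by (simp_all add: bounded_linear.linear bounded_linear_Re bounded_linear_Im)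
  have "0 \<le> (\<Sum>k<length c. storage (c ! k) * (Re s * (cmod (e k))\<^sup>2))"
    using c s storage_pos by (intro sum_nonneg mult_nonneg_nonneg) (auto simp: passive_circuit_def less_imp_le)
  also have "\<dots> = (\<Sum>k<length c. storage (c ! k) * (Re (s * e k) * Re (e k))) + (\<Sum>k<length c. storage (c ! k) * (Im (s * e k) * Im (e k)))"
    unfolding sum.distrib[symmetric] cmod_power2 by (rule sum.cong[OF refl]) (simp add: power2_eq_square algebra_simps)
  also have "\<dots> \<le> Re v * Re i + Im v * Im i"
    by (rule add_mono[OF static_oneport_passive[OF c static_oneport_linear[OF lin(1) e]] static_oneport_passive[OF c static_oneport_linear[OF lin(2) e]]])
  finally show ?thesis by simp
qed

lemma time_law_static:
  assumes x: "passive_element x" and law: "time_law x V J"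
    and int: "\<And>p. p < length (ports x) \<Longrightarrow> locally_integrable (V p) \<and> locally_integrable (J p)"
  shows "\<exists>f e. locally_integrable f \<and> (\<forall>t\<ge>0. e t = e 0 + integral {0..t} f) \<and>
    (\<forall>t\<ge>0. static_law x (\<lambda>p. V p t) (\<lambda>p. J p t) (f t) (e t))"
proof -
  have zero: "locally_integrable (\<lambda>t. 0)" by (simp add: locally_integrable_def)
  have scale: "locally_integrable (\<lambda>t. a * f t)" if "locally_integrable f" for a f
    using that unfolding locally_integrable_def by (auto intro: set_integrable_mult_right)
  show ?thesis
  proof (cases x)
    case (Inductor l y)
    then have l: "l > 0" and *: "\<forall>t\<ge>0. l * (J 0 t - J 0 0) = integral {0..t} (V 0)" using x law by auto
    have J: "J 0 t = J 0 0 + integral {0..t} (\<lambda>t. 1 / l * V 0 t)" if "t \<ge> 0" for t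
    proof -
      have "1 / l * integral {0..t} (V 0) = J 0 t - J 0 0" using *[rule_format, OF that] l by (metis nonzero_mult_div_cancel_left order_less_irrefl times_divide_eq_left mult_1)
      then show ?thesis by simp
    qed
    show ?thesis
    proof (intro exI conjI allI impI)
      show "locally_integrable (\<lambda>t. 1 / l * V 0 t)" by (rule scale) (use int[of 0] Inductor in simp)
      show "J 0 t = J 0 0 + integral {0..t} (\<lambda>t. 1 / l * V 0 t)" if "t \<ge> 0" for t by (rule J[OF that])
      show "static_law x (\<lambda>p. V p t) (\<lambda>p. J p t) (1 / l * V 0 t) (J 0 t)" for t using l by (simp add: Inductor)
    qed
  next
    case (Capacitor c y)
    then have c: "c > 0" and *: "\<forall>t\<ge>0. c * (V 0 t - V 0 0) = integral {0..t} (J 0)" using x law by auto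
    have V: "V 0 t = V 0 0 + integral {0..t} (\<lambda>t. 1 / c * J 0 t)" if "t \<ge> 0" for t
    proof -
      have "1 / c * integral {0..t} (J 0) = V 0 t - V 0 0" using *[rule_format, OF that] c by (metis nonzero_mult_div_cancel_left order_less_irrefl times_divide_eq_left mult_1)
      then show ?thesis by simp
    qed
    show ?thesis
    proof (intro exI conjI allI impI)
      show "locally_integrable (\<lambda>t. 1 / c * J 0 t)" by (rule scale) (use int[of 0] Capacitor in simp)
      show "V 0 t = V 0 0 + integral {0..t} (\<lambda>t. 1 / c * J 0 t)" if "t \<ge> 0" for t by (rule V[OF that])
      show "static_law x (\<lambda>p. V p t) (\<lambda>p. J p t) (1 / c * J 0 t) (V 0 t)" for t using c by (simp add: Capacitor)
    qed
  qed (use law zero in \<open>auto intro!: exI[of _ "\<lambda>t. 0"]\<close>)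
qed

lemma time_oneport_static:
  assumes c: "passive_circuit c" and t: "time_oneport c v i"
  shows "\<exists>f e. (\<forall>t\<ge>0. static_oneport c (v t) (i t) (\<lambda>k. f k t) (\<lambda>k. e k t)) \<and>
    (\<forall>k<length c. locally_integrable (f k) \<and> (\<forall>t\<ge>0. e k t = e k 0 + integral {0..t} (f k)))"
proof -
  obtain \<phi> :: "nat \<Rightarrow> real \<Rightarrow> real" and J :: "nat \<Rightarrow> nat \<Rightarrow> real \<Rightarrow> real" where
    *: "\<forall>t\<ge>0. \<phi> 0 t - \<phi> 1 t = v t \<and> kcl c (\<lambda>k p. J k p t) (i t)"
    "\<forall>k<length c. (\<forall>p<length (ports (c ! k)). locally_integrable (\<lambda>t. port_voltage c (\<lambda>x. \<phi> x t) k p) \<and> locally_integrable (J k p)) \<and>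
          time_law (c ! k) (\<lambda>p t. port_voltage c (\<lambda>x. \<phi> x t) k p) (J k)"
    using t unfolding time_oneport_def by blast
  have "\<forall>k\<in>{..<length c}. \<exists>f e. locally_integrable f \<and> (\<forall>t\<ge>0. e t = e 0 + integral {0..t} f) \<and>
    (\<forall>t\<ge>0. static_law (c ! k) (\<lambda>p. port_voltage c (\<lambda>x. \<phi> x t) k p) (\<lambda>p. J k p t) (f t) (e t))"
  proof
    fix k assume "k \<in> {..<length c}"
    then have k: "k < length c" by simp
    show "\<exists>f e. locally_integrable f \<and> (\<forall>t\<ge>0. e t = e 0 + integral {0..t} f) \<and>
      (\<forall>t\<ge>0. static_law (c ! k) (\<lambda>p. port_voltage c (\<lambda>x. \<phi> x t) k p) (\<lambda>p. J k p t) (f t) (e t))"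
      by (rule time_law_static[where V = "\<lambda>p t. port_voltage c (\<lambda>x. \<phi> x t) k p"])
        (use *(2) k c in \<open>auto simp: passive_circuit_def\<close>)
  qed
  from bchoice[OF this] obtain f where "\<forall>k\<in>{..<length c}. \<exists>e. locally_integrable (f k) \<and> (\<forall>t\<ge>0. e t = e 0 + integral {0..t} (f k)) \<and>
    (\<forall>t\<ge>0. static_law (c ! k) (\<lambda>p. port_voltage c (\<lambda>x. \<phi> x t) k p) (\<lambda>p. J k p t) (f k t) (e t))" by blast
  from bchoice[OF this] obtain e where fe: "\<forall>k\<in>{..<length c}. locally_integrable (f k) \<and> (\<forall>t\<ge>0. e k t = e k 0 + integral {0..t} (f k)) \<and>
    (\<forall>t\<ge>0. static_law (c ! k) (\<lambda>p. port_voltage c (\<lambda>x. \<phi> x t) k p) (\<lambda>p. J k p t) (f k t) (e k t))" by blast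
  have "static_oneport c (v t) (i t) (\<lambda>k. f k t) (\<lambda>k. e k t)" if "t \<ge> 0" for t
    unfolding static_oneport_def
  proof (intro exI[of _ "\<lambda>x. \<phi> x t"] exI[of _ "\<lambda>k p. J k p t"] conjI allI impI)
    show "\<phi> 0 t - \<phi> 1 t = v t" "kcl c (\<lambda>k p. J k p t) (i t)" using *(1) that by blast+
    fix k assume "k < length c"
    with fe that have "static_law (c ! k) (\<lambda>p. port_voltage c (\<lambda>x. \<phi> x t) k p) (\<lambda>p. J k p t) (f k t) (e k t)"
      by blast
    then show "static_law (c ! k) (port_voltage c (\<lambda>x. \<phi> x t) k) (\<lambda>p. J k p t) (f k t) (e k t)" .
  qed
  then show ?thesis using fe by blast
qed

text \<open>Each branch is counted at both of its ends. Besides potentials, \<open>\<phi>\<close>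
  will be their conjugates, for complex power, and the constant 1, for the total injected
  current.\<close>

lemma branch_power:
  fixes \<phi> :: "nat \<Rightarrow> 'a::comm_ring_1"
  assumes "\<And>m n. m < n \<Longrightarrow> n < M \<Longrightarrow> b n m = - b m n"
  shows "(\<Sum>m<M. \<phi> m * (\<Sum>n\<in>{..<M} - {m}. b m n)) = (\<Sum>n<M. \<Sum>m<n. (\<phi> m - \<phi> n) * b m n)"
  using assms
proof (induction M)
  case (Suc M)
  have IH: "(\<Sum>m<M. \<phi> m * (\<Sum>n\<in>{..<M} - {m}. b m n)) = (\<Sum>n<M. \<Sum>m<n. (\<phi> m - \<phi> n) * b m n)"
    by (rule Suc.IH) (simp add: Suc.prems)
  have "(\<Sum>n\<in>{..<Suc M} - {m}. b m n) = (\<Sum>n\<in>{..<M} - {m}. b m n) + b m M" if "m < M" for m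
  proof -
    have "{..<Suc M} - {m} = insert M ({..<M} - {m})" using that by auto
    then show ?thesis by (simp add: add.commute)
  qed
  then have "(\<Sum>m<M. \<phi> m * (\<Sum>n\<in>{..<Suc M} - {m}. b m n)) = (\<Sum>m<M. \<phi> m * (\<Sum>n\<in>{..<M} - {m}. b m n)) + (\<Sum>m<M. \<phi> m * b m M)"
    by (simp add: sum.distrib distrib_left)
  moreover have "{..<Suc M} - {M} = {..<M}" by auto
  moreover have "(\<Sum>n<M. b M n) = (\<Sum>m<M. - b m M)" by (rule sum.cong[OF refl]) (simp add: Suc.prems)
  ultimately have "(\<Sum>m<Suc M. \<phi> m * (\<Sum>n\<in>{..<Suc M} - {m}. b m n)) =
      (\<Sum>n<M. \<Sum>m<n. (\<phi> m - \<phi> n) * b m n) + ((\<Sum>m<M. \<phi> m * b m M) + \<phi> M * (\<Sum>m<M. - b m M))"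
    unfolding IH[symmetric] by simp
  also have "(\<Sum>m<M. \<phi> m * b m M) + \<phi> M * (\<Sum>m<M. - b m M) = (\<Sum>m<M. (\<phi> m - \<phi> M) * b m M)"
    unfolding sum_distrib_left sum.distrib[symmetric] by (rule sum.cong[OF refl]) (simp add: algebra_simps)
  finally show ?case by simp
qed simp

subsection \<open>The network relation\<close>

text \<open>\<open>\<Phi> m b\<close> is the potential of node \<open>m\<close> when boundary node
  \<open>b\<close> has potential 1, the other boundary nodes have potential 0, and no current enters
  at interior nodes. The boundary currents are then column \<open>b\<close> of the Kron-reduced
  matrix.\<close>

lemma kron_potentials:
  fixes y :: "nat \<Rightarrow> nat \<Rightarrow> transfer_fun"
  assumes NM: "N \<le> M" and sym: "\<And>m n. m < M \<Longrightarrow> n < M \<Longrightarrow> y m n = y n m"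
    and inv: "invertible_mat (interior_block N (admittance_matrix M y))"
    and kron: "kron_reduction N (admittance_matrix M y) = ys \<cdot>\<^sub>m Gamma_mat N"
  obtains \<Phi> where "\<And>m b. m < N \<Longrightarrow> \<Phi> m b = (if m = b then 1 else 0)"
    "\<And>m b. m < M \<Longrightarrow> b < N \<Longrightarrow> (\<Sum>n\<in>{..<M} - {m}. y m n * (\<Phi> m b - \<Phi> n b)) =
      (if m < N then ys * ((if m = b then of_nat N else 0) - 1) else 0)"
proof -
  define A where "A = admittance_matrix M y"
  have A: "A \<in> carrier_mat M M" by (simp add: A_def admittance_matrix_def)
  obtain A1 A2 A3 A4 where sp: "split_block A N N = (A1, A2, A3, A4)" by (cases "split_block A N N")
  have car: "A1 \<in> carrier_mat N N" "A2 \<in> carrier_mat N (M - N)" "A3 \<in> carrier_mat (M - N) N" "A4 \<in> carrier_mat (M - N) (M - N)"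
    using split_block[OF sp, of "M - N" "M - N"] A NM by auto
  have ent: "\<And>i j. i < N \<Longrightarrow> j < N \<Longrightarrow> A1 $$ (i, j) = A $$ (i, j)"
    "\<And>i j. i < N \<Longrightarrow> j < M - N \<Longrightarrow> A2 $$ (i, j) = A $$ (i, j + N)"
    "\<And>i j. i < M - N \<Longrightarrow> j < N \<Longrightarrow> A3 $$ (i, j) = A $$ (i + N, j)"
    "\<And>i j. i < M - N \<Longrightarrow> j < M - N \<Longrightarrow> A4 $$ (i, j) = A $$ (i + N, j + N)"
    using sp A unfolding split_block_def Let_def by auto
  have A4: "interior_block N A = A4" "kron_reduction N A = A1 - A2 * the (mat_inverse A4) * transpose_mat A2"
    by (simp_all add: interior_block_def kron_reduction_def sp)
  have "mat_inverse A4 \<noteq> None"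
  proof
    assume none: "mat_inverse A4 = None"
    have "invertible_mat A4" using inv A4 by (simp add: A_def)
    then obtain B where B: "inverts_mat A4 B" "inverts_mat B A4" unfolding invertible_mat_def by blast
    have eq: "A4 * B = 1\<^sub>m (M - N)" "B * A4 = 1\<^sub>m (dim_row B)" using B car by (auto simp: inverts_mat_def)
    have "dim_col (A4 * B) = M - N" "dim_col (B * A4) = dim_row B" using eq by simp_all
    then have "B \<in> carrier_mat (M - N) (M - N)" using car(4) by auto
    then have "A4 \<in> Units (ring_mat TYPE(transfer_fun) (M - N) ())"
      using eq car(4) unfolding Units_def by (auto simp: ring_mat_def)
    then show False using mat_inverse(1)[OF car(4) none, of "()"] by simp
  qed
  then obtain X where X: "mat_inverse A4 = Some X" by blast
  have AX: "A4 * X = 1\<^sub>m (M - N)" "X \<in> carrier_mat (M - N) (M - N)" using mat_inverse(2)[OF car(4) X] by auto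
  \<comment> \<open>The interior potentials up to sign: the interior rows require
    \<open>A4 * Q = A3\<close>, and \<open>A3\<close> is the transpose of \<open>A2\<close> by
    symmetry.\<close>
  define Q where "Q = X * transpose_mat A2"
  have Q: "Q \<in> carrier_mat (M - N) N" using AX car by (simp add: Q_def)
  have symA: "A $$ (m, n) = A $$ (n, m)" if "m < M" "n < M" for m n
    using that sym by (auto simp: A_def admittance_matrix_def)
  have A4Q: "A4 * Q = transpose_mat A2"
    using AX car(2,4) unfolding Q_def by (simp add: assoc_mult_mat[of A4 "M - N" "M - N" X "M - N", symmetric])
  have A2Q: "A2 * Q = A1 - ys \<cdot>\<^sub>m Gamma_mat N"
  proof -
    have "A1 - A2 * Q = ys \<cdot>\<^sub>m Gamma_mat N"
      using kron A4(2) AX(2) car(2) unfolding A_def[symmetric] Q_def X option.sel by (simp add: assoc_mult_mat[of A2 N "M - N" X "M - N"])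
    then have "A1 - (A1 - A2 * Q) = A1 - ys \<cdot>\<^sub>m Gamma_mat N" by simp
    moreover have "A1 - (A1 - A2 * Q) = A2 * Q" by (rule eq_matI) (use car Q in auto)
    ultimately show ?thesis by simp
  qed
  define \<Phi> where "\<Phi> m b = (if m < N then if m = b then 1 else 0 else - Q $$ (m - N, b))" for m b
  have mult_ent: "(B * Q) $$ (i, b) = (\<Sum>c<M - N. B $$ (i, c) * Q $$ (c, b))"
    if "B \<in> carrier_mat r (M - N)" "i < r" "b < N" for B r i b
    using that Q by (auto simp: scalar_prod_def atLeast0LessThan intro!: sum.cong)
  have split: "(\<Sum>n<M. A $$ (m, n) * \<Phi> n b) = A $$ (m, b) - (\<Sum>c<M - N. A $$ (m, c + N) * Q $$ (c, b))"
    if "b < N" for m b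
  proof -
    have "{..<M} = {..<N} \<union> (\<lambda>c. c + N) ` {..<M - N}"
    proof (rule equalityI; rule subsetI)
      fix n assume "n \<in> {..<M}"
      then show "n \<in> {..<N} \<union> (\<lambda>c. c + N) ` {..<M - N}"
        by (cases "n < N") (auto intro!: image_eqI[of _ _ "n - N"])
    next
      fix n assume "n \<in> {..<N} \<union> (\<lambda>c. c + N) ` {..<M - N}"
      then show "n \<in> {..<M}" using NM by auto
    qed
    then have "(\<Sum>n<M. A $$ (m, n) * \<Phi> n b) = (\<Sum>n<N. A $$ (m, n) * \<Phi> n b) + (\<Sum>n\<in>(\<lambda>c. c + N) ` {..<M - N}. A $$ (m, n) * \<Phi> n b)"
      by (simp only:) (rule sum.union_disjoint; auto)
    also have "(\<Sum>n<N. A $$ (m, n) * \<Phi> n b) = (\<Sum>n\<in>{b}. A $$ (m, n) * \<Phi> n b)"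
      by (rule sum.mono_neutral_right) (use that in \<open>auto simp: \<Phi>_def\<close>)
    also have "\<dots> = A $$ (m, b)" using that by (simp add: \<Phi>_def)
    also have "(\<Sum>n\<in>(\<lambda>c. c + N) ` {..<M - N}. A $$ (m, n) * \<Phi> n b) = (\<Sum>c<M - N. - (A $$ (m, c + N) * Q $$ (c, b)))"
      by (subst sum.reindex) (auto simp: inj_on_def \<Phi>_def)
    finally show ?thesis by (simp add: sum_negf)
  qed
  have row: "(\<Sum>n<M. A $$ (m, n) * \<Phi> n b) = (if m < N then ys * ((if m = b then of_nat N else 0) - 1) else 0)"
    if m: "m < M" and b: "b < N" for m b
  proof (cases "m < N")
    case True
    have "(\<Sum>c<M - N. A $$ (m, c + N) * Q $$ (c, b)) = (A2 * Q) $$ (m, b)"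
      unfolding mult_ent[OF car(2) True b] by (rule sum.cong[OF refl]) (use ent(2) True in auto)
    also have "\<dots> = A $$ (m, b) - ys * ((if m = b then of_nat N else 0) - 1)"
      unfolding A2Q using True b car ent(1) by (auto simp: Gamma_mat_def)
    finally show ?thesis using split[OF b] True by simp
  next
    case False
    then have mN: "m - N < M - N" using m by auto
    have "(\<Sum>c<M - N. A $$ (m, c + N) * Q $$ (c, b)) = (A4 * Q) $$ (m - N, b)"
      unfolding mult_ent[OF car(4) mN b] by (rule sum.cong[OF refl]) (use ent(4) mN False in auto)
    also have "\<dots> = A $$ (b, m)" unfolding A4Q using ent(2)[OF b mN] car(2) mN b False by simp
    also have "\<dots> = A $$ (m, b)" by (rule symA) (use m b NM in auto)
    finally show ?thesis using split[OF b] False by simp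
  qed
  show ?thesis
  proof (rule that[of \<Phi>])
    show "\<Phi> m b = (if m = b then 1 else 0)" if "m < N" for m b using that by (simp add: \<Phi>_def)
    fix m b assume m: "m < M" and b: "b < N"
    have "(\<Sum>n<M. A $$ (m, n) * \<Phi> n b) = A $$ (m, m) * \<Phi> m b + (\<Sum>n\<in>{..<M} - {m}. A $$ (m, n) * \<Phi> n b)"
      by (rule sum.remove) (use m in auto)
    also have "(\<Sum>n\<in>{..<M} - {m}. A $$ (m, n) * \<Phi> n b) = (\<Sum>n\<in>{..<M} - {m}. - (y m n * \<Phi> n b))"
      by (rule sum.cong[OF refl]) (use m in \<open>auto simp: A_def admittance_matrix_def\<close>)
    also have "A $$ (m, m) = (\<Sum>n\<in>{..<M} - {m}. y m n)" using m by (simp add: A_def admittance_matrix_def)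
    also have "(\<Sum>n\<in>{..<M} - {m}. y m n) * \<Phi> m b + (\<Sum>n\<in>{..<M} - {m}. - (y m n * \<Phi> n b)) =
        (\<Sum>n\<in>{..<M} - {m}. y m n * (\<Phi> m b - \<Phi> n b))"
      unfolding sum_distrib_right sum.distrib[symmetric] by (rule sum.cong[OF refl]) (simp add: right_diff_distrib)
    finally show "(\<Sum>n\<in>{..<M} - {m}. y m n * (\<Phi> m b - \<Phi> n b)) =
      (if m < N then ys * ((if m = b then of_nat N else 0) - 1) else 0)" using row[OF m b] by simp
  qed
qed

text \<open>
  \<open>Inl j\<close> labels the \<open>j\<close>-th oscillator and \<open>Inr (n, m)\<close> the branch between \<open>m < n\<close>. The two
  zero sums say that the means of the source currents and of the voltages have been taken out.
\<close>

definition network_relation ::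
    "nat \<Rightarrow> nat \<Rightarrow> circuit \<Rightarrow> (nat \<Rightarrow> nat \<Rightarrow> circuit) \<Rightarrow>
     ((nat + nat \<times> nat) \<times> nat \<Rightarrow> 'a::real_field) \<Rightarrow> ((nat + nat \<times> nat) \<times> nat \<Rightarrow> 'a) \<Rightarrow>
     (nat \<Rightarrow> 'a) \<Rightarrow> (nat \<Rightarrow> 'a) \<Rightarrow> bool" where
  "network_relation N M osc branch f e u v \<longleftrightarrow>
     (\<Sum>j<N. u j) = 0 \<and> (\<Sum>j<N. v j) = 0 \<and>
     (\<exists>\<phi> b i.
       (\<forall>j<N. v j = \<phi> j \<and> static_oneport osc (\<phi> j) (u j - i j) (\<lambda>k. f (Inl j, k)) (\<lambda>k. e (Inl j, k))) \<and>
       (\<forall>n<M. \<forall>m<n. static_oneport (branch m n) (\<phi> m - \<phi> n) (b m n) (\<lambda>k. f (Inr (n, m), k)) (\<lambda>k. e (Inr (n, m), k)) \<and>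
          b n m = - b m n) \<and>
       (\<forall>m<M. i m = (\<Sum>n\<in>{..<M} - {m}. b m n)) \<and>
       (\<forall>m. N \<le> m \<and> m < M \<longrightarrow> i m = 0))"

definition network_circuit :: "circuit \<Rightarrow> (nat \<Rightarrow> nat \<Rightarrow> circuit) \<Rightarrow> nat + nat \<times> nat \<Rightarrow> circuit" where
  "network_circuit osc branch l = (case l of Inl j \<Rightarrow> osc | Inr (n, m) \<Rightarrow> branch m n)"

definition network_states :: "nat \<Rightarrow> nat \<Rightarrow> circuit \<Rightarrow> (nat \<Rightarrow> nat \<Rightarrow> circuit) \<Rightarrow> ((nat + nat \<times> nat) \<times> nat) set" where
  "network_states N M osc branch =
     (SIGMA l:Inl ` {..<N} \<union> Inr ` (SIGMA n:{..<M}. {..<n}). {..<length (network_circuit osc branch l)})"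

lemma sum_network_states:
  "(\<Sum>k\<in>network_states N M osc branch. g k) =
    (\<Sum>j<N. \<Sum>k<length osc. g (Inl j, k)) + (\<Sum>n<M. \<Sum>m<n. \<Sum>k<length (branch m n). g (Inr (n, m), k))"
proof -
  have "(\<Sum>k\<in>network_states N M osc branch. g k) =
      (\<Sum>l\<in>Inl ` {..<N} \<union> Inr ` (SIGMA n:{..<M}. {..<n}). \<Sum>k<length (network_circuit osc branch l). g (l, k))"
    unfolding network_states_def by (subst sum.Sigma) auto
  also have "\<dots> = (\<Sum>l\<in>Inl ` {..<N}. \<Sum>k<length (network_circuit osc branch l). g (l, k)) +
      (\<Sum>l\<in>Inr ` (SIGMA n:{..<M}. {..<n}). \<Sum>k<length (network_circuit osc branch l). g (l, k))"
    by (rule sum.union_disjoint) auto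
  also have "(\<Sum>l\<in>Inl ` {..<N}. \<Sum>k<length (network_circuit osc branch l). g (l, k)) = (\<Sum>j<N. \<Sum>k<length osc. g (Inl j, k))"
    by (subst sum.reindex) (auto simp: network_circuit_def)
  also have "(\<Sum>l\<in>Inr ` (SIGMA n:{..<M}. {..<n}). \<Sum>k<length (network_circuit osc branch l). g (l, k)) =
      (\<Sum>n<M. \<Sum>m<n. \<Sum>k<length (branch m n). g (Inr (n, m), k))"
  proof -
    have "(\<Sum>n<M. \<Sum>m<n. \<Sum>k<length (branch m n). g (Inr (n, m), k)) =
        (\<Sum>(n, m)\<in>(SIGMA n:{..<M}. {..<n}). \<Sum>k<length (branch m n). g (Inr (n, m), k))"
      by (rule sum.Sigma) auto
    then show ?thesis
      by (subst sum.reindex) (auto simp: network_circuit_def split_def inj_on_def simp del: sum.Sigma intro!: sum.cong)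
  qed
  finally show ?thesis .
qed

text \<open>The power of the branches is what the oscillators inject, since interior nodes inject
  nothing; in the sum with the oscillator powers the injected currents cancel.\<close>

lemma network_passive:
  fixes u v :: "nat \<Rightarrow> real"
  assumes NM: "N \<le> M" and osc: "passive_circuit osc" and br: "\<And>m n. m < n \<Longrightarrow> n < M \<Longrightarrow> passive_circuit (branch m n)"
    and R: "network_relation N M osc branch f e u v"
  shows "(\<Sum>k\<in>network_states N M osc branch. storage (network_circuit osc branch (fst k) ! snd k) * (f k * e k)) \<le> (\<Sum>j<N. u j * v j)"
proof -
  obtain \<phi> b i where R': "\<forall>j<N. v j = \<phi> j \<and> static_oneport osc (\<phi> j) (u j - i j) (\<lambda>k. f (Inl j, k)) (\<lambda>k. e (Inl j, k))"
    "\<forall>n<M. \<forall>m<n. static_oneport (branch m n) (\<phi> m - \<phi> n) (b m n) (\<lambda>k. f (Inr (n, m), k)) (\<lambda>k. e (Inr (n, m), k)) \<and> b n m = - b m n"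
    "\<forall>m<M. i m = (\<Sum>n\<in>{..<M} - {m}. b m n)" "\<forall>m. N \<le> m \<and> m < M \<longrightarrow> i m = 0"
    using R unfolding network_relation_def by blast
  have *: "v j = \<phi> j" "static_oneport osc (\<phi> j) (u j - i j) (\<lambda>k. f (Inl j, k)) (\<lambda>k. e (Inl j, k))" if "j < N" for j
    using R'(1) that by blast+
  have **: "static_oneport (branch m n) (\<phi> m - \<phi> n) (b m n) (\<lambda>k. f (Inr (n, m), k)) (\<lambda>k. e (Inr (n, m), k))"
    "b n m = - b m n" if "m < n" "n < M" for m n
    using R'(2) that by blast+
  have "(\<Sum>k\<in>network_states N M osc branch. storage (network_circuit osc branch (fst k) ! snd k) * (f k * e k)) =
      (\<Sum>j<N. \<Sum>k<length osc. storage (osc ! k) * (f (Inl j, k) * e (Inl j, k))) +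
      (\<Sum>n<M. \<Sum>m<n. \<Sum>k<length (branch m n). storage (branch m n ! k) * (f (Inr (n, m), k) * e (Inr (n, m), k)))"
    unfolding sum_network_states by (simp add: network_circuit_def)
  also have "\<dots> \<le> (\<Sum>j<N. \<phi> j * (u j - i j)) + (\<Sum>n<M. \<Sum>m<n. (\<phi> m - \<phi> n) * b m n)"
    by (intro add_mono sum_mono static_oneport_passive osc br *(2) **(1)) auto
  also have "(\<Sum>n<M. \<Sum>m<n. (\<phi> m - \<phi> n) * b m n) = (\<Sum>m<M. \<phi> m * (\<Sum>n\<in>{..<M} - {m}. b m n))"
    by (rule branch_power[OF **(2), symmetric])
  also have "\<dots> = (\<Sum>m<M. \<phi> m * i m)" by (rule sum.cong[OF refl]) (use R'(3) in simp)
  also have "\<dots> = (\<Sum>m<N. \<phi> m * i m)" by (rule sum.mono_neutral_right) (use NM R'(4) in auto)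
  also have "(\<Sum>j<N. \<phi> j * (u j - i j)) + (\<Sum>m<N. \<phi> m * i m) = (\<Sum>j<N. u j * v j)"
    unfolding sum.distrib[symmetric] by (rule sum.cong[OF refl]) (simp add: *(1) algebra_simps)
  finally show ?thesis .
qed

lemma network_relation_comb:
  assumes "network_relation N M osc branch f e u v" "network_relation N M osc branch f' e' u' v'"
  shows "network_relation N M osc branch (\<lambda>k. a * f k + c * f' k) (\<lambda>k. a * e k + c * e' k)
    (\<lambda>j. a * u j + c * u' j) (\<lambda>j. a * v j + c * v' j)"
proof -
  obtain \<phi> b i where *: "\<forall>j<N. v j = \<phi> j \<and> static_oneport osc (\<phi> j) (u j - i j) (\<lambda>k. f (Inl j, k)) (\<lambda>k. e (Inl j, k))"
    "\<forall>n<M. \<forall>m<n. static_oneport (branch m n) (\<phi> m - \<phi> n) (b m n) (\<lambda>k. f (Inr (n, m), k)) (\<lambda>k. e (Inr (n, m), k)) \<and> b n m = - b m n"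
    "\<forall>m<M. i m = (\<Sum>n\<in>{..<M} - {m}. b m n)" "\<forall>m. N \<le> m \<and> m < M \<longrightarrow> i m = 0"
    using assms(1) unfolding network_relation_def by blast
  obtain \<phi>' b' i' where B: "\<forall>j<N. v' j = \<phi>' j \<and> static_oneport osc (\<phi>' j) (u' j - i' j) (\<lambda>k. f' (Inl j, k)) (\<lambda>k. e' (Inl j, k))"
    "\<forall>n<M. \<forall>m<n. static_oneport (branch m n) (\<phi>' m - \<phi>' n) (b' m n) (\<lambda>k. f' (Inr (n, m), k)) (\<lambda>k. e' (Inr (n, m), k)) \<and> b' n m = - b' m n"
    "\<forall>m<M. i' m = (\<Sum>n\<in>{..<M} - {m}. b' m n)" "\<forall>m. N \<le> m \<and> m < M \<longrightarrow> i' m = 0"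
    using assms(2) unfolding network_relation_def by blast
  show ?thesis unfolding network_relation_def
  proof (intro conjI exI allI impI)
    show "(\<Sum>j<N. a * u j + c * u' j) = 0" "(\<Sum>j<N. a * v j + c * v' j) = 0"
      using assms by (simp_all add: network_relation_def sum.distrib sum_distrib_left[symmetric])
    show "a * v j + c * v' j = (\<lambda>m. a * \<phi> m + c * \<phi>' m) j" if "j < N" for j using * B that by simp
    show "static_oneport osc ((\<lambda>m. a * \<phi> m + c * \<phi>' m) j) (a * u j + c * u' j - (\<lambda>m. a * i m + c * i' m) j)
        (\<lambda>k. a * f (Inl j, k) + c * f' (Inl j, k)) (\<lambda>k. a * e (Inl j, k) + c * e' (Inl j, k))" if "j < N" for j
    proof -
      have s: "static_oneport osc (\<phi> j) (u j - i j) (\<lambda>k. f (Inl j, k)) (\<lambda>k. e (Inl j, k))"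
        "static_oneport osc (\<phi>' j) (u' j - i' j) (\<lambda>k. f' (Inl j, k)) (\<lambda>k. e' (Inl j, k))" using * B that by blast+
      have "a * u j + c * u' j - (a * i j + c * i' j) = a * (u j - i j) + c * (u' j - i' j)" by (simp add: algebra_simps)
      then show ?thesis using static_oneport_comb[OF s, of a c] by simp
    qed
    fix n m :: nat assume nm: "n < M" "m < n"
    have s: "static_oneport (branch m n) (\<phi> m - \<phi> n) (b m n) (\<lambda>k. f (Inr (n, m), k)) (\<lambda>k. e (Inr (n, m), k))"
      "static_oneport (branch m n) (\<phi>' m - \<phi>' n) (b' m n) (\<lambda>k. f' (Inr (n, m), k)) (\<lambda>k. e' (Inr (n, m), k))" using * B nm by blast+
    have "(a * \<phi> m + c * \<phi>' m) - (a * \<phi> n + c * \<phi>' n) = a * (\<phi> m - \<phi> n) + c * (\<phi>' m - \<phi>' n)" by (simp add: algebra_simps)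
    then show "static_oneport (branch m n) ((\<lambda>m. a * \<phi> m + c * \<phi>' m) m - (\<lambda>m. a * \<phi> m + c * \<phi>' m) n) ((\<lambda>m n. a * b m n + c * b' m n) m n)
        (\<lambda>k. a * f (Inr (n, m), k) + c * f' (Inr (n, m), k)) (\<lambda>k. a * e (Inr (n, m), k) + c * e' (Inr (n, m), k))"
      using static_oneport_comb[OF s, of a c] by simp
    have "b n m = - b m n" "b' n m = - b' m n" using * B nm by blast+
    then show "(\<lambda>m n. a * b m n + c * b' m n) n m = - (\<lambda>m n. a * b m n + c * b' m n) m n" by simp
  next
    show "(\<lambda>m. a * i m + c * i' m) m = (\<Sum>n\<in>{..<M} - {m}. (\<lambda>m n. a * b m n + c * b' m n) m n)" if "m < M" for m
      using * B that by (simp add: sum.distrib sum_distrib_left)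
    show "(\<lambda>m. a * i m + c * i' m) m = 0" if "N \<le> m \<and> m < M" for m using * B that by simp
  qed
qed

lemma network_relation_linear:
  fixes h :: "complex \<Rightarrow> real"
  assumes h: "linear h" and R: "network_relation N M osc branch f e u v"
  shows "network_relation N M osc branch (\<lambda>k. h (f k)) (\<lambda>k. h (e k)) (\<lambda>j. h (u j)) (\<lambda>j. h (v j))"
proof -
  have h_simps: "h 0 = 0" "h (x - y) = h x - h y" "h (- x) = - h x" for x y
    using h by (simp_all add: linear_0 linear_diff linear_neg)
  obtain \<phi> b i where *: "\<forall>j<N. v j = \<phi> j \<and> static_oneport osc (\<phi> j) (u j - i j) (\<lambda>k. f (Inl j, k)) (\<lambda>k. e (Inl j, k))"
    "\<forall>n<M. \<forall>m<n. static_oneport (branch m n) (\<phi> m - \<phi> n) (b m n) (\<lambda>k. f (Inr (n, m), k)) (\<lambda>k. e (Inr (n, m), k)) \<and> b n m = - b m n"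
    "\<forall>m<M. i m = (\<Sum>n\<in>{..<M} - {m}. b m n)" "\<forall>m. N \<le> m \<and> m < M \<longrightarrow> i m = 0"
    using R unfolding network_relation_def by blast
  show ?thesis unfolding network_relation_def
  proof (intro conjI exI allI impI)
    have "(\<Sum>j<N. u j) = 0" "(\<Sum>j<N. v j) = 0" using R by (simp_all add: network_relation_def)
    from arg_cong[OF this(1), of h] arg_cong[OF this(2), of h]
    show "(\<Sum>j<N. h (u j)) = 0" "(\<Sum>j<N. h (v j)) = 0" by (simp_all add: linear_sum[OF h] h_simps)
    show "h (v j) = (\<lambda>m. h (\<phi> m)) j" if "j < N" for j using * that by simp
    show "static_oneport osc ((\<lambda>m. h (\<phi> m)) j) (h (u j) - (\<lambda>m. h (i m)) j) (\<lambda>k. h (f (Inl j, k))) (\<lambda>k. h (e (Inl j, k)))"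
      if "j < N" for j
      unfolding h_simps(2)[symmetric] by (rule static_oneport_linear[OF h]) (use * that in blast)
    show "static_oneport (branch m n) ((\<lambda>m. h (\<phi> m)) m - (\<lambda>m. h (\<phi> m)) n) ((\<lambda>m n. h (b m n)) m n)
        (\<lambda>k. h (f (Inr (n, m), k))) (\<lambda>k. h (e (Inr (n, m), k)))" if "n < M" "m < n" for n m
      unfolding h_simps(2)[symmetric] by (rule static_oneport_linear[OF h]) (use * that in blast)
    show "(\<lambda>m n. h (b m n)) n m = - (\<lambda>m n. h (b m n)) m n" if "n < M" "m < n" for n m
      using * that by (simp add: h_simps)
    show "(\<lambda>m. h (i m)) m = (\<Sum>n\<in>{..<M} - {m}. (\<lambda>m n. h (b m n)) m n)" if "m < M" for m
      using * that by (simp add: linear_sum[OF h])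
    show "(\<lambda>m. h (i m)) m = 0" if "N \<le> m \<and> m < M" for m using * that by (simp add: h_simps)
  qed
qed

section \<open>Removal of the mean\<close>

definition centre :: "nat \<Rightarrow> (nat \<Rightarrow> real) \<Rightarrow> nat \<Rightarrow> real" where
  "centre N x j = x j - (\<Sum>l<N. x l) / N"

text \<open>Centring written with fixed weights, so that closure under linear combinations applies
  to it.\<close>

lemma centre_eq_sum: "j < N \<Longrightarrow> (\<Sum>l<N. (of_bool (l = j) - 1 / N) * x l) = centre N x j"
proof -
  assume j: "j < N"
  have "(\<Sum>l<N. (of_bool (l = j) - 1 / N) * x l) = (\<Sum>l<N. of_bool (l = j) * x l) - (\<Sum>l<N. x l / N)"
    unfolding sum_subtractf[symmetric] by (rule sum.cong[OF refl]) (simp add: left_diff_distrib)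
  also have "(\<Sum>l<N. of_bool (l = j) * x l) = (\<Sum>l\<in>{j}. of_bool (l = j) * x l)"
    by (rule sum.mono_neutral_right) (use j in auto)
  finally show ?thesis by (simp add: centre_def sum_divide_distrib)
qed

lemma sum_centre: "N > 0 \<Longrightarrow> (\<Sum>j<N. centre N x j) = 0"
  by (simp add: centre_def sum_subtractf)

lemma sum_centre_squares:
  assumes N: "N > 0"
  shows "(\<Sum>j<N. (x j - c)\<^sup>2) = (\<Sum>j<N. (centre N x j)\<^sup>2) + N * ((\<Sum>l<N. x l) / N - c)\<^sup>2"
proof -
  define a where "a = (\<Sum>l<N. x l) / N"
  have "(\<Sum>j<N. (x j - c)\<^sup>2) = (\<Sum>j<N. (centre N x j)\<^sup>2 + (2 * (a - c) * centre N x j + (a - c)\<^sup>2))"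
    by (rule sum.cong[OF refl]) (simp add: centre_def a_def[symmetric] power2_eq_square algebra_simps)
  also have "\<dots> = (\<Sum>j<N. (centre N x j)\<^sup>2) + (2 * (a - c) * (\<Sum>j<N. centre N x j) + N * (a - c)\<^sup>2)"
    unfolding sum.distrib sum_distrib_left by simp
  finally show ?thesis by (simp add: sum_centre[OF N] a_def)
qed

text \<open>The mean minimizes the sum of squared deviations. Hence the mean of \<open>- g\<close>
  may be replaced by \<open>- g\<close> at the mean of the arguments, after which the Lipschitz
  bound applies term by term.\<close>

lemma centre_lipschitz:
  assumes N: "N > 0" and g: "\<And>a b. \<bar>g a - g b\<bar> \<le> \<sigma> * \<bar>a - b\<bar>"
  shows "(\<Sum>j<N. (centre N (\<lambda>l. - g (x l)) j)\<^sup>2) \<le> \<sigma>\<^sup>2 * (\<Sum>j<N. (centre N x j)\<^sup>2)"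
proof -
  define a where "a = (\<Sum>l<N. x l) / N"
  have "(\<Sum>j<N. (centre N (\<lambda>l. - g (x l)) j)\<^sup>2) \<le> (\<Sum>j<N. (- g (x j) - (- g a))\<^sup>2)"
    unfolding sum_centre_squares[OF N] by simp
  also have "\<dots> \<le> (\<Sum>j<N. \<sigma>\<^sup>2 * (centre N x j)\<^sup>2)"
  proof (rule sum_mono)
    fix j
    have "\<bar>g (x j) - g a\<bar>\<^sup>2 \<le> (\<sigma> * \<bar>x j - a\<bar>)\<^sup>2" by (rule power_mono[OF g]) simp
    then show "(- g (x j) - (- g a))\<^sup>2 \<le> \<sigma>\<^sup>2 * (centre N x j)\<^sup>2"
      by (simp add: centre_def a_def[symmetric] power_mult_distrib power2_commute)
  qed
  finally show ?thesis by (simp add: sum_distrib_left)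
qed

lemma locally_integrable_sum:
  fixes N :: nat
  assumes "\<And>l. l < N \<Longrightarrow> locally_integrable (f l)"
  shows "locally_integrable (\<lambda>t. \<Sum>l<N. a l * f l t)"
  using assms unfolding locally_integrable_def
  by (auto intro!: absolutely_integrable_sum set_integrable_mult_right)

lemma integral_locally_integrable_sum:
  fixes N :: nat
  assumes "\<And>l. l < N \<Longrightarrow> locally_integrable (f l)" "t \<ge> 0"
  shows "integral {0..t} (\<lambda>\<tau>. \<Sum>l<N. a l * f l \<tau>) = (\<Sum>l<N. a l * integral {0..t} (f l))"
proof -
  have int: "f l integrable_on {0..t}" if "l < N" for l
    using assms that by (auto simp: locally_integrable_def absolutely_integrable_on_def)
  have "integral {0..t} (\<lambda>\<tau>. \<Sum>l<N. a l * f l \<tau>) = (\<Sum>l<N. integral {0..t} (\<lambda>\<tau>. a l * f l \<tau>))"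
    by (rule integral_sum) (auto intro!: integrable_on_mult_right int)
  then show ?thesis by simp
qed

section \<open>Homogeneous networks of identical oscillators\<close>

locale homogeneous_oscillators =
  fixes N M :: nat and osc :: circuit and branch :: "nat \<Rightarrow> nat \<Rightarrow> circuit"
    and z ys :: transfer_fun and y :: "nat \<Rightarrow> nat \<Rightarrow> transfer_fun"
  assumes N: "N \<ge> 2" and NM: "N \<le> M"
    and osc: "passive_circuit osc" "has_impedance osc z"
    and branch: "\<And>m n. m < n \<Longrightarrow> n < M \<Longrightarrow> passive_circuit (branch m n)"
      "\<And>m n. m < n \<Longrightarrow> n < M \<Longrightarrow> has_admittance (branch m n) (y m n)"
    and y_sym: "\<And>m n. m < M \<Longrightarrow> n < M \<Longrightarrow> y m n = y n m"
    and inv: "invertible_mat (interior_block N (admittance_matrix M y))"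
    and kron: "kron_reduction N (admittance_matrix M y) = ys \<cdot>\<^sub>m Gamma_mat N"
begin

lemma kron_potentials_eval:
  "\<exists>\<Phi>. MOST s. (\<forall>m<N. \<forall>b<N. \<Phi> m b s = (if m = b then 1 else 0)) \<and>
    (\<forall>m<M. \<forall>b<N. (\<Sum>n\<in>{..<M} - {m}. tf_eval (y m n) s * (\<Phi> m b s - \<Phi> n b s)) =
      (if m < N then tf_eval ys s * ((if m = b then of_nat N else 0) - 1) else 0))"
proof -
  obtain \<Phi> where \<Phi>: "\<And>m b. m < N \<Longrightarrow> \<Phi> m b = (if m = b then 1 else 0)"
    "\<And>m b. m < M \<Longrightarrow> b < N \<Longrightarrow> (\<Sum>n\<in>{..<M} - {m}. y m n * (\<Phi> m b - \<Phi> n b)) =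
      (if m < N then ys * ((if m = b then of_nat N else 0) - 1) else 0)"
    using kron_potentials[OF NM y_sym inv kron] by blast
  have summand: "MOST s. tf_eval (y m n * (\<Phi> m b - \<Phi> n b)) s = tf_eval (y m n) s * (tf_eval (\<Phi> m b) s - tf_eval (\<Phi> n b) s)" for m n b
    using tf_eval_mult[of "y m n" "\<Phi> m b - \<Phi> n b"] tf_eval_diff[of "\<Phi> m b" "\<Phi> n b"] by eventually_elim simp
  have row: "MOST s. (\<Sum>n\<in>{..<M} - {m}. tf_eval (y m n) s * (tf_eval (\<Phi> m b) s - tf_eval (\<Phi> n b) s)) =
      (if m < N then tf_eval ys s * ((if m = b then of_nat N else 0) - 1) else 0)" if m: "m < M" and b: "b < N" for m b
  proof -
    define h :: transfer_fun where "h = (if m = b then of_nat N else 0)"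
    have "MOST s. tf_eval h s = (if m = b then of_nat N else 0)"
      using tf_eval_of_nat[of N] by (cases "m = b") (simp_all add: h_def)
    then have rhs: "MOST s. tf_eval (if m < N then ys * (h - 1) else 0) s = (if m < N then tf_eval ys s * ((if m = b then of_nat N else 0) - 1) else 0)"
      using tf_eval_mult[of ys "h - 1"] tf_eval_diff[of h 1] by eventually_elim simp
    have "MOST s. tf_eval (\<Sum>n\<in>{..<M} - {m}. y m n * (\<Phi> m b - \<Phi> n b)) s = (\<Sum>n\<in>{..<M} - {m}. tf_eval (y m n * (\<Phi> m b - \<Phi> n b)) s)"
      by (rule tf_eval_sum) simp
    moreover have "MOST s. \<forall>n\<in>{..<M} - {m}. tf_eval (y m n * (\<Phi> m b - \<Phi> n b)) s = tf_eval (y m n) s * (tf_eval (\<Phi> m b) s - tf_eval (\<Phi> n b) s)"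
      by (rule eventually_ball_finite) (use summand in auto)
    ultimately show ?thesis using rhs
    proof eventually_elim
      case (elim s)
      have "(\<Sum>n\<in>{..<M} - {m}. tf_eval (y m n) s * (tf_eval (\<Phi> m b) s - tf_eval (\<Phi> n b) s)) =
          (\<Sum>n\<in>{..<M} - {m}. tf_eval (y m n * (\<Phi> m b - \<Phi> n b)) s)"
        by (rule sum.cong[OF refl]) (use elim(2) in simp)
      also have "\<dots> = tf_eval (if m < N then ys * (h - 1) else 0) s"
        using elim(1) unfolding \<Phi>(2)[OF m b] h_def by (rule sym)
      also note elim(3)
      finally show ?case .
    qed
  qed
  have "MOST s. \<forall>m\<in>{..<M}. \<forall>b\<in>{..<N}. (\<Sum>n\<in>{..<M} - {m}. tf_eval (y m n) s * (tf_eval (\<Phi> m b) s - tf_eval (\<Phi> n b) s)) =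
      (if m < N then tf_eval ys s * ((if m = b then of_nat N else 0) - 1) else 0)"
    by (intro eventually_ball_finite ballI finite_lessThan) (use row in auto)
  then have "MOST s. (\<forall>m<N. \<forall>b<N. tf_eval (\<Phi> m b) s = (if m = b then 1 else 0)) \<and>
    (\<forall>m<M. \<forall>b<N. (\<Sum>n\<in>{..<M} - {m}. tf_eval (y m n) s * (tf_eval (\<Phi> m b) s - tf_eval (\<Phi> n b) s)) =
      (if m < N then tf_eval ys s * ((if m = b then of_nat N else 0) - 1) else 0))"
    by eventually_elim (use \<Phi>(1) in auto)
  then show ?thesis by (rule exI[of _ "\<lambda>m b. tf_eval (\<Phi> m b)"])
qed

text \<open>Superposition of the unit-potential solutions. The exceptional frequencies come from
  finitely many rational identities and do not depend on \<open>V\<close>.\<close>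

lemma network_response:
  "MOST s. \<forall>V. \<exists>\<phi>. (\<forall>m<N. \<phi> m = V m) \<and>
    (\<forall>m<M. (\<Sum>n\<in>{..<M} - {m}. tf_eval (y m n) s * (\<phi> m - \<phi> n)) =
      (if m < N then tf_eval ys s * (of_nat N * V m - (\<Sum>b<N. V b)) else 0))"
proof -
  obtain \<Phi> where "MOST s. (\<forall>m<N. \<forall>b<N. \<Phi> m b s = (if m = b then 1 else 0)) \<and>
    (\<forall>m<M. \<forall>b<N. (\<Sum>n\<in>{..<M} - {m}. tf_eval (y m n) s * (\<Phi> m b s - \<Phi> n b s)) =
      (if m < N then tf_eval ys s * ((if m = b then of_nat N else 0) - 1) else 0))"
    using kron_potentials_eval by blast
  then show ?thesis
  proof eventually_elim
    case (elim s)
    show ?case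
    proof
      fix V :: "nat \<Rightarrow> complex"
      define \<phi> where "\<phi> m = (\<Sum>b<N. \<Phi> m b s * V b)" for m
      have pick: "(\<Sum>b<N. (if m = b then c else 0) * V b) = c * V m" if "m < N" for m c
      proof -
        have "(\<Sum>b<N. (if m = b then c else 0) * V b) = (\<Sum>b\<in>{m}. (if m = b then c else 0) * V b)"
          by (rule sum.mono_neutral_right) (use that in auto)
        then show ?thesis by simp
      qed
      have bd: "\<phi> m = V m" if "m < N" for m
      proof -
        have "\<phi> m = (\<Sum>b<N. (if m = b then 1 else 0) * V b)"
          unfolding \<phi>_def by (rule sum.cong[OF refl]) (use elim that in auto)
        then show ?thesis using pick[OF that, of 1] by simp
      qed
      have row: "(\<Sum>n\<in>{..<M} - {m}. tf_eval (y m n) s * (\<phi> m - \<phi> n)) =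
          (if m < N then tf_eval ys s * (of_nat N * V m - (\<Sum>b<N. V b)) else 0)" if m: "m < M" for m
      proof -
        have "(\<Sum>n\<in>{..<M} - {m}. tf_eval (y m n) s * (\<phi> m - \<phi> n)) =
            (\<Sum>n\<in>{..<M} - {m}. \<Sum>b<N. tf_eval (y m n) s * (\<Phi> m b s - \<Phi> n b s) * V b)"
          unfolding \<phi>_def sum_subtractf[symmetric] sum_distrib_left
          by (intro sum.cong refl) (simp add: algebra_simps)
        also have "\<dots> = (\<Sum>b<N. (\<Sum>n\<in>{..<M} - {m}. tf_eval (y m n) s * (\<Phi> m b s - \<Phi> n b s)) * V b)"
          unfolding sum_distrib_right by (rule sum.swap)
        also have "\<dots> = (\<Sum>b<N. (if m < N then tf_eval ys s * ((if m = b then of_nat N else 0) - 1) else 0) * V b)"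
          by (rule sum.cong[OF refl]) (use elim m in auto)
        also have "\<dots> = (if m < N then tf_eval ys s * (of_nat N * V m - (\<Sum>b<N. V b)) else 0)"
        proof (cases "m < N")
          case True
          have "(\<Sum>b<N. tf_eval ys s * ((if m = b then of_nat N else 0) - 1) * V b) =
              tf_eval ys s * ((\<Sum>b<N. (if m = b then of_nat N else 0) * V b) - (\<Sum>b<N. V b))"
            unfolding sum_subtractf[symmetric] sum_distrib_left by (intro sum.cong refl) (simp add: algebra_simps)
          then show ?thesis using True pick[OF True] by simp
        qed simp
        finally show ?thesis .
      qed
      show "\<exists>\<phi>. (\<forall>m<N. \<phi> m = V m) \<and> (\<forall>m<M. (\<Sum>n\<in>{..<M} - {m}. tf_eval (y m n) s * (\<phi> m - \<phi> n)) =
          (if m < N then tf_eval ys s * (of_nat N * V m - (\<Sum>b<N. V b)) else 0))"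
        by (rule exI[of _ \<phi>]) (use bd row in blast)
    qed
  qed
qed

lemma branch_current_antisym:
  assumes "m < n" "n < M"
  shows "tf_eval (y n m) s * (\<phi> n - \<phi> m) = - (tf_eval (y m n) s * (\<phi> m - \<phi> n))"
  using y_sym[of m n] assms by (simp add: algebra_simps)

text \<open>With potentials 1 and -1 at two boundary nodes and 0 at the other ones, the complex
  power absorbed by the network is \<open>2 * N\<close> times the value of \<open>ys\<close>; its
  real part is a sum over passive branches.\<close>

lemma series_admittance_passive: "MOST s. Re s > 0 \<longrightarrow> Re (tf_eval ys s) \<ge> 0"
  using network_response
proof eventually_elim
  case (elim s)
  show ?case
  proof
    assume s: "Re s > 0"
    define V :: "nat \<Rightarrow> complex" where "V m = of_bool (m = 0) - of_bool (m = 1)" for m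
    have two: "(\<Sum>m<N. F m) = F 0 + F 1" if "\<And>m. m > 1 \<Longrightarrow> F m = 0" for F :: "nat \<Rightarrow> complex"
    proof -
      have "(\<Sum>m<N. F m) = (\<Sum>m\<in>{0, 1}. F m)"
        by (rule sum.mono_neutral_right) (use N that in auto)
      then show ?thesis by simp
    qed
    have V: "(\<Sum>m<N. V m) = 0" by (subst two) (simp_all add: V_def)
    obtain \<phi> where \<phi>: "\<forall>m<N. \<phi> m = V m" "\<forall>m<M. (\<Sum>n\<in>{..<M} - {m}. tf_eval (y m n) s * (\<phi> m - \<phi> n)) =
        (if m < N then tf_eval ys s * (of_nat N * V m - (\<Sum>b<N. V b)) else 0)"
      using elim by blast
    define b where "b m n = tf_eval (y m n) s * (\<phi> m - \<phi> n)" for m n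
    have "(\<Sum>m<M. cnj (\<phi> m) * (\<Sum>n\<in>{..<M} - {m}. b m n)) = (\<Sum>n<M. \<Sum>m<n. (cnj (\<phi> m) - cnj (\<phi> n)) * b m n)"
      by (rule branch_power) (simp add: b_def branch_current_antisym)
    moreover have "0 \<le> Re (\<Sum>n<M. \<Sum>m<n. (cnj (\<phi> m) - cnj (\<phi> n)) * b m n)"
      unfolding Re_sum
    proof (intro sum_nonneg)
      fix n m assume "n \<in> {..<M}" "m \<in> {..<n}"
      then have nm: "m < n" "n < M" by auto
      have "laplace_oneport (branch m n) s (\<phi> m - \<phi> n) (b m n)"
        using branch(2)[OF nm] s unfolding has_admittance_def b_def by blast
      from laplace_oneport_passive[OF branch(1)[OF nm] this] s
      show "0 \<le> Re ((cnj (\<phi> m) - cnj (\<phi> n)) * b m n)" by (simp add: algebra_simps)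
    qed
    moreover have "(\<Sum>m<M. cnj (\<phi> m) * (\<Sum>n\<in>{..<M} - {m}. b m n)) = (\<Sum>m<N. cnj (V m) * (tf_eval ys s * (of_nat N * V m)))"
    proof -
      have "(\<Sum>m<M. cnj (\<phi> m) * (\<Sum>n\<in>{..<M} - {m}. b m n)) =
          (\<Sum>m<M. cnj (\<phi> m) * (if m < N then tf_eval ys s * (of_nat N * V m) else 0))"
        by (rule sum.cong[OF refl]) (use \<phi>(2) V in \<open>simp add: b_def\<close>)
      also have "\<dots> = (\<Sum>m<N. cnj (\<phi> m) * (if m < N then tf_eval ys s * (of_nat N * V m) else 0))"
        by (rule sum.mono_neutral_right) (use NM in auto)
      also have "\<dots> = (\<Sum>m<N. cnj (V m) * (tf_eval ys s * (of_nat N * V m)))"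
        by (rule sum.cong[OF refl]) (use \<phi>(1) in simp)
      finally show ?thesis .
    qed
    moreover have "(\<Sum>m<N. cnj (V m) * (tf_eval ys s * (of_nat N * V m))) = of_nat (2 * N) * tf_eval ys s"
      by (subst two) (simp_all add: V_def)
    ultimately have "0 \<le> Re (of_nat (2 * N) * tf_eval ys s)" by simp
    then have "0 \<le> real (2 * N) * Re (tf_eval ys s)" by simp
    then show "0 \<le> Re (tf_eval ys s)" using N by (simp add: zero_le_mult_iff)
  qed
qed

lemma loop_eval: "MOST s. tf_eval (1 + z * (ys * of_nat N)) s = 1 + tf_eval z s * (tf_eval ys s * of_nat N)"
  using tf_eval_add[of 1 "z * (ys * of_nat N)"] tf_eval_mult[of z "ys * of_nat N"] tf_eval_mult[of ys "of_nat N"] tf_eval_of_nat[of N]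
  by eventually_elim simp

text \<open>At a large real frequency both impedance and admittance are nonnegative real numbers.\<close>

lemma loop_nonzero: "1 + z * (ys * of_nat N) \<noteq> 0"
proof
  assume w: "1 + z * (ys * of_nat N) = 0"
  have "MOST s. 0 = 1 + tf_eval z s * (tf_eval ys s * of_nat N) \<and> (Re s > 0 \<longrightarrow> Re (tf_eval ys s) \<ge> 0)"
    using loop_eval series_admittance_passive unfolding w by eventually_elim simp
  from eventually_conj[OF MOST_large_real[OF this] eventually_gt_at_top[of "0::real"]]
  obtain x where x: "x > 0" "0 = 1 + tf_eval z (of_real x) * (tf_eval ys (of_real x) * of_nat N)" "Re (tf_eval ys (of_real x)) \<ge> 0"
    by (auto dest: eventually_happens)
  obtain r q where rq: "tf_eval z (of_real x) = of_real r" "tf_eval ys (of_real x) = of_real q"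
    using tf_eval_real by meson
  have "laplace_oneport osc (of_real x) (of_real r) 1"
    using osc(2) x(1) rq(1) unfolding has_impedance_def by simp
  from laplace_oneport_passive[OF osc(1) this] x(1) have r: "r \<ge> 0" by simp
  have "complex_of_real (1 + r * (q * real N)) = 0" using x(2) unfolding rq by simp
  then have "1 + r * (q * real N) = 0" by (simp only: of_real_eq_0_iff)
  moreover have "r * (q * real N) \<ge> 0" using r x(3) rq(2) by simp
  ultimately show False by simp
qed

lemma lft_eval:
  "MOST s. 1 + tf_eval z s * (tf_eval ys s * of_nat N) \<noteq> 0 \<and>
    tf_eval (lft z (ys * of_nat N)) s = tf_eval z s / (1 + tf_eval z s * (tf_eval ys s * of_nat N))"
  using tf_eval_divide[OF loop_nonzero, of z] tf_eval_nonzero[OF loop_nonzero] loop_eval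
  unfolding lft_def by eventually_elim simp

text \<open>The voltages are prescribed as \<open>h * u j\<close>, which have zero sum, so the
  network draws \<open>ys * N\<close> times each of them. The oscillator equation then reduces to
  \<open>h * (1 + z * ys * N) = z\<close>, the defining property of the linear fractional
  transformation.\<close>

lemma laplace_network_relation:
  "MOST s. Re s > 0 \<longrightarrow> (\<forall>u. (\<Sum>j<N. u j) = 0 \<longrightarrow>
    (\<exists>e. network_relation N M osc branch (\<lambda>k. s * e k) e u (\<lambda>j. tf_eval (lft z (ys * of_nat N)) s * u j)))"
  using network_response lft_eval
proof eventually_elim
  case (elim s)
  define h where "h = tf_eval (lft z (ys * of_nat N)) s"
  show ?case unfolding h_def[symmetric]
  proof (intro impI allI)
    fix u :: "nat \<Rightarrow> complex"
    assume s: "Re s > 0" and u: "(\<Sum>j<N. u j) = 0"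
    have hu: "(\<Sum>j<N. h * u j) = 0" using u by (simp add: sum_distrib_left[symmetric])
    obtain \<phi> where \<phi>: "\<forall>m<N. \<phi> m = h * u m" "\<forall>m<M. (\<Sum>n\<in>{..<M} - {m}. tf_eval (y m n) s * (\<phi> m - \<phi> n)) =
        (if m < N then tf_eval ys s * (of_nat N * (h * u m) - (\<Sum>b<N. h * u b)) else 0)"
      using elim(1)[rule_format, of "\<lambda>j. h * u j"] by blast
    define b where "b m n = tf_eval (y m n) s * (\<phi> m - \<phi> n)" for m n
    define i where "i m = (\<Sum>n\<in>{..<M} - {m}. b m n)" for m
    have i: "i m = (if m < N then tf_eval ys s * of_nat N * (h * u m) else 0)" if "m < M" for m
      using \<phi>(2) that hu by (simp add: i_def b_def)
    have "\<exists>e. static_oneport osc (\<phi> j) (u j - i j) (\<lambda>k. s * e k) e" if j: "j < N" for j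
    proof (rule laplace_oneport_static)
      have "\<phi> j = tf_eval z s * (u j - i j)"
      proof -
        define w where "w = 1 + tf_eval z s * (tf_eval ys s * of_nat N)"
        have w: "w \<noteq> 0" "h * w = tf_eval z s" using elim(2) by (simp_all add: w_def h_def)
        have "tf_eval z s * (u j - i j) = tf_eval z s * u j - (w - 1) * (h * u j)"
          using i[of j] j NM by (simp add: w_def algebra_simps)
        also have "\<dots> = h * u j + (tf_eval z s - h * w) * u j" by (simp add: algebra_simps)
        finally show ?thesis using w(2) \<phi>(1) j by simp
      qed
      then show "laplace_oneport osc s (\<phi> j) (u j - i j)" using osc(2) s unfolding has_impedance_def by blast
    qed
    then have "\<forall>j\<in>{..<N}. \<exists>e. static_oneport osc (\<phi> j) (u j - i j) (\<lambda>k. s * e k) e" by simp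
    from bchoice[OF this] obtain eo where eo: "\<forall>j\<in>{..<N}. static_oneport osc (\<phi> j) (u j - i j) (\<lambda>k. s * eo j k) (eo j)" by blast
    have "\<forall>p\<in>(SIGMA n:{..<M}. {..<n}). \<exists>e. static_oneport (branch (snd p) (fst p)) (\<phi> (snd p) - \<phi> (fst p)) (b (snd p) (fst p)) (\<lambda>k. s * e k) e"
    proof
      fix p assume "p \<in> (SIGMA n:{..<M}. {..<n})"
      then have "snd p < fst p" "fst p < M" by auto
      from branch(2)[OF this] have "laplace_oneport (branch (snd p) (fst p)) s (\<phi> (snd p) - \<phi> (fst p)) (b (snd p) (fst p))"
        using s unfolding has_admittance_def b_def by blast
      then show "\<exists>e. static_oneport (branch (snd p) (fst p)) (\<phi> (snd p) - \<phi> (fst p)) (b (snd p) (fst p)) (\<lambda>k. s * e k) e"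
        by (rule laplace_oneport_static)
    qed
    from bchoice[OF this] obtain eb where eb: "\<forall>p\<in>(SIGMA n:{..<M}. {..<n}). static_oneport (branch (snd p) (fst p)) (\<phi> (snd p) - \<phi> (fst p)) (b (snd p) (fst p)) (\<lambda>k. s * eb p k) (eb p)" by blast
    define e where "e x = (case fst x of Inl j \<Rightarrow> eo j (snd x) | Inr p \<Rightarrow> eb p (snd x))" for x
    have e: "e (Inl j, k) = eo j k" "e (Inr p, k) = eb p k" for j p k by (simp_all add: e_def)
    show "\<exists>e. network_relation N M osc branch (\<lambda>k. s * e k) e u (\<lambda>j. h * u j)"
      unfolding network_relation_def
    proof (rule exI[of _ e], intro conjI u hu, rule exI[of _ \<phi>], rule exI[of _ b], rule exI[of _ i], intro conjI allI impI, unfold e)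
      show "h * u j = \<phi> j" if "j < N" for j using \<phi>(1) that by simp
      show "static_oneport osc (\<phi> j) (u j - i j) (\<lambda>k. s * eo j k) (\<lambda>k. eo j k)" if "j < N" for j using eo that by simp
      fix n m assume nm: "n < M" "m < n"
      then have "(n, m) \<in> (SIGMA n:{..<M}. {..<n})" by simp
      from eb[rule_format, OF this] show "static_oneport (branch m n) (\<phi> m - \<phi> n) (b m n) (\<lambda>k. s * eb (n, m) k) (\<lambda>k. eb (n, m) k)" by simp
      show "b n m = - b m n" unfolding b_def by (rule branch_current_antisym[OF nm(2,1)])
    next
      show "i m = (\<Sum>n\<in>{..<M} - {m}. b m n)" for m by (simp add: i_def)
      show "i m = 0" if "N \<le> m \<and> m < M" for m using i[of m] that by simp
    qed
  qed
qed

text \<open>The exceptional set collects the frequencies of the half-plane at which the Laplace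
  solution may be missing; being finite, it is avoided at large real frequencies and close to any
  point of the axis.\<close>

lemma passive_network_relation:
  assumes D: "((\<lambda>x. tf_eval (lft z (ys * of_nat N)) (complex_of_real x)) \<longlongrightarrow> of_real D) at_top"
    and H: "hinf_norm_defined (lft z (ys * of_nat N))"
  shows "\<exists>P. passive_relation (network_states N M osc branch) {..<N}
    (\<lambda>k. storage (network_circuit osc branch (fst k) ! snd k)) (network_relation N M osc branch)
    (tf_eval (lft z (ys * of_nat N))) D P"
proof -
  define h where "h = lft z (ys * of_nat N)"
  define good where "good s \<longleftrightarrow> (Re s > 0 \<longrightarrow> (\<forall>u. (\<Sum>j<N. u j) = 0 \<longrightarrow>
    (\<exists>e. network_relation N M osc branch (\<lambda>k. s * e k) e u (\<lambda>j. tf_eval h s * u j))))" for s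
  have good: "finite {s. \<not> good s}"
    using laplace_network_relation unfolding eventually_cofinite good_def h_def .
  have lin: "linear Re" "linear Im" by (simp_all add: bounded_linear.linear bounded_linear_Re bounded_linear_Im)
  show ?thesis unfolding h_def[symmetric]
  proof (rule exI[of _ "{s. \<not> good s}"], unfold_locales)
    show "finite (network_states N M osc branch)"
      unfolding network_states_def by (intro finite_SigmaI finite_UnI finite_imageI) auto
    show "0 < storage (network_circuit osc branch (fst k) ! snd k)" if "k \<in> network_states N M osc branch" for k
      using that osc(1) branch(1)
      by (auto simp: network_states_def network_circuit_def passive_circuit_def intro!: storage_pos)
    show "network_relation N M osc branch f e u' v"
      if "network_relation N M osc branch f e u v" "\<And>j. j \<in> {..<N} \<Longrightarrow> u j = u' j" for f e and u v u' :: "nat \<Rightarrow> real"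
    proof -
      have "\<forall>j<N. u' j = u j" using that(2) by simp
      moreover from this have "(\<Sum>j<N. u' j) = (\<Sum>j<N. u j)" by simp
      ultimately show ?thesis using that(1) unfolding network_relation_def by simp
    qed
    show "(\<Sum>k\<in>network_states N M osc branch. storage (network_circuit osc branch (fst k) ! snd k) * (f k * e k)) \<le> (\<Sum>j<N. u j * v j)"
      if "network_relation N M osc branch f e u v" for f e u v
      by (rule network_passive[OF NM osc(1) branch(1) that])
    show "\<exists>e. network_relation N M osc branch (\<lambda>k. Re (s * e k)) (\<lambda>k. Re (e k)) u (\<lambda>j. Re (tf_eval h s) * u j) \<and>
        network_relation N M osc branch (\<lambda>k. Im (s * e k)) (\<lambda>k. Im (e k)) (\<lambda>j. 0) (\<lambda>j. Im (tf_eval h s) * u j)"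
      if s: "Re s > 0" "s \<notin> {s. \<not> good s}" and u: "(\<Sum>j<N. u j) = 0" for s and u :: "nat \<Rightarrow> real"
    proof -
      have "(\<Sum>j<N. complex_of_real (u j)) = 0" using u by (simp add: of_real_sum[symmetric])
      then obtain e where e: "network_relation N M osc branch (\<lambda>k. s * e k) e (\<lambda>j. of_real (u j)) (\<lambda>j. tf_eval h s * of_real (u j))"
        using s unfolding good_def by blast
      show ?thesis
        using network_relation_linear[OF lin(1) e] network_relation_linear[OF lin(2) e] by (intro exI[of _ e]) simp
    qed
    show "\<exists>l. (tf_eval h \<longlongrightarrow> l) (at (\<i> * of_real \<omega>) within {s. Re s > 0})" for \<omega>
      using tf_eval_tendsto_axis[OF H, of \<omega>] unfolding h_def by blast
    show "((\<lambda>x. tf_eval h (complex_of_real x)) \<longlongrightarrow> complex_of_real D) at_top"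
      using D unfolding h_def .
    show "finite {s. \<not> good s}" by (rule good)
    show "network_relation N M osc branch (\<lambda>k. a * f k + b * f' k) (\<lambda>k. a * e k + b * e' k)
        (\<lambda>j. a * u j + b * u' j) (\<lambda>j. a * v j + b * v' j)"
      if "network_relation N M osc branch f e u v" "network_relation N M osc branch f' e' u' v'" for a b f e u v f' e' u' v'
      using that by (rule network_relation_comb)
  qed (simp_all add: network_relation_def)
qed

text \<open>Rates and states of the oscillators are centred together with voltages and source
  currents, which is legitimate because the oscillators are identical. The branches keep their
  signals: they see only potential differences, and the injected currents have zero sum
  already.\<close>

lemma trajectory_network_relation:
  assumes traj: "coupled_trajectory N M osc branch g v"
  shows "\<exists>f e. (\<forall>t\<ge>0. network_relation N M osc branch (f t) (e t)
      (centre N (\<lambda>l. - g (v l t))) (centre N (\<lambda>l. v l t))) \<and>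
    (\<forall>k\<in>network_states N M osc branch. locally_integrable (\<lambda>t. f t k) \<and>
      (\<forall>t\<ge>0. e t k = e 0 k + integral {0..t} (\<lambda>\<tau>. f \<tau> k)))"
proof -
  define S where "S c x i f e \<longleftrightarrow> (\<forall>t\<ge>0. static_oneport c (x t) (i t) (\<lambda>k. f k t) (\<lambda>k. e k t)) \<and>
    (\<forall>k<length c. locally_integrable (f k) \<and> (\<forall>t\<ge>0. e k t = e k 0 + integral {0..t} (f k)))"
    for c and x i :: "real \<Rightarrow> real" and f e
  have choice: "\<exists>F E. \<forall>a\<in>A. Q a (F a) (E a)" if "\<forall>a\<in>A. \<exists>f e. Q a f e" for A Q
    using that by metis
  obtain \<phi> b i where *: "\<forall>j<N. \<forall>t\<ge>0. v j t = \<phi> j t"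
    "\<forall>j<N. time_oneport osc (v j) (\<lambda>t. - g (v j t) - i j t)"
    "\<forall>n<M. \<forall>m<n. time_oneport (branch m n) (\<lambda>t. \<phi> m t - \<phi> n t) (b m n) \<and> (\<forall>t\<ge>0. b n m t = - b m n t)"
    "\<forall>m<M. \<forall>t\<ge>0. i m t = (\<Sum>n\<in>{..<M} - {m}. b m n t)"
    "\<forall>m. N \<le> m \<and> m < M \<longrightarrow> (\<forall>t\<ge>0. i m t = 0)"
    using traj unfolding coupled_trajectory_def by (elim exE conjE) (rule that)
  have "\<forall>j\<in>{..<N}. \<exists>f e. S osc (v j) (\<lambda>t. - g (v j t) - i j t) f e"
  proof
    fix j assume "j \<in> {..<N}"
    then show "\<exists>f e. S osc (v j) (\<lambda>t. - g (v j t) - i j t) f e"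
      unfolding S_def by (intro time_oneport_static[OF osc(1)]) (use *(2) in blast)
  qed
  from choice[OF this] obtain fo eo where fo: "\<forall>j\<in>{..<N}. S osc (v j) (\<lambda>t. - g (v j t) - i j t) (fo j) (eo j)" by blast
  have "\<forall>p\<in>(SIGMA n:{..<M}. {..<n}). \<exists>f e. S (branch (snd p) (fst p)) (\<lambda>t. \<phi> (snd p) t - \<phi> (fst p) t) (b (snd p) (fst p)) f e"
  proof
    fix p assume "p \<in> (SIGMA n:{..<M}. {..<n})"
    then have p: "snd p < fst p" "fst p < M" by auto
    show "\<exists>f e. S (branch (snd p) (fst p)) (\<lambda>t. \<phi> (snd p) t - \<phi> (fst p) t) (b (snd p) (fst p)) f e"
      unfolding S_def by (rule time_oneport_static[OF branch(1)[OF p]]) (use *(3) p in blast)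
  qed
  from choice[OF this] obtain fb eb where fb: "\<forall>p\<in>(SIGMA n:{..<M}. {..<n}).
      S (branch (snd p) (fst p)) (\<lambda>t. \<phi> (snd p) t - \<phi> (fst p) t) (b (snd p) (fst p)) (fb p) (eb p)" by blast
  define a where "a j l = of_bool (l = j) - 1 / real N" for j l :: nat
  have a: "(\<Sum>l<N. a j l * x l) = centre N x j" if "j < N" for j x
    unfolding a_def by (rule centre_eq_sum[OF that])
  define f where "f t x = (case fst x of Inl j \<Rightarrow> \<Sum>l<N. a j l * fo l (snd x) t | Inr p \<Rightarrow> fb p (snd x) t)" for t x
  define e where "e t x = (case fst x of Inl j \<Rightarrow> \<Sum>l<N. a j l * eo l (snd x) t | Inr p \<Rightarrow> eb p (snd x) t)" for t x
  have fe: "f t (Inl j, k) = (\<Sum>l<N. a j l * fo l k t)" "f t (Inr p, k) = fb p k t"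
    "e t (Inl j, k) = (\<Sum>l<N. a j l * eo l k t)" "e t (Inr p, k) = eb p k t" for t j p k
    by (simp_all add: f_def e_def)
  have sum_i: "(\<Sum>l<N. i l t) = 0" if t: "t \<ge> 0" for t
  proof -
    have "(\<Sum>m<M. 1 * (\<Sum>n\<in>{..<M} - {m}. b m n t)) = (\<Sum>n<M. \<Sum>m<n. (1 - 1) * b m n t)"
      by (rule branch_power[of M "\<lambda>m n. b m n t" "\<lambda>_. 1"]) (use *(3) t in blast)
    then have "(\<Sum>m<M. i m t) = 0" using *(4) t by simp
    moreover have "(\<Sum>m<M. i m t) = (\<Sum>m<N. i m t)"
      by (rule sum.mono_neutral_right) (use NM *(5) t in auto)
    ultimately show ?thesis by simp
  qed
  have rel: "network_relation N M osc branch (f t) (e t) (centre N (\<lambda>l. - g (v l t))) (centre N (\<lambda>l. v l t))"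
    if t: "t \<ge> 0" for t
  proof -
    \<comment> \<open>Subtracting the mean boundary voltage from every node, interior ones included,
      changes no branch voltage.\<close>
    define \<psi> where "\<psi> m = \<phi> m t - (\<Sum>l<N. v l t) / N" for m
    have N0: "N > 0" using N by simp
    show ?thesis unfolding network_relation_def
    proof (intro conjI sum_centre[OF N0], rule exI[of _ \<psi>], rule exI[of _ "\<lambda>m n. b m n t"], rule exI[of _ "\<lambda>m. i m t"],
        intro conjI allI impI, unfold fe)
      fix j assume j: "j < N"
      show v: "centre N (\<lambda>l. v l t) j = \<psi> j" using *(1) j t by (simp add: centre_def \<psi>_def)
      have "static_oneport osc (\<Sum>l<N. a j l * v l t) (\<Sum>l<N. a j l * (- g (v l t) - i l t))
          (\<lambda>k. \<Sum>l<N. a j l * fo l k t) (\<lambda>k. \<Sum>l<N. a j l * eo l k t)"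
        by (rule static_oneport_sum) (use fo t in \<open>simp add: S_def\<close>)
      moreover have "centre N (\<lambda>l. - g (v l t) - i l t) j = centre N (\<lambda>l. - g (v l t)) j - i j t"
        unfolding centre_def sum_subtractf sum_i[OF t] by simp
      ultimately show "static_oneport osc (\<psi> j) (centre N (\<lambda>l. - g (v l t)) j - i j t)
          (\<lambda>k. \<Sum>l<N. a j l * fo l k t) (\<lambda>k. \<Sum>l<N. a j l * eo l k t)"
        unfolding a[OF j] v by simp
    next
      fix n m assume nm: "n < M" "m < n"
      then have "(n, m) \<in> (SIGMA n:{..<M}. {..<n})" by simp
      from fb[rule_format, OF this]
      have "static_oneport (branch m n) (\<phi> m t - \<phi> n t) (b m n t) (\<lambda>k. fb (n, m) k t) (\<lambda>k. eb (n, m) k t)"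
        using t unfolding S_def by simp
      then show "static_oneport (branch m n) (\<psi> m - \<psi> n) (b m n t) (\<lambda>k. fb (n, m) k t) (\<lambda>k. eb (n, m) k t)"
        by (simp add: \<psi>_def)
      show "b n m t = - b m n t" using *(3) nm t by blast
    next
      show "i m t = (\<Sum>n\<in>{..<M} - {m}. b m n t)" if "m < M" for m using *(4) that t by blast
      show "i m t = 0" if "N \<le> m \<and> m < M" for m using *(5) that t by blast
    qed
  qed
  have int: "locally_integrable (\<lambda>t. f t k) \<and> (\<forall>t\<ge>0. e t k = e 0 k + integral {0..t} (\<lambda>\<tau>. f \<tau> k))"
    if k: "k \<in> network_states N M osc branch" for k
  proof -
    consider j q where "k = (Inl j, q)" "j < N" "q < length osc"
      | n m q where "k = (Inr (n, m), q)" "n < M" "m < n" "q < length (branch m n)"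
      using k by (auto simp: network_states_def network_circuit_def)
    then show ?thesis
    proof cases
      case 1
      have li: "locally_integrable (fo l q)" if "l < N" for l using fo that 1(3) by (simp add: S_def)
      have "(\<Sum>l<N. a j l * eo l q t) = (\<Sum>l<N. a j l * eo l q 0) + integral {0..t} (\<lambda>\<tau>. \<Sum>l<N. a j l * fo l q \<tau>)" if t: "t \<ge> 0" for t
      proof -
        have "eo l q t = eo l q 0 + integral {0..t} (fo l q)" if "l < N" for l
          using fo that 1(3) t unfolding S_def by blast
        then have "(\<Sum>l<N. a j l * eo l q t) = (\<Sum>l<N. a j l * (eo l q 0 + integral {0..t} (fo l q)))" 
          by (intro sum.cong refl) auto
        moreover have "integral {0..t} (\<lambda>\<tau>. \<Sum>l<N. a j l * fo l q \<tau>) = (\<Sum>l<N. a j l * integral {0..t} (fo l q))"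
          by (rule integral_locally_integrable_sum[OF li t])
        ultimately show ?thesis by (simp only: distrib_left sum.distrib)
      qed
      then show ?thesis unfolding 1(1) fe
        by (intro conjI allI impI locally_integrable_sum li)
    next
      case 2
      then have "(n, m) \<in> (SIGMA n:{..<M}. {..<n})" by simp
      from fb[rule_format, OF this]
      have "locally_integrable (fb (n, m) q) \<and> (\<forall>t\<ge>0. eb (n, m) q t = eb (n, m) q 0 + integral {0..t} (fb (n, m) q))"
        using 2(4) unfolding S_def fst_conv snd_conv by blast
      then show ?thesis unfolding 2(1) fe .
    qed
  qed
  show ?thesis using rel int by blast
qed

text \<open>Differences of voltages equal differences of centred voltages, so the small-gain result
  for the centred system suffices. The source gain enters as a Lipschitz constant, and the norm
  bounds every axis limit of the transfer function.\<close>

theorem synchronization: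
  assumes g: "(\<forall>x. g differentiable (at x)) \<or> piecewise_linear g" "bdd_above (abs ` slopes g)"
    and H: "hinf_norm_defined (lft z (ys * of_nat N))"
    and gain: "hinf_norm (lft z (ys * of_nat N)) * source_gain g < 1"
    and traj: "coupled_trajectory N M osc branch g v" and jk: "j < N" "k < N"
  shows "((\<lambda>t. v j t - v k t) \<longlongrightarrow> 0) at_top"
proof -
  define h where "h = lft z (ys * of_nat N)"
  have N0: "N > 0" using N by simp
  obtain D where D: "((\<lambda>x. tf_eval h (complex_of_real x)) \<longlongrightarrow> of_real D) at_top" "\<bar>D\<bar> \<le> hinf_norm h"
    using tf_eval_tendsto_infinity[OF H[folded h_def]] by blast
  obtain P where "passive_relation (network_states N M osc branch) {..<N}
    (\<lambda>k. storage (network_circuit osc branch (fst k) ! snd k)) (network_relation N M osc branch) (tf_eval h) D P"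
    using passive_network_relation[OF D(1)[unfolded h_def] H] unfolding h_def by blast
  then interpret passive_relation "network_states N M osc branch" "{..<N}"
    "\<lambda>k. storage (network_circuit osc branch (fst k) ! snd k)" "network_relation N M osc branch" "tf_eval h" D P .
  obtain f e where fe: "\<forall>t\<ge>0. network_relation N M osc branch (f t) (e t)
      (centre N (\<lambda>l. - g (v l t))) (centre N (\<lambda>l. v l t))"
    "\<forall>k\<in>network_states N M osc branch. locally_integrable (\<lambda>t. f t k) \<and>
      (\<forall>t\<ge>0. e t k = e 0 k + integral {0..t} (\<lambda>\<tau>. f \<tau> k))"
    using trajectory_network_relation[OF traj] by blast
  have lim: "((\<lambda>t. centre N (\<lambda>l. v l t) j) \<longlongrightarrow> 0) at_top" if "j < N" for j
  proof (rule small_gain_tendsto_zero[where ?j1.0 = 0 and ?j2.0 = 1 and f = f and e = e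
        and u = "\<lambda>t. centre N (\<lambda>l. - g (v l t))" and \<sigma> = "source_gain g" and \<gamma> = "hinf_norm h"])
    show "(\<lambda>t. f t k) absolutely_integrable_on {0..T}" if "k \<in> network_states N M osc branch" for k T
    proof (cases "T \<ge> 0")
      case True
      then show ?thesis using fe(2) that by (simp add: locally_integrable_def)
    qed (simp add: set_integrable_def)
    show "(\<Sum>j<N. (centre N (\<lambda>l. - g (v l t)) j)\<^sup>2) \<le> (source_gain g)\<^sup>2 * (\<Sum>j<N. (centre N (\<lambda>l. v l t) j)\<^sup>2)" for t
      by (rule centre_lipschitz[OF N0 lipschitz_bound_of_slopes(1)[OF g]])
    show "cmod l \<le> hinf_norm h"
      if "(tf_eval h \<longlongrightarrow> l) (at (\<i> * of_real \<omega>) within {s. Re s > 0})" for \<omega> l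
    proof -
      have "at (\<i> * complex_of_real \<omega>) within {s. Re s > 0} \<noteq> bot"
        by (rule axis_not_bot) simp
      from tendsto_unique[OF this that tf_eval_tendsto_axis[OF H[folded h_def]]]
      show ?thesis using hinf_norm_bound[OF H[folded h_def]] by simp
    qed
    show "network_relation N M osc branch (f t) (e t) (centre N (\<lambda>l. - g (v l t))) (centre N (\<lambda>l. v l t))" if "t \<ge> 0" for t
      using fe(1) that by blast
    show "e t k = e 0 k + integral {0..t} (\<lambda>\<tau>. f \<tau> k)" if "k \<in> network_states N M osc branch" "t \<ge> 0" for k t
      using fe(2) that by blast
    show "hinf_norm h * source_gain g < 1" "0 \<le> hinf_norm h" "\<bar>D\<bar> \<le> hinf_norm h" "0 \<le> source_gain g"
      using gain D(2) hinf_norm_nonneg[OF H] lipschitz_bound_of_slopes(2)[OF g] unfolding h_def by blast+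
  qed (use N that in simp_all)
  have "((\<lambda>t. centre N (\<lambda>l. v l t) j - centre N (\<lambda>l. v l t) k) \<longlongrightarrow> 0 - 0) at_top"
    by (intro tendsto_diff lim jk)
  then show ?thesis by (simp add: centre_def)
qed

end

theorem corollary2:
  fixes N M :: nat
    and osc :: circuit and branch :: "nat \<Rightarrow> nat \<Rightarrow> circuit"
    and z_osc y_series :: transfer_fun and y :: "nat \<Rightarrow> nat \<Rightarrow> transfer_fun"
    and g :: "real \<Rightarrow> real"
  assumes "N \<ge> 2" and "N \<le> M"
    and "passive_circuit osc" and "has_impedance osc z_osc"
    and "(\<forall>x. g differentiable (at x)) \<or> piecewise_linear g"
    and "bdd_above (abs ` slopes g)"
    and "\<And>m n. m < n \<Longrightarrow> n < M \<Longrightarrow> passive_circuit (branch m n)"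
    and "\<And>m n. m < n \<Longrightarrow> n < M \<Longrightarrow> has_admittance (branch m n) (y m n)"
    and "\<And>m n. m < M \<Longrightarrow> n < M \<Longrightarrow> y m n = y n m"
    and "connected_network M y"
    and "invertible_mat (interior_block N (admittance_matrix M y))"
    and "homogeneous_network N (admittance_matrix M y)"
    and "kron_reduction N (admittance_matrix M y) = y_series \<cdot>\<^sub>m Gamma_mat N"
    and "hinf_norm_defined (lft z_osc (y_series * of_nat N))"
    and "hinf_norm (lft z_osc (y_series * of_nat N)) * source_gain g < 1"
  shows "\<forall>v. coupled_trajectory N M osc branch g v \<longrightarrow>
           (\<forall>j<N. \<forall>k<N. ((\<lambda>t. v j t - v k t) \<longlongrightarrow> 0) at_top)"
proof (intro allI impI)
  fix v j k assume traj: "coupled_trajectory N M osc branch g v" and "j < N" "k < N"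
  interpret homogeneous_oscillators N M osc branch z_osc y_series y
    by unfold_locales (use assms in blast)+
  show "((\<lambda>t. v j t - v k t) \<longlongrightarrow> 0) at_top"
    by (rule synchronization) fact+
qed

end
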